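(* Let $X$ be a $C^*$-correspondence over $A$ with left action $\phi$, and let $Y=X\oplus T$ over $B=A\oplus T$ be formed by adding the tail $T=(\ker\phi)^{(\mathbb N)}$. Let $(\pi_Y,t_Y)$ be a universal $J(Y)$-coisometric representation of $Y$ in $\mathcal O_Y$, and define $\pi(a):=\pi_Y(a,\vec 0)$, $t(\xi):=t_Y(\xi,\vec 0)$. Then $(\pi,t)$ is a $J_X$-coisometric representation of $X$, the induced $*$-homomorphism $\rho_{(\pi,t)}:\mathcal O_X\to\mathcal O_Y$ is injective, its image is the $C^*$-subalgebra $C^*(\pi,t)$ of $\mathcal O_Y$ generated by $\{\pi_Y(a,\vec 0),t_Y(\xi,\vec 0):a\in A,\xi\in X\}$, and this subalgebra is a full corner of $\mathcal O_Y$. Consequently $\mathcal O_X$ is naturally isomorphic to a full corner of $\mathcal O_Y$.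
   Context: A $C^*$-correspondence over $A$ is a right Hilbert $A$-module $X$ with inner product $\langle\cdot,\cdot\rangle_A$ and a $*$-homomorphism $\phi:A\to\mathcal L(X)$; $\Theta_{\xi,\eta}(\zeta)=\xi\langle\eta,\zeta\rangle_A$, $\mathcal K(X)=\overline{\mathrm{span}}\{\Theta_{\xi,\eta}\}$, $J(X):=\phi^{-1}(\mathcal K(X))$, $(\ker\phi)^\perp:=\{a:ab=0\ \forall b\in\ker\phi\}$, $J_X:=J(X)\cap(\ker\phi)^\perp$. A representation of $X$ in a $C^*$-algebra $C$ is a pair $(\pi,t)$, $\pi:A\to C$ a $*$-homomorphism, $t:X\to C$ linear, with $t(\xi)^*t(\eta)=\pi(\langle\xi,\eta\rangle_A)$, $t(\phi(a)\xi)=\pi(a)t(\xi)$, $t(\xi a)=t(\xi)\pi(a)$; $C^*(\pi,t)$ is the $C^*$-algebra generated by $\pi(A)\cup t(X)$; $\pi^{(1)}(\Theta_{\xi,\eta})=t(\xi)t(\eta)^*$ defines $\pi^{(1)}$ on $\mathcal K(X)$; for an ideal $K\subseteq J(X)$, $(\pi,t)$ is $K$-coisometric if $\pi^{(1)}(\phi(a))=\pi(a)$ for $a\in K$. $\mathcal O(K,X)$ is the $C^*$-algebra generated by a universal $K$-coisometric representation $(\pi_X,t_X)$: every $K$-coisometric representation $(\pi,t)$ in $C$ is of the form $\pi=\rho_{(\pi,t)}\circ\pi_X$, $t=\rho_{(\pi,t)}\circ t_X$ for a $*$-homomorphism $\rho_{(\pi,t)}:\mathcal O(K,X)\to C$.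 $\mathcal O_X:=\mathcal O(J_X,X)$, and for $Y$, $\mathcal O_Y=\mathcal O(J_Y,Y)=\mathcal O(J(Y),Y)$ since $\phi_B$ is injective. Adding the tail: $T:=(\ker\phi)^{(\mathbb N)}$ is the $c_0$-direct sum of copies of $\ker\phi$ (coordinatewise operations), a Hilbert module over itself with $\langle\vec f,\vec g\rangle=\vec f^*\vec g$; $B:=A\oplus T$, $Y:=X\oplus T$ with $(\xi,\vec f)(a,\vec g)=(\xi a,\vec f\vec g)$, $\langle(\xi,\vec f),(\nu,\vec g)\rangle_B=(\langle\xi,\nu\rangle_A,\vec f^*\vec g)$, $\phi_B(a,\vec f)(\xi,\vec g)=(\phi(a)\xi,(ag_1,f_1g_2,f_2g_3,\dots))$. *)

theory Defs
  imports Complex_Main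
begin

record 'a cstar =
  carr :: "'a set"
  zer  :: 'a
  pls  :: "'a \<Rightarrow> 'a \<Rightarrow> 'a"
  mlt  :: "'a \<Rightarrow> 'a \<Rightarrow> 'a"
  scl  :: "complex \<Rightarrow> 'a \<Rightarrow> 'a"
  str  :: "'a \<Rightarrow> 'a"
  nrm  :: "'a \<Rightarrow> real"

definition vspace :: "'v set \<Rightarrow> 'v \<Rightarrow> ('v \<Rightarrow> 'v \<Rightarrow> 'v) \<Rightarrow> (complex \<Rightarrow> 'v \<Rightarrow> 'v) \<Rightarrow> bool" where
  "vspace V z p s \<longleftrightarrow> z \<in> V \<and> (\<forall>x\<in>V. \<forall>y\<in>V. p x y \<in> V) \<and> (\<forall>c. \<forall>x\<in>V. s c x \<in> V)
    \<and> (\<forall>x\<in>V. \<forall>y\<in>V. \<forall>w\<in>V. p (p x y) w = p x (p y w)) \<and> (\<forall>x\<in>V. \<forall>y\<in>V. p x y = p y x)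
    \<and> (\<forall>x\<in>V. p z x = x) \<and> (\<forall>x\<in>V. p x (s (-1) x) = z)
    \<and> (\<forall>c. \<forall>x\<in>V. \<forall>y\<in>V. s c (p x y) = p (s c x) (s c y))
    \<and> (\<forall>c d. \<forall>x\<in>V. s (c + d) x = p (s c x) (s d x))
    \<and> (\<forall>c d. \<forall>x\<in>V. s (c * d) x = s c (s d x)) \<and> (\<forall>x\<in>V. s 1 x = x)"

definition complete_wrt :: "'v set \<Rightarrow> ('v \<Rightarrow> 'v \<Rightarrow> 'v) \<Rightarrow> (complex \<Rightarrow> 'v \<Rightarrow> 'v) \<Rightarrow> ('v \<Rightarrow> real) \<Rightarrow> bool" where
  "complete_wrt V p s n \<longleftrightarrow> (\<forall>f. (\<forall>k. f k \<in> V) \<and>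
      (\<forall>e>0. \<exists>N. \<forall>m\<ge>N. \<forall>k\<ge>N. n (p (f m) (s (-1) (f k))) < e)
      \<longrightarrow> (\<exists>x\<in>V. (\<lambda>k. n (p (f k) (s (-1) x))) \<longlonglongrightarrow> 0))"

definition banach :: "'v set \<Rightarrow> 'v \<Rightarrow> ('v \<Rightarrow> 'v \<Rightarrow> 'v) \<Rightarrow> (complex \<Rightarrow> 'v \<Rightarrow> 'v) \<Rightarrow> ('v \<Rightarrow> real) \<Rightarrow> bool" where
  "banach V z p s n \<longleftrightarrow> vspace V z p s \<and> (\<forall>x\<in>V. n x \<ge> 0 \<and> (n x = 0 \<longleftrightarrow> x = z))
    \<and> (\<forall>c. \<forall>x\<in>V. n (s c x) = cmod c * n x) \<and> (\<forall>x\<in>V. \<forall>y\<in>V. n (p x y) \<le> n x + n y)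
    \<and> complete_wrt V p s n"

definition mns :: "'a cstar \<Rightarrow> 'a \<Rightarrow> 'a \<Rightarrow> 'a" where
  "mns C x y = pls C x (scl C (-1) y)"

definition cstar_alg :: "'a cstar \<Rightarrow> bool" where
  "cstar_alg C \<longleftrightarrow> banach (carr C) (zer C) (pls C) (scl C) (nrm C)
    \<and> (\<forall>x\<in>carr C. \<forall>y\<in>carr C. mlt C x y \<in> carr C)
    \<and> (\<forall>x\<in>carr C. \<forall>y\<in>carr C. \<forall>w\<in>carr C. mlt C (mlt C x y) w = mlt C x (mlt C y w))
    \<and> (\<forall>x\<in>carr C. \<forall>y\<in>carr C. \<forall>w\<in>carr C. mlt C x (pls C y w) = pls C (mlt C x y) (mlt C x w))
    \<and> (\<forall>x\<in>carr C. \<forall>y\<in>carr C. \<forall>w\<in>carr C. mlt C (pls C x y) w = pls C (mlt C x w) (mlt C y w))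
    \<and> (\<forall>c. \<forall>x\<in>carr C. \<forall>y\<in>carr C. mlt C (scl C c x) y = scl C c (mlt C x y)
                                     \<and> mlt C x (scl C c y) = scl C c (mlt C x y))
    \<and> (\<forall>x\<in>carr C. str C x \<in> carr C \<and> str C (str C x) = x)
    \<and> (\<forall>x\<in>carr C. \<forall>y\<in>carr C. str C (pls C x y) = pls C (str C x) (str C y))
    \<and> (\<forall>c. \<forall>x\<in>carr C. str C (scl C c x) = scl C (cnj c) (str C x))
    \<and> (\<forall>x\<in>carr C. \<forall>y\<in>carr C. str C (mlt C x y) = mlt C (str C y) (str C x))
    \<and> (\<forall>x\<in>carr C. \<forall>y\<in>carr C. nrm C (mlt C x y) \<le> nrm C x * nrm C y)
    \<and> (\<forall>x\<in>carr C. nrm C (mlt C (str C x) x) = (nrm C x)^2)"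

definition star_hom :: "'a cstar \<Rightarrow> 'c cstar \<Rightarrow> ('a \<Rightarrow> 'c) \<Rightarrow> bool" where
  "star_hom A C f \<longleftrightarrow> (\<forall>x\<in>carr A. f x \<in> carr C)
    \<and> (\<forall>x\<in>carr A. \<forall>y\<in>carr A. f (pls A x y) = pls C (f x) (f y))
    \<and> (\<forall>c. \<forall>x\<in>carr A. f (scl A c x) = scl C c (f x))
    \<and> (\<forall>x\<in>carr A. \<forall>y\<in>carr A. f (mlt A x y) = mlt C (f x) (f y))
    \<and> (\<forall>x\<in>carr A. f (str A x) = str C (f x))"

definition positive :: "'a cstar \<Rightarrow> 'a \<Rightarrow> bool" where
  "positive C a \<longleftrightarrow> (\<exists>b\<in>carr C. a = mlt C (str C b) b)"

definition closed_subspace :: "'a cstar \<Rightarrow> 'a set \<Rightarrow> bool" where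
  "closed_subspace C D \<longleftrightarrow> D \<subseteq> carr C \<and> zer C \<in> D
    \<and> (\<forall>x\<in>D. \<forall>y\<in>D. pls C x y \<in> D) \<and> (\<forall>c. \<forall>x\<in>D. scl C c x \<in> D)
    \<and> (\<forall>f x. (\<forall>n. f n \<in> D) \<and> x \<in> carr C \<and> (\<lambda>n. nrm C (mns C (f n) x)) \<longlonglongrightarrow> 0 \<longrightarrow> x \<in> D)"

definition cstar_sub :: "'a cstar \<Rightarrow> 'a set \<Rightarrow> bool" where
  "cstar_sub C D \<longleftrightarrow> closed_subspace C D
    \<and> (\<forall>x\<in>D. \<forall>y\<in>D. mlt C x y \<in> D) \<and> (\<forall>x\<in>D. str C x \<in> D)"

definition cstar_gen :: "'a cstar \<Rightarrow> 'a set \<Rightarrow> 'a set" where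
  "cstar_gen C S = \<Inter>{D. cstar_sub C D \<and> S \<subseteq> D}"

definition cl_span :: "'a cstar \<Rightarrow> 'a set \<Rightarrow> 'a set" where
  "cl_span C S = \<Inter>{D. closed_subspace C D \<and> S \<subseteq> D}"

text \<open>Full corners: D = pCp for a projection p in the multiplier algebra M(C)
  (multipliers as double centralizers (L,R), i.e. p c = L c, c p = R c),
  with p full, i.e. the closed linear span of C p C is C.\<close>

definition full_corner :: "'a cstar \<Rightarrow> 'a set \<Rightarrow> bool" where
  "full_corner C D \<longleftrightarrow> (\<exists>L R.
      (\<forall>x\<in>carr C. L x \<in> carr C \<and> R x \<in> carr C)
    \<and> (\<forall>a\<in>carr C. \<forall>b\<in>carr C. mlt C a (L b) = mlt C (R a) b)
    \<and> (\<forall>x\<in>carr C. L (L x) = L x)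
    \<and> (\<forall>x\<in>carr C. L x = str C (R (str C x)))
    \<and> D = {L (R x) | x. x \<in> carr C}
    \<and> cl_span C {mlt C (R a) b | a b. a \<in> carr C \<and> b \<in> carr C} = carr C)"

record ('x, 'a) hmod =
  hcarr :: "'x set"
  hzer  :: 'x
  hpls  :: "'x \<Rightarrow> 'x \<Rightarrow> 'x"
  hscl  :: "complex \<Rightarrow> 'x \<Rightarrow> 'x"
  ract  :: "'x \<Rightarrow> 'a \<Rightarrow> 'x"
  inr   :: "'x \<Rightarrow> 'x \<Rightarrow> 'a"

definition hnorm :: "'a cstar \<Rightarrow> ('x, 'a) hmod \<Rightarrow> 'x \<Rightarrow> real" where
  "hnorm A X x = sqrt (nrm A (inr X x x))"

definition hilbert_module :: "'a cstar \<Rightarrow> ('x, 'a) hmod \<Rightarrow> bool" where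
  "hilbert_module A X \<longleftrightarrow> cstar_alg A \<and> vspace (hcarr X) (hzer X) (hpls X) (hscl X)
    \<and> (\<forall>x\<in>hcarr X. \<forall>a\<in>carr A. ract X x a \<in> hcarr X)
    \<and> (\<forall>x\<in>hcarr X. \<forall>y\<in>hcarr X. \<forall>a\<in>carr A. ract X (hpls X x y) a = hpls X (ract X x a) (ract X y a))
    \<and> (\<forall>x\<in>hcarr X. \<forall>a\<in>carr A. \<forall>b\<in>carr A. ract X x (pls A a b) = hpls X (ract X x a) (ract X x b))
    \<and> (\<forall>c. \<forall>x\<in>hcarr X. \<forall>a\<in>carr A. ract X (hscl X c x) a = hscl X c (ract X x a)
                                  \<and> ract X x (scl A c a) = hscl X c (ract X x a))
    \<and> (\<forall>x\<in>hcarr X. \<forall>a\<in>carr A. \<forall>b\<in>carr A. ract X (ract X x a) b = ract X x (mlt A a b))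
    \<and> (\<forall>x\<in>hcarr X. \<forall>y\<in>hcarr X. inr X x y \<in> carr A)
    \<and> (\<forall>x\<in>hcarr X. \<forall>y\<in>hcarr X. \<forall>z\<in>hcarr X. inr X x (hpls X y z) = pls A (inr X x y) (inr X x z))
    \<and> (\<forall>c. \<forall>x\<in>hcarr X. \<forall>y\<in>hcarr X. inr X x (hscl X c y) = scl A c (inr X x y))
    \<and> (\<forall>x\<in>hcarr X. \<forall>y\<in>hcarr X. \<forall>a\<in>carr A. inr X x (ract X y a) = mlt A (inr X x y) a)
    \<and> (\<forall>x\<in>hcarr X. \<forall>y\<in>hcarr X. str A (inr X x y) = inr X y x)
    \<and> (\<forall>x\<in>hcarr X. positive A (inr X x x))
    \<and> (\<forall>x\<in>hcarr X. inr X x x = zer A \<longrightarrow> x = hzer X)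
    \<and> complete_wrt (hcarr X) (hpls X) (hscl X) (hnorm A X)"

definition opnorm :: "'a cstar \<Rightarrow> ('x, 'a) hmod \<Rightarrow> ('x \<Rightarrow> 'x) \<Rightarrow> real" where
  "opnorm A X T = Sup {hnorm A X (T x) | x. x \<in> hcarr X \<and> hnorm A X x \<le> 1}"

definition thsum :: "('x, 'a) hmod \<Rightarrow> ('x \<times> 'x) list \<Rightarrow> 'x \<Rightarrow> 'x" where
  "thsum X l z = foldr (\<lambda>(\<xi>, \<eta>) acc. hpls X (ract X \<xi> (inr X \<eta> z)) acc) l (hzer X)"

definition compact_op :: "'a cstar \<Rightarrow> ('x, 'a) hmod \<Rightarrow> ('x \<Rightarrow> 'x) \<Rightarrow> bool" where
  "compact_op A X T \<longleftrightarrow> (\<forall>e>0. \<exists>l. set l \<subseteq> hcarr X \<times> hcarr X \<and>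
      opnorm A X (\<lambda>z. hpls X (T z) (hscl X (-1) (thsum X l z))) < e)"

definition correspondence :: "'a cstar \<Rightarrow> ('x, 'a) hmod \<Rightarrow> ('a \<Rightarrow> 'x \<Rightarrow> 'x) \<Rightarrow> bool" where
  "correspondence A X phi \<longleftrightarrow> hilbert_module A X
    \<and> (\<forall>a\<in>carr A. \<forall>x\<in>hcarr X. phi a x \<in> hcarr X)
    \<and> (\<forall>a\<in>carr A. \<forall>x\<in>hcarr X. \<forall>y\<in>hcarr X. phi a (hpls X x y) = hpls X (phi a x) (phi a y))
    \<and> (\<forall>a\<in>carr A. \<forall>b\<in>carr A. \<forall>x\<in>hcarr X. phi (pls A a b) x = hpls X (phi a x) (phi b x))
    \<and> (\<forall>c. \<forall>a\<in>carr A. \<forall>x\<in>hcarr X. phi (scl A c a) x = hscl X c (phi a x))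
    \<and> (\<forall>a\<in>carr A. \<forall>b\<in>carr A. \<forall>x\<in>hcarr X. phi (mlt A a b) x = phi a (phi b x))
    \<and> (\<forall>a\<in>carr A. \<forall>x\<in>hcarr X. \<forall>y\<in>hcarr X. inr X (phi a x) y = inr X x (phi (str A a) y))"

definition Jid :: "'a cstar \<Rightarrow> ('x, 'a) hmod \<Rightarrow> ('a \<Rightarrow> 'x \<Rightarrow> 'x) \<Rightarrow> 'a set" where
  "Jid A X phi = {a \<in> carr A. compact_op A X (phi a)}"

definition kerphi :: "'a cstar \<Rightarrow> ('x, 'a) hmod \<Rightarrow> ('a \<Rightarrow> 'x \<Rightarrow> 'x) \<Rightarrow> 'a set" where
  "kerphi A X phi = {a \<in> carr A. \<forall>x\<in>hcarr X. phi a x = hzer X}"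

definition perp :: "'a cstar \<Rightarrow> 'a set \<Rightarrow> 'a set" where
  "perp A I = {a \<in> carr A. \<forall>b\<in>I. mlt A a b = zer A}"

definition JX :: "'a cstar \<Rightarrow> ('x, 'a) hmod \<Rightarrow> ('a \<Rightarrow> 'x \<Rightarrow> 'x) \<Rightarrow> 'a set" where
  "JX A X phi = Jid A X phi \<inter> perp A (kerphi A X phi)"

definition is_rep :: "'a cstar \<Rightarrow> ('x, 'a) hmod \<Rightarrow> ('a \<Rightarrow> 'x \<Rightarrow> 'x) \<Rightarrow> 'c cstar
    \<Rightarrow> ('a \<Rightarrow> 'c) \<Rightarrow> ('x \<Rightarrow> 'c) \<Rightarrow> bool" where
  "is_rep A X phi C p t \<longleftrightarrow> cstar_alg C \<and> star_hom A C p
    \<and> (\<forall>x\<in>hcarr X. t x \<in> carr C)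
    \<and> (\<forall>x\<in>hcarr X. \<forall>y\<in>hcarr X. t (hpls X x y) = pls C (t x) (t y))
    \<and> (\<forall>c. \<forall>x\<in>hcarr X. t (hscl X c x) = scl C c (t x))
    \<and> (\<forall>x\<in>hcarr X. \<forall>y\<in>hcarr X. mlt C (str C (t x)) (t y) = p (inr X x y))
    \<and> (\<forall>a\<in>carr A. \<forall>x\<in>hcarr X. t (phi a x) = mlt C (p a) (t x))
    \<and> (\<forall>a\<in>carr A. \<forall>x\<in>hcarr X. t (ract X x a) = mlt C (t x) (p a))"

definition tsum :: "'c cstar \<Rightarrow> ('x \<Rightarrow> 'c) \<Rightarrow> ('x \<times> 'x) list \<Rightarrow> 'c" where
  "tsum C t l = foldr (\<lambda>(\<xi>, \<eta>) acc. pls C (mlt C (t \<xi>) (str C (t \<eta>))) acc) l (zer C)"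

text \<open>\<open>pi1_value A X C t k c\<close>: \<open>\<pi>\<^sup>(\<^sup>1\<^sup>)(k) = c\<close>, where \<open>\<pi>\<^sup>(\<^sup>1\<^sup>)\<close> is the (continuous extension
  to K(X) of the) map \<open>\<Theta>\<^sub>\<xi>\<^sub>,\<^sub>\<eta> \<mapsto> t(\<xi>)t(\<eta>)\<^sup>*\<close>: along every sequence of finite sums of
  rank-one operators converging to k in operator norm, the corresponding sums converge to c.\<close>

definition pi1_value :: "'a cstar \<Rightarrow> ('x, 'a) hmod \<Rightarrow> 'c cstar \<Rightarrow> ('x \<Rightarrow> 'c) \<Rightarrow> ('x \<Rightarrow> 'x) \<Rightarrow> 'c \<Rightarrow> bool" where
  "pi1_value A X C t k c \<longleftrightarrow> (\<forall>ls :: nat \<Rightarrow> ('x \<times> 'x) list.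
      (\<forall>n. set (ls n) \<subseteq> hcarr X \<times> hcarr X)
      \<and> (\<lambda>n. opnorm A X (\<lambda>z. hpls X (k z) (hscl X (-1) (thsum X (ls n) z)))) \<longlonglongrightarrow> 0
      \<longrightarrow> (\<lambda>n. nrm C (mns C (tsum C t (ls n)) c)) \<longlonglongrightarrow> 0)"

definition coisometric :: "'a cstar \<Rightarrow> ('x, 'a) hmod \<Rightarrow> ('a \<Rightarrow> 'x \<Rightarrow> 'x) \<Rightarrow> 'a set \<Rightarrow> 'c cstar
    \<Rightarrow> ('a \<Rightarrow> 'c) \<Rightarrow> ('x \<Rightarrow> 'c) \<Rightarrow> bool" where
  "coisometric A X phi K C p t \<longleftrightarrow> is_rep A X phi C p t
    \<and> (\<forall>a\<in>K. pi1_value A X C t (phi a) (p a))"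

definition factors :: "'a cstar \<Rightarrow> ('x, 'a) hmod \<Rightarrow> ('a \<Rightarrow> 'o) \<Rightarrow> ('x \<Rightarrow> 'o)
    \<Rightarrow> ('a \<Rightarrow> 'c) \<Rightarrow> ('x \<Rightarrow> 'c) \<Rightarrow> ('o \<Rightarrow> 'c) \<Rightarrow> bool" where
  "factors A X pU tU p t rho \<longleftrightarrow> (\<forall>a\<in>carr A. rho (pU a) = p a) \<and> (\<forall>x\<in>hcarr X. rho (tU x) = t x)"

definition univ_rep :: "'a cstar \<Rightarrow> ('x, 'a) hmod \<Rightarrow> ('a \<Rightarrow> 'x \<Rightarrow> 'x) \<Rightarrow> 'a set \<Rightarrow> 'o cstar
    \<Rightarrow> ('a \<Rightarrow> 'o) \<Rightarrow> ('x \<Rightarrow> 'o) \<Rightarrow> 'c itself \<Rightarrow> bool" where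
  "univ_rep A X phi K Ou pU tU (ty :: 'c itself) \<longleftrightarrow> coisometric A X phi K Ou pU tU
    \<and> carr Ou = cstar_gen Ou (pU ` carr A \<union> tU ` hcarr X)
    \<and> (\<forall>(C :: 'c cstar) p t. coisometric A X phi K C p t \<longrightarrow>
          (\<exists>rho. star_hom Ou C rho \<and> factors A X pU tU p t rho))"

definition tailset :: "'a cstar \<Rightarrow> ('x, 'a) hmod \<Rightarrow> ('a \<Rightarrow> 'x \<Rightarrow> 'x) \<Rightarrow> (nat \<Rightarrow> 'a) set" where
  "tailset A X phi = {f. (\<forall>n. f n \<in> kerphi A X phi) \<and> (\<lambda>n. nrm A (f n)) \<longlonglongrightarrow> 0}"

definition tailB :: "'a cstar \<Rightarrow> ('x, 'a) hmod \<Rightarrow> ('a \<Rightarrow> 'x \<Rightarrow> 'x) \<Rightarrow> ('a \<times> (nat \<Rightarrow> 'a)) cstar" where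
  "tailB A X phi = \<lparr> carr = carr A \<times> tailset A X phi,
     zer = (zer A, \<lambda>n. zer A),
     pls = (\<lambda>(a, f) (b, g). (pls A a b, \<lambda>n. pls A (f n) (g n))),
     mlt = (\<lambda>(a, f) (b, g). (mlt A a b, \<lambda>n. mlt A (f n) (g n))),
     scl = (\<lambda>c (a, f). (scl A c a, \<lambda>n. scl A c (f n))),
     str = (\<lambda>(a, f). (str A a, \<lambda>n. str A (f n))),
     nrm = (\<lambda>(a, f). max (nrm A a) (Sup (range (\<lambda>n. nrm A (f n))))) \<rparr>"

definition tailY :: "'a cstar \<Rightarrow> ('x, 'a) hmod \<Rightarrow> ('a \<Rightarrow> 'x \<Rightarrow> 'x) \<Rightarrow> ('x \<times> (nat \<Rightarrow> 'a), 'a \<times> (nat \<Rightarrow> 'a)) hmod" where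
  "tailY A X phi = \<lparr> hcarr = hcarr X \<times> tailset A X phi,
     hzer = (hzer X, \<lambda>n. zer A),
     hpls = (\<lambda>(x, f) (y, g). (hpls X x y, \<lambda>n. pls A (f n) (g n))),
     hscl = (\<lambda>c (x, f). (hscl X c x, \<lambda>n. scl A c (f n))),
     ract = (\<lambda>(x, f) (a, g). (ract X x a, \<lambda>n. mlt A (f n) (g n))),
     inr = (\<lambda>(x, f) (y, g). (inr X x y, \<lambda>n. mlt A (str A (f n)) (g n))) \<rparr>"

text \<open>Left action: \<open>\<phi>\<^sub>B(a, f)(\<xi>, g) = (\<phi>(a)\<xi>, (a g\<^sub>1, f\<^sub>1 g\<^sub>2, f\<^sub>2 g\<^sub>3, \<dots>))\<close>, with sequences indexed from 0.\<close>

definition tailphi :: "'a cstar \<Rightarrow> ('x, 'a) hmod \<Rightarrow> ('a \<Rightarrow> 'x \<Rightarrow> 'x)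
    \<Rightarrow> ('a \<times> (nat \<Rightarrow> 'a)) \<Rightarrow> ('x \<times> (nat \<Rightarrow> 'a)) \<Rightarrow> ('x \<times> (nat \<Rightarrow> 'a))" where
  "tailphi A X phi = (\<lambda>(a, f) (x, g). (phi a x,
       \<lambda>n. if n = 0 then mlt A a (g 0) else mlt A (f (n - 1)) (g n)))"

end

(* The injectivity of O_X -> O_Y is proved by extending representations instead of by a gauge-invariant
  uniqueness theorem. For b = (a, f) in B and y = (x, g) in Y let b act on the Hilbert O_X-module l2(O_X) by the
  diagonal operator with entries pi_X(a), pi_X(f_0), pi_X(f_1), ..., and y by the operator with entry t_X(x) in the
  corner and entries pi_X(g_n) on the superdiagonal. This is a J(Y)-coisometric representation of Y, and it extends
  the universal representation of X in the corner entry; hence ||z|| <= ||rho z|| for z in O_X. Universality is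
  available only for C*-algebras whose elements belong to the type of O_X, so the operators are coded as elements
  of O_X: an infinite sequence of elements of a nonzero Banach space can be coded by a single element.

  The corner is cut out by the projection p = 1 - (sum of the units of all tail coordinates), which exists as a
  multiplier because O_Y is the direct sum of the elements annihilated by pi_Y(0, T) and their orthogonal
  complement. Words in O_Y that begin in p O_Y collapse to paths (an element of the subalgebra D followed by steps
  along the tail); only those of length 0 also end in O_Y p, so p O_Y p = D. Fullness holds since the path to each
  tail coordinate starts in D. *)
theory Submission
  imports Defs "HOL-Analysis.Analysis"
begin

section \<open>C*-algebras given by records as subalgebras of a type-class C*-algebra\<close>

text \<open>The algebras are records on carrier sets and need have no unit. They are embedded
  isometrically in one unital algebra, and positivity, approximate units and the contractivity of
  homomorphisms are derived there from a single device: the square root of 1 - b as fixed point of a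
  contraction. The fixed point lies in every closed set that the iteration preserves, so it stays in
  the subalgebra at hand even when the unit does not belong to it. The delicate point in extending
  the representation is coisometry on all of J(Y), since the head a of an element (a, f) of J(Y)
  need not lie in J_X. On tail coordinate 0 a finite-rank operator of Y is multiplication by an
  element of ker phi. Along an approximating sequence these elements converge to some c in ker phi,
  and a - c is orthogonal to ker phi and acts on X as a compact operator. So a - c lies in J_X,
  where coisometry is given, while c is reproduced by the superdiagonal entries. For the corner, p
  is never formed as an element: its left multiplication is the projection of O_Y onto the
  annihilator of the tail along the orthogonal complement, and approximate units of ker phi replace
  the units of the tail coordinates.\<close>

locale cstar_record =
  fixes C :: "'a cstar"
  assumes cstar: "cstar_alg C"
begin

lemma banach: "banach (carr C) (zer C) (pls C) (scl C) (nrm C)"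
  using cstar unfolding cstar_alg_def by (rule conjunct1)

lemma vspace: "vspace (carr C) (zer C) (pls C) (scl C)"
  using banach unfolding banach_def by (rule conjunct1)

lemma zer_carr [simp]: "zer C \<in> carr C"
  and pls_carr [simp]: "x \<in> carr C \<Longrightarrow> y \<in> carr C \<Longrightarrow> pls C x y \<in> carr C"
  and scl_carr [simp]: "x \<in> carr C \<Longrightarrow> scl C c x \<in> carr C"
  and pls_assoc: "x \<in> carr C \<Longrightarrow> y \<in> carr C \<Longrightarrow> w \<in> carr C \<Longrightarrow> pls C (pls C x y) w = pls C x (pls C y w)"
  and pls_comm: "x \<in> carr C \<Longrightarrow> y \<in> carr C \<Longrightarrow> pls C x y = pls C y x"
  and pls_zer_left [simp]: "x \<in> carr C \<Longrightarrow> pls C (zer C) x = x"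
  and pls_minus [simp]: "x \<in> carr C \<Longrightarrow> pls C x (scl C (-1) x) = zer C"
  and scl_pls: "x \<in> carr C \<Longrightarrow> y \<in> carr C \<Longrightarrow> scl C c (pls C x y) = pls C (scl C c x) (scl C c y)"
  and scl_add: "x \<in> carr C \<Longrightarrow> scl C (c + d) x = pls C (scl C c x) (scl C d x)"
  and scl_mult: "x \<in> carr C \<Longrightarrow> scl C (c * d) x = scl C c (scl C d x)"
  and scl_one [simp]: "x \<in> carr C \<Longrightarrow> scl C 1 x = x"
  using vspace unfolding vspace_def by meson+

lemma nrm_nonneg [simp]: "x \<in> carr C \<Longrightarrow> 0 \<le> nrm C x"
  and nrm_eq_0 [simp]: "x \<in> carr C \<Longrightarrow> nrm C x = 0 \<longleftrightarrow> x = zer C"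
  and nrm_scl: "x \<in> carr C \<Longrightarrow> nrm C (scl C c x) = cmod c * nrm C x"
  and nrm_pls: "x \<in> carr C \<Longrightarrow> y \<in> carr C \<Longrightarrow> nrm C (pls C x y) \<le> nrm C x + nrm C y"
  and complete: "complete_wrt (carr C) (pls C) (scl C) (nrm C)"
  using banach unfolding banach_def by simp_all

lemma mlt_carr [simp]: "x \<in> carr C \<Longrightarrow> y \<in> carr C \<Longrightarrow> mlt C x y \<in> carr C"
  and mlt_assoc: "x \<in> carr C \<Longrightarrow> y \<in> carr C \<Longrightarrow> w \<in> carr C \<Longrightarrow> mlt C (mlt C x y) w = mlt C x (mlt C y w)"
  and mlt_pls_right: "x \<in> carr C \<Longrightarrow> y \<in> carr C \<Longrightarrow> w \<in> carr C \<Longrightarrow> mlt C x (pls C y w) = pls C (mlt C x y) (mlt C x w)"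
  and mlt_pls_left: "x \<in> carr C \<Longrightarrow> y \<in> carr C \<Longrightarrow> w \<in> carr C \<Longrightarrow> mlt C (pls C x y) w = pls C (mlt C x w) (mlt C y w)"
  and mlt_scl_left: "x \<in> carr C \<Longrightarrow> y \<in> carr C \<Longrightarrow> mlt C (scl C c x) y = scl C c (mlt C x y)"
  and mlt_scl_right: "x \<in> carr C \<Longrightarrow> y \<in> carr C \<Longrightarrow> mlt C x (scl C c y) = scl C c (mlt C x y)"
  and str_carr [simp]: "x \<in> carr C \<Longrightarrow> str C x \<in> carr C"
  and str_str [simp]: "x \<in> carr C \<Longrightarrow> str C (str C x) = x"
  and str_pls: "x \<in> carr C \<Longrightarrow> y \<in> carr C \<Longrightarrow> str C (pls C x y) = pls C (str C x) (str C y)"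
  and str_scl: "x \<in> carr C \<Longrightarrow> str C (scl C c x) = scl C (cnj c) (str C x)"
  and str_mlt: "x \<in> carr C \<Longrightarrow> y \<in> carr C \<Longrightarrow> str C (mlt C x y) = mlt C (str C y) (str C x)"
  and nrm_mlt: "x \<in> carr C \<Longrightarrow> y \<in> carr C \<Longrightarrow> nrm C (mlt C x y) \<le> nrm C x * nrm C y"
  and nrm_str_mlt: "x \<in> carr C \<Longrightarrow> nrm C (mlt C (str C x) x) = (nrm C x)\<^sup>2"
  using cstar unfolding cstar_alg_def by meson+

lemma scl_scl [simp]: "x \<in> carr C \<Longrightarrow> scl C c (scl C d x) = scl C (c * d) x"
  by (simp add: scl_mult)

lemma pls_zer_right [simp]: "x \<in> carr C \<Longrightarrow> pls C x (zer C) = x"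
  using pls_comm by force

lemma scl_0 [simp]: "x \<in> carr C \<Longrightarrow> scl C 0 x = zer C"
  by (metis add.right_inverse pls_minus scl_add scl_one)

lemma scl_zer [simp]: "scl C c (zer C) = zer C"
  by (metis mult_zero_right scl_0 scl_scl zer_carr)

lemma mlt_zer_right [simp]: "x \<in> carr C \<Longrightarrow> mlt C x (zer C) = zer C"
  by (metis mlt_carr mlt_scl_right scl_0 zer_carr)

lemma mlt_zer_left [simp]: "x \<in> carr C \<Longrightarrow> mlt C (zer C) x = zer C"
  by (metis mlt_carr mlt_scl_left scl_0 zer_carr)

lemma str_zer [simp]: "str C (zer C) = zer C"
  by (metis complex_cnj_zero scl_0 str_carr str_scl zer_carr)

lemma nrm_zer [simp]: "nrm C (zer C) = 0"
  by simp

lemma nrm_str [simp]: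
  assumes x: "x \<in> carr C" shows "nrm C (str C x) = nrm C x"
proof -
  have *: "nrm C y \<le> nrm C (str C y)" if y: "y \<in> carr C" for y
  proof (cases "y = zer C")
    case False
    then have "0 < nrm C y" using y by (simp add: less_le)
    moreover have "nrm C y * nrm C y \<le> nrm C (str C y) * nrm C y"
      using nrm_mlt[of "str C y" y] nrm_str_mlt[OF y] y by (simp add: power2_eq_square)
    ultimately show ?thesis by simp
  qed simp
  from *[OF x] *[of "str C x"] x show ?thesis by simp
qed

lemma mns_carr [simp]: "x \<in> carr C \<Longrightarrow> y \<in> carr C \<Longrightarrow> mns C x y \<in> carr C"
  by (simp add: mns_def)

lemma pls_minus_left [simp]: "x \<in> carr C \<Longrightarrow> pls C (scl C (-1) x) x = zer C"
  by (simp add: pls_comm[of _ x])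

lemma pls_minus_cancel [simp]: "x \<in> carr C \<Longrightarrow> y \<in> carr C \<Longrightarrow> pls C x (pls C (scl C (-1) x) y) = y"
  and pls_minus_left_cancel [simp]: "x \<in> carr C \<Longrightarrow> y \<in> carr C \<Longrightarrow> pls C (scl C (-1) x) (pls C x y) = y"
  by (simp_all flip: pls_assoc)

lemma mns_triangle:
  "x \<in> carr C \<Longrightarrow> y \<in> carr C \<Longrightarrow> z \<in> carr C \<Longrightarrow> mns C x z = pls C (mns C x y) (mns C y z)"
  by (simp add: mns_def pls_assoc)

end

text \<open>The bounded sections over all C*-algebras with elements in \<open>'a\<close> form one Banach space on which each of
  these algebras acts faithfully by adjointable operators. So the type \<open>'a mul\<close> of adjointable operators on it
  is a unital C*-algebra that contains them all.\<close>

typedef 'a sec = "{F :: 'a cstar \<Rightarrow> 'a. (\<forall>R. cstar_alg R \<longrightarrow> F R \<in> carr R) \<and> (\<forall>R. \<not> cstar_alg R \<longrightarrow> F R = undefined)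
    \<and> (\<exists>K. \<forall>R. cstar_alg R \<longrightarrow> nrm R (F R) \<le> K)}"
  apply (rule exI[of _ "\<lambda>R. if cstar_alg R then zer R else undefined"])
  apply (intro CollectI conjI exI allI impI)
    apply (simp_all only: if_True if_False)
   apply (erule cstar_record.zer_carr[OF cstar_record.intro])
  apply (subst cstar_record.nrm_zer[OF cstar_record.intro], assumption)
  apply (rule order_refl)
  done

definition mksec :: "('a cstar \<Rightarrow> 'a) \<Rightarrow> 'a sec" where
  "mksec f = Abs_sec (\<lambda>R. if cstar_alg R then f R else undefined)"

lemma sec_carr: "cstar_alg R \<Longrightarrow> Rep_sec F R \<in> carr R"
  using Rep_sec[of F] by auto

lemma sec_bounded: "\<exists>K. \<forall>R. cstar_alg R \<longrightarrow> nrm R (Rep_sec F R) \<le> K"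
  using Rep_sec[of F] by auto

text \<open>At records that are not C*-algebras every section takes the fixed value
  \<open>undefined\<close>, so agreement on C*-algebras already means equality of the underlying
  functions.\<close>

lemma sec_eqI:
  assumes "\<And>R. cstar_alg R \<Longrightarrow> Rep_sec F R = Rep_sec G R" shows "F = G"
proof -
  have "Rep_sec F R = Rep_sec G R" for R
  proof (cases "cstar_alg R")
    case False
    then show ?thesis using Rep_sec[of F] Rep_sec[of G] by simp
  qed (rule assms)
  then show ?thesis by (simp add: ext flip: Rep_sec_inject)
qed

text \<open>\<open>Abs_sec\<close> is meaningful only for bounded families, so every pointwise
  operation on sections passes through this rule with a bound that is uniform in the
  algebra.\<close>

lemma Rep_mksec:
  assumes "\<And>R. cstar_alg R \<Longrightarrow> f R \<in> carr R" "\<And>R. cstar_alg R \<Longrightarrow> nrm R (f R) \<le> K" "cstar_alg R"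
  shows "Rep_sec (mksec f) R = f R"
  unfolding mksec_def using assms by (subst Abs_sec_inverse) auto

instantiation sec :: (type) real_vector
begin

definition zero_sec :: "'a sec" where "zero_sec = mksec zer"
definition plus_sec :: "'a sec \<Rightarrow> 'a sec \<Rightarrow> 'a sec" where
  "plus_sec F G = mksec (\<lambda>R. pls R (Rep_sec F R) (Rep_sec G R))"
definition scaleR_sec :: "real \<Rightarrow> 'a sec \<Rightarrow> 'a sec" where
  "scaleR_sec r F = mksec (\<lambda>R. scl R (complex_of_real r) (Rep_sec F R))"
definition uminus_sec :: "'a sec \<Rightarrow> 'a sec" where "uminus_sec F = (-1) *\<^sub>R F"
definition minus_sec :: "'a sec \<Rightarrow> 'a sec \<Rightarrow> 'a sec" where "minus_sec F G = F + (- G)"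

lemma Rep_zero_sec: "cstar_alg R \<Longrightarrow> Rep_sec 0 R = zer R"
  unfolding zero_sec_def
  by (rule Rep_mksec[where K=0]) (auto simp: cstar_record.zer_carr cstar_record.nrm_zer cstar_record.intro)

lemma Rep_plus_sec:
  assumes R: "cstar_alg R" shows "Rep_sec (F + G) R = pls R (Rep_sec F R) (Rep_sec G R)"
proof -
  obtain K L where K: "\<And>R. cstar_alg R \<Longrightarrow> nrm R (Rep_sec F R) \<le> K"
    and L: "\<And>R. cstar_alg R \<Longrightarrow> nrm R (Rep_sec G R) \<le> L"
    using sec_bounded by metis
  show ?thesis unfolding plus_sec_def
  proof (rule Rep_mksec[where K = "K + L", OF _ _ R])
    fix S :: "'a cstar" assume S: "cstar_alg S"
    interpret cstar_record S by (rule cstar_record.intro[OF S])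
    show "pls S (Rep_sec F S) (Rep_sec G S) \<in> carr S" by (simp add: sec_carr S)
    show "nrm S (pls S (Rep_sec F S) (Rep_sec G S)) \<le> K + L"
      using nrm_pls[OF sec_carr[OF S] sec_carr[OF S], of F G] K[OF S] L[OF S] by linarith
  qed
qed

lemma Rep_scaleR_sec:
  assumes R: "cstar_alg R" shows "Rep_sec (r *\<^sub>R F) R = scl R (complex_of_real r) (Rep_sec F R)"
proof -
  obtain K where K: "\<And>R. cstar_alg R \<Longrightarrow> nrm R (Rep_sec F R) \<le> K"
    using sec_bounded by metis
  show ?thesis unfolding scaleR_sec_def
  proof (rule Rep_mksec[where K = "\<bar>r\<bar> * K", OF _ _ R])
    fix S :: "'a cstar" assume S: "cstar_alg S"
    interpret cstar_record S by (rule cstar_record.intro[OF S])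
    show "scl S (complex_of_real r) (Rep_sec F S) \<in> carr S" by (simp add: sec_carr S)
    show "nrm S (scl S (complex_of_real r) (Rep_sec F S)) \<le> \<bar>r\<bar> * K"
      using K[OF S] by (simp add: nrm_scl sec_carr[OF S] mult_left_mono)
  qed
qed

lemma Rep_uminus_sec: "cstar_alg R \<Longrightarrow> Rep_sec (- F) R = scl R (-1) (Rep_sec F R)"
  by (simp add: uminus_sec_def Rep_scaleR_sec)

lemma Rep_minus_sec: "cstar_alg R \<Longrightarrow> Rep_sec (F - G) R = mns R (Rep_sec F R) (Rep_sec G R)"
  by (simp add: minus_sec_def Rep_plus_sec Rep_uminus_sec mns_def)

lemmas Rep_sec_simps = Rep_zero_sec Rep_plus_sec Rep_scaleR_sec Rep_uminus_sec Rep_minus_sec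

instance
proof
  fix F G H :: "'a sec" and r s :: real
  show "F + G + H = F + (G + H)"
    by (rule sec_eqI) (simp add: Rep_sec_simps sec_carr cstar_record.pls_assoc cstar_record.intro)
  show "F + G = G + F"
    by (rule sec_eqI) (simp add: Rep_sec_simps sec_carr cstar_record.pls_comm cstar_record.intro)
  show "0 + F = F"
    by (rule sec_eqI) (simp add: Rep_sec_simps sec_carr cstar_record.pls_zer_left cstar_record.intro)
  show "- F + F = 0"
    by (rule sec_eqI)
      (metis Rep_plus_sec Rep_uminus_sec Rep_zero_sec cstar_record.intro cstar_record.pls_comm cstar_record.pls_minus cstar_record.scl_carr sec_carr)
  show "F - G = F + - G" by (rule minus_sec_def)
  show "r *\<^sub>R (F + G) = r *\<^sub>R F + r *\<^sub>R G"
    by (rule sec_eqI) (simp add: Rep_sec_simps sec_carr cstar_record.scl_pls cstar_record.intro)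
  show "(r + s) *\<^sub>R F = r *\<^sub>R F + s *\<^sub>R F"
    by (rule sec_eqI) (simp add: Rep_sec_simps sec_carr cstar_record.scl_add cstar_record.intro)
  show "r *\<^sub>R s *\<^sub>R F = (r * s) *\<^sub>R F"
    by (rule sec_eqI) (simp add: Rep_sec_simps sec_carr cstar_record.scl_scl cstar_record.intro)
  show "1 *\<^sub>R F = F"
    by (rule sec_eqI) (simp add: Rep_sec_simps sec_carr cstar_record.scl_one cstar_record.intro)
qed

end

instantiation sec :: (type) real_normed_vector
begin

text \<open>The value 0 at other records lets the supremum run over the whole type: the set is
  nonempty, and a bound only has to be nonnegative and valid on C*-algebras.\<close>

definition norm_sec :: "'a sec \<Rightarrow> real" where
  "norm_sec F = (SUP R. if cstar_alg R then nrm R (Rep_sec F R) else 0)"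
definition dist_sec :: "'a sec \<Rightarrow> 'a sec \<Rightarrow> real" where "dist_sec F G = norm (F - G)"
definition sgn_sec :: "'a sec \<Rightarrow> 'a sec" where "sgn_sec F = F /\<^sub>R norm F"
definition uniformity_sec :: "('a sec \<times> 'a sec) filter" where
  "uniformity_sec = (INF e\<in>{0<..}. principal {(x, y). dist x y < e})"
definition open_sec :: "'a sec set \<Rightarrow> bool" where
  "open_sec U = (\<forall>x\<in>U. eventually (\<lambda>(x', y). x' = x \<longrightarrow> y \<in> U) uniformity)"

lemma bdd_sec: "bdd_above (range (\<lambda>R. if cstar_alg R then nrm R (Rep_sec F R) else 0))"
proof -
  obtain K where K: "\<And>R. cstar_alg R \<Longrightarrow> nrm R (Rep_sec F R) \<le> K" using sec_bounded by metis
  then show ?thesis by (intro bdd_aboveI[of _ "max K 0"]) (auto simp: max.coboundedI1)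
qed

lemma nrm_le_norm_sec: "cstar_alg R \<Longrightarrow> nrm R (Rep_sec F R) \<le> norm F"
  unfolding norm_sec_def using cSUP_upper[OF UNIV_I bdd_sec[of F], of R] by simp

lemma norm_sec_nonneg: "0 \<le> norm (F :: 'a sec)"
proof (cases "\<exists>R::'a cstar. cstar_alg R")
  case True
  then obtain R :: "'a cstar" where R: "cstar_alg R" by blast
  then show ?thesis using nrm_le_norm_sec[OF R, of F]
    by (meson cstar_record.intro cstar_record.nrm_nonneg order_trans sec_carr)
qed (simp add: norm_sec_def)

lemma norm_sec_leI: "0 \<le> K \<Longrightarrow> (\<And>R. cstar_alg R \<Longrightarrow> nrm R (Rep_sec F R) \<le> K) \<Longrightarrow> norm F \<le> K"
  unfolding norm_sec_def by (rule cSUP_least) auto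

instance
proof
  fix F G :: "'a sec" and r :: real
  show "(norm F = 0) = (F = 0)"
  proof
    assume "norm F = 0"
    then show "F = 0" using nrm_le_norm_sec[of _ F]
      by (intro sec_eqI) (metis Rep_zero_sec antisym cstar_record.intro cstar_record.nrm_eq_0 cstar_record.nrm_nonneg sec_carr)
  next
    assume "F = 0" then show "norm F = 0"
      by (intro antisym norm_sec_nonneg norm_sec_leI) (simp_all add: Rep_zero_sec cstar_record.nrm_zer cstar_record.intro)
  qed
  show "norm (F + G) \<le> norm F + norm G"
  proof (rule norm_sec_leI)
    fix R :: "'a cstar" assume R: "cstar_alg R"
    show "nrm R (Rep_sec (F + G) R) \<le> norm F + norm G"
      using cstar_record.nrm_pls[OF cstar_record.intro[OF R] sec_carr[OF R] sec_carr[OF R], of F G]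
        nrm_le_norm_sec[OF R, of F] nrm_le_norm_sec[OF R, of G] by (simp add: Rep_plus_sec R)
  qed (simp add: norm_sec_nonneg)
  have le: "norm (r *\<^sub>R F) \<le> \<bar>r\<bar> * norm F" for r and F :: "'a sec"
    by (rule norm_sec_leI)
      (auto simp: Rep_scaleR_sec cstar_record.nrm_scl[OF cstar_record.intro] sec_carr nrm_le_norm_sec mult_left_mono norm_sec_nonneg)
  show "norm (r *\<^sub>R F) = \<bar>r\<bar> * norm F"
  proof (cases "r = 0")
    case True then show ?thesis using le[of 0 F] norm_sec_nonneg[of "0 *\<^sub>R F"] by simp
  next
    case False
    then have "norm F \<le> \<bar>inverse r\<bar> * norm (r *\<^sub>R F)" using le[of "inverse r" "r *\<^sub>R F"] by simp
    then have "\<bar>r\<bar> * norm F \<le> norm (r *\<^sub>R F)" using False by (simp add: field_simps)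
    then show ?thesis using le[of r F] by simp
  qed
qed (simp_all add: dist_sec_def sgn_sec_def uniformity_sec_def open_sec_def)

end

instance sec :: (type) banach
proof
  fix X :: "nat \<Rightarrow> 'a sec" assume X: "Cauchy X"
  have C: "\<exists>x\<in>carr R. (\<lambda>k. nrm R (mns R (Rep_sec (X k) R) x)) \<longlonglongrightarrow> 0" if R: "cstar_alg R" for R :: "'a cstar"
  proof -
    interpret cstar_record R by (rule cstar_record.intro[OF R])
    have "\<exists>N. \<forall>m\<ge>N. \<forall>k\<ge>N. nrm R (pls R (Rep_sec (X m) R) (scl R (-1) (Rep_sec (X k) R))) < e" if "e > 0" for e
    proof -
      obtain N where N: "\<forall>m\<ge>N. \<forall>n\<ge>N. norm (X m - X n) < e" using X \<open>e > 0\<close> by (meson CauchyD)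
      then show ?thesis using nrm_le_norm_sec[OF R]
        by (metis Rep_minus_sec[OF R] mns_def order.strict_trans1)
    qed
    then show ?thesis using complete sec_carr[OF R] unfolding complete_wrt_def mns_def by auto
  qed
  define L where "L R = (SOME x. x \<in> carr R \<and> (\<lambda>k. nrm R (mns R (Rep_sec (X k) R) x)) \<longlonglongrightarrow> 0)" for R :: "'a cstar"
  have L: "L R \<in> carr R \<and> (\<lambda>k. nrm R (mns R (Rep_sec (X k) R) (L R))) \<longlonglongrightarrow> 0" if "cstar_alg R" for R :: "'a cstar"
    unfolding L_def by (rule someI_ex) (use C[OF that] in blast)
  \<comment> \<open>The limit is taken in each algebra separately, but \<open>n\<close> depends on
    the sections alone. This uniformity in \<open>R\<close> yields both the boundedness of
    \<open>L\<close> and convergence in norm.\<close>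
  have lim: "nrm R (mns R (Rep_sec (X n) R) (L R)) \<le> e"
    if R: "cstar_alg R" and N: "\<forall>m\<ge>n. norm (X n - X m) < e" for R :: "'a cstar" and n e
  proof -
    interpret cstar_record R by (rule cstar_record.intro[OF R])
    have "(\<lambda>k. e + nrm R (mns R (Rep_sec (X k) R) (L R))) \<longlonglongrightarrow> e + 0"
      using L[OF R] by (intro tendsto_intros) auto
    moreover have "nrm R (mns R (Rep_sec (X n) R) (L R)) \<le> e + nrm R (mns R (Rep_sec (X k) R) (L R))" if "k \<ge> n" for k
    proof -
      let ?n = "Rep_sec (X n) R" and ?k = "Rep_sec (X k) R"
      have c: "?n \<in> carr R" "?k \<in> carr R" "L R \<in> carr R" using R L sec_carr by auto
      have "mns R ?n (L R) = pls R (mns R ?n ?k) (mns R ?k (L R))"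
        using c by (rule mns_triangle)
      then have "nrm R (mns R ?n (L R)) \<le> nrm R (mns R ?n ?k) + nrm R (mns R ?k (L R))"
        using c by (simp add: nrm_pls)
      moreover have "nrm R (mns R ?n ?k) \<le> e"
        using nrm_le_norm_sec[OF R, of "X n - X k"] N that by (simp add: Rep_minus_sec R order.trans less_imp_le)
      ultimately show ?thesis by linarith
    qed
    ultimately show ?thesis
      by (intro LIMSEQ_le_const[where X="\<lambda>k. e + nrm R (mns R (Rep_sec (X k) R) (L R))" and x=e]) auto
  qed
  \<comment> \<open>One index with distance below 1 bounds the limit by
    \<open>norm (X N) + 1\<close> in all algebras at once, so that \<open>L\<close> defines a
    section.\<close>
  obtain N where N: "\<forall>m\<ge>N. norm (X N - X m) < 1" using X by (meson CauchyD order_refl zero_less_one)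
  have RL: "Rep_sec (mksec L) R = L R" if "cstar_alg R" for R
  proof (rule Rep_mksec[where K="norm (X N) + 1", OF _ _ that])
    fix S :: "'a cstar" assume S: "cstar_alg S"
    interpret cstar_record S by (rule cstar_record.intro[OF S])
    show "L S \<in> carr S" using L[OF S] by blast
    have c: "Rep_sec (X N) S \<in> carr S" "L S \<in> carr S" using S L sec_carr by auto
    have "L S = pls S (Rep_sec (X N) S) (scl S (-1) (mns S (Rep_sec (X N) S) (L S)))"
      using c unfolding mns_def by (simp add: scl_pls scl_scl pls_assoc[symmetric])
    then have "nrm S (L S) \<le> nrm S (Rep_sec (X N) S) + nrm S (mns S (Rep_sec (X N) S) (L S))"
      using nrm_pls[of "Rep_sec (X N) S" "scl S (-1) (mns S (Rep_sec (X N) S) (L S))"] c by (simp add: nrm_scl)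
    also have "\<dots> \<le> norm (X N) + 1" using nrm_le_norm_sec[OF S] lim[OF S N] by (intro add_mono)
    finally show "nrm S (L S) \<le> norm (X N) + 1" .
  qed
  have "X \<longlonglongrightarrow> mksec L"
  proof (rule LIMSEQ_I)
    fix r :: real assume "r > 0"
    then obtain N where N: "\<forall>m\<ge>N. \<forall>n\<ge>N. norm (X m - X n) < r / 2" using X by (meson CauchyD half_gt_zero)
    have "norm (X n - mksec L) \<le> r / 2" if "n \<ge> N" for n
    proof (rule norm_sec_leI)
      fix R :: "'a cstar" assume "cstar_alg R"
      then show "nrm R (Rep_sec (X n - mksec L) R) \<le> r / 2"
        using lim[of R n "r / 2"] N that by (simp add: Rep_minus_sec RL)
    qed (use \<open>r > 0\<close> in simp)
    then show "\<exists>no. \<forall>n\<ge>no. norm (X n - mksec L) < r" using \<open>r > 0\<close> by (metis field_sum_of_halves less_add_same_cancel1 half_gt_zero order.strict_trans1)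
  qed
  then show "convergent X" by (rule convergentI)
qed

text \<open>\<open>iu\<close> is the central imaginary unit: the classes for Banach algebras are over the reals.\<close>

class cst1 = real_normed_algebra + banach + monoid_mult +
  fixes st :: "'a \<Rightarrow> 'a" and iu :: 'a
  assumes st_st [simp]: "st (st x) = x"
    and st_add [simp]: "st (x + y) = st x + st y"
    and st_scaleR [simp]: "st (r *\<^sub>R x) = r *\<^sub>R st x"
    and st_mult [simp]: "st (x * y) = st y * st x"
    and st_iu [simp]: "st iu = - iu"
    and iu_iu: "iu * iu = - 1"
    and iu_comm: "iu * x = x * iu"
    and norm_st_mult: "norm (st x * x) = (norm x)\<^sup>2"

text \<open>A Hilbert module reduced to its norm identities. Real linearity suffices, since an
  operator with an adjoint is automatically compatible with multiplication by i. Instantiated with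
  the sections to obtain the ambient algebra, and with \<open>ell2\<close> to obtain the operators
  of the extended representation.\<close>

locale adjointable =
  fixes ip :: "'e::banach \<Rightarrow> 'e \<Rightarrow> 'b::real_normed_vector" and cj :: "'b \<Rightarrow> 'b"
  assumes ip_add_right: "ip x (y + z) = ip x y + ip x z"
    and ip_scaleR_right: "ip x (r *\<^sub>R y) = r *\<^sub>R ip x y"
    and cj_ip: "cj (ip x y) = ip y x"
    and cj_add: "cj (a + b) = cj a + cj b"
    and cj_scaleR: "cj (r *\<^sub>R a) = r *\<^sub>R cj a"
    and norm_ip: "norm (ip x y) \<le> norm x * norm y"
    and norm_ip_self: "norm (ip x x) = (norm x)\<^sup>2"
begin

lemma ip_add_left: "ip (x + y) z = ip x z + ip y z"
  by (metis cj_ip cj_add ip_add_right)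

lemma ip_scaleR_left: "ip (r *\<^sub>R x) y = r *\<^sub>R ip x y"
  by (metis cj_ip cj_scaleR ip_scaleR_right)

lemma ip_minus_right: "ip x (- y) = - ip x y"
  using ip_scaleR_right[of x "-1" y] by simp

lemma ip_minus_left: "ip (- x) y = - ip x y"
  using ip_scaleR_left[of "-1" x y] by simp

lemma ip_diff_right: "ip x (y - z) = ip x y - ip x z"
  using ip_add_right[of x y "- z"] by (simp add: ip_minus_right)

lemma ip_eqI:
  assumes "\<And>z. ip z x = ip z y" shows "x = y"
proof -
  have "(norm (x - y))\<^sup>2 = 0" by (simp flip: norm_ip_self add: ip_diff_right assms)
  then show ?thesis by simp
qed

text \<open>A relation between two operators, because a bounded operator on a Hilbert module may
  have no adjoint.\<close>

definition AD :: "('e \<Rightarrow>\<^sub>L 'e) \<Rightarrow> ('e \<Rightarrow>\<^sub>L 'e) \<Rightarrow> bool" where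
  "AD T S \<longleftrightarrow> (\<forall>x y. ip (T x) y = ip x (S y))"

lemma AD_D: "AD T S \<Longrightarrow> ip (T x) y = ip x (S y)"
  by (simp add: AD_def)

lemma AD_unique: "AD T S \<Longrightarrow> AD T S' \<Longrightarrow> S = S'"
  by (rule blinfun_eqI, rule ip_eqI) (simp flip: AD_D)

lemma AD_sym: "AD T S \<Longrightarrow> AD S T"
  unfolding AD_def by (metis cj_ip)

lemma AD_add: "AD T S \<Longrightarrow> AD T' S' \<Longrightarrow> AD (T + T') (S + S')"
  by (simp add: AD_def blinfun.add_left ip_add_left ip_add_right)

lemma AD_scaleR: "AD T S \<Longrightarrow> AD (r *\<^sub>R T) (r *\<^sub>R S)"
  by (simp add: AD_def blinfun.scaleR_left ip_scaleR_left ip_scaleR_right)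

lemma AD_minus: "AD T S \<Longrightarrow> AD (- T) (- S)"
  using AD_scaleR[of T S "-1"] by simp

lemma AD_diff: "AD T S \<Longrightarrow> AD T' S' \<Longrightarrow> AD (T - T') (S - S')"
  using AD_add[OF _ AD_minus] by force

lemma AD_comp: "AD T S \<Longrightarrow> AD T' S' \<Longrightarrow> AD (T o\<^sub>L T') (S' o\<^sub>L S)"
  by (simp add: AD_def)

lemma AD_id: "AD id_blinfun id_blinfun"
  by (simp add: AD_def)

lemma AD_zero: "AD 0 0"
  using AD_scaleR[OF AD_id, of 0] by simp

lemma AD_norm_comp_ge:
  assumes "AD T S" shows "(norm T)\<^sup>2 \<le> norm (S o\<^sub>L T)"
proof -
  have "norm (T x) \<le> sqrt (norm (S o\<^sub>L T)) * norm x" for x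
  proof -
    have "(norm (T x))\<^sup>2 = norm (ip x ((S o\<^sub>L T) x))"
      by (simp flip: norm_ip_self add: AD_D[OF assms])
    also have "\<dots> \<le> norm x * (norm (S o\<^sub>L T) * norm x)"
      by (meson norm_ip norm_blinfun mult_left_mono norm_ge_zero order_trans)
    also have "\<dots> = (sqrt (norm (S o\<^sub>L T)) * norm x)\<^sup>2"
      by (simp add: power_mult_distrib power2_eq_square)
    finally show ?thesis by (rule power2_le_imp_le) simp
  qed
  then have "norm T \<le> sqrt (norm (S o\<^sub>L T))" by (intro norm_blinfun_bound) auto
  then show ?thesis by (metis norm_ge_zero power2_le_iff_abs_le real_le_rsqrt abs_of_nonneg real_sqrt_ge_zero real_sqrt_pow2 power_mono)
qed

lemma AD_norm:
  assumes "AD T S" shows "norm S = norm T"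
proof -
  have *: "norm T \<le> norm S" if "AD T S" for T S
  proof (cases "norm T = 0")
    case False
    have "norm T * norm T \<le> norm S * norm T"
      using AD_norm_comp_ge[OF that] norm_blinfun_compose[of S T] by (simp add: power2_eq_square)
    then show ?thesis using False by simp
  qed simp
  show ?thesis using *[OF assms] *[OF AD_sym[OF assms]] by simp
qed

lemma AD_norm_comp: "AD T S \<Longrightarrow> norm (S o\<^sub>L T) = (norm T)\<^sup>2"
  using AD_norm_comp_ge[of T S] norm_blinfun_compose[of S T] AD_norm[of T S]
  by (simp add: power2_eq_square)

text \<open>Passing to the adjoint preserves the norm of differences, so the adjoints of a
  convergent sequence form a Cauchy sequence. This is the completeness of the algebra of adjointable
  operators.\<close>

lemma AD_limit:
  assumes X: "X \<longlonglongrightarrow> T" and AD: "\<And>n. \<exists>S. AD (X n) S"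
  shows "\<exists>S. AD T S"
proof -
  obtain Y where Y: "\<And>n. AD (X n) (Y n)" using AD by metis
  have d: "norm (Y m - Y n) = norm (X m - X n)" for m n by (rule AD_norm[OF AD_diff[OF Y Y]])
  have "Cauchy Y" using LIMSEQ_imp_Cauchy[OF X] unfolding Cauchy_def dist_norm d .
  then obtain S where S: "Y \<longlonglongrightarrow> S" using Cauchy_convergent convergent_def by metis
  have bl: "bounded_linear (ip x)" for x
    by (intro bounded_linear_intro[where K="norm x"]) (simp_all add: ip_add_right ip_scaleR_right norm_ip mult.commute[of _ "norm x"])
  have br: "bounded_linear (\<lambda>x. ip x y)" for y
    by (intro bounded_linear_intro[where K="norm y"]) (simp_all add: ip_add_left ip_scaleR_left norm_ip)
  have "ip (T x) y = ip x (S y)" for x y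
  proof (rule LIMSEQ_unique)
    show "(\<lambda>n. ip (X n x) y) \<longlonglongrightarrow> ip (T x) y"
      by (intro bounded_linear.tendsto[OF br] blinfun.tendsto X tendsto_const)
    show "(\<lambda>n. ip (X n x) y) \<longlonglongrightarrow> ip x (S y)"
      unfolding AD_D[OF Y] by (intro bounded_linear.tendsto[OF bl] blinfun.tendsto S tendsto_const)
  qed
  then show ?thesis unfolding AD_def by blast
qed

definition adj :: "('e \<Rightarrow>\<^sub>L 'e) \<Rightarrow> ('e \<Rightarrow>\<^sub>L 'e)" where
  "adj T = (THE S. AD T S)"

lemma adj_eq: "AD T S \<Longrightarrow> adj T = S"
  unfolding adj_def using AD_unique by blast

lemma AD_adj: "\<exists>S. AD T S \<Longrightarrow> AD T (adj T)"
  using adj_eq by blast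

end

section \<open>The C*-algebra of adjointable operators on the sections\<close>

definition sip :: "'a sec \<Rightarrow> 'a sec \<Rightarrow> 'a sec" where
  "sip F G = mksec (\<lambda>R. mlt R (str R (Rep_sec F R)) (Rep_sec G R))"

definition sst :: "'a sec \<Rightarrow> 'a sec" where
  "sst F = mksec (\<lambda>R. str R (Rep_sec F R))"

definition simul :: "'a sec \<Rightarrow> 'a sec" where
  "simul F = mksec (\<lambda>R. scl R \<i> (Rep_sec F R))"

lemma Rep_sip: "cstar_alg R \<Longrightarrow> Rep_sec (sip F G) R = mlt R (str R (Rep_sec F R)) (Rep_sec G R)"
  and norm_sip: "norm (sip F G) \<le> norm F * norm G"
proof -
  have b: "nrm R (mlt R (str R (Rep_sec F R)) (Rep_sec G R)) \<le> norm F * norm G" if "cstar_alg R" for R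
  proof -
    interpret cstar_record R by (rule cstar_record.intro[OF that])
    have c: "Rep_sec F R \<in> carr R" "Rep_sec G R \<in> carr R" using sec_carr that by auto
    have "nrm R (mlt R (str R (Rep_sec F R)) (Rep_sec G R)) \<le> nrm R (Rep_sec F R) * nrm R (Rep_sec G R)"
      using nrm_mlt[of "str R (Rep_sec F R)" "Rep_sec G R"] c by simp
    also have "\<dots> \<le> norm F * norm G"
      using c by (intro mult_mono nrm_le_norm_sec that) simp_all
    finally show ?thesis .
  qed
  have *: "Rep_sec (sip F G) R = mlt R (str R (Rep_sec F R)) (Rep_sec G R)" if R: "cstar_alg R" for R
    unfolding sip_def
    by (rule Rep_mksec[OF _ b R])
      (simp_all add: sec_carr cstar_record.mlt_carr[OF cstar_record.intro] cstar_record.str_carr[OF cstar_record.intro])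
  then show "cstar_alg R \<Longrightarrow> Rep_sec (sip F G) R = mlt R (str R (Rep_sec F R)) (Rep_sec G R)" .
  show "norm (sip F G) \<le> norm F * norm G" by (rule norm_sec_leI) (simp_all add: * b)
qed

lemma Rep_sst:
  assumes "cstar_alg R" shows "Rep_sec (sst F) R = str R (Rep_sec F R)"
  unfolding sst_def
  by (rule Rep_mksec[where K="norm F", OF _ _ assms])
    (simp_all add: sec_carr cstar_record.str_carr[OF cstar_record.intro] cstar_record.nrm_str[OF cstar_record.intro] nrm_le_norm_sec)

lemma Rep_simul:
  assumes "cstar_alg R" shows "Rep_sec (simul F) R = scl R \<i> (Rep_sec F R)"
  unfolding simul_def
  by (rule Rep_mksec[where K="norm F", OF _ _ assms])
    (simp_all add: sec_carr cstar_record.scl_carr[OF cstar_record.intro] cstar_record.nrm_scl[OF cstar_record.intro] nrm_le_norm_sec)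

interpretation sec: adjointable sip sst
proof
  fix x y z :: "'a sec" and r :: real
  note c = cstar_record.intro
  show "sip x (y + z) = sip x y + sip x z"
    by (rule sec_eqI) (simp add: Rep_sip Rep_sec_simps sec_carr cstar_record.mlt_pls_right[OF c] cstar_record.str_carr[OF c])
  show "sip x (r *\<^sub>R y) = r *\<^sub>R sip x y"
    by (rule sec_eqI) (simp add: Rep_sip Rep_sec_simps sec_carr cstar_record.mlt_scl_right[OF c] cstar_record.str_carr[OF c])
  show "sst (sip x y) = sip y x"
    by (rule sec_eqI) (simp add: Rep_sip Rep_sst sec_carr cstar_record.str_mlt[OF c] cstar_record.str_carr[OF c] cstar_record.str_str[OF c])
  show "sst (x + y) = sst x + sst y"
    by (rule sec_eqI) (simp add: Rep_sec_simps Rep_sst sec_carr cstar_record.str_pls[OF c])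
  show "sst (r *\<^sub>R x) = r *\<^sub>R sst x"
    by (rule sec_eqI) (simp add: Rep_sec_simps Rep_sst sec_carr cstar_record.str_scl[OF c])
  show "norm (sip x y) \<le> norm x * norm y" by (rule norm_sip)
  show "norm (sip x x) = (norm x)\<^sup>2"
  proof (rule antisym)
    show "norm (sip x x) \<le> (norm x)\<^sup>2" using norm_sip[of x x] by (simp add: power2_eq_square)
    have "norm x \<le> sqrt (norm (sip x x))"
    proof (rule norm_sec_leI)
      fix R :: "'a cstar" assume R: "cstar_alg R"
      have "(nrm R (Rep_sec x R))\<^sup>2 \<le> norm (sip x x)"
        using nrm_le_norm_sec[OF R, of "sip x x"] by (simp add: Rep_sip R sec_carr cstar_record.nrm_str_mlt[OF c])
      then show "nrm R (Rep_sec x R) \<le> sqrt (norm (sip x x))" by (rule real_le_rsqrt)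
    qed simp
    then show "(norm x)\<^sup>2 \<le> norm (sip x x)" by (metis norm_ge_zero power_mono real_sqrt_pow2)
  qed
qed

definition simulL :: "'a sec \<Rightarrow>\<^sub>L 'a sec" where "simulL = Blinfun simul"

lemma simulL_apply [simp]: "blinfun_apply simulL = simul"
  unfolding simulL_def
proof (rule bounded_linear_Blinfun_apply, rule bounded_linear_intro[where K=1])
  fix x y :: "'a sec" and r :: real
  note c = cstar_record.intro
  show "simul (x + y) = simul x + simul y"
    by (rule sec_eqI) (simp add: Rep_simul Rep_sec_simps sec_carr cstar_record.scl_pls[OF c])
  show "simul (r *\<^sub>R x) = r *\<^sub>R simul x"
    by (rule sec_eqI) (simp add: Rep_simul Rep_sec_simps sec_carr cstar_record.scl_scl[OF c] mult.commute)
  show "norm (simul x) \<le> norm x * 1"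
    by (rule norm_sec_leI) (simp_all add: Rep_simul sec_carr cstar_record.nrm_scl[OF c] nrm_le_norm_sec)
qed

lemma sip_simul: "sip x (simul y) = simul (sip x y)" and sip_simul_left: "sip (simul x) y = - simul (sip x y)"
  and simul_simul: "simul (simul x) = - x"
  by (rule sec_eqI, simp add: Rep_simul Rep_sip Rep_sec_simps sec_carr cstar_record.mlt_scl_right[OF cstar_record.intro]
    cstar_record.mlt_scl_left[OF cstar_record.intro] cstar_record.str_carr[OF cstar_record.intro]
    cstar_record.str_scl[OF cstar_record.intro] cstar_record.scl_carr[OF cstar_record.intro] cstar_record.mlt_carr[OF cstar_record.intro]
    cstar_record.scl_scl[OF cstar_record.intro])+

lemma AD_simulL: "sec.AD simulL (- simulL)"
  by (simp add: sec.AD_def blinfun.minus_left sip_simul sip_simul_left sec.ip_minus_right)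

typedef 'a mul = "{T :: 'a sec \<Rightarrow>\<^sub>L 'a sec. \<exists>S. sec.AD T S}"
  using sec.AD_zero by auto

setup_lifting type_definition_mul

instantiation mul :: (type) real_vector
begin

lift_definition zero_mul :: "'a mul" is 0 using sec.AD_zero by blast
lift_definition plus_mul :: "'a mul \<Rightarrow> 'a mul \<Rightarrow> 'a mul" is "(+)" using sec.AD_add by blast
lift_definition minus_mul :: "'a mul \<Rightarrow> 'a mul \<Rightarrow> 'a mul" is "(-)" using sec.AD_diff by blast
lift_definition uminus_mul :: "'a mul \<Rightarrow> 'a mul" is "uminus" using sec.AD_minus by blast
lift_definition scaleR_mul :: "real \<Rightarrow> 'a mul \<Rightarrow> 'a mul" is "(*\<^sub>R)" using sec.AD_scaleR by blast

instance
  by standard (transfer, simp add: algebra_simps)+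

end

instantiation mul :: (type) real_normed_vector
begin

lift_definition norm_mul :: "'a mul \<Rightarrow> real" is norm .
definition dist_mul :: "'a mul \<Rightarrow> 'a mul \<Rightarrow> real" where "dist_mul F G = norm (F - G)"
definition sgn_mul :: "'a mul \<Rightarrow> 'a mul" where "sgn_mul F = F /\<^sub>R norm F"
definition uniformity_mul :: "('a mul \<times> 'a mul) filter" where
  "uniformity_mul = (INF e\<in>{0<..}. principal {(x, y). dist x y < e})"
definition open_mul :: "'a mul set \<Rightarrow> bool" where
  "open_mul U = (\<forall>x\<in>U. eventually (\<lambda>(x', y). x' = x \<longrightarrow> y \<in> U) uniformity)"

instance
proof
  fix F G :: "'a mul" and r :: real
  show "(norm F = 0) = (F = 0)" by transfer simp
  show "norm (F + G) \<le> norm F + norm G" by transfer (rule norm_triangle_ineq)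
  show "norm (r *\<^sub>R F) = \<bar>r\<bar> * norm F" by transfer simp
qed (simp_all add: dist_mul_def sgn_mul_def uniformity_mul_def open_mul_def)

end

instance mul :: (type) banach
proof
  fix X :: "nat \<Rightarrow> 'a mul" assume X: "Cauchy X"
  have d: "dist (Rep_mul (X m)) (Rep_mul (X n)) = dist (X m) (X n)" for m n
    by (simp add: dist_norm norm_mul.rep_eq minus_mul.rep_eq)
  have "Cauchy (\<lambda>n. Rep_mul (X n))" using X unfolding Cauchy_def d .
  then obtain T where T: "(\<lambda>n. Rep_mul (X n)) \<longlonglongrightarrow> T" using Cauchy_convergent convergent_def by metis
  then have "\<exists>S. sec.AD T S" by (rule sec.AD_limit) (use Rep_mul in blast)
  then obtain L where L: "Rep_mul L = T" using Abs_mul_inverse by blast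
  have "X \<longlonglongrightarrow> L" using T unfolding L[symmetric] LIMSEQ_def
    by (simp add: dist_norm norm_mul.rep_eq minus_mul.rep_eq)
  then show "convergent X" by (rule convergentI)
qed

instantiation mul :: (type) cst1
begin

lift_definition times_mul :: "'a mul \<Rightarrow> 'a mul \<Rightarrow> 'a mul" is "(o\<^sub>L)" using sec.AD_comp by blast
lift_definition one_mul :: "'a mul" is "id_blinfun" using sec.AD_id by blast
lift_definition st_mul :: "'a mul \<Rightarrow> 'a mul" is sec.adj using sec.AD_adj sec.AD_sym by blast
lift_definition iu_mul :: "'a mul" is "simulL" using AD_simulL by blast

instance
proof
  fix x y z :: "'a mul" and r :: real
  show "x * y * z = x * (y * z)" by transfer (rule blinfun_eqI, simp)
  show "(x + y) * z = x * z + y * z" by transfer (rule blinfun_eqI, simp add: blinfun.add_left)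
  show "x * (y + z) = x * y + x * z" by transfer (rule blinfun_eqI, simp add: blinfun.add_left blinfun.add_right)
  show "r *\<^sub>R x * y = r *\<^sub>R (x * y)" by transfer (rule blinfun_eqI, simp add: blinfun.scaleR_left)
  show "x * r *\<^sub>R y = r *\<^sub>R (x * y)" by transfer (rule blinfun_eqI, simp add: blinfun.scaleR_left blinfun.scaleR_right)
  show "norm (x * y) \<le> norm x * norm y" by transfer (rule norm_blinfun_compose)
  show "1 * x = x" by transfer (rule blinfun_eqI, simp)
  show "x * 1 = x" by transfer (rule blinfun_eqI, simp)
  show "st (st x) = x" by transfer (metis sec.AD_adj sec.AD_sym sec.adj_eq)
  show "st (x + y) = st x + st y" by transfer (metis sec.AD_adj sec.AD_add sec.adj_eq)
  show "st (r *\<^sub>R x) = r *\<^sub>R st x" by transfer (metis sec.AD_adj sec.AD_scaleR sec.adj_eq)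
  show "st (x * y) = st y * st x" by transfer (metis sec.AD_adj sec.AD_comp sec.adj_eq)
  show "st iu = - (iu :: 'a mul)" by transfer (rule sec.adj_eq[OF AD_simulL])
  show "iu * iu = - (1 :: 'a mul)" by transfer (rule blinfun_eqI, simp add: simul_simul blinfun.minus_left)
  \<comment> \<open>An adjointable operator is complex linear: moved to the other side of the inner
    product it becomes its adjoint, and \<open>sip\<close> commutes with \<open>simul\<close> in its
    second argument.\<close>
  show "iu * x = x * iu"
  proof (transfer, clarify)
    fix T S :: "'a sec \<Rightarrow>\<^sub>L 'a sec" assume A: "sec.AD T S"
    show "simulL o\<^sub>L T = T o\<^sub>L simulL"
      by (rule blinfun_eqI, rule sec.ip_eqI) (simp add: sip_simul flip: sec.AD_D[OF sec.AD_sym[OF A]])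
  qed
  show "norm (st x * x) = (norm x)\<^sup>2" by transfer (metis sec.AD_norm_comp sec.AD_adj)
qed

end

section \<open>Embedding every C*-algebra into the operators on sections\<close>

definition csc :: "complex \<Rightarrow> 'a::cst1 \<Rightarrow> 'a" where
  "csc c x = Re c *\<^sub>R x + Im c *\<^sub>R (iu * x)"

text \<open>The left regular representation of \<open>R\<close> on its own fibre, extended by zero
  to the other fibres.\<close>

definition ebf :: "'a cstar \<Rightarrow> 'a \<Rightarrow> 'a sec \<Rightarrow> 'a sec" where
  "ebf R a x = mksec (\<lambda>S. if S = R then mlt R a (Rep_sec x R) else zer S)"

text \<open>The unit \<open>1\<close> is the identity on all fibres and need not be in the image.
  Elements such as \<open>1 - emb R a\<close> therefore take the part of a unitization of
  \<open>R\<close>.\<close>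

definition emb :: "'a cstar \<Rightarrow> 'a \<Rightarrow> 'a mul" where
  "emb R a = Abs_mul (Blinfun (ebf R a))"

context cstar_record
begin

lemma cc [simp]: "cstar_alg C" by (rule cstar)

lemma Rep_ebf:
  assumes a: "a \<in> carr C" and S: "cstar_alg S"
  shows "Rep_sec (ebf C a x) S = (if S = C then mlt C a (Rep_sec x C) else zer S)"
  unfolding ebf_def
proof (rule Rep_mksec[where K="nrm C a * norm x", OF _ _ S])
  fix S :: "'a cstar" assume S: "cstar_alg S"
  show "(if S = C then mlt C a (Rep_sec x C) else zer S) \<in> carr S"
    using a by (simp add: sec_carr cstar_record.zer_carr[OF cstar_record.intro[OF S]])
  have "nrm C (mlt C a (Rep_sec x C)) \<le> nrm C a * norm x"
    using nrm_mlt[OF a sec_carr[OF cstar, of x]] mult_left_mono[OF nrm_le_norm_sec[OF cstar, of x] nrm_nonneg[OF a]] by linarith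
  then show "nrm S (if S = C then mlt C a (Rep_sec x C) else zer S) \<le> nrm C a * norm x"
    using a by (simp add: cstar_record.nrm_zer[OF cstar_record.intro[OF S]])
qed

lemma norm_ebf:
  assumes a: "a \<in> carr C" shows "norm (ebf C a x) \<le> norm x * nrm C a"
proof (rule norm_sec_leI)
  fix S :: "'a cstar" assume S: "cstar_alg S"
  have "nrm C (mlt C a (Rep_sec x C)) \<le> nrm C a * norm x"
    using nrm_mlt[OF a sec_carr[OF cstar, of x]] mult_left_mono[OF nrm_le_norm_sec[OF cstar, of x] nrm_nonneg[OF a]] by linarith
  then show "nrm S (Rep_sec (ebf C a x) S) \<le> norm x * nrm C a"
    using a by (simp add: Rep_ebf S cstar_record.nrm_zer[OF cstar_record.intro[OF S]] mult.commute)
qed (use a in simp)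

lemma ebf_linear:
  assumes a: "a \<in> carr C" shows "bounded_linear (ebf C a)"
proof (rule bounded_linear_intro[where K="nrm C a"])
  fix x y :: "'a sec" and r :: real
  note c = cstar_record.intro
  show "ebf C a (x + y) = ebf C a x + ebf C a y"
    by (rule sec_eqI) (simp add: Rep_ebf a Rep_sec_simps sec_carr mlt_pls_right cstar_record.zer_carr[OF c] cstar_record.pls_zer_left[OF c])
  show "ebf C a (r *\<^sub>R x) = r *\<^sub>R ebf C a x"
    by (rule sec_eqI) (simp add: Rep_ebf a Rep_sec_simps sec_carr mlt_scl_right cstar_record.scl_zer[OF c])
  show "norm (ebf C a x) \<le> norm x * nrm C a" by (rule norm_ebf[OF a])
qed

lemma ebf_Blinfun [simp]: "a \<in> carr C \<Longrightarrow> blinfun_apply (Blinfun (ebf C a)) = ebf C a"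
  by (rule bounded_linear_Blinfun_apply[OF ebf_linear])

lemma AD_ebf:
  assumes a: "a \<in> carr C" shows "sec.AD (Blinfun (ebf C a)) (Blinfun (ebf C (str C a)))"
  unfolding sec.AD_def
proof (intro allI sec_eqI)
  fix x y and S :: "'a cstar" assume S: "cstar_alg S"
  interpret S: cstar_record S by (rule cstar_record.intro[OF S])
  show "Rep_sec (sip (blinfun_apply (Blinfun (ebf C a)) x) y) S = Rep_sec (sip x (blinfun_apply (Blinfun (ebf C (str C a))) y)) S"
    using a by (auto simp: Rep_sip S Rep_ebf str_mlt sec_carr mlt_assoc)
qed

lemma Rep_emb: "a \<in> carr C \<Longrightarrow> Rep_mul (emb C a) = Blinfun (ebf C a)"
  unfolding emb_def using AD_ebf by (subst Abs_mul_inverse) auto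

lemma mul_eqI: "(\<And>x. Rep_mul F x = Rep_mul G x) \<Longrightarrow> F = G"
  by (simp add: blinfun_eqI flip: Rep_mul_inject)

lemma emb_pls: "a \<in> carr C \<Longrightarrow> b \<in> carr C \<Longrightarrow> emb C (pls C a b) = emb C a + emb C b"
  by (intro mul_eqI sec_eqI) (auto simp: plus_mul.rep_eq Rep_emb blinfun.add_left Rep_ebf Rep_sec_simps mlt_pls_left sec_carr
      cstar_record.zer_carr[OF cstar_record.intro] cstar_record.pls_zer_left[OF cstar_record.intro])

lemma emb_mlt: "a \<in> carr C \<Longrightarrow> b \<in> carr C \<Longrightarrow> emb C (mlt C a b) = emb C a * emb C b"
  by (intro mul_eqI sec_eqI) (auto simp: times_mul.rep_eq Rep_emb Rep_ebf Rep_sec_simps mlt_assoc sec_carr)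

lemma emb_str: "a \<in> carr C \<Longrightarrow> emb C (str C a) = st (emb C a)"
  using sec.adj_eq[OF AD_ebf[of a]] by (simp add: st_mul.rep_eq Rep_emb flip: Rep_mul_inject)

lemma emb_scl: "a \<in> carr C \<Longrightarrow> emb C (scl C c a) = csc c (emb C a)"
proof -
  assume a: "a \<in> carr C"
  have "scl C c y = pls C (scl C (complex_of_real (Re c)) y) (scl C (complex_of_real (Im c) * \<i>) y)" if "y \<in> carr C" for y
    using that by (simp flip: scl_add add: mult.commute[of _ \<i>] flip: complex_eq)
  then show ?thesis using a unfolding csc_def
    by (intro mul_eqI sec_eqI)
      (auto simp: plus_mul.rep_eq times_mul.rep_eq iu_mul.rep_eq scaleR_mul.rep_eq blinfun.scaleR_left Rep_emb blinfun.add_left Rep_ebf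
        Rep_sec_simps Rep_simul mlt_scl_left mlt_pls_left sec_carr
      cstar_record.zer_carr[OF cstar_record.intro] cstar_record.pls_zer_left[OF cstar_record.intro] cstar_record.scl_zer[OF cstar_record.intro])
qed

lemma norm_emb:
  assumes a: "a \<in> carr C" shows "norm (emb C a) = nrm C a"
proof (rule antisym)
  show "norm (emb C a) \<le> nrm C a"
    unfolding norm_mul.rep_eq Rep_emb[OF a] using a
    by (intro norm_blinfun_bound) (simp_all add: norm_ebf mult.commute)
  \<comment> \<open>The test vector for the lower bound is the adjoint of \<open>a\<close> placed in
    its own fibre: applying \<open>a\<close> to it gives an element of norm
    \<open>(nrm C a)^2\<close>.\<close>
  define d where "d = mksec (\<lambda>S. if S = C then str C a else zer S)"
  have Rd: "Rep_sec d S = (if S = C then str C a else zer S)" if S: "cstar_alg S" for S unfolding d_def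
    by (rule Rep_mksec[where K="nrm C a", OF _ _ S])
       (auto simp: a cstar_record.zer_carr[OF cstar_record.intro] cstar_record.nrm_zer[OF cstar_record.intro])
  have nd: "norm d \<le> nrm C a"
    by (rule norm_sec_leI) (auto simp: Rd a cstar_record.nrm_zer[OF cstar_record.intro])
  have "(nrm C a)\<^sup>2 = nrm C (mlt C a (str C a))"
    using nrm_str_mlt[of "str C a"] a by simp
  also have "\<dots> \<le> norm (ebf C a d)"
    using nrm_le_norm_sec[OF cstar, of "ebf C a d"] by (simp add: Rep_ebf a Rd)
  also have "\<dots> \<le> norm (emb C a) * norm d"
    using norm_blinfun[of "Rep_mul (emb C a)" d] a by (simp add: Rep_emb norm_mul.rep_eq)
  also have "\<dots> \<le> norm (emb C a) * nrm C a" by (intro mult_left_mono nd) simp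
  finally have "nrm C a * nrm C a \<le> norm (emb C a) * nrm C a" by (simp add: power2_eq_square)
  then show "nrm C a \<le> norm (emb C a)"
    using nrm_nonneg[OF a] by (cases "nrm C a = 0") (simp_all add: mult_le_cancel_right)
qed

lemma emb_zer [simp]: "emb C (zer C) = 0"
  using norm_emb[of "zer C"] by simp

lemma emb_mns: "a \<in> carr C \<Longrightarrow> b \<in> carr C \<Longrightarrow> emb C (mns C a b) = emb C a - emb C b"
  by (simp add: mns_def emb_pls emb_scl csc_def)

lemma emb_inj: "a \<in> carr C \<Longrightarrow> b \<in> carr C \<Longrightarrow> emb C a = emb C b \<longleftrightarrow> a = b"
proof
  assume ab: "a \<in> carr C" "b \<in> carr C" and e: "emb C a = emb C b"
  then have "nrm C (mns C a b) = 0" using norm_emb[of "mns C a b"] by (simp add: emb_mns)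
  then have "mns C a b = zer C" using ab by simp
  then have "pls C (pls C a (scl C (-1) b)) b = b" using ab by (simp add: mns_def)
  then show "a = b" using ab by (simp add: pls_assoc)
qed simp

lemma nrm_mns: "a \<in> carr C \<Longrightarrow> b \<in> carr C \<Longrightarrow> nrm C (mns C a b) = norm (emb C a - emb C b)"
  by (simp flip: emb_mns norm_emb)

end

section \<open>Norms of adjoints, square roots near 1, and real parts of unitaries\<close>

lemma st_zero [simp]: "st (0::'a::cst1) = 0"
  using st_scaleR[of 0 "0::'a"] by simp

lemma st_minus [simp]: "st (- x :: 'a::cst1) = - st x"
  using st_scaleR[of "-1" x] by simp

lemma st_diff [simp]: "st (x - y :: 'a::cst1) = st x - st y"
  using st_add[of x "- y"] by simp

lemma st_one [simp]: "st (1::'a::cst1) = 1"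
  by (metis mult.right_neutral st_mult st_st)

lemma norm_st [simp]: "norm (st x) = norm (x :: 'a::cst1)"
proof -
  have *: "norm x \<le> norm (st x)" for x :: 'a
  proof (cases "x = 0")
    case False
    then show ?thesis using norm_mult_ineq[of "st x" x] by (simp add: norm_st_mult power2_eq_square)
  qed simp
  show ?thesis using *[of x] *[of "st x"] by simp
qed

lemma iu_mult_iu_mult: "iu * x * (iu * y) = - (x * y)" for x y :: "'a::cst1"
proof -
  have "iu * x * (iu * y) = iu * (x * iu) * y" by (simp only: mult.assoc)
  also have "\<dots> = iu * iu * (x * y)" by (simp only: mult.assoc iu_comm[of x, symmetric])
  finally show ?thesis by (simp add: iu_iu)
qed

lemma bounded_linear_st: "bounded_linear (st :: 'a::cst1 \<Rightarrow> 'a)"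
  by (rule bounded_linear_intro[where K=1]) auto

lemmas tendsto_st [tendsto_intros] = bounded_linear.tendsto[OF bounded_linear_st]
lemmas continuous_on_st [continuous_intros] = bounded_linear.continuous_on[OF bounded_linear_st]

text \<open>An inequality because the zero algebra belongs to the class, where the unit has norm
  0.\<close>

lemma norm_one_le [simp]: "norm (1::'a::cst1) \<le> 1"
proof -
  have "norm (1::'a) * norm (1::'a) = norm (1::'a)" using norm_st_mult[of "1::'a"] by (simp add: power2_eq_square)
  then show ?thesis by (metis mult_cancel_left1 norm_ge_zero order_refl zero_le_one)
qed

lemma norm_scaleR_one_le: "norm (r *\<^sub>R (1::'a::cst1)) \<le> \<bar>r\<bar>"
  using mult_left_mono[OF norm_one_le, of "\<bar>r\<bar>"] by simp

lemma norm_self_adjoint_square: "st x = x \<Longrightarrow> norm (x * x) = (norm x)\<^sup>2" for x :: "'a::cst1"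
  using norm_st_mult[of x] by simp

text \<open>The equation for \<open>d\<close> says (1 - d)^2 = 1 - b, and \<open>d\<close> is the
  fixed point of u \<mapsto> (b + u u) / 2. The iteration can be run inside any closed invariant set
  that contains 0, which gives the last conclusion. Through it \<open>d\<close> inherits
  self-adjointness, commutation relations and membership in subalgebras without the unit.\<close>

lemma sqrt_fixpoint:
  fixes b :: "'a::cst1"
  assumes b: "norm b < 1"
  obtains d where "norm d < 1" "2 *\<^sub>R d - d * d = b"
    "\<And>S. closed S \<Longrightarrow> 0 \<in> S \<Longrightarrow> (\<And>u. u \<in> S \<Longrightarrow> (1/2) *\<^sub>R (b + u * u) \<in> S) \<Longrightarrow> d \<in> S"
proof -
  \<comment> \<open>The smaller root of norm b + r^2 = 2 r: the ball of this radius is mapped into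
    itself, and the root, being below 1, is a Lipschitz constant there.\<close>
  define \<rho> where "\<rho> = 1 - sqrt (1 - norm b)"
  have \<rho>: "0 \<le> \<rho>" "\<rho> < 1" using b by (simp_all add: \<rho>_def)
  have "(1 - \<rho>)\<^sup>2 = 1 - norm b" using b by (simp add: \<rho>_def)
  then have \<rho>_eq: "norm b + \<rho> * \<rho> = 2 * \<rho>" by (simp add: power2_eq_square algebra_simps)
  define f where "f u = (1/2) *\<^sub>R (b + u * u)" for u :: 'a
  have f_ball: "f u \<in> cball 0 \<rho>" if "u \<in> cball 0 \<rho>" for u
  proof -
    have "norm (b + u * u) \<le> norm b + norm u * norm u"
      by (meson norm_triangle_ineq norm_mult_ineq add_left_mono order_trans)
    also have "\<dots> \<le> 2 * \<rho>" using that mult_mono[of "norm u" \<rho> "norm u" \<rho>] \<rho> by (simp add: \<rho>_eq[symmetric])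
    finally show ?thesis by (simp add: f_def)
  qed
  have f_contr: "dist (f u) (f v) \<le> \<rho> * dist u v" if "u \<in> cball 0 \<rho>" "v \<in> cball 0 \<rho>" for u v
  proof -
    have "u * u - v * v = u * (u - v) + (u - v) * v" by (simp add: algebra_simps)
    then have "norm (u * u - v * v) \<le> norm u * norm (u - v) + norm (u - v) * norm v"
      by (metis norm_triangle_le norm_mult_ineq add_mono)
    also have "\<dots> \<le> \<rho> * norm (u - v) + norm (u - v) * \<rho>"
      using that \<rho> by (intro add_mono mult_mono) auto
    finally show ?thesis by (simp add: f_def dist_norm flip: scaleR_diff_right)
  qed
  \<comment> \<open>Used for the whole space and for an invariant set \<open>S\<close>; uniqueness
    in the ball identifies the two fixed points.\<close>
  have fix1: "\<exists>!x. x \<in> cball 0 \<rho> \<inter> S \<and> f x = x" if "closed S" "0 \<in> S" "\<And>u. u \<in> S \<Longrightarrow> f u \<in> S" for S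
  proof -
    have "\<exists>!x\<in>cball 0 \<rho> \<inter> S. f x = x"
    proof (rule Banach_fix[where c=\<rho>])
      show "complete (cball 0 \<rho> \<inter> S)" using that by (simp add: complete_eq_closed closed_Int)
      show "cball 0 \<rho> \<inter> S \<noteq> {}" using that \<rho> by force
      show "f ` (cball 0 \<rho> \<inter> S) \<subseteq> cball 0 \<rho> \<inter> S" using that f_ball by blast
      show "\<And>x y. x \<in> cball 0 \<rho> \<inter> S \<Longrightarrow> y \<in> cball 0 \<rho> \<inter> S \<Longrightarrow> dist (f x) (f y) \<le> \<rho> * dist x y" using f_contr by blast
    qed (use \<rho> in simp_all)
    then show ?thesis .
  qed
  obtain d where d: "d \<in> cball 0 \<rho>" "f d = d" and uniq: "\<And>x. x \<in> cball 0 \<rho> \<Longrightarrow> f x = x \<Longrightarrow> x = d"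
  proof -
    have "\<exists>!x. x \<in> cball 0 \<rho> \<and> f x = x" using fix1[of UNIV] by simp
    then show thesis by (rule ex1E) (blast intro: that)
  qed
  show thesis
  proof (rule that)
    show "norm d < 1" using d \<rho> by simp
    have "2 *\<^sub>R f d = b + d * d" by (simp add: f_def)
    then show "2 *\<^sub>R d - d * d = b" using d by (simp add: algebra_simps)
  next
    fix S assume "closed S" "0 \<in> S" "\<And>u. u \<in> S \<Longrightarrow> (1/2) *\<^sub>R (b + u * u) \<in> S"
    then obtain x where "x \<in> cball 0 \<rho>" "x \<in> S" "f x = x" using fix1[of S] unfolding f_def by blast
    then show "d \<in> S" using uniq by blast
  qed
qed

lemma closed_commutant: "closed {u :: 'a::cst1. c * u = u * c}"
  by (intro closed_Collect_eq continuous_intros)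

lemma closed_self_adjoint: "closed {u :: 'a::cst1. st u = u}"
  by (intro closed_Collect_eq continuous_intros)

lemma sqrt_one_minus:
  fixes b :: "'a::cst1"
  assumes b: "norm b < 1" and sa: "st b = b"
  obtains d where "norm d < 1" "(1 - d) * (1 - d) = 1 - b" "st d = d" "\<And>c. c * b = b * c \<Longrightarrow> c * d = d * c"
proof -
  obtain d where d: "norm d < 1" "2 *\<^sub>R d - d * d = b"
    and S: "\<And>S. closed S \<Longrightarrow> 0 \<in> S \<Longrightarrow> (\<And>u. u \<in> S \<Longrightarrow> (1/2) *\<^sub>R (b + u * u) \<in> S) \<Longrightarrow> d \<in> S"
    using sqrt_fixpoint[OF b] by metis
  show thesis
  proof (rule that[OF d(1)])
    show "(1 - d) * (1 - d) = 1 - b" by (simp add: d(2)[symmetric] algebra_simps scaleR_2)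
    show "st d = d" using S[OF closed_self_adjoint] sa by auto
    fix c assume cb: "c * b = b * c"
    have "c * ((1/2) *\<^sub>R (b + u * u)) = (1/2) *\<^sub>R (b + u * u) * c" if "c * u = u * c" for u
    proof -
      have "c * (u * u) = u * u * c" by (metis that mult.assoc)
      then show ?thesis using cb by (simp add: algebra_simps)
    qed
    then show "c * d = d * c" using S[OF closed_commutant[of c]] by auto
  qed
qed

text \<open>\<open>h\<close> is the real part of u = h + i d, and \<open>st u * u\<close> is the
  scalar r^2 because \<open>h\<close> and \<open>d\<close> are self-adjoint and commute. This takes
  the place of the spectral radius in the estimates below.\<close>

lemma unitary_bound:
  fixes h d :: "'a::cst1"
  assumes sa: "st h = h" "st d = d" and comm: "h * d = d * h" and sq: "h * h + d * d = (r * r) *\<^sub>R 1" and r: "0 \<le> r"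
  shows "norm h \<le> r"
proof -
  define u where "u = h + iu * d"
  have su: "st u = h - iu * d" by (simp add: u_def sa iu_comm)
  have "iu * d * (iu * d) = - (d * d)"
    by (rule iu_mult_iu_mult)
  moreover have "h * (iu * d) = iu * d * h"
    by (metis comm iu_comm mult.assoc)
  ultimately have "st u * u = h * h + d * d" unfolding su unfolding u_def by (simp add: algebra_simps)
  then have "(norm u)\<^sup>2 \<le> r * r" using norm_scaleR_one_le[of "r * r", where 'a='a] sq r by (simp flip: norm_st_mult)
  then have nu: "norm u \<le> r" using r power2_le_imp_le[of "norm u" r] by (simp add: power2_eq_square)
  have "2 *\<^sub>R h = u + st u" unfolding su unfolding u_def by (simp add: scaleR_2)
  then have "2 * norm h \<le> norm u + norm (st u)" by (metis norm_scaleR norm_triangle_ineq abs_numeral)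
  then show ?thesis using nu by simp
qed

section \<open>Positive elements\<close>

text \<open>A characterisation of positivity by norms, which needs no spectra and is evidently closed under sums.\<close>

definition Pos :: "'a::cst1 \<Rightarrow> bool" where
  "Pos a \<longleftrightarrow> st a = a \<and> (\<exists>l\<ge>0. norm (l *\<^sub>R 1 - a) \<le> l)"

lemma Pos_sa: "Pos a \<Longrightarrow> st a = a"
  by (simp add: Pos_def)

lemma Pos_add:
  assumes "Pos a" "Pos b" shows "Pos (a + b)"
proof -
  obtain l m where lm: "0 \<le> l" "norm (l *\<^sub>R 1 - a) \<le> l" "0 \<le> m" "norm (m *\<^sub>R 1 - b) \<le> m"
    using assms unfolding Pos_def by auto
  then have "norm ((l + m) *\<^sub>R 1 - (a + b)) \<le> l + m"
    using norm_triangle_ineq[of "l *\<^sub>R 1 - a" "m *\<^sub>R 1 - b"] by (simp add: algebra_simps)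
  then show ?thesis using assms lm unfolding Pos_def by (metis add_nonneg_nonneg st_add)
qed

lemma Pos_scaleR:
  assumes "Pos a" "0 \<le> r" shows "Pos (r *\<^sub>R a)"
proof -
  obtain l where l: "0 \<le> l" "norm (l *\<^sub>R 1 - a) \<le> l" using assms unfolding Pos_def by auto
  have "norm ((r * l) *\<^sub>R 1 - r *\<^sub>R a) = r * norm (l *\<^sub>R 1 - a)"
    using assms(2) by (simp flip: scaleR_scaleR scaleR_diff_right)
  then show ?thesis using assms l unfolding Pos_def by (metis mult_left_mono mult_nonneg_nonneg st_scaleR)
qed

lemma Pos_diff_scaleR_one: "st a = a \<Longrightarrow> norm a \<le> r \<Longrightarrow> Pos (r *\<^sub>R 1 - a)"
  unfolding Pos_def by (auto intro!: exI[of _ r] intro: order_trans[OF norm_ge_zero])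

lemma Pos_add_scaleR_one: "st a = a \<Longrightarrow> norm a \<le> r \<Longrightarrow> Pos (r *\<^sub>R 1 + a)"
  using Pos_diff_scaleR_one[of "- a" r] by simp

lemma Pos_scaleR_one: "0 \<le> r \<Longrightarrow> Pos (r *\<^sub>R 1)"
  using Pos_diff_scaleR_one[of 0 r] by simp

lemma Pos_zero [simp]: "Pos 0"
  using Pos_scaleR_one[of 0] by simp

text \<open>Up to a positive factor a + e equals 1 - b with norm b < 1, where the added e makes the
  inequality strict; then two square roots are taken. With a fourth root available, the square root
  of a + e is itself a square and hence positive.\<close>

lemma Pos_root4:
  fixes a :: "'a::cst1"
  assumes a: "Pos a" and e: "0 < e"
  obtains k where "st k = k" "k * k * (k * k) = a + e *\<^sub>R 1" "\<And>c. c * a = a * c \<Longrightarrow> c * k = k * c"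
proof -
  obtain l where l: "0 \<le> l" "norm (l *\<^sub>R 1 - a) \<le> l" using a unfolding Pos_def by auto
  define lm where "lm = l + e"
  have lm: "lm > 0" using l e by (simp add: lm_def)
  define b where "b = (1 / lm) *\<^sub>R (l *\<^sub>R 1 - a)"
  have nb: "norm b < 1" using l e lm by (simp add: b_def lm_def)
  have sb: "st b = b" using Pos_sa[OF a] by (simp add: b_def)
  have cb: "c * b = b * c" if "c * a = a * c" for c using that by (simp add: b_def algebra_simps)
  obtain d where d: "norm d < 1" "(1 - d) * (1 - d) = 1 - b" "st d = d" "\<And>c. c * b = b * c \<Longrightarrow> c * d = d * c"
    using sqrt_one_minus[OF nb sb] by blast
  obtain x where x: "norm x < 1" "(1 - x) * (1 - x) = 1 - d" "st x = x" "\<And>c. c * d = d * c \<Longrightarrow> c * x = x * c"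
    using sqrt_one_minus[OF d(1,3)] by blast
  define k where "k = sqrt (sqrt lm) *\<^sub>R (1 - x)"
  have kk: "k * k = sqrt lm *\<^sub>R (1 - d)" using lm by (simp add: k_def x(2))
  show thesis
  proof (rule that)
    show "st k = k" by (simp add: k_def x)
    have "k * k * (k * k) = lm *\<^sub>R (1 - b)" using lm by (simp add: kk d(2))
    also have "\<dots> = a + e *\<^sub>R 1" using lm by (simp add: b_def algebra_simps) (simp add: lm_def algebra_simps)
    finally show "k * k * (k * k) = a + e *\<^sub>R 1" .
    fix c assume "c * a = a * c"
    then have "c * x = x * c" using cb d(4) x(4) by blast
    then show "c * k = k * c" by (simp add: k_def algebra_simps)
  qed
qed

text \<open>Put g = h / sqrt l and (1 - d)^2 = 1 - g^2. Then 1 - d and g are the two parts of a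
  unitary, so 1 - d and its square are contractions.\<close>

lemma square_bound:
  fixes h :: "'a::cst1"
  assumes sa: "st h = h" and l: "(norm h)\<^sup>2 < l"
  shows "norm (l *\<^sub>R 1 - h * h) \<le> l"
proof -
  have l0: "l > 0" using l by (meson le_less_trans zero_le_power2)
  define g where "g = (1 / sqrt l) *\<^sub>R h"
  have sg: "st g = g" by (simp add: g_def sa)
  have gg: "g * g = (1 / l) *\<^sub>R (h * h)" using l0 by (simp add: g_def)
  have ng: "norm (g * g) < 1" using l l0 by (simp add: gg norm_self_adjoint_square[OF sa])
  obtain d where d: "(1 - d) * (1 - d) = 1 - g * g" "st d = d" "\<And>c. c * (g * g) = g * g * c \<Longrightarrow> c * d = d * c"
    using sqrt_one_minus[OF ng] sg by (auto simp: mult.assoc)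
  have "g * d = d * g" by (rule d(3)) (simp add: mult.assoc)
  then have "norm (1 - d) \<le> 1"
    using unitary_bound[of "1 - d" g 1] d sg by (simp add: algebra_simps)
  then have "norm ((1 - d) * (1 - d)) \<le> 1"
    using norm_mult_ineq[of "1 - d" "1 - d"] mult_mono[of "norm (1 - d)" 1 "norm (1 - d)" 1] by simp
  then have "l * norm (1 - g * g) \<le> l" using l0 d(1) by simp
  moreover have "l *\<^sub>R 1 - h * h = l *\<^sub>R (1 - g * g)" using l0 by (simp add: gg algebra_simps)
  ultimately show ?thesis using l0 by simp
qed

lemma Pos_square: "st h = h \<Longrightarrow> Pos (h * h)" for h :: "'a::cst1"
  unfolding Pos_def using square_bound[of h "(norm h)\<^sup>2 + 1"] by (auto intro!: exI[of _ "(norm h)\<^sup>2 + 1"])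

lemma Pos_sqrt:
  fixes a :: "'a::cst1"
  assumes a: "Pos a" and e: "0 < e"
  obtains h where "st h = h" "h * h = a + e *\<^sub>R 1" "\<And>c. c * a = a * c \<Longrightarrow> c * h = h * c"
proof -
  obtain k where k: "st k = k" "k * k * (k * k) = a + e *\<^sub>R 1" "\<And>c. c * a = a * c \<Longrightarrow> c * k = k * c"
    using Pos_root4[OF a e] by blast
  show thesis
  proof (rule that[OF _ k(2)])
    show "st (k * k) = k * k" by (simp add: k(1))
    show "c * (k * k) = k * k * c" if "c * a = a * c" for c by (metis k(3)[OF that] mult.assoc)
  qed
qed

text \<open>The definition of \<open>Pos\<close> provides one suitable scalar; here every
  \<open>r\<close> at least \<open>norm a\<close> is suitable, because \<open>a\<close> is a square
  up to e and squares obey \<open>square_bound\<close>. A scalar chosen from the norm alone is what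
  makes \<open>Pos\<close> closed under limits.\<close>

lemma Pos_norm_bound:
  fixes a :: "'a::cst1"
  assumes a: "Pos a" and r: "norm a \<le> r"
  shows "norm (r *\<^sub>R 1 - a) \<le> r"
proof (rule field_le_epsilon)
  fix e :: real assume e: "0 < e"
  \<comment> \<open>One third of \<open>e\<close> makes the square root exist, one gives the strict
    inequality that \<open>square_bound\<close> asks for, and one is lost when the shift is
    removed.\<close>
  obtain h where h: "st h = h" "h * h = a + (e/3) *\<^sub>R 1"
    using Pos_sqrt[OF a, of "e/3"] e by (metis zero_less_divide_iff zero_less_numeral)
  have "(norm h)\<^sup>2 = norm (a + (e/3) *\<^sub>R 1)" using norm_self_adjoint_square[OF h(1)] h(2) by simp
  also have "\<dots> \<le> r + e/3" using norm_triangle_ineq[of a "(e/3) *\<^sub>R 1"] norm_scaleR_one_le[of "e/3", where 'a='a] r e by linarith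
  finally have "norm ((r + e/3 + e/3) *\<^sub>R 1 - h * h) \<le> r + e/3 + e/3"
    using e by (intro square_bound h) auto
  moreover have eq: "r *\<^sub>R 1 - a = ((r + e/3 + e/3) *\<^sub>R 1 - h * h) - (e/3) *\<^sub>R 1"
    by (simp add: h algebra_simps flip: scaleR_add_left)
  ultimately have "norm (r *\<^sub>R 1 - a) \<le> (r + e/3 + e/3) + e/3"
    unfolding eq
    using norm_triangle_ineq4[of "(r + e/3 + e/3) *\<^sub>R 1 - h * h" "(e/3) *\<^sub>R 1"]
      norm_scaleR_one_le[of "e/3", where 'a='a] e by linarith
  then show "norm (r *\<^sub>R 1 - a) \<le> r + e" by simp
qed

lemma Pos_lim:
  fixes a :: "'a::cst1"
  assumes X: "X \<longlonglongrightarrow> a" and P: "\<And>n. Pos (X n)"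
  shows "Pos a"
  unfolding Pos_def
proof (intro conjI exI[of _ "norm a"])
  show "st a = a"
    using LIMSEQ_unique[OF tendsto_st[OF X]] X P by (simp add: Pos_sa)
  show "norm (norm a *\<^sub>R 1 - a) \<le> norm a"
  proof (rule LIMSEQ_le)
    show "(\<lambda>n. norm (norm (X n) *\<^sub>R 1 - X n)) \<longlonglongrightarrow> norm (norm a *\<^sub>R 1 - a)" by (intro tendsto_intros X)
    show "(\<lambda>n. norm (X n)) \<longlonglongrightarrow> norm a" by (intro tendsto_intros X)
  qed (use Pos_norm_bound P in blast)
qed simp

lemma inverse_Suc_scaleR_tendsto: "(\<lambda>n. (inverse (real (Suc n))) *\<^sub>R (1::'a::cst1)) \<longlonglongrightarrow> 0"
  using tendsto_scaleR[OF LIMSEQ_inverse_real_of_nat tendsto_const, of "1::'a"] by simp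

lemma inverse_Suc_pos: "0 < inverse (real (Suc n))"
  by simp

lemma Pos_eps:
  fixes a :: "'a::cst1"
  assumes "\<And>e. 0 < e \<Longrightarrow> Pos (a + e *\<^sub>R 1)"
  shows "Pos a"
proof (rule Pos_lim)
  show "(\<lambda>n. a + (inverse (real (Suc n))) *\<^sub>R 1) \<longlonglongrightarrow> a"
    using tendsto_add[OF tendsto_const inverse_Suc_scaleR_tendsto, of a] by simp
qed (rule assms, simp)

text \<open>Approximate square roots of commuting elements commute with each other, so every
  approximant is the square of a self-adjoint product.\<close>

lemma Pos_mult:
  fixes x y :: "'a::cst1"
  assumes x: "Pos x" and y: "Pos y" and xy: "x * y = y * x"
  shows "Pos (x * y)"
proof (rule Pos_lim)
  let ?e = "\<lambda>n. (inverse (real (Suc n))) *\<^sub>R (1::'a)"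
  have "(\<lambda>n. (x + ?e n) * (y + ?e n)) \<longlonglongrightarrow> (x + 0) * (y + 0)"
    by (intro tendsto_intros inverse_Suc_scaleR_tendsto)
  then show "(\<lambda>n. (x + ?e n) * (y + ?e n)) \<longlonglongrightarrow> x * y" by simp
  fix n
  obtain k where k: "st k = k" "k * k = x + ?e n" "\<And>c. c * x = x * c \<Longrightarrow> c * k = k * c"
    by (rule Pos_sqrt[OF x inverse_Suc_pos[of n]]) (rule that)
  obtain l where l: "st l = l" "l * l = y + ?e n" "\<And>c. c * y = y * c \<Longrightarrow> c * l = l * c"
    by (rule Pos_sqrt[OF y inverse_Suc_pos[of n]]) (rule that)
  have kl: "k * l = l * k" using k(3)[of y] l(3)[of k] xy by simp
  have "(x + ?e n) * (y + ?e n) = (k * l) * (k * l)"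
    unfolding k(2)[symmetric] l(2)[symmetric] by (metis kl mult.assoc)
  then show "Pos ((x + ?e n) * (y + ?e n))" using Pos_square[of "k * l"] k(1) l(1) kl by simp
qed

text \<open>With square roots k of r + z and l of r - z, z^2 + (k l)^2 = r^2, so z is the real part
  of r times a unitary. The roots exist after adding e to both elements.\<close>

lemma norm_le_of_Pos:
  fixes z :: "'a::cst1"
  assumes z: "st z = z" and p: "Pos (r *\<^sub>R 1 + z)" and m: "Pos (r *\<^sub>R 1 - z)" and r: "0 \<le> r"
  shows "norm z \<le> r"
proof (rule field_le_epsilon)
  fix e :: real assume e: "0 < e"
  obtain k where k: "st k = k" "k * k = (r *\<^sub>R 1 + z) + e *\<^sub>R 1" "\<And>c. c * (r *\<^sub>R 1 + z) = (r *\<^sub>R 1 + z) * c \<Longrightarrow> c * k = k * c"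
    by (rule Pos_sqrt[OF p e]) (rule that)
  obtain l where l: "st l = l" "l * l = (r *\<^sub>R 1 - z) + e *\<^sub>R 1" "\<And>c. c * (r *\<^sub>R 1 - z) = (r *\<^sub>R 1 - z) * c \<Longrightarrow> c * l = l * c"
    by (rule Pos_sqrt[OF m e]) (rule that)
  have zk: "z * k = k * z" and zl: "z * l = l * z" by (rule k(3), simp add: algebra_simps, rule l(3), simp add: algebra_simps)
  have kl: "k * l = l * k" by (rule l(3)) (simp add: algebra_simps zk)
  have "(k * l) * (k * l) = (k * k) * (l * l)" by (metis kl mult.assoc)
  then have "z * z + (k * l) * (k * l) = ((r + e) * (r + e)) *\<^sub>R 1"
    unfolding k(2) l(2) by (simp add: algebra_simps) (simp flip: scaleR_add_left)
  then show "norm z \<le> r + e"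
    using e r k(1) l(1) kl z by (intro unitary_bound[of z "k * l"]) (simp_all, metis zk zl mult.assoc)
qed

text \<open>If \<open>a\<close> lies between 0 and r, then a - r/2 lies between -r/2 and
  r/2.\<close>

lemma Pos_norm_le:
  fixes a :: "'a::cst1"
  assumes a: "Pos a" and m: "Pos (r *\<^sub>R 1 - a)" and r: "0 \<le> r"
  shows "norm a \<le> r"
proof -
  have "norm (a - (r/2) *\<^sub>R 1) \<le> r/2"
  proof (rule norm_le_of_Pos)
    show "st (a - (r/2) *\<^sub>R 1) = a - (r/2) *\<^sub>R 1" by (simp add: Pos_sa[OF a])
    have "(r/2) *\<^sub>R 1 - (a - (r/2) *\<^sub>R 1) = (r/2 + r/2) *\<^sub>R 1 - a" unfolding scaleR_add_left by simp
    also have "\<dots> = r *\<^sub>R 1 - a" by simp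
    finally show "Pos ((r/2) *\<^sub>R 1 - (a - (r/2) *\<^sub>R 1))" using m by (simp only:)
  qed (use a r in simp_all)
  then show ?thesis using norm_triangle_ineq[of "a - (r/2) *\<^sub>R 1" "(r/2) *\<^sub>R 1"] norm_scaleR_one_le[of "r/2", where 'a='a] r by simp
qed

lemma norm_mono:
  fixes a :: "'a::cst1"
  assumes a: "Pos a" and b: "Pos b" shows "norm a \<le> norm (a + b)"
proof (rule Pos_norm_le[OF a])
  have "Pos ((norm (a + b) *\<^sub>R 1 - (a + b)) + b)"
    by (intro Pos_add Pos_diff_scaleR_one b) (simp_all add: Pos_sa[OF a] Pos_sa[OF b])
  then show "Pos (norm (a + b) *\<^sub>R 1 - a)" by simp
qed simp

text \<open>Twice this element is the sum of the squares of the self-adjoint elements c + st c and i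
  (c - st c).\<close>

lemma Pos_st_mult_sum: "Pos (st c * c + c * st c)" for c :: "'a::cst1"
proof -
  define x y where "x = c + st c" and "y = iu * (c - st c)"
  have s: "st x = x" "st y = y" by (simp_all add: x_def y_def iu_comm algebra_simps)
  have "y * y = - ((c - st c) * (c - st c))"
    unfolding y_def by (rule iu_mult_iu_mult)
  then have "x * x + y * y = 2 *\<^sub>R (st c * c + c * st c)" unfolding x_def by (simp add: algebra_simps scaleR_2)
  then have "st c * c + c * st c = (1/2) *\<^sub>R (x * x + y * y)" by simp
  then show ?thesis using Pos_scaleR[OF Pos_add[OF Pos_square[OF s(1)] Pos_square[OF s(2)]], of "1/2"] by simp
qed

lemma norm_st_mult_le:
  fixes c :: "'a::cst1"
  assumes P: "Pos (\<delta> *\<^sub>R 1 - st c * c)" and \<delta>: "0 \<le> \<delta>"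
  shows "norm (st c * c) \<le> \<delta>"
proof -
  define m where "m = norm (st c * c)"
  define s where "s = c * st c"
  have m0: "0 \<le> m" by (simp add: m_def)
  have mc: "m = norm c * norm c" by (simp add: m_def norm_st_mult power2_eq_square)
  have ss: "st s = s" by (simp add: s_def)
  have ns: "norm s = m" using norm_st_mult[of "st c"] by (simp add: s_def mc power2_eq_square)
  have 1: "norm (m *\<^sub>R 1 + st c * c) \<le> m + \<delta>"
  proof (rule Pos_norm_le)
    show "Pos (m *\<^sub>R 1 + st c * c)" by (rule Pos_add_scaleR_one) (simp_all add: m_def)
    show "Pos ((m + \<delta>) *\<^sub>R 1 - (m *\<^sub>R 1 + st c * c))" using P by (simp add: algebra_simps)
  qed (use m0 \<delta> in simp)
  have "m *\<^sub>R s + s * s = c * ((m *\<^sub>R 1 + st c * c) * st c)" by (simp add: s_def algebra_simps)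
  then have "norm (m *\<^sub>R s + s * s) \<le> norm c * (norm (m *\<^sub>R 1 + st c * c) * norm (st c))"
    using mult_left_mono[OF norm_mult_ineq[of "m *\<^sub>R 1 + st c * c" "st c"] norm_ge_zero[of c]]
      norm_mult_ineq[of c "(m *\<^sub>R 1 + st c * c) * st c"] by simp
  also have "\<dots> = m * norm (m *\<^sub>R 1 + st c * c)" by (simp add: mc)
  also have "\<dots> \<le> m * (m + \<delta>)" by (rule mult_left_mono[OF 1 m0])
  finally have 2: "norm (m *\<^sub>R s + s * s) \<le> m * (m + \<delta>)" .
  \<comment> \<open>Completing the square: a bound for the norm \<open>R\<close> of s + m/2 gives
    the upper bound R - m/2 for s.\<close>
  have "(s + (m/2) *\<^sub>R 1) * (s + (m/2) *\<^sub>R 1) = (m *\<^sub>R s + s * s) + (m*m/4) *\<^sub>R 1"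
    by (simp add: algebra_simps flip: scaleR_add_left)
  then have "norm ((s + (m/2) *\<^sub>R 1) * (s + (m/2) *\<^sub>R 1)) \<le> m * (m + \<delta>) + m*m/4"
    using norm_triangle_ineq[of "m *\<^sub>R s + s * s" "(m*m/4) *\<^sub>R 1"] 2 norm_scaleR_one_le[of "m*m/4", where 'a='a] by simp
  then have R2: "(norm (s + (m/2) *\<^sub>R 1))\<^sup>2 \<le> m * (m + \<delta>) + m*m/4"
    by (subst (asm) norm_self_adjoint_square) (simp_all add: ss)
  define R where "R = norm (s + (m/2) *\<^sub>R 1)"
  define r where "r = max (R - m/2) \<delta>"
  have "m \<le> r"
    unfolding ns[symmetric]
  proof (rule norm_le_of_Pos[OF ss])
    have "Pos ((r - \<delta>) *\<^sub>R 1 + ((st c * c + c * st c) + (\<delta> *\<^sub>R 1 - st c * c)))"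
      by (intro Pos_add Pos_st_mult_sum P Pos_scaleR_one) (simp add: r_def)
    then show "Pos (r *\<^sub>R 1 + s)" by (simp add: s_def algebra_simps)
    have "Pos ((r - (R - m/2)) *\<^sub>R 1 + (R *\<^sub>R 1 - (s + (m/2) *\<^sub>R 1)))"
      by (intro Pos_add Pos_scaleR_one Pos_diff_scaleR_one) (simp_all add: r_def R_def ss)
    then show "Pos (r *\<^sub>R 1 - s)" by (simp add: algebra_simps)
  qed (use \<delta> r_def in simp)
  then consider "m \<le> R - m/2" | "m \<le> \<delta>" unfolding r_def by linarith
  then show ?thesis unfolding m_def[symmetric]
  proof cases
    case 1
    \<comment> \<open>From 3 m / 2 <= R and R^2 <= m (m + \<delta>) + m^2 / 4 one gets (9/4) m^2 <=
      (5/4) m^2 + m \<delta>.\<close>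
    then have "(3 * m / 2) * (3 * m / 2) \<le> R * R" using m0 by (intro mult_mono) auto
    then have "m * m \<le> m * \<delta>" using R2 unfolding R_def[symmetric] by (simp add: power2_eq_square algebra_simps)
    then show "m \<le> \<delta>" using m0 \<delta> by (cases "m = 0") auto
  qed
qed

text \<open>With h = sqrt(a^2 + e) and p = h - a, the element c = b p sqrt(h) satisfies 4 c* c = e^2 - p^4, so it is
  almost negative; the preceding bound then forces p to be small, i.e. a is close to the positive h.\<close>

theorem Pos_st_mult:
  fixes b :: "'a::cst1" shows "Pos (st b * b)"
proof (rule Pos_eps)
  fix \<eta> :: real assume \<eta>: "0 < \<eta>"
  define a where "a = st b * b"
  have sa: "st a = a" by (simp add: a_def)
  \<comment> \<open>The final estimate is that the fourth power of \<open>norm p\<close> is at most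
    2 e^2, which equals \<eta>^4 / 2.\<close>
  define e where "e = \<eta>\<^sup>2 / 2"
  have e: "0 < e" using \<eta> by (simp add: e_def)
  obtain k where k: "st k = k" "k * k * (k * k) = a * a + e *\<^sub>R 1" "\<And>c. c * (a * a) = a * a * c \<Longrightarrow> c * k = k * c"
    by (rule Pos_root4[OF Pos_square[OF sa] e]) (rule that)
  define h p q where "h = k * k" and "p = h - a" and "q = h + a"
  have ak: "a * k = k * a" by (rule k(3)) (simp add: mult.assoc)
  have ah: "a * h = h * a" unfolding h_def by (metis ak mult.assoc)
  have kp: "k * p = p * k" by (simp add: p_def h_def algebra_simps ak)
  have hh: "h * h = a * a + e *\<^sub>R 1" using k(2) by (simp add: h_def)
  have qp: "q * p = e *\<^sub>R 1" by (simp add: p_def q_def algebra_simps hh ah)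
  have sp: "st p = p" by (simp add: p_def h_def sa k(1))
  \<comment> \<open>This choice gives st c * c = h a p^2. As 4 h a = q^2 - p^2 and q p = e, four
    times it is e^2 - p^4.\<close>
  define c where "c = b * p * k"
  have "st c * c = k * (p * a * p) * k" by (simp add: c_def sp k(1) a_def mult.assoc)
  also have "\<dots> = h * (p * a * p)" unfolding h_def
    by (metis (no_types, lifting) ak kp mult.assoc)
  also have "p * a * p = a * (p * p)"
  proof -
    have "p * a = a * p" by (simp add: p_def algebra_simps ah)
    then show ?thesis by (simp only: mult.assoc)
  qed
  finally have c: "st c * c = h * a * (p * p)" by (simp add: mult.assoc)
  have "4 *\<^sub>R (h * a) = q * q - p * p"
    using scaleR_scaleR[of 2 2 "h * a"] by (simp add: p_def q_def algebra_simps ah scaleR_2)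
  then have "4 *\<^sub>R (st c * c) = (q * q - p * p) * (p * p)" unfolding c by (metis mult_scaleR_left)
  also have "\<dots> = q * (q * p) * p - p * p * (p * p)" by (simp add: algebra_simps)
  finally have c4: "4 *\<^sub>R (st c * c) = (e * e) *\<^sub>R 1 - p * p * (p * p)" by (simp add: qp)
  have sc: "st c * c = (1/4) *\<^sub>R ((e * e) *\<^sub>R 1 - p * p * (p * p))" unfolding c4[symmetric] by simp
  have pp: "Pos (p * p * (p * p))" by (rule Pos_square) (simp add: sp)
  have "norm (st c * c) \<le> e * e / 4"
  proof (rule norm_st_mult_le)
    have "(e * e / 4) *\<^sub>R 1 - st c * c = (1/4) *\<^sub>R (p * p * (p * p))" unfolding sc by (simp add: algebra_simps)
    then show "Pos ((e * e / 4) *\<^sub>R 1 - st c * c)" using Pos_scaleR[OF pp, of "1/4"] by simp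
  qed simp
  then have "norm (4 *\<^sub>R (st c * c)) \<le> e * e" by simp
  moreover have "p * p * (p * p) = (e * e) *\<^sub>R 1 - 4 *\<^sub>R (st c * c)" by (simp add: c4)
  ultimately have "norm (p * p * (p * p)) \<le> e * e + e * e"
    using norm_triangle_ineq4[of "(e * e) *\<^sub>R 1" "4 *\<^sub>R (st c * c)"] norm_scaleR_one_le[of "e * e", where 'a='a] by simp
  have "norm (p * p * (p * p)) = (norm p)^4"
    using norm_self_adjoint_square[of "p * p"] norm_self_adjoint_square[OF sp] sp by simp
  have "(norm p)^4 \<le> \<eta>^4"
  proof -
    have "e * e + e * e = \<eta>^4 / 2" by (simp add: e_def power4_eq_xxxx power2_eq_square)
    then show ?thesis using \<open>norm (p * p * (p * p)) \<le> e * e + e * e\<close> \<open>norm (p * p * (p * p)) = _\<close> zero_le_power[of \<eta> 4] \<eta> by linarith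
  qed
  then have "norm p \<le> \<eta>" using \<eta> by (meson less_imp_le power_mono_iff norm_ge_zero zero_less_numeral)
  then have "Pos (h + (\<eta> *\<^sub>R 1 - p))" unfolding h_def by (intro Pos_add Pos_square k(1) Pos_diff_scaleR_one sp)
  then show "Pos (st b * b + \<eta> *\<^sub>R 1)" by (simp add: p_def a_def algebra_simps)
qed

lemma Pos_conj:
  fixes a r :: "'a::cst1"
  assumes a: "Pos a" shows "Pos (st r * a * r)"
proof (rule Pos_lim)
  let ?e = "\<lambda>n. (inverse (real (Suc n))) *\<^sub>R (1::'a)"
  have "(\<lambda>n. st r * (a + ?e n) * r) \<longlonglongrightarrow> st r * (a + 0) * r"
    by (intro tendsto_intros inverse_Suc_scaleR_tendsto)
  then show "(\<lambda>n. st r * (a + ?e n) * r) \<longlonglongrightarrow> st r * a * r" by simp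
  fix n
  obtain k where k: "st k = k" "k * k = a + ?e n"
    by (rule Pos_sqrt[OF a inverse_Suc_pos[of n]]) (rule that)
  have "st r * (a + ?e n) * r = st (k * r) * (k * r)" unfolding k(2)[symmetric] by (simp add: k(1) mult.assoc)
  then show "Pos (st r * (a + ?e n) * r)" by (simp add: Pos_st_mult del: st_mult)
qed

text \<open>The second hypothesis is the positivity of the inner square of y - s x r, where p, r and
  q are the inner products of x with x, x with y, and y with y. In this form it serves Hilbert
  modules as well as finite sums of products.\<close>

lemma Cauchy_Schwarz_Pos:
  fixes p q r :: "'a::cst1"
  assumes p: "Pos p" and P: "\<And>s. 0 < s \<Longrightarrow> Pos (q - (2 * s) *\<^sub>R (st r * r) + (s * s) *\<^sub>R (st r * p * r))"
  shows "(norm r)\<^sup>2 \<le> norm p * norm q"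
proof -
  have *: "(norm r)\<^sup>2 \<le> (norm p + e) * norm q" if e: "0 < e" for e
  proof -
    \<comment> \<open>Close to the optimal value 1 / norm p; adding \<open>e\<close> covers p =
      0.\<close>
    define s where "s = 1 / (norm p + e)"
    have pe: "norm p + e > 0" using e by (simp add: add_nonneg_pos)
    have s: "0 < s" "s * norm p \<le> 1" using pe e by (simp_all add: s_def)
    have "Pos (norm p *\<^sub>R 1 - p)" by (rule Pos_diff_scaleR_one) (simp_all add: Pos_sa[OF p])
    then have "Pos ((s * s) *\<^sub>R (st r * (norm p *\<^sub>R 1 - p) * r) + (s - s * (s * norm p)) *\<^sub>R (st r * r)
        + (q - (2 * s) *\<^sub>R (st r * r) + (s * s) *\<^sub>R (st r * p * r)))"
      using s by (intro Pos_add Pos_scaleR Pos_conj P Pos_st_mult) (auto intro: mult_left_le)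
    moreover have "(s * s) *\<^sub>R (st r * (norm p *\<^sub>R 1 - p) * r) + (s - s * (s * norm p)) *\<^sub>R (st r * r)
        + (q - (2 * s) *\<^sub>R (st r * r) + (s * s) *\<^sub>R (st r * p * r)) = q - s *\<^sub>R (st r * r)"
      by (simp add: algebra_simps) (simp flip: scaleR_add_left scaleR_2)
    ultimately have "Pos (q - s *\<^sub>R (st r * r))" by simp
    then have "norm (s *\<^sub>R (st r * r)) \<le> norm q"
      using norm_mono[of "s *\<^sub>R (st r * r)" "q - s *\<^sub>R (st r * r)"] s by (simp add: Pos_scaleR Pos_st_mult)
    then have "s * (norm r)\<^sup>2 \<le> norm q" using s by (simp add: norm_st_mult)
    then show ?thesis using pe by (simp add: s_def field_simps)
  qed
  have "(norm r)\<^sup>2 \<le> norm p * norm q + x" if x: "0 < x" for x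
  proof -
    have "(norm r)\<^sup>2 \<le> (norm p + x / (norm q + 1)) * norm q" by (rule *) (use x in \<open>simp add: add_nonneg_pos\<close>)
    also have "\<dots> = norm p * norm q + x * (norm q / (norm q + 1))" by (simp add: algebra_simps)
    also have "\<dots> \<le> norm p * norm q + x"
      using x by (intro add_left_mono mult_left_le) (simp_all add: divide_le_eq_1 add_nonneg_pos)
    finally show ?thesis .
  qed
  then show ?thesis by (rule field_le_epsilon)
qed

text \<open>With b = 1 - a the positive elements a b^k decrease in k. Hence n + 1 times a b^n is at
  most the telescoping sum of the a b^k with k <= n, which is 1 - b^(n+1) and so at most 1.\<close>

lemma norm_mult_power_le:
  fixes a :: "'a::cst1"
  assumes a: "Pos a" and a1: "norm a \<le> 1"
  shows "norm (a * (1 - a) ^ n) \<le> 1 / real (Suc n)"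
proof -
  define b where "b = 1 - a"
  have ab: "a * b = b * a" by (simp add: b_def algebra_simps)
  have abk: "a * b ^ k = b ^ k * a" for k
    by (induction k) (simp_all, metis ab mult.assoc)
  have Pb: "Pos b" using Pos_diff_scaleR_one[OF Pos_sa[OF a] a1] by (simp add: b_def)
  have Pbk: "Pos (b ^ k)" for k
  proof (induction k)
    case 0 then show ?case using Pos_scaleR_one[of 1] by simp
  next
    case (Suc k) then show ?case by (simp add: Pos_mult[OF Pb] power_commutes)
  qed
  have nb: "norm b \<le> 1" using Pos_norm_bound[OF a a1] by (simp add: b_def)
  have nbk: "norm (b ^ k) \<le> 1" for k
  proof (induction k)
    case (Suc k)
    then have "norm b * norm (b ^ k) \<le> 1 * 1" using nb by (intro mult_mono) auto
    then show ?case using norm_mult_ineq[of b "b ^ k"] by simp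
  qed simp
  have P1: "Pos (1 - b ^ k)" for k
    using Pos_diff_scaleR_one[OF Pos_sa[OF Pbk] nbk, of k] by simp
  have Pab: "Pos (a * b ^ k)" for k by (rule Pos_mult[OF a Pbk abk])
  have P2: "Pos (a * b ^ k - a * b ^ n)" if "k \<le> n" for k
  proof -
    have "a * b ^ k - a * b ^ n = a * b ^ k * (1 - b ^ (n - k))"
      using that by (simp add: algebra_simps flip: power_add)
    moreover have "a * b ^ k * (1 - b ^ (n - k)) = (1 - b ^ (n - k)) * (a * b ^ k)"
      by (simp add: algebra_simps) (metis (no_types, lifting) abk mult.assoc power_add power_commutes add.commute)
    ultimately show ?thesis using Pos_mult[OF Pab P1] by simp
  qed
  have sum: "(\<Sum>k\<le>m. a * b ^ k) = 1 - b ^ Suc m" for m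
    by (induction m) (simp_all add: b_def algebra_simps)
  have Ps: "Pos (\<Sum>k\<le>m. a * b ^ k - a * b ^ n)" if "m \<le> n" for m
    using that by (induction m) (simp_all add: P2[of 0, simplified] Pos_add P2[simplified power_Suc] del: power_Suc)
  have "(\<Sum>k\<le>n. a * b ^ k - a * b ^ n) + b ^ Suc n = 1 *\<^sub>R 1 - real (Suc n) *\<^sub>R (a * b ^ n)"
    by (simp add: sum_subtractf sum sum_constant_scaleR)
  then have "Pos (1 *\<^sub>R 1 - real (Suc n) *\<^sub>R (a * b ^ n))" using Pos_add[OF Ps Pbk, of n "Suc n"] by simp
  then have "norm (real (Suc n) *\<^sub>R (a * b ^ n)) \<le> 1"
    by (intro Pos_norm_le) (auto intro!: Pos_scaleR Pab)
  then have "real (Suc n) * norm (a * b ^ n) \<le> 1" by (simp only: norm_scaleR abs_of_nat)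
  then show ?thesis unfolding b_def[symmetric] by (simp add: pos_le_divide_eq mult.commute)
qed

text \<open>h = 1 - (1 - a)^n, where a is \<open>st x * x\<close> scaled to norm 1, is a polynomial
  in a without constant term. So h belongs to every subalgebra containing \<open>st x * x\<close>,
  closed or not, and the square of norm (x - x h) is at most (norm x)^2 / (n + 1) by the preceding
  bound.\<close>

lemma approximate_unit:
  fixes x :: "'a::cst1"
  assumes e: "0 < e"
  obtains h where "norm (x - x * h) < e" "st h = h" "norm h \<le> 1"
    "\<And>S. (\<And>u v. u \<in> S \<Longrightarrow> v \<in> S \<Longrightarrow> u + v \<in> S) \<Longrightarrow> (\<And>r u. u \<in> S \<Longrightarrow> r *\<^sub>R u \<in> S)
      \<Longrightarrow> (\<And>u v. u \<in> S \<Longrightarrow> v \<in> S \<Longrightarrow> u * v \<in> S) \<Longrightarrow> st x * x \<in> S \<Longrightarrow> h \<in> S"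
proof (cases "x = 0")
  case True
  have "0 \<in> S" if "\<And>r u. u \<in> S \<Longrightarrow> r *\<^sub>R u \<in> S" "st x * x \<in> S" for S using that(1)[OF that(2), of 0] by simp
  then show thesis using True e by (intro that[of 0]) auto
next
  case False
  define a where "a = (1 / (norm x)\<^sup>2) *\<^sub>R (st x * x)"
  have a: "Pos a" unfolding a_def by (intro Pos_scaleR Pos_st_mult) simp
  have a1: "norm a \<le> 1" using False by (simp add: a_def norm_st_mult)
  define b where "b = 1 - a"
  have sb: "st b = b" using Pos_sa[OF a] by (simp add: b_def)
  have sbk: "st (b ^ k) = b ^ k" for k by (induction k) (simp_all add: sb power_commutes)
  have nb: "norm b \<le> 1" using Pos_norm_bound[OF a a1] by (simp add: b_def)
  have nbk: "norm (b ^ k) \<le> 1" for k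
  proof (induction k)
    case (Suc k)
    then have "norm b * norm (b ^ k) \<le> 1 * 1" using nb by (intro mult_mono) auto
    then show ?case using norm_mult_ineq[of b "b ^ k"] by simp
  qed simp
  obtain n where n: "(norm x)\<^sup>2 / real (Suc n) < e\<^sup>2"
  proof -
    have "(\<lambda>n. (norm x)\<^sup>2 * inverse (real (Suc n))) \<longlonglongrightarrow> (norm x)\<^sup>2 * 0"
      by (intro tendsto_intros LIMSEQ_inverse_real_of_nat)
    then have "eventually (\<lambda>n. (norm x)\<^sup>2 * inverse (real (Suc n)) < e\<^sup>2) sequentially"
      using e by (intro order_tendstoD(2)) auto
    then show thesis using that by (auto simp: eventually_sequentially divide_inverse)
  qed
  have xx: "st x * x = (norm x)\<^sup>2 *\<^sub>R a" using False by (simp add: a_def)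
  have "(norm (x * b ^ n))\<^sup>2 = norm (b ^ n * (st x * x) * b ^ n)"
    by (simp add: sbk mult.assoc flip: norm_st_mult)
  also have "\<dots> = (norm x)\<^sup>2 * norm (b ^ n * (a * b ^ n))" by (simp add: xx mult.assoc)
  also have "\<dots> \<le> (norm x)\<^sup>2 * (1 * (1 / real (Suc n)))"
  proof (rule mult_left_mono)
    have "norm (b ^ n) * norm (a * b ^ n) \<le> 1 * (1 / real (Suc n))"
      by (intro mult_mono nbk) (use norm_mult_power_le[OF a a1, of n] in \<open>auto simp: b_def\<close>)
    then show "norm (b ^ n * (a * b ^ n)) \<le> 1 * (1 / real (Suc n))"
      using norm_mult_ineq[of "b ^ n" "a * b ^ n"] by linarith
  qed simp
  finally have "(norm (x * b ^ n))\<^sup>2 < e\<^sup>2" using n by simp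
  then have xb: "norm (x * b ^ n) < e" using e by (simp add: power2_less_imp_less)
  have in_S: "1 - b ^ n \<in> S" if add: "\<And>u v. u \<in> S \<Longrightarrow> v \<in> S \<Longrightarrow> u + v \<in> S" and scl: "\<And>r u. u \<in> S \<Longrightarrow> r *\<^sub>R u \<in> S"
      and mlt: "\<And>u v. u \<in> S \<Longrightarrow> v \<in> S \<Longrightarrow> u * v \<in> S" and x: "st x * x \<in> S" for S
  proof (induction n)
    case 0 then show ?case using scl[OF x, of 0] by simp
  next
    case (Suc n)
    have aS: "a \<in> S" unfolding a_def by (rule scl[OF x])
    have "1 - b ^ Suc n = (a + (1 - b ^ n)) + (-1) *\<^sub>R (a * (1 - b ^ n))" by (simp add: b_def algebra_simps)
    show ?case unfolding \<open>1 - b ^ Suc n = _\<close> by (intro add scl mlt Suc aS)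
  qed
  have P1: "norm (1 - b ^ n) \<le> 1"
  proof -
    have "Pos (b ^ n)"
    proof (induction n)
      case 0 then show ?case using Pos_scaleR_one[of 1] by simp
    next
      case (Suc k)
      have "Pos b" using Pos_diff_scaleR_one[OF Pos_sa[OF a] a1] by (simp add: b_def)
      then show ?case using Suc by (simp add: Pos_mult power_commutes)
    qed
    then show ?thesis using Pos_norm_bound[OF _ nbk, of n] by simp
  qed
  show thesis
    by (rule that[of "1 - b ^ n"]) (use xb sbk in_S P1 in \<open>auto simp: algebra_simps\<close>)
qed

section \<open>Approximate units and contractive homomorphisms for records\<close>

lemma csc_of_real [simp]: "csc (complex_of_real r) x = r *\<^sub>R x"
  by (simp add: csc_def)

lemma csc_minus_one [simp]: "csc (-1) x = - x"
  by (simp add: csc_def)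

context cstar_record
begin

lemma emb_scaleR: "a \<in> carr C \<Longrightarrow> emb C (scl C (complex_of_real r) a) = r *\<^sub>R emb C a"
  by (simp add: emb_scl)

lemma tendsto_emb:
  assumes "\<And>n. x n \<in> carr C" "a \<in> carr C"
  shows "(\<lambda>n. emb C (x n)) \<longlonglongrightarrow> emb C a \<longleftrightarrow> (\<lambda>n. nrm C (mns C (x n) a)) \<longlonglongrightarrow> 0"
  using assms by (simp add: nrm_mns tendsto_norm_zero_iff flip: LIM_zero_iff[of _ "emb C a"])

lemma Cauchy_emb:
  assumes x: "\<And>n. x n \<in> carr C" and "Cauchy (\<lambda>n. emb C (x n))"
  obtains a where "a \<in> carr C" "(\<lambda>n. emb C (x n)) \<longlonglongrightarrow> emb C a"
proof -
  have "\<exists>N. \<forall>m\<ge>N. \<forall>k\<ge>N. nrm C (pls C (x m) (scl C (-1) (x k))) < e" if "0 < e" for e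
    using assms(2) that x unfolding Cauchy_def mns_def[symmetric] by (simp add: nrm_mns dist_norm)
  then obtain a where "a \<in> carr C" "(\<lambda>k. nrm C (pls C (x k) (scl C (-1) a))) \<longlonglongrightarrow> 0"
    using complete x unfolding complete_wrt_def by blast
  then show thesis using tendsto_emb[of x a] x that by (simp add: mns_def)
qed

lemma closed_emb: "closed (emb C ` carr C)"
  unfolding closed_sequential_limits
proof (intro allI impI, elim conjE)
  fix X L assume "\<forall>n. X n \<in> emb C ` carr C" and L: "X \<longlonglongrightarrow> L"
  then have "\<forall>n. \<exists>x. x \<in> carr C \<and> X n = emb C x" by blast
  then obtain x where x: "\<forall>n. x n \<in> carr C \<and> X n = emb C (x n)" using choice by metis
  then have X: "X = (\<lambda>n. emb C (x n))" by auto
  obtain a where "a \<in> carr C" "X \<longlonglongrightarrow> emb C a"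
    using Cauchy_emb[of x] LIMSEQ_imp_Cauchy[OF L] x unfolding X by metis
  then show "L \<in> emb C ` carr C" using L LIMSEQ_unique by blast
qed

text \<open>Applied below to the kernel of the left action and to whole algebras.\<close>

lemma approximate_unit_record:
  assumes K: "K \<subseteq> carr C" and add: "\<And>u v. u \<in> K \<Longrightarrow> v \<in> K \<Longrightarrow> pls C u v \<in> K" and scl: "\<And>c u. u \<in> K \<Longrightarrow> scl C c u \<in> K"
    and mlt: "\<And>u v. u \<in> K \<Longrightarrow> v \<in> K \<Longrightarrow> mlt C u v \<in> K" and str: "\<And>u. u \<in> K \<Longrightarrow> str C u \<in> K"
    and x: "x \<in> K" and e: "0 < e"
  obtains h where "h \<in> K" "str C h = h" "nrm C h \<le> 1" "nrm C (mns C x (mlt C x h)) < e"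
proof -
  obtain h where h: "norm (emb C x - emb C x * h) < e" "st h = h" "norm h \<le> 1"
    and S: "\<And>S. (\<And>u v. u \<in> S \<Longrightarrow> v \<in> S \<Longrightarrow> u + v \<in> S) \<Longrightarrow> (\<And>r u. u \<in> S \<Longrightarrow> r *\<^sub>R u \<in> S)
      \<Longrightarrow> (\<And>u v. u \<in> S \<Longrightarrow> v \<in> S \<Longrightarrow> u * v \<in> S) \<Longrightarrow> st (emb C x) * emb C x \<in> S \<Longrightarrow> h \<in> S"
    using approximate_unit[OF e, of "emb C x"] by metis
  note KC = subsetD[OF K]
  have "h \<in> emb C ` K"
  proof (rule S)
    show "st (emb C x) * emb C x \<in> emb C ` K"
      by (rule image_eqI[of _ _ "mlt C (str C x) x"]) (simp_all add: x KC emb_mlt emb_str mlt str)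
    fix u v assume "u \<in> emb C ` K" "v \<in> emb C ` K"
    then show "u + v \<in> emb C ` K" "u * v \<in> emb C ` K"
      using KC add mlt by (auto simp flip: emb_pls emb_mlt)
  next
    fix r :: real and u assume "u \<in> emb C ` K"
    then show "r *\<^sub>R u \<in> emb C ` K" using KC scl by (auto simp flip: emb_scaleR)
  qed
  then obtain k where k: "k \<in> K" "h = emb C k" by blast
  show thesis
    by (rule that[OF k(1)]) (use h k KC x in \<open>simp_all add: norm_emb nrm_mns emb_mlt flip: emb_str\<close>, metis KC emb_inj str_carr)
qed

end

text \<open>For self-adjoint x of norm below 1 there is v in A with v + v = v v + x x. This equation
  does not mention the unit, so \<open>f\<close> preserves it, and in the target it makes f x and 1
  - f v the two parts of a unitary. Scaling and the C*-identity settle the general case.\<close>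

lemma star_hom_contractive:
  assumes A: "cstar_alg A" and C: "cstar_alg C" and f: "star_hom A C f" and x: "x \<in> carr A"
  shows "nrm C (f x) \<le> nrm A x"
proof -
  interpret A: cstar_record A by (rule cstar_record.intro[OF A])
  interpret C: cstar_record C by (rule cstar_record.intro[OF C])
  have fc [simp]: "f x \<in> carr C" if "x \<in> carr A" for x using f that unfolding star_hom_def by blast
  have f_pls: "f (pls A x y) = pls C (f x) (f y)" and f_mlt: "f (mlt A x y) = mlt C (f x) (f y)"
    if "x \<in> carr A" "y \<in> carr A" for x y using f that unfolding star_hom_def by blast+
  have f_scl: "f (scl A c x) = scl C c (f x)" and f_str: "f (str A x) = str C (f x)"
    if "x \<in> carr A" for x c using f that unfolding star_hom_def by blast+
  have 1: "nrm C (f x) \<le> 1" if x: "x \<in> carr A" and sa: "str A x = x" and n: "nrm A x < 1" for x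
  proof -
    let ?a = "emb A x"
    have "norm (?a * ?a) \<le> norm ?a * norm ?a" by (rule norm_mult_ineq)
    also have "\<dots> < 1" using mult_strict_mono[of "nrm A x" 1 "nrm A x" 1] n x by (simp add: A.norm_emb)
    finally have "norm (?a * ?a) < 1" .
    then obtain d where d: "2 *\<^sub>R d - d * d = ?a * ?a"
      and S: "\<And>S. closed S \<Longrightarrow> 0 \<in> S \<Longrightarrow> (\<And>u. u \<in> S \<Longrightarrow> (1/2) *\<^sub>R (?a * ?a + u * u) \<in> S) \<Longrightarrow> d \<in> S"
      using sqrt_fixpoint[of "?a * ?a"] by metis
    \<comment> \<open>The solution has to lie in A before \<open>f\<close> can be applied to
      it.\<close>
    have "d \<in> emb A ` carr A"
    proof (rule S)
      show "0 \<in> emb A ` carr A" using A.emb_zer A.zer_carr by (metis imageI)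
      fix u assume "u \<in> emb A ` carr A"
      then obtain v where v: "v \<in> carr A" "u = emb A v" by blast
      have "(1/2) *\<^sub>R (?a * ?a + u * u) = emb A (scl A (complex_of_real (1/2)) (pls A (mlt A x x) (mlt A v v)))"
        using v x by (simp only: A.emb_scaleR A.emb_pls A.emb_mlt A.mlt_carr A.pls_carr)
      then show "(1/2) *\<^sub>R (?a * ?a + u * u) \<in> emb A ` carr A" using v x by simp
    qed (rule A.closed_emb)
    then obtain v where v: "v \<in> carr A" "d = emb A v" by blast
    have sa': "st ?a = ?a" using sa x by (simp flip: A.emb_str)
    have sd: "st d = d" using S[OF closed_self_adjoint] sa' by auto
    have ad: "?a * d = d * ?a"
    proof -
      have "?a * ((1/2) *\<^sub>R (?a * ?a + u * u)) = (1/2) *\<^sub>R (?a * ?a + u * u) * ?a" if "?a * u = u * ?a" for u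
      proof -
        have "?a * (u * u) = u * u * ?a" by (metis that mult.assoc)
        then show ?thesis by (simp add: algebra_simps)
      qed
      then show ?thesis using S[OF closed_commutant[of ?a]] by auto
    qed
    have "str A v = v" using sd v by (simp add: A.emb_inj flip: A.emb_str)
    then have sv: "st (emb C (f v)) = emb C (f v)" using v by (simp flip: C.emb_str f_str)
    have sx: "st (emb C (f x)) = emb C (f x)" using x sa by (simp flip: C.emb_str f_str)
    have "mlt A x v = mlt A v x" using ad v x by (simp add: A.emb_inj flip: A.emb_mlt)
    then have comm: "emb C (f x) * emb C (f v) = emb C (f v) * emb C (f x)" using v x by (metis C.emb_mlt fc f_mlt)
    have "d + d = d * d + ?a * ?a" using d by (simp add: scaleR_2 algebra_simps)
    then have "pls A v v = pls A (mlt A v v) (mlt A x x)"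
      using v x by (simp add: A.emb_inj flip: A.emb_pls A.emb_mlt)
    then have "emb C (f v) + emb C (f v) = emb C (f v) * emb C (f v) + emb C (f x) * emb C (f x)"
      using v x by (metis A.mlt_carr C.emb_mlt C.emb_pls C.mlt_carr f_mlt f_pls fc)
    then have "norm (emb C (f x)) \<le> 1"
      using comm sv sx by (intro unitary_bound[of "emb C (f x)" "1 - emb C (f v)" 1]) (simp_all add: algebra_simps)
    then show ?thesis using x by (simp add: C.norm_emb)
  qed
  have 2: "nrm C (f x) \<le> nrm A x" if x: "x \<in> carr A" and sa: "str A x = x" for x
  proof (rule dense_ge)
    fix r assume r: "nrm A x < r"
    then have r0: "r > 0" using A.nrm_nonneg[OF x] by linarith
    let ?y = "scl A (complex_of_real (1 / r)) x"
    have "nrm C (f ?y) \<le> 1"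
      by (rule 1) (use x sa r r0 in \<open>simp_all add: A.nrm_scl A.str_scl norm_divide\<close>)
    then show "nrm C (f x) \<le> r" using x r0 by (simp add: f_scl C.nrm_scl norm_divide field_simps)
  qed
  have "(nrm C (f x))\<^sup>2 = nrm C (f (mlt A (str A x) x))" using x by (simp add: f_mlt f_str C.nrm_str_mlt)
  also have "\<dots> \<le> (nrm A x)\<^sup>2" using 2[of "mlt A (str A x) x"] x by (simp add: A.str_mlt A.nrm_str_mlt)
  finally show ?thesis by (rule power2_le_imp_le) (use x in simp)
qed

section \<open>Correspondences and the tail\<close>

text \<open>The common ground of X and the tail module Y: \<open>precorr_Y\<close> verifies these
  properties for Y, so everything proved here is available for both.\<close>

locale precorr =
  fixes A :: "'a cstar" and X :: "('x, 'a) hmod" and phi :: "'a \<Rightarrow> 'x \<Rightarrow> 'x"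
  assumes A: "cstar_alg A" and Xv: "vspace (hcarr X) (hzer X) (hpls X) (hscl X)"
    and ract_carr [simp]: "x \<in> hcarr X \<Longrightarrow> a \<in> carr A \<Longrightarrow> ract X x a \<in> hcarr X"
    and inr_carr [simp]: "x \<in> hcarr X \<Longrightarrow> y \<in> hcarr X \<Longrightarrow> inr X x y \<in> carr A"
    and inr_hpls: "x \<in> hcarr X \<Longrightarrow> y \<in> hcarr X \<Longrightarrow> z \<in> hcarr X \<Longrightarrow> inr X x (hpls X y z) = pls A (inr X x y) (inr X x z)"
    and inr_hscl: "x \<in> hcarr X \<Longrightarrow> y \<in> hcarr X \<Longrightarrow> inr X x (hscl X c y) = scl A c (inr X x y)"
    and inr_ract: "x \<in> hcarr X \<Longrightarrow> y \<in> hcarr X \<Longrightarrow> a \<in> carr A \<Longrightarrow> inr X x (ract X y a) = mlt A (inr X x y) a"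
    and str_inr: "x \<in> hcarr X \<Longrightarrow> y \<in> hcarr X \<Longrightarrow> str A (inr X x y) = inr X y x"
    and inr_positive: "x \<in> hcarr X \<Longrightarrow> Defs.positive A (inr X x x)"
    and inr_definite: "x \<in> hcarr X \<Longrightarrow> inr X x x = zer A \<Longrightarrow> x = hzer X"
    and phi_carr [simp]: "a \<in> carr A \<Longrightarrow> x \<in> hcarr X \<Longrightarrow> phi a x \<in> hcarr X"
    and phi_hpls: "a \<in> carr A \<Longrightarrow> x \<in> hcarr X \<Longrightarrow> y \<in> hcarr X \<Longrightarrow> phi a (hpls X x y) = hpls X (phi a x) (phi a y)"
    and phi_pls: "a \<in> carr A \<Longrightarrow> b \<in> carr A \<Longrightarrow> x \<in> hcarr X \<Longrightarrow> phi (pls A a b) x = hpls X (phi a x) (phi b x)"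
    and phi_scl: "a \<in> carr A \<Longrightarrow> x \<in> hcarr X \<Longrightarrow> phi (scl A c a) x = hscl X c (phi a x)"
    and phi_mlt: "a \<in> carr A \<Longrightarrow> b \<in> carr A \<Longrightarrow> x \<in> hcarr X \<Longrightarrow> phi (mlt A a b) x = phi a (phi b x)"
    and inr_phi: "a \<in> carr A \<Longrightarrow> x \<in> hcarr X \<Longrightarrow> y \<in> hcarr X \<Longrightarrow> inr X (phi a x) y = inr X x (phi (str A a) y)"
begin

sublocale A: cstar_record A by (rule cstar_record.intro[OF A])

lemma hzer_carr [simp]: "hzer X \<in> hcarr X"
  and hpls_carr [simp]: "x \<in> hcarr X \<Longrightarrow> y \<in> hcarr X \<Longrightarrow> hpls X x y \<in> hcarr X"
  and hscl_carr [simp]: "x \<in> hcarr X \<Longrightarrow> hscl X c x \<in> hcarr X"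
  and hpls_assoc: "x \<in> hcarr X \<Longrightarrow> y \<in> hcarr X \<Longrightarrow> w \<in> hcarr X \<Longrightarrow> hpls X (hpls X x y) w = hpls X x (hpls X y w)"
  and hpls_comm: "x \<in> hcarr X \<Longrightarrow> y \<in> hcarr X \<Longrightarrow> hpls X x y = hpls X y x"
  and hpls_hzer_left [simp]: "x \<in> hcarr X \<Longrightarrow> hpls X (hzer X) x = x"
  and hpls_minus [simp]: "x \<in> hcarr X \<Longrightarrow> hpls X x (hscl X (-1) x) = hzer X"
  and hscl_hpls: "x \<in> hcarr X \<Longrightarrow> y \<in> hcarr X \<Longrightarrow> hscl X c (hpls X x y) = hpls X (hscl X c x) (hscl X c y)"
  and hscl_add: "x \<in> hcarr X \<Longrightarrow> hscl X (c + d) x = hpls X (hscl X c x) (hscl X d x)"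
  and hscl_mult: "x \<in> hcarr X \<Longrightarrow> hscl X (c * d) x = hscl X c (hscl X d x)"
  and hscl_one [simp]: "x \<in> hcarr X \<Longrightarrow> hscl X 1 x = x"
  using Xv unfolding vspace_def by meson+

lemma hscl_0 [simp]: "x \<in> hcarr X \<Longrightarrow> hscl X 0 x = hzer X"
  using hscl_add[of x 1 "-1"] by simp

lemma hpls_hzer_right [simp]: "x \<in> hcarr X \<Longrightarrow> hpls X x (hzer X) = x"
  by (simp add: hpls_comm[of x "hzer X"])

lemma hscl_hzer [simp]: "hscl X c (hzer X) = hzer X"
  by (metis mult_zero_right hscl_0 hscl_mult hzer_carr)

text \<open>The inner product read in the ambient unital algebra, where \<open>Pos\<close> and the
  norm estimates are stated.\<close>

definition ipt :: "'x \<Rightarrow> 'x \<Rightarrow> 'a mul" where "ipt x y = emb A (inr X x y)"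

lemma ipt_hpls: "x \<in> hcarr X \<Longrightarrow> y \<in> hcarr X \<Longrightarrow> z \<in> hcarr X \<Longrightarrow> ipt x (hpls X y z) = ipt x y + ipt x z"
  and ipt_hscl: "x \<in> hcarr X \<Longrightarrow> y \<in> hcarr X \<Longrightarrow> ipt x (hscl X c y) = csc c (ipt x y)"
  and ipt_ract: "x \<in> hcarr X \<Longrightarrow> y \<in> hcarr X \<Longrightarrow> a \<in> carr A \<Longrightarrow> ipt x (ract X y a) = ipt x y * emb A a"
  and st_ipt: "x \<in> hcarr X \<Longrightarrow> y \<in> hcarr X \<Longrightarrow> st (ipt x y) = ipt y x"
  and ipt_phi: "a \<in> carr A \<Longrightarrow> x \<in> hcarr X \<Longrightarrow> y \<in> hcarr X \<Longrightarrow> ipt (phi a x) y = ipt x (phi (str A a) y)"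
  unfolding ipt_def by (simp_all add: inr_hpls A.emb_pls inr_hscl A.emb_scl inr_ract A.emb_mlt inr_phi str_inr flip: A.emb_str)

lemma ipt_hpls_left: "x \<in> hcarr X \<Longrightarrow> y \<in> hcarr X \<Longrightarrow> z \<in> hcarr X \<Longrightarrow> ipt (hpls X x y) z = ipt x z + ipt y z"
  using st_ipt[of z "hpls X x y"] by (simp add: ipt_hpls st_ipt)

lemma ipt_hscl_left: "x \<in> hcarr X \<Longrightarrow> y \<in> hcarr X \<Longrightarrow> ipt (hscl X (complex_of_real r) x) y = r *\<^sub>R ipt x y"
  using st_ipt[of y "hscl X (complex_of_real r) x"] by (simp add: ipt_hscl st_ipt)

lemma ipt_hminus_left: "x \<in> hcarr X \<Longrightarrow> y \<in> hcarr X \<Longrightarrow> ipt (hscl X (-1) x) y = - ipt x y"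
  using ipt_hscl_left[of x y "-1"] by simp

lemma ipt_ract_left: "x \<in> hcarr X \<Longrightarrow> y \<in> hcarr X \<Longrightarrow> a \<in> carr A \<Longrightarrow> ipt (ract X x a) y = st (emb A a) * ipt x y"
  using st_ipt[of y "ract X x a"] by (simp add: ipt_ract st_ipt)

lemma Pos_ipt: "x \<in> hcarr X \<Longrightarrow> Pos (ipt x x)"
  using inr_positive[of x] unfolding Defs.positive_def ipt_def by (auto simp: A.emb_mlt A.emb_str Pos_st_mult)

lemma norm_ipt_self: "x \<in> hcarr X \<Longrightarrow> norm (ipt x x) = (hnorm A X x)\<^sup>2"
  by (simp add: hnorm_def ipt_def A.norm_emb)

lemma hnorm_nonneg [simp]: "x \<in> hcarr X \<Longrightarrow> 0 \<le> hnorm A X x"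
  by (simp add: hnorm_def)

lemma Cauchy_Schwarz:
  assumes x: "x \<in> hcarr X" and y: "y \<in> hcarr X"
  shows "norm (ipt x y) \<le> hnorm A X x * hnorm A X y"
proof -
  have "(norm (ipt x y))\<^sup>2 \<le> norm (ipt x x) * norm (ipt y y)"
  proof (rule Cauchy_Schwarz_Pos[OF Pos_ipt[OF x]])
    fix s :: real
    \<comment> \<open>The vector y + w is y - s x <x, y>; its inner square is the quadratic
      expression in \<open>Cauchy_Schwarz_Pos\<close>.\<close>
    define w where "w = hscl X (complex_of_real (- s)) (ract X x (inr X x y))"
    have w: "w \<in> hcarr X" using x y by (simp add: w_def)
    have "ipt (hpls X y w) (hpls X y w) = ipt y y - (2 * s) *\<^sub>R (st (ipt x y) * ipt x y) + (s * s) *\<^sub>R (st (ipt x y) * ipt x x * ipt x y)"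
      using x y w by (simp add: ipt_hpls ipt_hpls_left)
        (simp add: w_def ipt_hscl ipt_hscl_left ipt_ract ipt_ract_left st_ipt ipt_def[symmetric] mult.assoc scaleR_2 flip: scaleR_scaleR del: of_real_minus)
    then show "Pos (ipt y y - (2 * s) *\<^sub>R (st (ipt x y) * ipt x y) + (s * s) *\<^sub>R (st (ipt x y) * ipt x x * ipt x y))"
      using Pos_ipt[of "hpls X y w"] y w by simp
  qed
  also have "\<dots> = (hnorm A X x * hnorm A X y)\<^sup>2" using x y by (simp add: norm_ipt_self power_mult_distrib)
  finally show ?thesis by (rule power2_le_imp_le) (use x y in simp)
qed

lemma hnorm_triangle:
  assumes x: "x \<in> hcarr X" and y: "y \<in> hcarr X"
  shows "hnorm A X (hpls X x y) \<le> hnorm A X x + hnorm A X y"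
proof (rule power2_le_imp_le)
  have "(hnorm A X (hpls X x y))\<^sup>2 = norm (ipt x x + ipt x y + (ipt y x + ipt y y))"
    using x y by (simp add: ipt_hpls ipt_hpls_left algebra_simps flip: norm_ipt_self)
  also have "\<dots> \<le> norm (ipt x x) + norm (ipt x y) + (norm (ipt y x) + norm (ipt y y))"
    by (intro order_trans[OF norm_triangle_ineq] add_mono norm_triangle_ineq)
  also have "\<dots> \<le> (hnorm A X x + hnorm A X y)\<^sup>2"
    using Cauchy_Schwarz[OF x y] Cauchy_Schwarz[OF y x] x y by (simp add: norm_ipt_self power2_eq_square algebra_simps)
  finally show "(hnorm A X (hpls X x y))\<^sup>2 \<le> (hnorm A X x + hnorm A X y)\<^sup>2" .
qed (use x y in simp)

lemma hnorm_hminus: "x \<in> hcarr X \<Longrightarrow> hnorm A X (hscl X (-1) x) = hnorm A X x"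
proof -
  assume x: "x \<in> hcarr X"
  have "(hnorm A X (hscl X (-1) x))\<^sup>2 = (hnorm A X x)\<^sup>2" using x by (simp flip: norm_ipt_self add: ipt_hscl ipt_hminus_left)
  then show ?thesis using x by simp
qed

lemma hnorm_ract:
  assumes x: "x \<in> hcarr X" and a: "a \<in> carr A" shows "hnorm A X (ract X x a) \<le> hnorm A X x * nrm A a"
proof (rule power2_le_imp_le)
  have "(hnorm A X (ract X x a))\<^sup>2 = norm (st (emb A a) * ipt x x * emb A a)"
    using x a by (simp flip: norm_ipt_self add: ipt_ract ipt_ract_left mult.assoc)
  also have "\<dots> \<le> norm (st (emb A a)) * norm (ipt x x) * norm (emb A a)"
    by (meson norm_mult_ineq mult_right_mono norm_ge_zero order_trans)
  also have "\<dots> = (hnorm A X x * nrm A a)\<^sup>2" using x a by (simp add: A.norm_emb norm_ipt_self power2_eq_square)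
  finally show "(hnorm A X (ract X x a))\<^sup>2 \<le> (hnorm A X x * nrm A a)\<^sup>2" .
qed (use x a in simp)

text \<open>Let aa be \<open>st a * a\<close> divided by r^2, and let v be self-adjoint with v + v =
  v v + aa. Then z = x - phi v x has <z, z> = <x, x> - <x, phi aa x>, and the subtracted term is the
  inner square of phi a x divided by r^2. Positivity of <z, z> gives the bound.\<close>

lemma hnorm_phi:
  assumes x: "x \<in> hcarr X" and a: "a \<in> carr A" shows "hnorm A X (phi a x) \<le> nrm A a * hnorm A X x"
proof -
  \<comment> \<open>With \<open>r\<close> strictly above the norm of \<open>a\<close> the scaled
    element has norm below 1, as the square root requires.\<close>
  have *: "hnorm A X (phi a x) \<le> r * hnorm A X x" if r: "nrm A a < r" for r
  proof -
    have r0: "r > 0" using r A.nrm_nonneg[OF a] by linarith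
    define aa where "aa = scl A (complex_of_real (1 / r\<^sup>2)) (mlt A (str A a) a)"
    have aa: "aa \<in> carr A" using a by (simp add: aa_def)
    have "norm (emb A aa) = (nrm A a)\<^sup>2 / r\<^sup>2" using a by (simp add: A.norm_emb aa_def A.nrm_scl A.nrm_str_mlt norm_divide norm_power)
    also have "\<dots> < 1" using r r0 A.nrm_nonneg[OF a] by (simp add: power2_eq_square mult_strict_mono)
    finally have n: "norm (emb A aa) < 1" .
    then obtain d where d: "2 *\<^sub>R d - d * d = emb A aa"
      and S: "\<And>S. closed S \<Longrightarrow> 0 \<in> S \<Longrightarrow> (\<And>u. u \<in> S \<Longrightarrow> (1/2) *\<^sub>R (emb A aa + u * u) \<in> S) \<Longrightarrow> d \<in> S"
      using sqrt_fixpoint[OF n] by metis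
    have "d \<in> emb A ` carr A"
    proof (rule S)
      show "0 \<in> emb A ` carr A" using A.emb_zer A.zer_carr by (metis imageI)
      fix u assume "u \<in> emb A ` carr A"
      then obtain v where v: "v \<in> carr A" "u = emb A v" by blast
      have "(1/2) *\<^sub>R (emb A aa + u * u) = emb A (scl A (complex_of_real (1/2)) (pls A aa (mlt A v v)))"
        using v aa by (simp only: A.emb_scaleR A.emb_pls A.emb_mlt A.mlt_carr A.pls_carr)
      then show "(1/2) *\<^sub>R (emb A aa + u * u) \<in> emb A ` carr A" using v aa by simp
    qed (rule A.closed_emb)
    then obtain v where v: "v \<in> carr A" "d = emb A v" by blast
    have sb: "st (emb A aa) = emb A aa" using a by (simp add: aa_def A.str_scl A.str_mlt flip: A.emb_str)
    have "st d = d" using S[OF closed_self_adjoint] sb by auto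
    then have sv: "str A v = v" using v by (simp add: A.emb_inj flip: A.emb_str)
    have "d + d = d * d + emb A aa" using d by (simp add: scaleR_2 algebra_simps)
    then have vv: "pls A v v = pls A (mlt A v v) aa"
      using v aa by (simp add: A.emb_inj flip: A.emb_pls A.emb_mlt)
    define F where "F b = ipt x (phi b x)" for b
    have F_pls: "F (pls A b c) = F b + F c" if "b \<in> carr A" "c \<in> carr A" for b c
      using that x by (simp add: F_def phi_pls ipt_hpls)
    have FF: "F v + F v = F (mlt A v v) + F aa" using v aa by (metis F_pls vv A.mlt_carr)
    have Fa: "F aa = (1 / r\<^sup>2) *\<^sub>R ipt (phi a x) (phi a x)"
      using x a by (simp add: F_def aa_def phi_scl ipt_hscl phi_mlt ipt_phi del: of_real_divide of_real_power)
    define z where "z = hpls X x (hscl X (-1) (phi v x))"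
    have z: "z \<in> hcarr X" using x v by (simp add: z_def)
    have "ipt z z = ipt x x - (F v + F v - F (mlt A v v))"
      using x v by (simp add: z_def ipt_hpls ipt_hpls_left ipt_hscl ipt_hminus_left F_def phi_mlt ipt_phi sv)
    then have zz: "ipt z z = ipt x x - F aa" using FF by simp
    have "Pos (F aa)" unfolding Fa using x a by (intro Pos_scaleR Pos_ipt) simp_all
    then have "norm (F aa) \<le> norm (ipt x x)" using norm_mono[OF _ Pos_ipt[OF z], of "F aa"] by (simp add: zz)
    then have "(hnorm A X (phi a x))\<^sup>2 / r\<^sup>2 \<le> (hnorm A X x)\<^sup>2"
      unfolding Fa using x a by (simp add: norm_ipt_self)
    then have "(hnorm A X (phi a x))\<^sup>2 \<le> (r * hnorm A X x)\<^sup>2" using r0 by (simp add: field_simps)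
    then show ?thesis by (rule power2_le_imp_le) (use r0 x in simp)
  qed
  show ?thesis
  proof (rule field_le_epsilon)
    fix e :: real assume e: "0 < e"
    have "hnorm A X (phi a x) \<le> (nrm A a + e / (hnorm A X x + 1)) * hnorm A X x"
      by (rule *) (use e x in \<open>simp add: add_nonneg_pos\<close>)
    also have "\<dots> = nrm A a * hnorm A X x + e * (hnorm A X x / (hnorm A X x + 1))" by (simp add: algebra_simps)
    also have "\<dots> \<le> nrm A a * hnorm A X x + e"
      using e x by (intro add_left_mono mult_left_le) (simp_all add: divide_le_eq_1 add_nonneg_pos)
    finally show "hnorm A X (phi a x) \<le> nrm A a * hnorm A X x + e" .
  qed
qed

lemma hnorm_eq_0: "x \<in> hcarr X \<Longrightarrow> hnorm A X x = 0 \<longleftrightarrow> x = hzer X"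
proof
  assume x: "x \<in> hcarr X" and "hnorm A X x = 0"
  then have "nrm A (inr X x x) = 0" by (simp add: hnorm_def)
  then show "x = hzer X" using x inr_definite[OF x] by simp
next
  assume x: "x = hzer X"
  have "inr X (hzer X) (hzer X) = zer A" using inr_hscl[of "hzer X" "hzer X" 0] by simp
  then show "hnorm A X x = 0" using x by (simp add: hnorm_def)
qed

lemma hnorm_hzer [simp]: "hnorm A X (hzer X) = 0"
  by (simp add: hnorm_eq_0)

lemma heqI:
  assumes x: "x \<in> hcarr X" and y: "y \<in> hcarr X" and e: "\<And>z. z \<in> hcarr X \<Longrightarrow> inr X z x = inr X z y"
  shows "x = y"
proof -
  let ?d = "hpls X x (hscl X (-1) y)"
  have d: "?d \<in> hcarr X" using x y by simp
  have "inr X ?d ?d = zer A" using e[OF d] x y d by (simp add: inr_hpls inr_hscl)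
  then have "?d = hzer X" using d inr_definite by blast
  then have "hpls X ?d y = y" using y by simp
  then show ?thesis using x y by (metis hpls_assoc hpls_comm hpls_hzer_right hpls_minus hscl_carr)
qed

lemma phi_diff:
  "a \<in> carr A \<Longrightarrow> b \<in> carr A \<Longrightarrow> x \<in> hcarr X \<Longrightarrow> phi (mns A a b) x = hpls X (phi a x) (hscl X (-1) (phi b x))"
  by (simp add: mns_def phi_pls phi_scl)

lemma ker_carr: "a \<in> kerphi A X phi \<Longrightarrow> a \<in> carr A"
  by (simp add: kerphi_def)

lemma ker_zer [simp]: "zer A \<in> kerphi A X phi"
  using phi_scl[of "zer A" _ 0] by (simp add: kerphi_def)

lemma ker_pls [simp]: "a \<in> kerphi A X phi \<Longrightarrow> b \<in> kerphi A X phi \<Longrightarrow> pls A a b \<in> kerphi A X phi"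
  and ker_scl [simp]: "a \<in> kerphi A X phi \<Longrightarrow> scl A c a \<in> kerphi A X phi"
  by (simp_all add: kerphi_def phi_pls phi_scl)

lemma phi_hzer: "a \<in> carr A \<Longrightarrow> phi a (hzer X) = hzer X"
proof -
  assume a: "a \<in> carr A"
  have "hnorm A X (phi a (hzer X)) \<le> nrm A a * hnorm A X (hzer X)" by (rule hnorm_phi) (use a in simp_all)
  then have "hnorm A X (phi a (hzer X)) = 0"
    using a hnorm_eq_0[of "hzer X"] by (intro antisym hnorm_nonneg) simp_all
  then show ?thesis using hnorm_eq_0[of "phi a (hzer X)"] a by simp
qed

lemma ker_mlt_left: "a \<in> carr A \<Longrightarrow> b \<in> kerphi A X phi \<Longrightarrow> mlt A a b \<in> kerphi A X phi"
  by (simp add: kerphi_def phi_mlt phi_hzer)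

lemma ker_str [simp]:
  assumes a: "a \<in> kerphi A X phi" shows "str A a \<in> kerphi A X phi"
  unfolding kerphi_def
proof (intro CollectI conjI ballI)
  have ac: "a \<in> carr A" using a by (simp add: kerphi_def)
  then show "str A a \<in> carr A" by simp
  fix x assume x: "x \<in> hcarr X"
  show "phi (str A a) x = hzer X"
  proof (rule heqI)
    fix z assume z: "z \<in> hcarr X"
    have "inr X z (phi (str A a) x) = inr X (phi a z) x" using ac x z by (simp add: inr_phi)
    also have "\<dots> = inr X (hzer X) x" using a z by (simp add: kerphi_def)
    also have "\<dots> = zer A" using x inr_hscl[of x "hzer X" 0] by (metis A.scl_0 A.str_zer hscl_0 hzer_carr inr_carr str_inr)
    also have "\<dots> = inr X z (hzer X)" using z inr_hscl[of z "hzer X" 0] by simp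
    finally show "inr X z (phi (str A a) x) = inr X z (hzer X)" .
  qed (use ac x in simp_all)
qed

lemma ker_mlt [simp]: "a \<in> kerphi A X phi \<Longrightarrow> b \<in> kerphi A X phi \<Longrightarrow> mlt A a b \<in> kerphi A X phi"
  using ker_mlt_left ker_carr by blast

lemma ker_mns [simp]: "a \<in> kerphi A X phi \<Longrightarrow> b \<in> kerphi A X phi \<Longrightarrow> mns A a b \<in> kerphi A X phi"
  by (simp add: mns_def)

lemma ker_closed:
  assumes k: "\<And>n. k n \<in> kerphi A X phi" and a: "a \<in> carr A" and lim: "(\<lambda>n. nrm A (mns A (k n) a)) \<longlonglongrightarrow> 0"
  shows "a \<in> kerphi A X phi"
  unfolding kerphi_def
proof (intro CollectI conjI ballI a)
  fix x assume x: "x \<in> hcarr X"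
  have "hnorm A X (phi a x) \<le> nrm A (mns A (k n) a) * hnorm A X x" for n
  proof -
    have kc: "k n \<in> carr A" and kx: "phi (k n) x = hzer X" using k[of n] x by (auto simp: kerphi_def)
    then show ?thesis using hnorm_phi[OF x, of "mns A (k n) a"] a x by (simp add: phi_diff hnorm_hminus kerphi_def)
  qed
  moreover have "(\<lambda>n. nrm A (mns A (k n) a) * hnorm A X x) \<longlonglongrightarrow> 0 * hnorm A X x" by (intro tendsto_intros lim)
  ultimately have "hnorm A X (phi a x) \<le> 0 * hnorm A X x" by (intro LIMSEQ_le_const) auto
  then have "hnorm A X (phi a x) = 0" using a x by (intro antisym hnorm_nonneg) simp_all
  then show "phi a x = hzer X" using hnorm_eq_0 a x by simp
qed

lemma thsum_carr [simp]: "set l \<subseteq> hcarr X \<times> hcarr X \<Longrightarrow> x \<in> hcarr X \<Longrightarrow> thsum X l x \<in> hcarr X"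
  unfolding thsum_def by (induction l) auto

text \<open>\<open>opnorm\<close> is a bare \<open>Sup\<close>, which carries information only over
  a set that is bounded above; this bound provides that for finite-rank operators.\<close>

lemma thsum_bounded:
  assumes "set l \<subseteq> hcarr X \<times> hcarr X"
  shows "\<exists>K. \<forall>x\<in>hcarr X. hnorm A X (thsum X l x) \<le> K * hnorm A X x"
  using assms
proof (induction l)
  case Nil
  then show ?case by (auto simp: thsum_def hnorm_eq_0 intro!: exI[of _ 0])
next
  case (Cons p l)
  obtain \<xi> \<eta> where p: "p = (\<xi>, \<eta>)" "\<xi> \<in> hcarr X" "\<eta> \<in> hcarr X" using Cons by (cases p) auto
  obtain K where K: "\<And>x. x \<in> hcarr X \<Longrightarrow> hnorm A X (thsum X l x) \<le> K * hnorm A X x" using Cons by auto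
  have "hnorm A X (thsum X (p # l) x) \<le> (hnorm A X \<xi> * hnorm A X \<eta> + K) * hnorm A X x" if x: "x \<in> hcarr X" for x
  proof -
    have "thsum X (p # l) x = hpls X (ract X \<xi> (inr X \<eta> x)) (thsum X l x)" by (simp add: thsum_def p)
    then have "hnorm A X (thsum X (p # l) x) \<le> hnorm A X (ract X \<xi> (inr X \<eta> x)) + hnorm A X (thsum X l x)"
      using hnorm_triangle[of "ract X \<xi> (inr X \<eta> x)" "thsum X l x"] Cons.prems p x by simp
    also have "\<dots> \<le> hnorm A X \<xi> * (hnorm A X \<eta> * hnorm A X x) + K * hnorm A X x"
    proof (intro add_mono K x)
      have "hnorm A X (ract X \<xi> (inr X \<eta> x)) \<le> hnorm A X \<xi> * nrm A (inr X \<eta> x)" by (rule hnorm_ract) (use p x in simp_all)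
      also have "\<dots> \<le> hnorm A X \<xi> * (hnorm A X \<eta> * hnorm A X x)"
        using Cauchy_Schwarz[of \<eta> x] p x by (intro mult_left_mono) (simp_all add: ipt_def A.norm_emb)
      finally show "hnorm A X (ract X \<xi> (inr X \<eta> x)) \<le> hnorm A X \<xi> * (hnorm A X \<eta> * hnorm A X x)" .
    qed
    finally show ?thesis by (simp add: algebra_simps)
  qed
  then show ?case by blast
qed

text \<open>The error of a finite-rank approximation to the left action; both
  \<open>compact_op\<close> and \<open>pi1_value\<close> are conditions on its operator
  norm.\<close>

definition defect :: "'a \<Rightarrow> ('x \<times> 'x) list \<Rightarrow> 'x \<Rightarrow> 'x" where
  "defect a l z = hpls X (phi a z) (hscl X (-1) (thsum X l z))"

lemma bdd_defect:
  assumes a: "a \<in> carr A" and l: "set l \<subseteq> hcarr X \<times> hcarr X"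
  shows "bdd_above {hnorm A X (defect a l x) | x. x \<in> hcarr X \<and> hnorm A X x \<le> 1}"
proof -
  obtain K where K: "\<And>x. x \<in> hcarr X \<Longrightarrow> hnorm A X (thsum X l x) \<le> K * hnorm A X x" using thsum_bounded[OF l] by blast
  have "hnorm A X (defect a l x) \<le> nrm A a + max K 0" if x: "x \<in> hcarr X" "hnorm A X x \<le> 1" for x
  proof -
    have "hnorm A X (defect a l x) \<le> hnorm A X (phi a x) + hnorm A X (thsum X l x)"
      unfolding defect_def using hnorm_triangle[of "phi a x" "hscl X (-1) (thsum X l x)"] a l x by (simp add: hnorm_hminus)
    also have "\<dots> \<le> nrm A a * hnorm A X x + max K 0 * hnorm A X x"
      using hnorm_phi[OF x(1) a] K[OF x(1)] mult_right_mono[of K "max K 0" "hnorm A X x"] x by simp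
    also have "\<dots> \<le> nrm A a * 1 + max K 0 * 1"
      using x a by (intro add_mono mult_left_mono) auto
    finally show ?thesis by simp
  qed
  then show ?thesis by (intro bdd_aboveI[of _ "nrm A a + max K 0"]) auto
qed

lemma defect_le_opnorm:
  assumes "a \<in> carr A" "set l \<subseteq> hcarr X \<times> hcarr X" "x \<in> hcarr X" "hnorm A X x \<le> 1"
  shows "hnorm A X (defect a l x) \<le> opnorm A X (defect a l)"
  unfolding opnorm_def by (rule cSup_upper[OF _ bdd_defect]) (use assms in auto)

lemma opnorm_defect_nonneg:
  assumes "a \<in> carr A" "set l \<subseteq> hcarr X \<times> hcarr X"
  shows "0 \<le> opnorm A X (defect a l)"
proof -
  have "0 \<le> hnorm A X (defect a l (hzer X))" using assms by (simp add: defect_def)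
  then show ?thesis using defect_le_opnorm[OF assms, of "hzer X"] hnorm_eq_0[of "hzer X"] by simp
qed

lemma opnorm_le:
  assumes "\<And>x. x \<in> hcarr X \<Longrightarrow> hnorm A X x \<le> 1 \<Longrightarrow> hnorm A X (T x) \<le> r"
  shows "opnorm A X T \<le> r"
  unfolding opnorm_def
proof (rule cSup_least)
  have "hnorm A X (hzer X) \<le> 1" using hnorm_eq_0[of "hzer X"] by simp
  then show "{hnorm A X (T x) |x. x \<in> hcarr X \<and> hnorm A X x \<le> 1} \<noteq> {}" using hzer_carr by blast
qed (use assms in auto)

end

lemma correspondence_precorr: "correspondence A X phi \<Longrightarrow> precorr A X phi"
  unfolding correspondence_def hilbert_module_def precorr_def by meson

section \<open>The algebra B and the module Y with the tail\<close>

context precorr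
begin

abbreviation "I \<equiv> kerphi A X phi"
abbreviation "T \<equiv> tailset A X phi"
abbreviation "B \<equiv> tailB A X phi"
abbreviation "Y \<equiv> tailY A X phi"
abbreviation "phiB \<equiv> tailphi A X phi"

lemma tail_ker: "f \<in> T \<Longrightarrow> f n \<in> I"
  by (simp add: tailset_def)

lemma tail_carr: "f \<in> T \<Longrightarrow> f n \<in> carr A"
  using ker_carr[of "f n"] tail_ker[of f n] by blast

lemma tail_null: "f \<in> T \<Longrightarrow> (\<lambda>n. nrm A (f n)) \<longlonglongrightarrow> 0"
  by (simp add: tailset_def)

lemma tailI:
  assumes f: "\<And>n. f n \<in> I" and g: "g \<longlonglongrightarrow> 0" and fg: "\<And>n. nrm A (f n) \<le> g n" shows "f \<in> T"
  unfolding tailset_def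
proof (intro CollectI conjI allI f)
  have "0 \<le> nrm A (f n)" for n using ker_carr[OF f] by simp
  then show "(\<lambda>n. nrm A (f n)) \<longlonglongrightarrow> 0"
    by (intro tendsto_sandwich[OF _ _ tendsto_const[of 0] g]) (simp_all add: fg)
qed

lemma tail_zer [simp]: "(\<lambda>n. zer A) \<in> T"
  by (rule tailI[where g="\<lambda>n. 0"]) simp_all

lemma tail_pls [simp]: "f \<in> T \<Longrightarrow> g \<in> T \<Longrightarrow> (\<lambda>n. pls A (f n) (g n)) \<in> T"
  using tendsto_add[OF tail_null tail_null, of f g]
  by (intro tailI[where g="\<lambda>n. nrm A (f n) + nrm A (g n)"]) (simp_all add: A.nrm_pls tail_ker[of f] tail_ker[of g] tail_carr[of f] tail_carr[of g])

lemma tail_scl [simp]: "f \<in> T \<Longrightarrow> (\<lambda>n. scl A c (f n)) \<in> T"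
  using tendsto_mult_left[OF tail_null, of f "cmod c"]
  by (intro tailI[where g="\<lambda>n. cmod c * nrm A (f n)"]) (simp_all add: A.nrm_scl tail_ker[of f] tail_carr[of f])

lemma tail_str [simp]: "f \<in> T \<Longrightarrow> (\<lambda>n. str A (f n)) \<in> T"
  using tail_null by (intro tailI[where g="\<lambda>n. nrm A (f n)"]) (simp_all add: tail_ker[of f] tail_carr[of f])

lemma tail_bounded: "f \<in> T \<Longrightarrow> bdd_above (range (\<lambda>n. nrm A (f n)))"
  by (rule bounded_imp_bdd_above[OF convergent_imp_bounded[OF tail_null]])

definition tnorm :: "(nat \<Rightarrow> 'a) \<Rightarrow> real" where "tnorm f = Sup (range (\<lambda>n. nrm A (f n)))"

lemma nrm_le_tnorm: "f \<in> T \<Longrightarrow> nrm A (f n) \<le> tnorm f"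
  unfolding tnorm_def by (rule cSUP_upper[OF UNIV_I tail_bounded])

lemma tnorm_leI: "(\<And>n. nrm A (f n) \<le> r) \<Longrightarrow> tnorm f \<le> r"
  unfolding tnorm_def by (rule cSUP_least) auto

lemma tnorm_nonneg [simp]: "f \<in> T \<Longrightarrow> 0 \<le> tnorm f"
  using nrm_le_tnorm[of f 0] A.nrm_nonneg[OF tail_carr[of f 0]] by linarith

lemma tail_mlt_left: "f \<in> T \<Longrightarrow> (\<And>n. a n \<in> carr A) \<Longrightarrow> (\<And>n. nrm A (a n) \<le> K) \<Longrightarrow> (\<lambda>n. mlt A (a n) (f n)) \<in> T"
proof (rule tailI[where g="\<lambda>n. K * nrm A (f n)"])
  assume f: "f \<in> T" and a: "\<And>n. a n \<in> carr A" and K: "\<And>n. nrm A (a n) \<le> K"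
  show "mlt A (a n) (f n) \<in> I" for n using tail_ker[OF f] a by (simp add: ker_mlt_left)
  show "nrm A (mlt A (a n) (f n)) \<le> K * nrm A (f n)" for n
    using A.nrm_mlt[OF a tail_carr[OF f], of n n] mult_right_mono[OF K A.nrm_nonneg[OF tail_carr[OF f]], of n n] by linarith
  show "(\<lambda>n. K * nrm A (f n)) \<longlonglongrightarrow> 0" using tendsto_mult_left[OF tail_null[OF f], of K] by simp
qed

lemma tail_mlt [simp]: "f \<in> T \<Longrightarrow> g \<in> T \<Longrightarrow> (\<lambda>n. mlt A (f n) (g n)) \<in> T"
  by (rule tail_mlt_left[where K="tnorm f"]) (simp_all add: nrm_le_tnorm tail_carr[of f])

lemma tail_phi [simp]:
  assumes a: "a \<in> carr A" and f: "f \<in> T" and g: "g \<in> T"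
  shows "(\<lambda>n. if n = 0 then mlt A a (g 0) else mlt A (f (n - 1)) (g n)) \<in> T"
proof -
  have "(\<lambda>n. mlt A (if n = 0 then a else f (n - 1)) (g n)) \<in> T"
    using a f nrm_le_tnorm[OF f] tail_carr[OF f] by (intro tail_mlt_left[OF g, where K="max (nrm A a) (tnorm f)"]) (auto simp: le_max_iff_disj)
  moreover have "(\<lambda>n. mlt A (if n = 0 then a else f (n - 1)) (g n)) = (\<lambda>n. if n = 0 then mlt A a (g 0) else mlt A (f (n - 1)) (g n))"
    by auto
  ultimately show ?thesis by simp
qed

lemma B_simps [simp]:
  "carr B = carr A \<times> T" "zer B = (zer A, \<lambda>n. zer A)" "pls B (a, f) (b, g) = (pls A a b, \<lambda>n. pls A (f n) (g n))"
  "mlt B (a, f) (b, g) = (mlt A a b, \<lambda>n. mlt A (f n) (g n))" "scl B c (a, f) = (scl A c a, \<lambda>n. scl A c (f n))"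
  "str B (a, f) = (str A a, \<lambda>n. str A (f n))" "nrm B (a, f) = max (nrm A a) (tnorm f)"
  by (simp_all add: tailB_def tnorm_def)

lemma Y_simps [simp]:
  "hcarr Y = hcarr X \<times> T" "hzer Y = (hzer X, \<lambda>n. zer A)" "hpls Y (x, f) (y, g) = (hpls X x y, \<lambda>n. pls A (f n) (g n))"
  "hscl Y c (x, f) = (hscl X c x, \<lambda>n. scl A c (f n))" "ract Y (x, f) (a, g) = (ract X x a, \<lambda>n. mlt A (f n) (g n))"
  "inr Y (x, f) (y, g) = (inr X x y, \<lambda>n. mlt A (str A (f n)) (g n))"
  by (simp_all add: tailY_def)

lemma phiB_simps [simp]:
  "phiB (a, f) (x, g) = (phi a x, \<lambda>n. if n = 0 then mlt A a (g 0) else mlt A (f (n - 1)) (g n))"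
  by (simp add: tailphi_def)

lemma tnorm_zer [simp]: "tnorm (\<lambda>n. zer A) = 0"
  by (simp add: tnorm_def)

lemma tnorm_scl:
  assumes f: "f \<in> T" shows "tnorm (\<lambda>n. scl A c (f n)) = cmod c * tnorm f"
proof -
  have le: "tnorm (\<lambda>n. scl A c (f n)) \<le> cmod c * tnorm f" if "f \<in> T" for c f
    using that tail_carr[OF that] by (intro tnorm_leI) (simp add: A.nrm_scl mult_left_mono nrm_le_tnorm)
  show ?thesis
  proof (cases "c = 0")
    case True then show ?thesis using tail_carr[OF f] by simp
  next
    case False
    have "tnorm f \<le> cmod (inverse c) * tnorm (\<lambda>n. scl A c (f n))"
      using le[of "\<lambda>n. scl A c (f n)" "inverse c"] f False tail_carr[OF f] by simp
    then have "cmod c * tnorm f \<le> tnorm (\<lambda>n. scl A c (f n))" using False by (simp add: norm_inverse norm_divide field_simps)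
    then show ?thesis using le[OF f, of c] by simp
  qed
qed

lemma B_complete: "complete_wrt (carr B) (pls B) (scl B) (nrm B)"
  unfolding complete_wrt_def
proof (intro allI impI, elim conjE)
  fix F :: "nat \<Rightarrow> 'a \<times> (nat \<Rightarrow> 'a)" assume F: "\<forall>k. F k \<in> carr B"
    and C: "\<forall>e>0. \<exists>N. \<forall>m\<ge>N. \<forall>k\<ge>N. nrm B (pls B (F m) (scl B (- 1) (F k))) < e"
  define a f where "a k = fst (F k)" and "f k = snd (F k)" for k :: nat
  have Fk: "F k = (a k, f k)" for k by (simp add: a_def f_def)
  have a: "a k \<in> carr A" and f: "f k \<in> T" for k using F[rule_format, of k] by (simp_all add: Fk)
  note [simp] = tail_carr[OF f] tail_ker[OF f]
  have C': "\<exists>N. \<forall>m\<ge>N. \<forall>k\<ge>N. nrm A (mns A (a m) (a k)) < e \<and> (\<forall>n. nrm A (mns A (f m n) (f k n)) < e)" if "e > 0" for e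
  proof -
    obtain N where "\<forall>m\<ge>N. \<forall>k\<ge>N. nrm B (pls B (F m) (scl B (- 1) (F k))) < e" using C \<open>e > 0\<close> by blast
    then have N: "nrm B (pls B (F m) (scl B (- 1) (F k))) < e" if "m \<ge> N" "k \<ge> N" for m k using that by blast
    have "nrm A (mns A (a m) (a k)) < e \<and> (\<forall>n. nrm A (mns A (f m n) (f k n)) < e)" if "m \<ge> N" "k \<ge> N" for m k
      using N[OF that] nrm_le_tnorm[of "\<lambda>n. pls A (f m n) (scl A (- 1) (f k n))"] f
      by (simp add: Fk mns_def) (meson le_less_trans)
    then show ?thesis by blast
  qed
  have "Cauchy (\<lambda>k. emb A (a k))" unfolding Cauchy_def dist_norm using C' a by (simp flip: A.nrm_mns) blast
  then obtain a' where a': "a' \<in> carr A" "(\<lambda>k. emb A (a k)) \<longlonglongrightarrow> emb A a'" using A.Cauchy_emb[of a] a by blast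
  have "\<exists>b. b \<in> carr A \<and> (\<lambda>k. emb A (f k n)) \<longlonglongrightarrow> emb A b" for n
  proof -
    have "Cauchy (\<lambda>k. emb A (f k n))" unfolding Cauchy_def dist_norm using C' f by (simp flip: A.nrm_mns) blast
    then show ?thesis using A.Cauchy_emb[of "\<lambda>k. f k n"] f by (metis tail_carr)
  qed
  then obtain f' where f': "\<And>n. f' n \<in> carr A" "\<And>n. (\<lambda>k. emb A (f k n)) \<longlonglongrightarrow> emb A (f' n)" by metis
  \<comment> \<open>Uniformity in the coordinate is what carries the null-sequence property over to
    the limit.\<close>
  have unif: "\<exists>N. \<forall>k\<ge>N. \<forall>n. nrm A (mns A (f k n) (f' n)) \<le> e" if "e > 0" for e
  proof -
    obtain N where N: "\<And>m k n. m \<ge> N \<Longrightarrow> k \<ge> N \<Longrightarrow> nrm A (mns A (f m n) (f k n)) < e" using C'[OF \<open>e > 0\<close>] by blast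
    have "nrm A (mns A (f k n) (f' n)) \<le> e" if "k \<ge> N" for k n
    proof (rule LIMSEQ_le_const2)
      show "(\<lambda>m. nrm A (mns A (f k n) (f m n))) \<longlonglongrightarrow> nrm A (mns A (f k n) (f' n))"
        using f f'(1) by (simp add: A.nrm_mns) (intro tendsto_intros f')
      show "\<exists>M. \<forall>m\<ge>M. nrm A (mns A (f k n) (f m n)) \<le> e" using N[OF that] by (meson less_imp_le)
    qed
    then show ?thesis by blast
  qed
  have f'I: "f' n \<in> I" for n
    by (rule ker_closed[of "\<lambda>k. f k n"]) (use f f' A.tendsto_emb[of "\<lambda>k. f k n"] in auto)
  note [simp] = f'I ker_carr[OF f'I]
  have f'T: "f' \<in> T"
    unfolding tailset_def
  proof (intro CollectI conjI allI f'I LIMSEQ_I)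
    fix e :: real assume e: "e > 0"
    obtain N where N: "\<And>n. nrm A (mns A (f N n) (f' n)) \<le> e/2" using unif[of "e/2"] e by auto
    obtain M where M: "\<And>n. n \<ge> M \<Longrightarrow> nrm A (f N n) < e/2"
      using LIMSEQ_D[OF tail_null[OF f[of N]], of "e/2"] e f by auto
    have "norm (nrm A (f' n) - 0) < e" if "n \<ge> M" for n
    proof -
      have "norm (emb A (f' n)) \<le> norm (emb A (f N n)) + norm (emb A (f N n) - emb A (f' n))"
        by (metis norm_triangle_sub norm_minus_commute)
      then show ?thesis using N[of n] M[OF that] f f'(1) by (simp add: A.nrm_mns A.norm_emb)
    qed
    then show "\<exists>no. \<forall>n\<ge>no. norm (nrm A (f' n) - 0) < e" by blast
  qed
  have "(\<lambda>k. nrm B (pls B (F k) (scl B (- 1) (a', f')))) \<longlonglongrightarrow> 0"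
  proof (rule LIMSEQ_I)
    fix e :: real assume e: "e > 0"
    obtain N where N: "\<And>k n. k \<ge> N \<Longrightarrow> nrm A (mns A (f k n) (f' n)) \<le> e/2" using unif[of "e/2"] e by auto
    obtain M where M: "\<And>k. k \<ge> M \<Longrightarrow> norm (emb A (a k) - emb A a') < e" using LIMSEQ_D[OF a'(2) e] by blast
    have "norm (nrm B (pls B (F k) (scl B (- 1) (a', f'))) - 0) < e" if k: "k \<ge> max M N" for k
    proof -
      have "tnorm (\<lambda>n. pls A (f k n) (scl A (- 1) (f' n))) \<le> e/2" using N[of k] k by (intro tnorm_leI) (simp add: mns_def)
      moreover have "0 \<le> tnorm (\<lambda>n. pls A (f k n) (scl A (- 1) (f' n)))" using f f'T by simp
      moreover have "nrm A (pls A (a k) (scl A (- 1) a')) < e" using M[of k] k a a' A.nrm_mns[of "a k" a'] by (simp add: mns_def)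
      ultimately show ?thesis using e by (simp add: Fk)
    qed
    then show "\<exists>no. \<forall>k\<ge>no. norm (nrm B (pls B (F k) (scl B (- 1) (a', f'))) - 0) < e" by blast
  qed
  then show "\<exists>x\<in>carr B. (\<lambda>k. nrm B (pls B (F k) (scl B (- 1) x))) \<longlonglongrightarrow> 0" using a' f'T by force
qed

lemma tnorm_mlt_str:
  assumes f: "f \<in> T" shows "tnorm (\<lambda>n. mlt A (str A (f n)) (f n)) = (tnorm f)\<^sup>2"
proof (rule antisym)
  note [simp] = tail_carr[OF f] tail_ker[OF f]
  show "tnorm (\<lambda>n. mlt A (str A (f n)) (f n)) \<le> (tnorm f)\<^sup>2"
    using f nrm_le_tnorm[OF f] by (intro tnorm_leI) (simp add: A.nrm_str_mlt power_mono)
  have "tnorm f \<le> sqrt (tnorm (\<lambda>n. mlt A (str A (f n)) (f n)))"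
  proof (rule tnorm_leI)
    fix n
    have "(nrm A (f n))\<^sup>2 \<le> tnorm (\<lambda>n. mlt A (str A (f n)) (f n))"
      using nrm_le_tnorm[of "\<lambda>n. mlt A (str A (f n)) (f n)" n] f by (simp add: A.nrm_str_mlt)
    then show "nrm A (f n) \<le> sqrt (tnorm (\<lambda>n. mlt A (str A (f n)) (f n)))" by (rule real_le_rsqrt)
  qed
  moreover have "0 \<le> tnorm (\<lambda>n. mlt A (str A (f n)) (f n))" using f by simp
  ultimately show "(tnorm f)\<^sup>2 \<le> tnorm (\<lambda>n. mlt A (str A (f n)) (f n))"
    using f by (metis power_mono real_sqrt_pow2 tnorm_nonneg)
qed

lemma B_vspace: "vspace (carr B) (zer B) (pls B) (scl B)"
  unfolding vspace_def
proof (intro conjI ballI allI)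
  fix x y w c d assume "x \<in> carr B"
  then obtain a f where x: "x = (a, f)" "a \<in> carr A" "f \<in> T" by auto
  note [simp] = tail_carr[OF x(3)] tail_ker[OF x(3)]
  show "scl B c x \<in> carr B" "pls B (zer B) x = x" "pls B x (scl B (- 1) x) = zer B" "scl B 1 x = x"
    "scl B (c + d) x = pls B (scl B c x) (scl B d x)" "scl B (c * d) x = scl B c (scl B d x)"
    using x by (simp_all add: A.scl_add)
  assume "y \<in> carr B"
  then obtain b g where y: "y = (b, g)" "b \<in> carr A" "g \<in> T" by auto
  note [simp] = tail_carr[OF y(3)] tail_ker[OF y(3)]
  show "pls B x y \<in> carr B" "scl B c (pls B x y) = pls B (scl B c x) (scl B c y)" "pls B x y = pls B y x"
    using x y by (auto simp: A.scl_pls intro!: ext A.pls_comm)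
  assume "w \<in> carr B"
  then obtain e h where w: "w = (e, h)" "e \<in> carr A" "h \<in> T" by auto
  note [simp] = tail_carr[OF w(3)] tail_ker[OF w(3)]
  show "pls B (pls B x y) w = pls B x (pls B y w)" using x y w by (simp add: A.pls_assoc)
qed simp

lemma B_banach: "Defs.banach (carr B) (zer B) (pls B) (scl B) (nrm B)"
  unfolding Defs.banach_def
proof (intro conjI B_vspace B_complete ballI allI)
  fix x y c assume "x \<in> carr B"
  then obtain a f where x: "x = (a, f)" "a \<in> carr A" "f \<in> T" by auto
  note [simp] = tail_carr[OF x(3)] tail_ker[OF x(3)]
  show "0 \<le> nrm B x" using x by (simp add: le_max_iff_disj)
  show "(nrm B x = 0) = (x = zer B)"
  proof
    assume "nrm B x = 0"
    then have 0: "nrm A a \<le> 0" "tnorm f \<le> 0" using x by (simp_all add: max_def split: if_splits)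
    have "nrm A (f n) = 0" for n
      using nrm_le_tnorm[of f n] 0 x by (intro antisym A.nrm_nonneg) simp_all
    moreover have "nrm A a = 0" using 0 x by (intro antisym A.nrm_nonneg) simp_all
    ultimately show "x = zer B" using x by (auto simp: fun_eq_iff)
  qed (use x in simp)
  show "nrm B (scl B c x) = cmod c * nrm B x" using x by (simp add: A.nrm_scl tnorm_scl max_mult_distrib_left)
  assume "y \<in> carr B"
  then obtain b g where y: "y = (b, g)" "b \<in> carr A" "g \<in> T" by auto
  note [simp] = tail_carr[OF y(3)] tail_ker[OF y(3)]
  have "tnorm (\<lambda>n. pls A (f n) (g n)) \<le> tnorm f + tnorm g"
    using x y nrm_le_tnorm by (intro tnorm_leI order_trans[OF A.nrm_pls] add_mono) auto
  then show "nrm B (pls B x y) \<le> nrm B x + nrm B y" using x y A.nrm_pls[of a b] by (auto simp: max_def)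
qed

lemma cstar_B: "cstar_alg B"
  unfolding cstar_alg_def
proof (intro conjI B_banach ballI allI)
  fix x y w c assume "x \<in> carr B"
  then obtain a f where x: "x = (a, f)" "a \<in> carr A" "f \<in> T" by auto
  note [simp] = tail_carr[OF x(3)] tail_ker[OF x(3)]
  show "str B x \<in> carr B" "str B (str B x) = x" "str B (scl B c x) = scl B (cnj c) (str B x)"
    using x by (simp_all add: A.str_scl)
  have "max ((nrm A a)\<^sup>2) ((tnorm f)\<^sup>2) = (max (nrm A a) (tnorm f))\<^sup>2"
    using x by (simp add: max_def power_mono)
  then show "nrm B (mlt B (str B x) x) = (nrm B x)\<^sup>2" using x by (simp add: A.nrm_str_mlt tnorm_mlt_str)
  assume "y \<in> carr B"
  then obtain b g where y: "y = (b, g)" "b \<in> carr A" "g \<in> T" by auto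
  note [simp] = tail_carr[OF y(3)] tail_ker[OF y(3)]
  show "mlt B x y \<in> carr B" "mlt B (scl B c x) y = scl B c (mlt B x y)" "mlt B x (scl B c y) = scl B c (mlt B x y)"
    "str B (pls B x y) = pls B (str B x) (str B y)" "str B (mlt B x y) = mlt B (str B y) (str B x)"
    using x y by (simp_all add: A.mlt_scl_left A.mlt_scl_right A.str_pls A.str_mlt)
  have "tnorm (\<lambda>n. mlt A (f n) (g n)) \<le> tnorm f * tnorm g"
    using x y nrm_le_tnorm by (intro tnorm_leI order_trans[OF A.nrm_mlt] mult_mono) auto
  also have "\<dots> \<le> nrm B x * nrm B y" using x y by (intro mult_mono) (auto simp: le_max_iff_disj)
  finally have "tnorm (\<lambda>n. mlt A (f n) (g n)) \<le> nrm B x * nrm B y" .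
  moreover have "nrm A (mlt A a b) \<le> nrm B x * nrm B y"
    using x y by (intro order_trans[OF A.nrm_mlt] mult_mono) (auto simp: le_max_iff_disj)
  ultimately show "nrm B (mlt B x y) \<le> nrm B x * nrm B y" by (simp add: x(1) y(1))
  assume "w \<in> carr B"
  then obtain d h where w: "w = (d, h)" "d \<in> carr A" "h \<in> T" by auto
  note [simp] = tail_carr[OF w(3)] tail_ker[OF w(3)]
  show "mlt B (mlt B x y) w = mlt B x (mlt B y w)" "mlt B x (pls B y w) = pls B (mlt B x y) (mlt B x w)"
    "mlt B (pls B x y) w = pls B (mlt B x w) (mlt B y w)"
    using x y w by (simp_all add: A.mlt_assoc A.mlt_pls_left A.mlt_pls_right)
qed

lemma precorr_Y: "precorr B Y phiB"
proof
  show "vspace (hcarr Y) (hzer Y) (hpls Y) (hscl Y)"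
    unfolding vspace_def
  proof (intro conjI ballI allI)
    fix x y w c d assume "x \<in> hcarr Y"
    then obtain a f where x: "x = (a, f)" "a \<in> hcarr X" "f \<in> T" by auto
    note [simp] = tail_carr[OF x(3)] tail_ker[OF x(3)]
    show "hscl Y c x \<in> hcarr Y" "hpls Y (hzer Y) x = x" "hpls Y x (hscl Y (- 1) x) = hzer Y" "hscl Y 1 x = x"
      "hscl Y (c + d) x = hpls Y (hscl Y c x) (hscl Y d x)" "hscl Y (c * d) x = hscl Y c (hscl Y d x)"
      using x by (simp_all add: A.scl_add hscl_add hscl_mult)
    assume "y \<in> hcarr Y"
    then obtain b g where y: "y = (b, g)" "b \<in> hcarr X" "g \<in> T" by auto
    note [simp] = tail_carr[OF y(3)] tail_ker[OF y(3)]
    show "hpls Y x y \<in> hcarr Y" "hscl Y c (hpls Y x y) = hpls Y (hscl Y c x) (hscl Y c y)" "hpls Y x y = hpls Y y x"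
      using x y by (auto simp: A.scl_pls hscl_hpls intro!: ext A.pls_comm hpls_comm)
    assume "w \<in> hcarr Y"
    then obtain e h where w: "w = (e, h)" "e \<in> hcarr X" "h \<in> T" by auto
    note [simp] = tail_carr[OF w(3)] tail_ker[OF w(3)]
    show "hpls Y (hpls Y x y) w = hpls Y x (hpls Y y w)" using x y w by (simp add: A.pls_assoc hpls_assoc)
  qed simp
  fix c x y z a b assume "x \<in> hcarr Y"
  then obtain x' f where x: "x = (x', f)" "x' \<in> hcarr X" "f \<in> T" by auto
  note [simp] = tail_carr[OF x(3)] tail_ker[OF x(3)]
  show "Defs.positive B (inr Y x x)"
    using x inr_positive[OF x(2)] unfolding Defs.positive_def by force
  show "x = hzer Y" if "inr Y x x = zer B"
  proof -
    have "mlt A (str A (f n)) (f n) = zer A" for n using that x by (auto simp: fun_eq_iff)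
    then have "nrm A (f n) = 0" for n using A.nrm_str_mlt[of "f n"] x by simp
    then show ?thesis using that x inr_definite[of x'] by (auto simp: fun_eq_iff)
  qed
  show "ract Y x a \<in> hcarr Y" if "a \<in> carr B"
  proof -
    obtain a1 a2 where a: "a = (a1, a2)" "a1 \<in> carr A" "a2 \<in> T" using \<open>a \<in> carr B\<close> by auto
    note [simp] = tail_carr[OF a(3)] tail_ker[OF a(3)]
    show ?thesis using x a by auto
  qed
  show "phiB a x \<in> hcarr Y" if "a \<in> carr B"
  proof -
    obtain a1 a2 where a: "a = (a1, a2)" "a1 \<in> carr A" "a2 \<in> T" using \<open>a \<in> carr B\<close> by auto
    note [simp] = tail_carr[OF a(3)] tail_ker[OF a(3)]
    show ?thesis using x a by auto
  qed
  show "phiB (scl B c a) x = hscl Y c (phiB a x)" if "a \<in> carr B"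
  proof -
    obtain a1 a2 where a: "a = (a1, a2)" "a1 \<in> carr A" "a2 \<in> T" using \<open>a \<in> carr B\<close> by auto
    note [simp] = tail_carr[OF a(3)] tail_ker[OF a(3)]
    show ?thesis using x a by (auto simp: phi_scl A.mlt_scl_left)
  qed
  show "phiB (pls B a b) x = hpls Y (phiB a x) (phiB b x)" if "a \<in> carr B" "b \<in> carr B"
  proof -
    obtain a1 a2 where a: "a = (a1, a2)" "a1 \<in> carr A" "a2 \<in> T" using \<open>a \<in> carr B\<close> by auto
    obtain b1 b2 where b: "b = (b1, b2)" "b1 \<in> carr A" "b2 \<in> T" using \<open>b \<in> carr B\<close> by auto
    note [simp] = tail_carr[OF a(3)] tail_ker[OF a(3)]
    note [simp] = tail_carr[OF b(3)] tail_ker[OF b(3)]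
    show ?thesis using x a b by (auto simp: phi_pls A.mlt_pls_left)
  qed
  show "phiB (mlt B a b) x = phiB a (phiB b x)" if "a \<in> carr B" "b \<in> carr B"
  proof -
    obtain a1 a2 where a: "a = (a1, a2)" "a1 \<in> carr A" "a2 \<in> T" using \<open>a \<in> carr B\<close> by auto
    obtain b1 b2 where b: "b = (b1, b2)" "b1 \<in> carr A" "b2 \<in> T" using \<open>b \<in> carr B\<close> by auto
    note [simp] = tail_carr[OF a(3)] tail_ker[OF a(3)]
    note [simp] = tail_carr[OF b(3)] tail_ker[OF b(3)]
    show ?thesis using x a b by (auto simp: phi_mlt A.mlt_assoc)
  qed
  assume "y \<in> hcarr Y"
  then obtain y' g where y: "y = (y', g)" "y' \<in> hcarr X" "g \<in> T" by auto
  note [simp] = tail_carr[OF y(3)] tail_ker[OF y(3)]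
  show "inr Y x y \<in> carr B" "inr Y x (hscl Y c y) = scl B c (inr Y x y)" "str B (inr Y x y) = inr Y y x"
    using x y by (simp_all add: inr_hscl A.mlt_scl_right str_inr A.str_mlt)
  show "inr Y x (ract Y y a) = mlt B (inr Y x y) a" if "a \<in> carr B"
  proof -
    obtain a1 a2 where a: "a = (a1, a2)" "a1 \<in> carr A" "a2 \<in> T" using \<open>a \<in> carr B\<close> by auto
    note [simp] = tail_carr[OF a(3)] tail_ker[OF a(3)]
    show ?thesis using x y a by (auto simp: inr_ract A.mlt_assoc)
  qed
  show "phiB a (hpls Y x y) = hpls Y (phiB a x) (phiB a y)" if "a \<in> carr B"
  proof -
    obtain a1 a2 where a: "a = (a1, a2)" "a1 \<in> carr A" "a2 \<in> T" using \<open>a \<in> carr B\<close> by auto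
    note [simp] = tail_carr[OF a(3)] tail_ker[OF a(3)]
    show ?thesis using x y a by (auto simp: phi_hpls A.mlt_pls_right)
  qed
  show "inr Y (phiB a x) y = inr Y x (phiB (str B a) y)" if "a \<in> carr B"
  proof -
    obtain a1 a2 where a: "a = (a1, a2)" "a1 \<in> carr A" "a2 \<in> T" using \<open>a \<in> carr B\<close> by auto
    note [simp] = tail_carr[OF a(3)] tail_ker[OF a(3)]
    show ?thesis using x y a by (auto simp: inr_phi A.str_mlt A.mlt_assoc)
  qed
  assume "z \<in> hcarr Y"
  then obtain z' h where z: "z = (z', h)" "z' \<in> hcarr X" "h \<in> T" by auto
  note [simp] = tail_carr[OF z(3)] tail_ker[OF z(3)]
  show "inr Y x (hpls Y y z) = pls B (inr Y x y) (inr Y x z)"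
    using x y z by (simp add: inr_hpls A.mlt_pls_right)
qed (rule cstar_B)

lemma hnorm_Y:
  assumes x: "x \<in> hcarr X" and f: "f \<in> T"
  shows "hnorm B Y (x, f) = max (hnorm A X x) (tnorm f)"
proof -
  have sqrt_max: "sqrt (max a b) = max (sqrt a) (sqrt b)" for a b by (simp add: max_def)
  have "hnorm B Y (x, f) = sqrt (max (nrm A (inr X x x)) ((tnorm f)\<^sup>2))"
    using f by (simp add: hnorm_def tnorm_mlt_str)
  also have "\<dots> = max (sqrt (nrm A (inr X x x))) (sqrt ((tnorm f)\<^sup>2))" by (rule sqrt_max)
  finally show ?thesis using f by (simp add: hnorm_def)
qed

section \<open>Finite-rank operators on Y, coordinate by coordinate\<close>

definition single :: "nat \<Rightarrow> 'a \<Rightarrow> nat \<Rightarrow> 'a" where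
  "single i g = (\<lambda>n. if n = i then g else zer A)"

lemma single_T [simp]: "g \<in> I \<Longrightarrow> single i g \<in> T"
proof -
  assume g: "g \<in> I"
  have "(\<lambda>n. nrm A (single i g n)) \<longlonglongrightarrow> 0"
    by (rule tendsto_eventually, rule eventually_sequentiallyI[of "Suc i"]) (simp add: single_def)
  then show ?thesis using g by (auto simp: tailset_def single_def)
qed

lemma tnorm_single: "g \<in> I \<Longrightarrow> tnorm (single i g) = nrm A g"
  using nrm_le_tnorm[OF single_T, of g i i] ker_carr
  by (intro antisym tnorm_leI) (auto simp: single_def)

text \<open>Ranks are invisible on the tail: on coordinate \<open>n\<close> a finite sum of rank-one
  operators of Y acts as left multiplication by this one element of the kernel.\<close>

definition csum :: "(('x \<times> (nat \<Rightarrow> 'a)) \<times> ('x \<times> (nat \<Rightarrow> 'a))) list \<Rightarrow> nat \<Rightarrow> 'a" where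
  "csum l n = foldr (\<lambda>((\<xi>, g), (\<eta>, h)) acc. pls A (mlt A (g n) (str A (h n))) acc) l (zer A)"

definition xlist :: "(('x \<times> (nat \<Rightarrow> 'a)) \<times> ('x \<times> (nat \<Rightarrow> 'a))) list \<Rightarrow> ('x \<times> 'x) list" where
  "xlist l = map (\<lambda>((\<xi>, g), (\<eta>, h)). (\<xi>, \<eta>)) l"

lemma csum_Nil [simp]: "csum [] n = zer A"
  and csum_Cons [simp]: "csum (((\<xi>, g), (\<eta>, h)) # l) n = pls A (mlt A (g n) (str A (h n))) (csum l n)"
  by (simp_all add: csum_def)

lemma xlist_Nil [simp]: "xlist [] = []"
  and xlist_Cons [simp]: "xlist (((\<xi>, g), (\<eta>, h)) # l) = (\<xi>, \<eta>) # xlist l"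
  by (simp_all add: xlist_def)

lemma thsum_Nil [simp]: "thsum X [] z = hzer X"
  and thsum_Cons [simp]: "thsum X ((\<xi>, \<eta>) # l) z = hpls X (ract X \<xi> (inr X \<eta> z)) (thsum X l z)"
  by (simp_all add: thsum_def)

lemma csum_T: "set l \<subseteq> hcarr Y \<times> hcarr Y \<Longrightarrow> csum l \<in> T"
proof (induction l)
  case Nil
  have "csum [] = (\<lambda>n. zer A)" by (simp add: fun_eq_iff)
  then show ?case by simp
next
  case (Cons p l)
  obtain \<xi> g \<eta> h where p: "p = ((\<xi>, g), (\<eta>, h))" by (metis prod.exhaust)
  have gh: "g \<in> T" "h \<in> T" "csum l \<in> T" using Cons p by auto
  have "csum (p # l) = (\<lambda>n. pls A (mlt A (g n) (str A (h n))) (csum l n))" by (auto simp: csum_def p)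
  then show ?case using gh by simp
qed

lemma xlist_carr: "set l \<subseteq> hcarr Y \<times> hcarr Y \<Longrightarrow> set (xlist l) \<subseteq> hcarr X \<times> hcarr X"
  unfolding xlist_def by force

lemma thsum_Y:
  assumes "set l \<subseteq> hcarr Y \<times> hcarr Y" "x \<in> hcarr X" "w \<in> T"
  shows "thsum Y l (x, w) = (thsum X (xlist l) x, \<lambda>n. mlt A (csum l n) (w n))"
  using assms(1)
proof (induction l)
  case Nil then show ?case using tail_carr[OF assms(3)] by (simp add: thsum_def)
next
  case (Cons p l)
  obtain \<xi> g \<eta> h where p: "p = ((\<xi>, g), (\<eta>, h))" by (metis prod.exhaust)
  have gh: "g \<in> T" "h \<in> T" "csum l \<in> T" using Cons.prems p csum_T[of l] by auto
  note [simp] = gh[THEN tail_carr] tail_carr[OF assms(3)]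
  have "thsum Y (p # l) (x, w) = hpls Y (ract Y (\<xi>, g) (inr Y (\<eta>, h) (x, w))) (thsum Y l (x, w))"
    by (simp add: thsum_def p)
  then show ?case using Cons gh assms by (simp add: p A.mlt_pls_left A.mlt_assoc)
qed

text \<open>The left action of (a, f) multiplies coordinate \<open>n\<close> by this element. It
  runs one place behind \<open>f\<close>, since coordinate 0 is acted on by the head
  \<open>a\<close>.\<close>

definition coef :: "'a \<Rightarrow> (nat \<Rightarrow> 'a) \<Rightarrow> nat \<Rightarrow> 'a" where
  "coef a f n = (if n = 0 then a else f (n - 1))"

interpretation Yc: precorr B Y phiB by (rule precorr_Y)

lemma defect_Y:
  assumes a: "a \<in> carr A" "f \<in> T" and l: "set l \<subseteq> hcarr Y \<times> hcarr Y" and x: "x \<in> hcarr X" "w \<in> T"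
  shows "Yc.defect (a, f) l (x, w) = (defect a (xlist l) x, \<lambda>n. mlt A (mns A (coef a f n) (csum l n)) (w n))"
  using a x csum_T[OF l] a(2)[THEN tail_carr] x(2)[THEN tail_carr] csum_T[OF l, THEN tail_carr]
  by (auto simp: Yc.defect_def defect_def thsum_Y[OF l x] coef_def mns_def A.mlt_pls_left A.mlt_scl_left)

text \<open>The norm of Y is the maximum over the components, so test vectors (x, 0) and (0,
  \<open>single n g\<close>) isolate the X-part and coordinate \<open>n\<close>. The multiplier at
  \<open>n\<close> is seen only through its products with kernel elements.\<close>

lemma defect_Y_bound:
  assumes a: "a \<in> carr A" "f \<in> T" and l: "set l \<subseteq> hcarr Y \<times> hcarr Y"
  shows "opnorm A X (defect a (xlist l)) \<le> opnorm B Y (Yc.defect (a, f) l)"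
    and "g \<in> I \<Longrightarrow> nrm A (mlt A (mns A (coef a f n) (csum l n)) g) \<le> opnorm B Y (Yc.defect (a, f) l) * nrm A g"
proof -
  have c: "mns A (coef a f n) (csum l n) \<in> carr A" for n
    using a csum_T[OF l] by (simp add: coef_def tail_carr)
  have T: "(\<lambda>n. mlt A (mns A (coef a f n) (csum l n)) (w n)) \<in> T" if "w \<in> T" for w
  proof -
    have "phiB (a, f) (hzer X, w) \<in> hcarr Y" "thsum Y l (hzer X, w) \<in> hcarr Y"
      using a that by (simp, intro Yc.thsum_carr l) (use that in simp)
    then have "Yc.defect (a, f) l (hzer X, w) \<in> hcarr Y" by (simp only: Yc.defect_def Yc.hpls_carr Yc.hscl_carr)
    then show ?thesis using that by (simp add: defect_Y[OF a l])
  qed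
  have X: "hnorm A X (defect a (xlist l) x) \<le> opnorm B Y (Yc.defect (a, f) l)
    \<and> (\<forall>n. nrm A (mlt A (mns A (coef a f n) (csum l n)) (w n)) \<le> opnorm B Y (Yc.defect (a, f) l))"
    if x: "x \<in> hcarr X" "w \<in> T" "hnorm A X x \<le> 1" "tnorm w \<le> 1" for x w
  proof -
    have dc: "defect a (xlist l) x \<in> hcarr X" using a x xlist_carr[OF l] by (simp add: defect_def)
    have "max (hnorm A X (defect a (xlist l) x)) (tnorm (\<lambda>n. mlt A (mns A (coef a f n) (csum l n)) (w n))) \<le> opnorm B Y (Yc.defect (a, f) l)"
      using Yc.defect_le_opnorm[of "(a, f)" l "(x, w)"] a l x dc T[OF x(2)] by (simp add: defect_Y[OF a l] hnorm_Y)
    then show ?thesis using nrm_le_tnorm[OF T[OF x(2)]] by (meson max.boundedE order_trans)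
  qed
  show "opnorm A X (defect a (xlist l)) \<le> opnorm B Y (Yc.defect (a, f) l)"
    using X[of _ "\<lambda>n. zer A"] by (intro opnorm_le) simp
  assume g: "g \<in> I"
  show "nrm A (mlt A (mns A (coef a f n) (csum l n)) g) \<le> opnorm B Y (Yc.defect (a, f) l) * nrm A g"
  proof (cases "g = zer A")
    case True then show ?thesis using c by simp
  next
    case False
    have gc: "g \<in> carr A" using g ker_carr by blast
    then have ng: "nrm A g > 0" using False by (simp add: less_le)
    let ?w = "single n (scl A (complex_of_real (1 / nrm A g)) g)"
    have "nrm A (mlt A (mns A (coef a f n) (csum l n)) (?w n)) \<le> opnorm B Y (Yc.defect (a, f) l)"
      using X[of "hzer X" ?w] g gc ng by (simp add: tnorm_single A.nrm_scl norm_divide)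
    then show ?thesis using ng gc c by (simp add: single_def A.mlt_scl_right A.nrm_scl norm_divide field_simps)
  qed
qed

text \<open>From coordinate 1 on the difference of the multipliers lies in the kernel and can be
  tested on its own adjoint, which gives its norm. At coordinate 0 this fails because the head
  \<open>a\<close> need not lie in the kernel.\<close>

lemma csum_bound:
  assumes a: "a \<in> carr A" "f \<in> T" and l: "set l \<subseteq> hcarr Y \<times> hcarr Y"
  shows "nrm A (mns A (f n) (csum l (Suc n))) \<le> opnorm B Y (Yc.defect (a, f) l)"
proof (cases "mns A (f n) (csum l (Suc n)) = zer A")
  case True then show ?thesis using Yc.opnorm_defect_nonneg[of "(a, f)" l] a l by simp
next
  case False
  let ?k = "mns A (f n) (csum l (Suc n))"
  have k: "?k \<in> I" using a csum_T[OF l] by (simp add: tail_ker)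
  then have kc: "?k \<in> carr A" using ker_carr by blast
  have "nrm A (mlt A ?k (str A ?k)) \<le> opnorm B Y (Yc.defect (a, f) l) * nrm A (str A ?k)"
    using defect_Y_bound(2)[OF a l, of "str A ?k" "Suc n"] k by (simp add: coef_def)
  moreover have "nrm A (mlt A ?k (str A ?k)) = nrm A ?k * nrm A ?k" using A.nrm_str_mlt[of "str A ?k"] kc by (simp add: power2_eq_square)
  moreover have "0 < nrm A ?k" using kc False by (simp add: less_le)
  ultimately show ?thesis using kc by simp
qed

end

section \<open>Finite sums of products and square-summable sequences\<close>

lemma Pos_sum: "(\<And>i. i \<in> F \<Longrightarrow> Pos (f i)) \<Longrightarrow> Pos (\<Sum>i\<in>F. f i)"
  by (induction F rule: infinite_finite_induct) (auto intro: Pos_add)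

lemma Pos_suminf:
  assumes "summable f" "\<And>i. Pos (f i)" shows "Pos (suminf f)"
  by (rule Pos_lim[OF summable_LIMSEQ[OF assms(1)]]) (simp add: Pos_sum assms(2))

definition psum :: "(nat \<Rightarrow> 'o::cst1) \<Rightarrow> (nat \<Rightarrow> 'o) \<Rightarrow> nat set \<Rightarrow> 'o" where
  "psum x y F = (\<Sum>i\<in>F. st (x i) * y i)"

definition psn :: "(nat \<Rightarrow> 'o::cst1) \<Rightarrow> nat set \<Rightarrow> real" where
  "psn x F = sqrt (norm (psum x x F))"

lemma psn_nonneg [simp]: "0 \<le> psn x F"
  by (simp add: psn_def)

lemma psn_sq: "(psn x F)\<^sup>2 = norm (psum x x F)"
  by (simp add: psn_def)

lemma st_sum [simp]: "st (\<Sum>i\<in>F. f i) = (\<Sum>i\<in>F. st (f i :: 'o::cst1))"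
  by (induction F rule: infinite_finite_induct) auto

lemma st_psum: "st (psum x y F) = psum y x F"
  by (simp add: psum_def)

lemma Pos_psum: "Pos (psum x x F)"
  by (simp add: psum_def Pos_sum Pos_st_mult)

lemma psum_Cauchy_Schwarz: "norm (psum x y F) \<le> psn x F * psn y F" for x y :: "nat \<Rightarrow> 'o::cst1"
proof -
  have "(norm (psum x y F))\<^sup>2 \<le> norm (psum x x F) * norm (psum y y F)"
  proof (rule Cauchy_Schwarz_Pos[OF Pos_psum])
    fix s :: real
    define r where "r = psum x y F"
    define w where "w i = y i - s *\<^sub>R (x i * r)" for i
    have "st (w i) * w i = st (y i) * y i - s *\<^sub>R (st (y i) * x i * r) - s *\<^sub>R (st r * (st (x i) * y i))
        + (s * s) *\<^sub>R (st r * (st (x i) * x i) * r)" for i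
      by (simp add: w_def algebra_simps)
    then have "psum w w F = psum y y F - s *\<^sub>R (psum y x F * r) - s *\<^sub>R (st r * psum x y F) + (s * s) *\<^sub>R (st r * psum x x F * r)"
      by (simp add: psum_def sum.distrib sum_subtractf scaleR_sum_right sum_distrib_left sum_distrib_right)
    also have "psum y x F = st r" by (simp add: r_def st_psum)
    finally have "psum w w F = psum y y F - (2 * s) *\<^sub>R (st r * r) + (s * s) *\<^sub>R (st r * psum x x F * r)"
      unfolding r_def[symmetric] using scaleR_2[of "s *\<^sub>R (st r * r)"] by (simp add: algebra_simps)
    then show "Pos (psum y y F - (2 * s) *\<^sub>R (st (psum x y F) * psum x y F) + (s * s) *\<^sub>R (st (psum x y F) * psum x x F * psum x y F))"
      using Pos_psum[of w F] unfolding r_def[symmetric] by simp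
  qed
  also have "\<dots> = (psn x F * psn y F)\<^sup>2" by (simp add: psn_sq power_mult_distrib)
  finally show ?thesis by (rule power2_le_imp_le) simp
qed

lemma psum_add: "psum (\<lambda>i. x i + y i) (\<lambda>i. x i + y i) F = psum x x F + psum x y F + psum y x F + psum y y F"
  by (simp add: psum_def sum.distrib algebra_simps)

lemma psn_triangle: "psn (\<lambda>i. x i + y i) F \<le> psn x F + psn y F"
proof (rule power2_le_imp_le)
  have "(psn (\<lambda>i. x i + y i) F)\<^sup>2 = norm (psum x x F + psum x y F + psum y x F + psum y y F)"
    by (simp add: psn_sq psum_add)
  also have "\<dots> \<le> norm (psum x x F) + norm (psum x y F) + norm (psum y x F) + norm (psum y y F)"
    by (intro order_trans[OF norm_triangle_ineq] add_mono order_refl)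
  also have "\<dots> \<le> (psn x F + psn y F)\<^sup>2"
    using psum_Cauchy_Schwarz[of x y F] psum_Cauchy_Schwarz[of y x F] by (simp add: psn_sq[symmetric] power2_eq_square algebra_simps)
  finally show "(psn (\<lambda>i. x i + y i) F)\<^sup>2 \<le> (psn x F + psn y F)\<^sup>2" .
qed simp

lemma psn_mono:
  assumes "finite G" "F \<subseteq> G" shows "psn x F \<le> psn x G"
proof -
  have "psum x x G = psum x x F + psum x x (G - F)"
    unfolding psum_def using sum.subset_diff[OF assms(2,1)] by (metis add.commute)
  then show ?thesis using norm_mono[OF Pos_psum Pos_psum, of x F x "G - F"] by (simp add: psn_def)
qed

lemma norm_le_psn: "finite F \<Longrightarrow> i \<in> F \<Longrightarrow> norm (x i) \<le> psn x F"
  using psn_mono[of F "{i}" x] by (simp add: psn_def psum_def norm_st_mult)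

text \<open>The comparison is made in the order: K^2 minus
  \<open>st (\<alpha> i) * \<alpha> i\<close> is positive, and conjugation by \<open>x i\<close>
  keeps it so. Norm bounds for single terms would not control the norm of the sum.\<close>

lemma psn_diag:
  assumes K: "\<And>i. norm (\<alpha> i) \<le> K" "0 \<le> K"
  shows "psn (\<lambda>i. \<alpha> i * x i) F \<le> K * psn x F"
proof -
  have "Pos (\<Sum>i\<in>F. (K * K) *\<^sub>R (st (x i) * x i) - st (\<alpha> i * x i) * (\<alpha> i * x i))"
  proof (rule Pos_sum)
    fix i
    have "Pos ((K * K) *\<^sub>R 1 - st (\<alpha> i) * \<alpha> i)"
      by (rule Pos_diff_scaleR_one) (use K in \<open>simp_all add: norm_st_mult power2_eq_square mult_mono\<close>)
    from Pos_conj[OF this, of "x i"]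
    show "Pos ((K * K) *\<^sub>R (st (x i) * x i) - st (\<alpha> i * x i) * (\<alpha> i * x i))" by (simp add: algebra_simps)
  qed
  then have "Pos ((K * K) *\<^sub>R psum x x F - psum (\<lambda>i. \<alpha> i * x i) (\<lambda>i. \<alpha> i * x i) F)"
    by (simp add: psum_def sum_subtractf scaleR_sum_right)
  from norm_mono[OF Pos_psum[of "\<lambda>i. \<alpha> i * x i" F] this] have "norm (psum (\<lambda>i. \<alpha> i * x i) (\<lambda>i. \<alpha> i * x i) F) \<le> K * K * norm (psum x x F)"
    by simp
  then have "(psn (\<lambda>i. \<alpha> i * x i) F)\<^sup>2 \<le> (K * psn x F)\<^sup>2"
    by (simp add: psn_sq power_mult_distrib) (simp add: power2_eq_square)
  then show ?thesis by (rule power2_le_imp_le) (use K in simp)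
qed

text \<open>The series has to converge in norm; bounded partial sums would be a weaker condition
  when the coefficients are not scalars.\<close>

definition is_l2 :: "(nat \<Rightarrow> 'o::cst1) \<Rightarrow> bool" where
  "is_l2 x \<longleftrightarrow> summable (\<lambda>i. st (x i) * x i)"

lemma is_l2_iff: "is_l2 x \<longleftrightarrow> (\<forall>e>0. \<exists>N. \<forall>m\<ge>N. \<forall>n. psn x {m..<n} < e)"
proof
  assume x: "is_l2 x"
  show "\<forall>e>0. \<exists>N. \<forall>m\<ge>N. \<forall>n. psn x {m..<n} < e"
  proof (intro allI impI)
    fix e :: real assume e: "e > 0"
    then obtain N where "\<forall>m\<ge>N. \<forall>n. norm (\<Sum>i=m..<n. st (x i) * x i) < e\<^sup>2"
      using x unfolding is_l2_def summable_Cauchy by (metis zero_less_power)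
    then have "\<forall>m\<ge>N. \<forall>n. (psn x {m..<n})\<^sup>2 < e\<^sup>2" by (simp add: psn_sq psum_def)
    then show "\<exists>N. \<forall>m\<ge>N. \<forall>n. psn x {m..<n} < e" using e by (meson less_imp_le power2_less_imp_less)
  qed
next
  assume x: "\<forall>e>0. \<exists>N. \<forall>m\<ge>N. \<forall>n. psn x {m..<n} < e"
  show "is_l2 x" unfolding is_l2_def summable_Cauchy
  proof (intro allI impI)
    fix e :: real assume e: "e > 0"
    then obtain N where "\<forall>m\<ge>N. \<forall>n. psn x {m..<n} < sqrt e" using x by (metis real_sqrt_gt_zero)
    then have "\<forall>m\<ge>N. \<forall>n. (psn x {m..<n})\<^sup>2 < (sqrt e)\<^sup>2" by (simp add: power_strict_mono)
    then show "\<exists>N. \<forall>m\<ge>N. \<forall>n. norm (\<Sum>i=m..<n. st (x i) * x i) < e" using e by (auto simp: psn_sq psum_def)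
  qed
qed

lemma is_l2_le:
  assumes x: "is_l2 x" and y: "\<And>F. psn y F \<le> K * psn x F"
  shows "is_l2 y"
  unfolding is_l2_iff
proof (intro allI impI)
  fix e :: real assume e: "e > 0"
  then obtain N where N: "\<forall>m\<ge>N. \<forall>n. psn x {m..<n} < e / (\<bar>K\<bar> + 1)" using x unfolding is_l2_iff by (metis abs_ge_zero add_nonneg_pos divide_pos_pos zero_less_one)
  have "psn y {m..<n} < e" if "m \<ge> N" for m n
  proof -
    have "psn y {m..<n} \<le> (\<bar>K\<bar> + 1) * psn x {m..<n}"
      by (rule order_trans[OF y mult_right_mono]) simp_all
    also have "\<dots> < (\<bar>K\<bar> + 1) * (e / (\<bar>K\<bar> + 1))" using N that by (intro mult_strict_left_mono) auto
    finally show ?thesis by simp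
  qed
  then show "\<exists>N. \<forall>m\<ge>N. \<forall>n. psn y {m..<n} < e" by blast
qed

lemma is_l2_add:
  assumes x: "is_l2 x" and y: "is_l2 y" shows "is_l2 (\<lambda>i. x i + y i)"
  unfolding is_l2_iff
proof (intro allI impI)
  fix e :: real assume e: "e > 0"
  then obtain N M where N: "\<forall>m\<ge>N. \<forall>n. psn x {m..<n} < e / 2" and M: "\<forall>m\<ge>M. \<forall>n. psn y {m..<n} < e / 2"
    using x y unfolding is_l2_iff by (metis half_gt_zero)
  have "psn (\<lambda>i. x i + y i) {m..<n} < e" if "m \<ge> max N M" for m n
  proof -
    have "psn x {m..<n} < e / 2" "psn y {m..<n} < e / 2" using N M that by auto
    then show ?thesis using psn_triangle[of x y "{m..<n}"] by linarith
  qed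
  then show "\<exists>N. \<forall>m\<ge>N. \<forall>n. psn (\<lambda>i. x i + y i) {m..<n} < e" by blast
qed

lemma is_l2_diag:
  assumes x: "is_l2 x" and K: "\<And>i. norm (\<alpha> i) \<le> K" shows "is_l2 (\<lambda>i. \<alpha> i * x i)"
  by (rule is_l2_le[OF x psn_diag[OF K order_trans[OF norm_ge_zero K]]])

lemma is_l2_scaleR: "is_l2 x \<Longrightarrow> is_l2 (\<lambda>i. r *\<^sub>R x i)"
  using is_l2_diag[of x "\<lambda>i. r *\<^sub>R 1" "\<bar>r\<bar>"] norm_scaleR_one_le[of r] by simp

lemma is_l2_zero: "is_l2 (\<lambda>i. 0)"
  by (simp add: is_l2_def)

lemma is_l2_uminus: "is_l2 x \<Longrightarrow> is_l2 (\<lambda>i. - x i)"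
  using is_l2_scaleR[of x "-1"] by simp

lemma is_l2_diff: "is_l2 x \<Longrightarrow> is_l2 y \<Longrightarrow> is_l2 (\<lambda>i. x i - y i)"
  using is_l2_add[OF _ is_l2_uminus, of x y] by simp

lemma summable_ip:
  assumes x: "is_l2 x" and y: "is_l2 y" shows "summable (\<lambda>i. st (x i) * y i)"
  unfolding summable_Cauchy
proof (intro allI impI)
  fix e :: real assume e: "e > 0"
  then obtain N M where N: "\<forall>m\<ge>N. \<forall>n. psn x {m..<n} < e" and M: "\<forall>m\<ge>M. \<forall>n. psn y {m..<n} < 1"
    using x y unfolding is_l2_iff by (metis zero_less_one)
  have "norm (\<Sum>i=m..<n. st (x i) * y i) < e" if "m \<ge> max N M" for m n
  proof -
    have "psn x {m..<n} < e" "psn y {m..<n} < 1" using N M that by auto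
    then have "psn x {m..<n} * psn y {m..<n} < e * 1"
      using e by (intro mult_strict_mono') auto
    then show ?thesis using psum_Cauchy_Schwarz[of x y "{m..<n}"] by (simp add: psum_def)
  qed
  then show "\<exists>N. \<forall>m\<ge>N. \<forall>n. norm (\<Sum>i=m..<n. st (x i) * y i) < e" by blast
qed

section \<open>The module of square-summable sequences\<close>

typedef (overloaded) 'o ell2 = "{x :: nat \<Rightarrow> 'o::cst1. is_l2 x}"
  using is_l2_zero by blast

setup_lifting type_definition_ell2

lemma l2_Rep [simp]: "is_l2 (Rep_ell2 x)"
  using Rep_ell2 by auto

instantiation ell2 :: (cst1) real_vector
begin

lift_definition zero_ell2 :: "'a ell2" is "\<lambda>i. 0" by (rule is_l2_zero)
lift_definition plus_ell2 :: "'a ell2 \<Rightarrow> 'a ell2 \<Rightarrow> 'a ell2" is "\<lambda>x y i. x i + y i" by (rule is_l2_add)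
lift_definition minus_ell2 :: "'a ell2 \<Rightarrow> 'a ell2 \<Rightarrow> 'a ell2" is "\<lambda>x y i. x i - y i" by (rule is_l2_diff)
lift_definition uminus_ell2 :: "'a ell2 \<Rightarrow> 'a ell2" is "\<lambda>x i. - x i" by (rule is_l2_uminus)
lift_definition scaleR_ell2 :: "real \<Rightarrow> 'a ell2 \<Rightarrow> 'a ell2" is "\<lambda>r x i. r *\<^sub>R x i" by (rule is_l2_scaleR)

instance
  by standard (transfer, simp add: algebra_simps)+

end

definition lip :: "'o::cst1 ell2 \<Rightarrow> 'o ell2 \<Rightarrow> 'o" where
  "lip x y = (\<Sum>i. st (Rep_ell2 x i) * Rep_ell2 y i)"

lemma lip_sums: "(\<lambda>i. st (Rep_ell2 x i) * Rep_ell2 y i) sums lip x y"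
  unfolding lip_def by (intro summable_sums summable_ip) auto

lemma lip_LIMSEQ: "(\<lambda>n. psum (Rep_ell2 x) (Rep_ell2 y) {..<n}) \<longlonglongrightarrow> lip x y"
  using lip_sums unfolding sums_def psum_def .

lemma lip_add_right: "lip x (y + z) = lip x y + lip x z"
  by (rule sums_unique2[OF lip_sums]) (use sums_add[OF lip_sums lip_sums, of x y x z] in \<open>simp add: plus_ell2.rep_eq algebra_simps\<close>)

lemma lip_scaleR_right: "lip x (r *\<^sub>R y) = r *\<^sub>R lip x y"
  by (rule sums_unique2[OF lip_sums]) (use sums_scaleR_right[OF lip_sums, of r x y] in \<open>simp add: scaleR_ell2.rep_eq\<close>)

lemma st_lip: "st (lip x y) = lip y x"
  by (rule sums_unique2[OF _ lip_sums]) (use bounded_linear.sums[OF bounded_linear_st lip_sums, of x y] in simp)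

instantiation ell2 :: (cst1) real_normed_vector
begin

definition norm_ell2 :: "'a ell2 \<Rightarrow> real" where "norm_ell2 x = sqrt (norm (lip x x))"
definition dist_ell2 :: "'a ell2 \<Rightarrow> 'a ell2 \<Rightarrow> real" where "dist_ell2 F G = norm (F - G)"
definition sgn_ell2 :: "'a ell2 \<Rightarrow> 'a ell2" where "sgn_ell2 F = F /\<^sub>R norm F"
definition uniformity_ell2 :: "('a ell2 \<times> 'a ell2) filter" where
  "uniformity_ell2 = (INF e\<in>{0<..}. principal {(x, y). dist x y < e})"
definition open_ell2 :: "'a ell2 set \<Rightarrow> bool" where
  "open_ell2 U = (\<forall>x\<in>U. eventually (\<lambda>(x', y). x' = x \<longrightarrow> y \<in> U) uniformity)"

lemma psn_tendsto: "(\<lambda>n. psn (Rep_ell2 x) {..<n}) \<longlonglongrightarrow> norm x"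
  unfolding psn_def norm_ell2_def by (intro tendsto_intros lip_LIMSEQ)

lemma psn_le_norm: "psn (Rep_ell2 x) {..<n} \<le> norm x"
  by (rule LIMSEQ_le_const[OF psn_tendsto]) (meson psn_mono finite_lessThan lessThan_subset_iff)

lemma norm_coord_le: "norm (Rep_ell2 x i) \<le> norm x"
  using norm_le_psn[of "{..<Suc i}" i "Rep_ell2 x"] psn_le_norm[of x "Suc i"] by simp

lemma norm_ell2_leI: "(\<And>n. psn (Rep_ell2 x) {..<n} \<le> r) \<Longrightarrow> norm x \<le> r"
  by (rule LIMSEQ_le_const2[OF psn_tendsto]) auto

instance
proof
  fix F G :: "'a ell2" and r :: real
  have nn: "0 \<le> norm F" for F :: "'a ell2" by (simp add: norm_ell2_def)
  show "(norm F = 0) = (F = 0)"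
  proof
    assume "norm F = 0"
    then have "Rep_ell2 F i = 0" for i using norm_coord_le[of F i] by simp
    then show "F = 0" by (simp add: zero_ell2.rep_eq fun_eq_iff flip: Rep_ell2_inject)
  next
    assume "F = 0" then show "norm F = 0" by (simp add: norm_ell2_def lip_def zero_ell2.rep_eq)
  qed
  show "norm (F + G) \<le> norm F + norm G"
  proof (rule norm_ell2_leI)
    show "psn (Rep_ell2 (F + G)) {..<n} \<le> norm F + norm G" for n
      unfolding plus_ell2.rep_eq by (rule order_trans[OF psn_triangle add_mono[OF psn_le_norm psn_le_norm]])
  qed
  have "lip (r *\<^sub>R F) (r *\<^sub>R F) = (r * r) *\<^sub>R lip F F"
    by (metis lip_scaleR_right st_lip st_scaleR scaleR_scaleR)
  then show "norm (r *\<^sub>R F) = \<bar>r\<bar> * norm F"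
    by (simp add: norm_ell2_def real_sqrt_mult abs_mult)
qed (simp_all add: dist_ell2_def sgn_ell2_def uniformity_ell2_def open_ell2_def)

end

lemma norm_lip: "norm (lip x y) \<le> norm x * norm y"
proof (rule LIMSEQ_le)
  show "(\<lambda>n. norm (psum (Rep_ell2 x) (Rep_ell2 y) {..<n})) \<longlonglongrightarrow> norm (lip x y)"
    by (intro tendsto_intros lip_LIMSEQ)
  show "(\<lambda>n. psn (Rep_ell2 x) {..<n} * psn (Rep_ell2 y) {..<n}) \<longlonglongrightarrow> norm x * norm y"
    by (intro tendsto_intros psn_tendsto)
qed (use psum_Cauchy_Schwarz in blast)

lemma psn_le_norm_finite: "finite F \<Longrightarrow> psn (Rep_ell2 x) F \<le> norm x"
  by (metis finite_nat_bounded order_trans psn_le_norm psn_mono finite_lessThan)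

instance ell2 :: (cst1) banach
proof
  fix X :: "nat \<Rightarrow> 'a ell2" assume X: "Cauchy X"
  have "\<exists>l. (\<lambda>n. Rep_ell2 (X n) i) \<longlonglongrightarrow> l" for i
  proof -
    have "Cauchy (\<lambda>n. Rep_ell2 (X n) i)"
    proof (rule CauchyI)
      fix e :: real assume "e > 0"
      then obtain N where "\<forall>m\<ge>N. \<forall>n\<ge>N. norm (X m - X n) < e" using X by (meson CauchyD)
      then show "\<exists>N. \<forall>m\<ge>N. \<forall>n\<ge>N. norm (Rep_ell2 (X m) i - Rep_ell2 (X n) i) < e"
        using norm_coord_le[of "X _ - X _" i] by (metis minus_ell2.rep_eq le_less_trans)
    qed
    then show ?thesis using Cauchy_convergent convergent_def by metis
  qed
  then obtain L where L: "\<And>i. (\<lambda>n. Rep_ell2 (X n) i) \<longlonglongrightarrow> L i" by metis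
  \<comment> \<open>Estimates over finite index sets survive the coordinatewise limit with a bound
    independent of \<open>F\<close>; this gives square summability of \<open>L\<close> as well as
    convergence in norm.\<close>
  have bound: "psn (\<lambda>i. Rep_ell2 (X m) i - L i) F \<le> e"
    if "\<forall>n\<ge>m. norm (X m - X n) < e" "finite F" for m e F
  proof (rule LIMSEQ_le_const2)
    show "(\<lambda>n. psn (Rep_ell2 (X m - X n)) F) \<longlonglongrightarrow> psn (\<lambda>i. Rep_ell2 (X m) i - L i) F"
      unfolding psn_def psum_def minus_ell2.rep_eq by (intro tendsto_intros L)
    show "\<exists>N. \<forall>n\<ge>N. psn (Rep_ell2 (X m - X n)) F \<le> e"
      using that psn_le_norm_finite by (meson less_imp_le order_trans)
  qed
  have lL: "is_l2 L" unfolding is_l2_iff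
  proof (intro allI impI)
    fix e :: real assume e: "e > 0"
    obtain M where M: "\<forall>m\<ge>M. \<forall>n\<ge>M. norm (X m - X n) < e/2" using X e by (meson CauchyD half_gt_zero)
    obtain N where N: "\<forall>m\<ge>N. \<forall>n. psn (Rep_ell2 (X M)) {m..<n} < e/2" using l2_Rep[of "X M"] e unfolding is_l2_iff by (meson half_gt_zero)
    have "psn L {m..<n} < e" if "m \<ge> N" for m n
    proof -
      have "psn L {m..<n} = psn (\<lambda>i. Rep_ell2 (X M) i + (-1) *\<^sub>R (Rep_ell2 (X M) i - L i)) {m..<n}" by simp
      also have "\<dots> \<le> psn (Rep_ell2 (X M)) {m..<n} + psn (\<lambda>i. (-1) *\<^sub>R (Rep_ell2 (X M) i - L i)) {m..<n}"
        by (rule psn_triangle)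
      also have "psn (\<lambda>i. (-1) *\<^sub>R (Rep_ell2 (X M) i - L i)) {m..<n} = psn (\<lambda>i. Rep_ell2 (X M) i - L i) {m..<n}"
        by (simp add: psn_def psum_def algebra_simps)
      also have "\<dots> \<le> e/2" by (rule bound) (use M in auto)
      finally show ?thesis using N that by (smt (verit) field_sum_of_halves)
    qed
    then show "\<exists>N. \<forall>m\<ge>N. \<forall>n. psn L {m..<n} < e" by blast
  qed
  then obtain l where l: "Rep_ell2 l = L" using Abs_ell2_inverse by blast
  have "X \<longlonglongrightarrow> l"
  proof (rule LIMSEQ_I)
    fix e :: real assume e: "e > 0"
    obtain M where M: "\<forall>m\<ge>M. \<forall>n\<ge>M. norm (X m - X n) < e/2" using X e by (meson CauchyD half_gt_zero)
    have "norm (X m - l) \<le> e/2" if "m \<ge> M" for m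
      by (rule norm_ell2_leI, unfold minus_ell2.rep_eq l, rule bound) (use M that in auto)
    then show "\<exists>no. \<forall>n\<ge>no. norm (X n - l) < e" using e by (metis field_sum_of_halves less_add_same_cancel1 half_gt_zero order.strict_trans1)
  qed
  then show "convergent X" by (rule convergentI)
qed

interpretation ell2: adjointable lip st
  by standard (simp_all add: lip_add_right lip_scaleR_right st_lip norm_lip, simp add: norm_ell2_def)

lemma ell2_eqI: "(\<And>i. Rep_ell2 x i = Rep_ell2 y i) \<Longrightarrow> x = y"
  by (simp add: fun_eq_iff flip: Rep_ell2_inject)

section \<open>Diagonal operators, shifts and matrix entries\<close>

definition bseq :: "(nat \<Rightarrow> 'o::cst1) \<Rightarrow> bool" where "bseq \<alpha> \<longleftrightarrow> (\<exists>K. \<forall>i. norm (\<alpha> i) \<le> K)"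

lemma bseqI: "(\<And>i. norm (\<alpha> i) \<le> K) \<Longrightarrow> bseq \<alpha>"
  by (auto simp: bseq_def)

definition Diag :: "(nat \<Rightarrow> 'o::cst1) \<Rightarrow> 'o ell2 \<Rightarrow>\<^sub>L 'o ell2" where
  "Diag \<alpha> = Blinfun (\<lambda>x. Abs_ell2 (\<lambda>i. \<alpha> i * Rep_ell2 x i))"

lemma Diag_apply_norm:
  assumes "bseq \<alpha>" shows "Rep_ell2 (Diag \<alpha> x) i = \<alpha> i * Rep_ell2 x i"
    and "(\<And>i. norm (\<alpha> i) \<le> K) \<Longrightarrow> norm (Diag \<alpha>) \<le> K"
proof -
  define f where "f x = Abs_ell2 (\<lambda>i. \<alpha> i * Rep_ell2 x i)" for x :: "'a ell2"
  obtain M where M: "\<And>i. norm (\<alpha> i) \<le> M" using assms unfolding bseq_def by blast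
  have R: "Rep_ell2 (f x) = (\<lambda>i. \<alpha> i * Rep_ell2 x i)" for x
    using is_l2_diag[OF l2_Rep M] unfolding f_def by (intro Abs_ell2_inverse) simp
  have n: "norm (f x) \<le> norm x * K" if K: "\<And>i. norm (\<alpha> i) \<le> K" for x K
  proof (rule norm_ell2_leI)
    have K0: "0 \<le> K" using K[of 0] norm_ge_zero[of "\<alpha> 0"] by linarith
    fix n show "psn (Rep_ell2 (f x)) {..<n} \<le> norm x * K"
      unfolding R using psn_diag[of \<alpha>, OF K K0, of "Rep_ell2 x" "{..<n}"] mult_left_mono[OF psn_le_norm[of x n] K0]
      by (simp add: mult.commute)
  qed
  have "bounded_linear f"
  proof (rule bounded_linear_intro[where K=M])
    show "f (x + y) = f x + f y" "f (r *\<^sub>R x) = r *\<^sub>R f x" for x y r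
      by (rule ell2_eqI, simp add: R plus_ell2.rep_eq scaleR_ell2.rep_eq algebra_simps)+
  qed (rule n[OF M])
  then have D: "blinfun_apply (Diag \<alpha>) = f" unfolding Diag_def f_def[abs_def] by (rule bounded_linear_Blinfun_apply)
  show "Rep_ell2 (Diag \<alpha> x) i = \<alpha> i * Rep_ell2 x i" by (simp add: D R)
  assume K: "\<And>i. norm (\<alpha> i) \<le> K"
  have "0 \<le> K" using K[of 0] norm_ge_zero[of "\<alpha> 0"] by linarith
  then show "norm (Diag \<alpha>) \<le> K" using n[OF K] by (intro norm_blinfun_bound) (simp_all add: D mult.commute)
qed

lemma bseq_st: "bseq \<alpha> \<Longrightarrow> bseq (\<lambda>i. st (\<alpha> i))"
  by (simp add: bseq_def)

lemma bseq_mult: "bseq \<alpha> \<Longrightarrow> bseq \<beta> \<Longrightarrow> bseq (\<lambda>i. \<alpha> i * \<beta> i)"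
proof -
  assume "bseq \<alpha>" "bseq \<beta>"
  then obtain K L where K: "\<And>i. norm (\<alpha> i) \<le> K" and L: "\<And>i. norm (\<beta> i) \<le> L" unfolding bseq_def by blast
  have "norm (\<alpha> i * \<beta> i) \<le> K * L" for i
    using norm_mult_ineq[of "\<alpha> i" "\<beta> i"] mult_mono[OF K[of i] L[of i] order_trans[OF norm_ge_zero K] norm_ge_zero] by linarith
  then show ?thesis by (rule bseqI)
qed

lemma bseq_add: "bseq \<alpha> \<Longrightarrow> bseq \<beta> \<Longrightarrow> bseq (\<lambda>i. \<alpha> i + \<beta> i)"
proof -
  assume "bseq \<alpha>" "bseq \<beta>"
  then obtain K L where K: "\<And>i. norm (\<alpha> i) \<le> K" and L: "\<And>i. norm (\<beta> i) \<le> L" unfolding bseq_def by blast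
  show ?thesis by (rule bseqI[of _ "K + L"], rule order_trans[OF norm_triangle_ineq add_mono[OF K L]])
qed

lemma AD_Diag: "bseq \<alpha> \<Longrightarrow> ell2.AD (Diag \<alpha>) (Diag (\<lambda>i. st (\<alpha> i)))"
  unfolding ell2.AD_def lip_def by (simp add: Diag_apply_norm(1) bseq_st mult.assoc)

definition Shift :: "'o::cst1 ell2 \<Rightarrow>\<^sub>L 'o ell2" where
  "Shift = Blinfun (\<lambda>x. Abs_ell2 (\<lambda>i. Rep_ell2 x (Suc i)))"

definition Unshift :: "'o::cst1 ell2 \<Rightarrow>\<^sub>L 'o ell2" where
  "Unshift = Blinfun (\<lambda>x. Abs_ell2 (\<lambda>i. if i = 0 then 0 else Rep_ell2 x (i - 1)))"

lemma Shift_apply: "Rep_ell2 (Shift x) i = Rep_ell2 x (Suc i)"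
proof -
  define f where "f x = Abs_ell2 (\<lambda>i. Rep_ell2 x (Suc i))" for x :: "'a ell2"
  have R: "Rep_ell2 (f x) = (\<lambda>i. Rep_ell2 x (Suc i))" for x
    using l2_Rep[of x] unfolding is_l2_def unfolding f_def by (intro Abs_ell2_inverse) (simp add: is_l2_def summable_Suc_iff[of "\<lambda>i. st (Rep_ell2 x i) * Rep_ell2 x i"])
  have "bounded_linear f"
  proof (rule bounded_linear_intro[where K=1])
    show "f (x + y) = f x + f y" "f (r *\<^sub>R x) = r *\<^sub>R f x" for x y r
      by (rule ell2_eqI, simp add: R plus_ell2.rep_eq scaleR_ell2.rep_eq)+
    show "norm (f x) \<le> norm x * 1" for x
    proof (rule norm_ell2_leI)
      fix n
      have "psn (Rep_ell2 (f x)) {..<n} = psn (Rep_ell2 x) (Suc ` {..<n})"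
        unfolding R psn_def psum_def by (simp add: sum.reindex)
      then show "psn (Rep_ell2 (f x)) {..<n} \<le> norm x * 1" using psn_le_norm_finite[of "Suc ` {..<n}" x] by simp
    qed
  qed
  then have "blinfun_apply Shift = f" unfolding Shift_def f_def[abs_def] by (rule bounded_linear_Blinfun_apply)
  then show ?thesis by (simp add: R)
qed

lemma Unshift_apply: "Rep_ell2 (Unshift x) i = (if i = 0 then 0 else Rep_ell2 x (i - 1))"
proof -
  define f where "f x = Abs_ell2 (\<lambda>i. if i = 0 then 0 else Rep_ell2 x (i - 1))" for x :: "'a ell2"
  have R: "Rep_ell2 (f x) = (\<lambda>i. if i = 0 then 0 else Rep_ell2 x (i - 1))" for x
  unfolding f_def
  proof (rule Abs_ell2_inverse, rule CollectI)
    show "is_l2 (\<lambda>i. if i = 0 then 0 else Rep_ell2 x (i - 1))"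
      unfolding is_l2_def by (subst summable_Suc_iff[symmetric]) (use l2_Rep[of x] in \<open>simp add: is_l2_def\<close>)
  qed
  have "bounded_linear f"
  proof (rule bounded_linear_intro[where K=1])
    show "f (x + y) = f x + f y" "f (r *\<^sub>R x) = r *\<^sub>R f x" for x y r
      by (rule ell2_eqI, simp add: R plus_ell2.rep_eq scaleR_ell2.rep_eq)+
    show "norm (f x) \<le> norm x * 1" for x
    proof (rule norm_ell2_leI)
      fix n
      have "psum (Rep_ell2 (f x)) (Rep_ell2 (f x)) {..<Suc n} = psum (Rep_ell2 x) (Rep_ell2 x) {..<n}"
        unfolding R psum_def by (subst sum.lessThan_Suc_shift) simp
      then have "psn (Rep_ell2 (f x)) {..<Suc n} = psn (Rep_ell2 x) {..<n}" by (simp add: psn_def)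
      moreover have "psn (Rep_ell2 (f x)) {..<n} \<le> psn (Rep_ell2 (f x)) {..<Suc n}" by (rule psn_mono) auto
      ultimately show "psn (Rep_ell2 (f x)) {..<n} \<le> norm x * 1" using psn_le_norm[of x n] by simp
    qed
  qed
  then have "blinfun_apply Unshift = f" unfolding Unshift_def f_def[abs_def] by (rule bounded_linear_Blinfun_apply)
  then show ?thesis by (simp add: R)
qed

lemma AD_Shift: "ell2.AD Shift Unshift"
  unfolding ell2.AD_def
proof (intro allI)
  fix x y :: "'a ell2"
  have "(\<lambda>i. st (Rep_ell2 x (Suc i)) * Rep_ell2 (Unshift y) (Suc i)) sums (lip x (Unshift y) - st (Rep_ell2 x 0) * Rep_ell2 (Unshift y) 0)"
    using sums_Suc_iff[of "\<lambda>i. st (Rep_ell2 x i) * Rep_ell2 (Unshift y) i" "lip x (Unshift y) - st (Rep_ell2 x 0) * Rep_ell2 (Unshift y) 0"]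
      lip_sums[of x "Unshift y"] by simp
  then have "(\<lambda>i. st (Rep_ell2 (Shift x) i) * Rep_ell2 y i) sums lip x (Unshift y)" by (simp add: Shift_apply Unshift_apply)
  then show "lip (Shift x) y = lip x (Unshift y)" using lip_sums sums_unique2 by blast
qed

definition ebase :: "nat \<Rightarrow> 'o::cst1 ell2" where
  "ebase j = Abs_ell2 (\<lambda>i. if i = j then 1 else 0)"

lemma Rep_ebase: "Rep_ell2 (ebase j) = (\<lambda>i. if i = j then 1 else 0)"
  unfolding ebase_def
proof (rule Abs_ell2_inverse, rule CollectI)
  show "is_l2 (\<lambda>i. if i = j then 1 else 0 :: 'o::cst1)"
    unfolding is_l2_def by (rule summable_finite[of "{j}"]) auto
qed

lemma lip_ebase: "lip (ebase j) x = Rep_ell2 x j"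
proof -
  have "(\<lambda>i. st (Rep_ell2 (ebase j) i) * Rep_ell2 x i) sums (\<Sum>i\<in>{j}. st (Rep_ell2 (ebase j) i) * Rep_ell2 x i)"
    by (rule sums_finite) (auto simp: Rep_ebase)
  from sums_unique2[OF lip_sums this] show ?thesis by (simp add: Rep_ebase)
qed

definition ent :: "('o::cst1 ell2 \<Rightarrow>\<^sub>L 'o ell2) \<Rightarrow> nat \<Rightarrow> nat \<Rightarrow> 'o" where
  "ent U i j = Rep_ell2 (U (ebase j)) i"

lemma ent_adj: "ell2.AD U V \<Longrightarrow> ent V i j = st (ent U j i)"
  unfolding ent_def by (simp add: st_lip ell2.AD_D flip: lip_ebase)

text \<open>Row \<open>i\<close> of \<open>U\<close> is encoded in \<open>V (ebase i)\<close>, so it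
  acts on a vector through an inner product and the series converges.\<close>

lemma ent_apply_sums:
  assumes "ell2.AD U V" shows "(\<lambda>k. ent U i k * Rep_ell2 x k) sums Rep_ell2 (U x) i"
proof -
  have "Rep_ell2 (U x) i = lip (V (ebase i)) x"
    using ell2.AD_D[OF ell2.AD_sym[OF assms]] by (simp flip: lip_ebase)
  then show ?thesis using lip_sums[of "V (ebase i)" x] ent_adj[OF assms, of _ i] by (simp add: ent_def)
qed

text \<open>An adjointable operator thus amounts to a countable family of algebra elements, and
  these can be coded by one element.\<close>

lemma ent_inject:
  assumes "ell2.AD U V" "ell2.AD U' V'" "ent U = ent U'" shows "U = U'"
proof (rule blinfun_eqI, rule ell2_eqI)
  show "Rep_ell2 (U x) i = Rep_ell2 (U' x) i" for x i
    using ent_apply_sums[OF assms(1), of i x] ent_apply_sums[OF assms(2), of i x] assms(3) by (simp add: sums_unique2)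
qed

lemma norm_ent_le: "norm (ent U i j) \<le> norm U"
proof -
  have "norm (ebase j :: 'a ell2) \<le> 1" using lip_ebase[of j "ebase j :: 'a ell2"] by (simp add: norm_ell2_def Rep_ebase)
  then have "norm (U (ebase j)) \<le> norm U * 1" using norm_blinfun[of U "ebase j"] mult_left_mono[of "norm (ebase j :: 'a ell2)" 1 "norm U"] by simp
  then show ?thesis unfolding ent_def using norm_coord_le[of "U (ebase j)" i] by simp
qed

lemma ent_add: "ent (U + V) i j = ent U i j + ent V i j"
  and ent_diff: "ent (U - V) i j = ent U i j - ent V i j"
  by (simp_all add: ent_def blinfun.add_left blinfun.diff_left plus_ell2.rep_eq minus_ell2.rep_eq)

lemma ent_Diag: "bseq \<alpha> \<Longrightarrow> ent (Diag \<alpha>) i j = (if i = j then \<alpha> i else 0)"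
  by (simp add: ent_def Diag_apply_norm Rep_ebase)

lemma ent_Diag_comp: "bseq \<alpha> \<Longrightarrow> ent (Diag \<alpha> o\<^sub>L U) i j = \<alpha> i * ent U i j"
  by (simp add: ent_def Diag_apply_norm)

lemma ent_Shift: "ent Shift i j = (if Suc i = j then 1 else 0)"
  by (simp add: ent_def Shift_apply Rep_ebase)

section \<open>Coding sequences by elements of a Banach space\<close>

text \<open>In \<open>sequence_coding\<close> this bounds from below the distance of
  \<open>g s\<close> to the other values of \<open>g\<close>, where k is the norm bound of
  \<open>s\<close>. Inside one shell the gap is at least 1 / (4^k * 2 (k + 1)), between different
  shells at least 1 / (4^k * 8), and the weight is below both.\<close>

definition code_weight :: "nat \<Rightarrow> real" where
  "code_weight k = 1 / (4 ^ k * (8 * (real k + 1)))"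

lemma code_weight_pos: "0 < code_weight k" and code_weight_le: "code_weight k \<le> 1"
proof -
  show "0 < code_weight k" by (simp add: code_weight_def)
  have "1 * 1 \<le> (4::real) ^ k * (8 * (real k + 1))" by (intro mult_mono) auto
  then show "code_weight k \<le> 1" by (simp add: code_weight_def)
qed

lemma code_weight_antimono: "k \<le> l \<Longrightarrow> code_weight l \<le> code_weight k"
  unfolding code_weight_def by (intro divide_left_mono mult_mono power_increasing mult_pos_pos) auto

text \<open>A Banach space has as many elements as it has sequences. Elements are coded by sequences in a maximal
  1-separated set \<open>S\<close>, and a sequence \<open>(s\<^sub>n)\<close> in \<open>S\<close> by a series \<open>\<Sum>w\<^sub>n g(s\<^sub>n)\<close>: here \<open>g\<close> maps \<open>S\<close> into
  disjoint shells around 0, one for each bound on the norm of \<open>s\<close>, and \<open>w\<^bsub>n+1\<^esub>\<close> is so small compared with the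
  separation of \<open>g(s\<^sub>n)\<close> from the rest of \<open>g(S)\<close> that the first \<open>n\<close> terms can be read off the sum.\<close>

lemma sequence_coding:
  fixes V :: "'b::banach set"
  assumes cl: "closed V" and add: "\<And>x y. x \<in> V \<Longrightarrow> y \<in> V \<Longrightarrow> x + y \<in> V" and scl: "\<And>r x. x \<in> V \<Longrightarrow> r *\<^sub>R x \<in> V"
    and ne: "v0 \<in> V" "v0 \<noteq> 0"
  obtains J :: "(nat \<Rightarrow> 'b) \<Rightarrow> 'b" where "inj_on J {f. \<forall>n. f n \<in> V}" "\<And>f. (\<And>n. f n \<in> V) \<Longrightarrow> J f \<in> V"
proof -
  define u where "u = (1 / norm v0) *\<^sub>R v0"
  have u: "u \<in> V" "norm u = 1" using ne scl by (simp_all add: u_def)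
  define Sep where "Sep = {S. S \<subseteq> V \<and> (\<forall>s\<in>S. \<forall>s'\<in>S. s \<noteq> s' \<longrightarrow> 1 \<le> norm (s - s'))}"
  \<comment> \<open>Separation concerns two points at a time and therefore passes to unions of
    chains. Maximality then places a point of \<open>S\<close> within distance 1 of every element of
    \<open>V\<close>.\<close>
  have "\<exists>M\<in>Sep. \<forall>X\<in>Sep. M \<subseteq> X \<longrightarrow> X = M"
  proof (rule subset_Zorn')
    fix C assume C: "subset.chain Sep C"
    show "\<Union>C \<in> Sep"
      unfolding Sep_def
    proof (intro CollectI conjI ballI impI)
      show "\<Union>C \<subseteq> V" using C unfolding subset.chain_def Sep_def by blast
      fix s s' assume "s \<in> \<Union>C" "s' \<in> \<Union>C" and ss: "s \<noteq> s'"
      then obtain M M' where M: "M \<in> C" "s \<in> M" "M' \<in> C" "s' \<in> M'" by blast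
      then consider "M \<subseteq> M'" | "M' \<subseteq> M" using C unfolding subset.chain_def by blast
      then obtain N where "N \<in> C" "s \<in> N" "s' \<in> N" using M by cases blast+
      moreover have "N \<in> Sep" using C \<open>N \<in> C\<close> unfolding subset.chain_def by blast
      ultimately show "1 \<le> norm (s - s')" using ss unfolding Sep_def by blast
    qed
  qed
  then obtain S where S: "S \<in> Sep" and max: "\<And>X. X \<in> Sep \<Longrightarrow> S \<subseteq> X \<Longrightarrow> X = S" by blast
  have SV: "S \<subseteq> V" and sep: "\<And>s s'. s \<in> S \<Longrightarrow> s' \<in> S \<Longrightarrow> s \<noteq> s' \<Longrightarrow> 1 \<le> norm (s - s')" using S unfolding Sep_def by blast+
  have dense: "\<exists>s\<in>S. norm (v - s) < 1" if v: "v \<in> V" for v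
  proof (rule ccontr)
    assume neg: "\<not> (\<exists>s\<in>S. norm (v - s) < 1)"
    then have far: "1 \<le> norm (v - s)" "1 \<le> norm (s - v)" if "s \<in> S" for s using that by (auto simp: norm_minus_commute not_less)
    have "insert v S \<in> Sep" unfolding Sep_def using SV v far sep by auto
    then have "insert v S = S" using max by blast
    then have "v \<in> S" by blast
    then show False using neg by force
  qed
  \<comment> \<open>A point of \<open>S\<close> within 1 of n v. If v and w yield the same points
    for all n, then n (v - w) has norm below 2 for all n and so v = w; hence the sequence of points
    determines v.\<close>
  define nr where "nr v n = (SOME s. s \<in> S \<and> norm (real n *\<^sub>R v - s) < 1)" for v n
  have nr: "nr v n \<in> S \<and> norm (real n *\<^sub>R v - nr v n) < 1" if "v \<in> V" for v n
    unfolding nr_def by (rule someI_ex) (use dense[OF scl[OF that]] in blast)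
  have nr_inj: "v = w" if v: "v \<in> V" and w: "w \<in> V" and eq: "\<And>n. nr v n = nr w n" for v w
  proof (rule ccontr)
    assume "v \<noteq> w"
    then have p: "0 < norm (v - w)" by simp
    then obtain n :: nat where n: "2 < real n * norm (v - w)" using reals_Archimedean3 by blast
    have "real n *\<^sub>R (v - w) = (real n *\<^sub>R v - nr v n) - (real n *\<^sub>R w - nr w n)" by (simp add: eq algebra_simps)
    then have "norm (real n *\<^sub>R (v - w)) \<le> norm (real n *\<^sub>R v - nr v n) + norm (real n *\<^sub>R w - nr w n)"
      by (metis norm_triangle_ineq4)
    then show False using n nr[OF v, of n] nr[OF w, of n] by simp
  qed
  define k where "k s = nat \<lceil>norm s\<rceil>" for s :: 'b
  have k: "norm s \<le> real (k s)" for s unfolding k_def by linarith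
  \<comment> \<open>The bracket has norm between 1/2 and 3/2, so \<open>g s\<close> lies in a shell
    whose radius is about the k-th power of 1/4. The factor 4 exceeds the ratio 3 of the two bounds
    and keeps the shells apart, while the small multiple of \<open>s\<close> preserves the
    separation inside a shell.\<close>
  define g where "g s = (1 / 4 ^ k s) *\<^sub>R (u + (1 / (2 * (real (k s) + 1))) *\<^sub>R s)" for s
  have gV: "g s \<in> V" if "s \<in> S" for s unfolding g_def using that SV u by (intro scl add) auto
  have half: "norm ((1 / (2 * (real (k s) + 1))) *\<^sub>R s) \<le> 1/2" for s
    using k[of s] by (simp add: field_simps)
  have g_up: "norm (g s) \<le> (3/2) / 4 ^ k s" for s
  proof -
    have "norm (u + (1 / (2 * (real (k s) + 1))) *\<^sub>R s) \<le> 3/2" using norm_triangle_ineq[of u "(1 / (2 * (real (k s) + 1))) *\<^sub>R s"] half[of s] u by linarith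
    then have "norm (u + (1 / (2 * (real (k s) + 1))) *\<^sub>R s) / 4 ^ k s \<le> (3/2) / 4 ^ k s" by (rule divide_right_mono) simp
    then show ?thesis by (simp add: g_def)
  qed
  have g_low: "(1/2) / 4 ^ k s \<le> norm (g s)" for s
  proof -
    have "1/2 \<le> norm (u + (1 / (2 * (real (k s) + 1))) *\<^sub>R s)" using norm_diff_ineq[of u "(1 / (2 * (real (k s) + 1))) *\<^sub>R s"] half[of s] u by linarith
    then have "(1/2) / 4 ^ k s \<le> norm (u + (1 / (2 * (real (k s) + 1))) *\<^sub>R s) / 4 ^ k s" by (rule divide_right_mono) simp
    then show ?thesis by (simp add: g_def)
  qed
  have g_sep1: "code_weight (k s) \<le> norm (g s - g s') \<and> code_weight (k s') \<le> norm (g s - g s')"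
    if s: "s \<in> S" "s' \<in> S" "s \<noteq> s'" "k s \<le> k s'" for s s'
  proof -
    have "code_weight (k s) \<le> norm (g s - g s')"
    proof (cases "k s = k s'")
      case True
      have "g s - g s' = (1 / 4 ^ k s) *\<^sub>R ((1 / (2 * (real (k s) + 1))) *\<^sub>R (s - s'))"
        unfolding g_def True by (simp add: algebra_simps)
      then have "norm (g s - g s') = norm (s - s') / (4 ^ k s * (2 * (real (k s) + 1)))" by (simp add: divide_simps)
      also have "\<dots> \<ge> 1 / (4 ^ k s * (2 * (real (k s) + 1)))" using sep[OF s(1-3)] by (intro divide_right_mono) auto
      also have "1 / (4 ^ k s * (2 * (real (k s) + 1))) \<ge> code_weight (k s)"
        unfolding code_weight_def by (intro divide_left_mono mult_left_mono) auto
      finally show ?thesis .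
    next
      case False
      then have "Suc (k s) \<le> k s'" using s by simp
      then have "(4::real) ^ Suc (k s) \<le> 4 ^ k s'" by (intro power_increasing) auto
      then have "(3/2) / 4 ^ k s' \<le> (3/2) / (4 ^ Suc (k s) :: real)" by (intro divide_left_mono) auto
      then have "(1/2) / 4 ^ k s - (3/2) / (4 * 4 ^ k s) \<le> norm (g s - g s')"
        using g_low[of s] g_up[of s'] norm_triangle_ineq2[of "g s" "g s'"] by simp
      moreover have "(1/2) / 4 ^ k s - (3/2) / (4 * 4 ^ k s) = 1 / (4 ^ k s * (8::real))" by (simp add: field_simps)
      moreover have "code_weight (k s) \<le> 1 / (4 ^ k s * 8)"
        unfolding code_weight_def by (intro divide_left_mono mult_left_mono) auto
      ultimately show ?thesis by linarith
    qed
    then show ?thesis using code_weight_antimono[OF s(4)] by linarith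
  qed
  have g_sep: "code_weight (k s) \<le> norm (g s - g s')" "code_weight (k s') \<le> norm (g s - g s')"
    if s: "s \<in> S" "s' \<in> S" "s \<noteq> s'" for s s'
    using g_sep1[OF s] g_sep1[OF s(2,1)] s(3) by (metis norm_minus_commute nat_le_linear)+
  \<comment> \<open>The weights up to \<open>n\<close> depend only on the entries before
    \<open>n\<close>, so they agree for sequences that first differ at \<open>n\<close>. The terms
    after \<open>n\<close> sum to at most twice the next weight, which is a quarter of
    \<open>w t n\<close> times the separation; two such remainders cannot bridge a full
    separation.\<close>
  define w where "w t = rec_nat 1 (\<lambda>n r. r * (code_weight (k (t n)) / 8))" for t :: "nat \<Rightarrow> 'b"
  have w0: "w t 0 = 1" and wS: "w t (Suc n) = w t n * (code_weight (k (t n)) / 8)" for t n by (simp_all add: w_def)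
  have wpos: "0 < w t n" for t n by (induction n) (simp_all add: w0 wS code_weight_pos)
  have wdec: "w t (n + m) \<le> w t n * (1/4) ^ m" for t n m
  proof (induction m)
    case (Suc m)
    have "w t (n + Suc m) \<le> w t (n + m) * (1/4)"
      using wpos[of t "n + m"] code_weight_le[of "k (t (n + m))"] by (simp add: wS)
    then show ?case using Suc by simp
  qed simp
  have ng: "norm (g s) \<le> 3/2" for s
  proof -
    have "(3/2) / 4 ^ k s \<le> (3/2) / (1::real)" by (intro divide_left_mono) auto
    then show ?thesis using g_up[of s] by simp
  qed
  have term_le: "norm (w t (n + m) *\<^sub>R g (t (n + m))) \<le> w t n * (3/2) * (1/4) ^ m" for t n m
  proof -
    have "norm (w t (n + m) *\<^sub>R g (t (n + m))) = w t (n + m) * norm (g (t (n + m)))"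
      using wpos[of t "n + m"] by simp
    also have "\<dots> \<le> (w t n * (1/4) ^ m) * (3/2)" by (intro mult_mono wdec ng) (use wpos[of t n] in simp_all)
    finally show ?thesis by simp
  qed
  have geo: "(\<lambda>m. c * (1/4::real) ^ m) sums (c * (4/3))" for c
    using sums_mult[OF geometric_sums[of "1/4::real"], of c] by simp
  have summ: "summable (\<lambda>m. w t (n + m) *\<^sub>R g (t (n + m)))" for t n
    by (rule summable_comparison_test'[of "\<lambda>m. w t n * (3/2) * (1/4) ^ m" 0]) (use geo sums_summable term_le in blast)+
  have tail: "norm (\<Sum>m. w t (n + m) *\<^sub>R g (t (n + m))) \<le> w t n * 2" for t n
  proof -
    have "norm (\<Sum>m. w t (n + m) *\<^sub>R g (t (n + m))) \<le> w t n * (3/2) * (4/3)"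
      by (rule norm_suminf_le[of _ "\<lambda>m. w t n * (3/2) * (1/4) ^ m", THEN order_trans])
        (use term_le geo[of "w t n * (3/2)"] in \<open>auto simp: sums_iff\<close>)
    then show ?thesis by simp
  qed
  define X where "X t = (\<Sum>m. w t m *\<^sub>R g (t m))" for t
  have X_split: "X t = (\<Sum>m<n. w t m *\<^sub>R g (t m)) + w t n *\<^sub>R g (t n) + (\<Sum>m. w t (Suc n + m) *\<^sub>R g (t (Suc n + m)))" for t n
    using suminf_split_initial_segment[OF summ[of t 0, simplified], of "Suc n"] by (simp add: X_def add.commute)
  have XV: "X t \<in> V" if "\<And>n. t n \<in> S" for t
  proof -
    have 0: "0 \<in> V" using scl[OF ne(1), of 0] by simp
    have "(\<Sum>m<n. w t m *\<^sub>R g (t m)) \<in> V" for n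
      by (induction n) (use 0 gV[OF that] in \<open>auto intro!: add scl\<close>)
    moreover have "(\<lambda>n. \<Sum>m<n. w t m *\<^sub>R g (t m)) \<longlonglongrightarrow> X t"
      unfolding X_def using summable_LIMSEQ[OF summ[of t 0]] by simp
    ultimately show ?thesis by (rule closed_sequentially[OF cl])
  qed
  have X_inj: "t = t'" if t: "\<And>n. t n \<in> S" and t': "\<And>n. t' n \<in> S" and eq: "X t = X t'" for t t'
  proof (rule ccontr)
    assume "t \<noteq> t'"
    then have ex: "\<exists>n. t n \<noteq> t' n" by auto
    define n where "n = (LEAST n. t n \<noteq> t' n)"
    have n: "t n \<noteq> t' n" unfolding n_def by (rule LeastI_ex[OF ex])
    have before: "t m = t' m" if "m < n" for m using that not_less_Least unfolding n_def by blast
    have weq: "w t m = w t' m" if "m \<le> n" for m using that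
      by (induction m) (simp_all add: w0 wS before)
    have sumeq: "(\<Sum>m<n. w t m *\<^sub>R g (t m)) = (\<Sum>m<n. w t' m *\<^sub>R g (t' m))"
      by (rule sum.cong) (simp_all add: before weq)
    define R R' where "R = (\<Sum>m. w t (Suc n + m) *\<^sub>R g (t (Suc n + m)))" and "R' = (\<Sum>m. w t' (Suc n + m) *\<^sub>R g (t' (Suc n + m)))"
    have "w t n *\<^sub>R g (t n) + R = w t n *\<^sub>R g (t' n) + R'"
      using eq X_split[of t n] X_split[of t' n] sumeq weq[of n] unfolding R_def R'_def by simp
    then have "w t n *\<^sub>R (g (t n) - g (t' n)) = R' - R" by (simp add: algebra_simps)
    then have "norm (w t n *\<^sub>R (g (t n) - g (t' n))) \<le> norm R' + norm R" by (metis norm_triangle_ineq4)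
    then have 1: "w t n * norm (g (t n) - g (t' n)) \<le> norm R' + norm R" using wpos[of t n] by simp
    have "norm R \<le> w t n * (code_weight (k (t n)) / 8) * 2" using tail[of t "Suc n"] by (simp add: R_def wS)
    also have "\<dots> \<le> w t n * (norm (g (t n) - g (t' n)) / 8) * 2"
      using g_sep(1)[OF t t' n] wpos[of t n] by (intro mult_right_mono mult_left_mono divide_right_mono) auto
    finally have 2: "norm R \<le> w t n * norm (g (t n) - g (t' n)) / 4" by simp
    have "norm R' \<le> w t n * (code_weight (k (t' n)) / 8) * 2" using tail[of t' "Suc n"] weq[of n] by (simp add: R'_def wS)
    also have "\<dots> \<le> w t n * (norm (g (t n) - g (t' n)) / 8) * 2"
      using g_sep(2)[OF t t' n] wpos[of t n] by (intro mult_right_mono mult_left_mono divide_right_mono) auto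
    finally have 3: "norm R' \<le> w t n * norm (g (t n) - g (t' n)) / 4" by simp
    have "0 < norm (g (t n) - g (t' n))" using g_sep(1)[OF t t' n] code_weight_pos[of "k (t n)"] by linarith
    then have "0 < w t n * norm (g (t n) - g (t' n))" using wpos[of t n] by simp
    then show False using 1 2 3 by linarith
  qed
  \<comment> \<open>A sequence of elements gives a double sequence of points of \<open>S\<close>,
    flattened by the pairing function.\<close>
  define code where "code f m = nr (f (fst (prod_decode m))) (snd (prod_decode m))" for f m
  show thesis
  proof (rule that[of "\<lambda>f. X (code f)"])
    have cS: "code f m \<in> S" if "\<And>n. f n \<in> V" for f m using nr that by (simp add: code_def)
    show "X (code f) \<in> V" if "\<And>n. f n \<in> V" for f by (rule XV[OF cS[OF that]])
    show "inj_on (\<lambda>f. X (code f)) {f. \<forall>n. f n \<in> V}"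
    proof (rule inj_onI, unfold mem_Collect_eq, rule ext)
      fix f f' i assume f: "\<forall>n. f n \<in> V" and f': "\<forall>n. f' n \<in> V" and eq: "X (code f) = X (code f')"
      have "code f = code f'" by (rule X_inj[OF cS cS eq]) (use f f' in auto)
      then have "nr (f i) n = nr (f' i) n" for n
        unfolding code_def by (metis fst_conv prod_encode_inverse snd_conv)
      then show "f i = f' i" using nr_inj f f' by blast
    qed
  qed
qed

section \<open>Extending a representation of X to Y\<close>

text \<open>Bounded operators form a real vector space; composing with \<open>JL\<close> provides
  its complex structure.\<close>

definition JL :: "'o::cst1 ell2 \<Rightarrow>\<^sub>L 'o ell2" where "JL = Diag (\<lambda>i. iu)"

lemma bseq_const: "bseq (\<lambda>i. c)"
  by (rule bseqI[of _ "norm c"]) simp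

lemma Rep_JL: "Rep_ell2 (JL x) i = iu * Rep_ell2 x i"
  by (simp add: JL_def Diag_apply_norm bseq_const)

lemma lip_JL: "lip x (JL y) = iu * lip x y"
proof (rule sums_unique2[OF lip_sums])
  have "st a * (iu * b) = iu * (st a * b)" for a b :: 'a by (metis iu_comm mult.assoc)
  then show "(\<lambda>i. st (Rep_ell2 x i) * Rep_ell2 (JL y) i) sums (iu * lip x y)"
    using sums_mult[OF lip_sums, of iu x y] by (simp add: Rep_JL)
qed

lemma AD_JL: "ell2.AD (JL :: 'o::cst1 ell2 \<Rightarrow>\<^sub>L 'o ell2) (- JL)"
proof -
  have "Diag (\<lambda>i. - iu) = - (JL :: 'o ell2 \<Rightarrow>\<^sub>L 'o ell2)"
    by (rule blinfun_eqI, rule ell2_eqI) (simp add: JL_def Diag_apply_norm bseq_const blinfun.minus_left uminus_ell2.rep_eq)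
  then show ?thesis using AD_Diag[OF bseq_const, of "iu :: 'o"] by (simp add: JL_def)
qed

lemma JL_JL: "JL (JL x) = - x"
  by (rule ell2_eqI) (simp add: Rep_JL uminus_ell2.rep_eq iu_iu flip: mult.assoc)

lemma AD_JL_commute: "ell2.AD U V \<Longrightarrow> U (JL x) = JL (U x)"
  by (rule ell2.ip_eqI) (simp add: lip_JL flip: ell2.AD_D[OF ell2.AD_sym])

definition csL :: "complex \<Rightarrow> ('o::cst1 ell2 \<Rightarrow>\<^sub>L 'o ell2) \<Rightarrow> ('o ell2 \<Rightarrow>\<^sub>L 'o ell2)" where
  "csL c U = Re c *\<^sub>R U + Im c *\<^sub>R (JL o\<^sub>L U)"

lemma csL_apply: "csL c U x = Re c *\<^sub>R U x + Im c *\<^sub>R JL (U x)"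
  by (simp add: csL_def blinfun.add_left blinfun.scaleR_left)

lemma csL_add_right: "csL c (U + V) = csL c U + csL c V"
  by (rule blinfun_eqI) (simp add: csL_apply blinfun.add_left blinfun.add_right algebra_simps)

lemma csL_add_left: "csL (c + d) U = csL c U + csL d U"
  by (rule blinfun_eqI) (simp add: csL_apply blinfun.add_left algebra_simps)

lemma csL_mult: "csL (c * d) U = csL c (csL d U)"
  by (rule blinfun_eqI) (simp add: csL_apply blinfun.add_right blinfun.scaleR_right JL_JL algebra_simps)

lemma csL_one: "csL 1 U = U" and csL_minus_one: "csL (-1) U = - U" and csL_of_real: "csL (complex_of_real r) U = r *\<^sub>R U"
  by (rule blinfun_eqI, simp add: csL_apply blinfun.minus_left blinfun.scaleR_left)+

lemma csL_comp_left: "csL c U o\<^sub>L V = csL c (U o\<^sub>L V)"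
  by (rule blinfun_eqI) (simp add: csL_apply)

lemma csL_comp_right: "ell2.AD U U' \<Longrightarrow> U o\<^sub>L csL c V = csL c (U o\<^sub>L V)"
  by (rule blinfun_eqI) (simp add: csL_apply blinfun.add_right blinfun.scaleR_right AD_JL_commute)

lemma AD_csL:
  assumes "ell2.AD U V" shows "ell2.AD (csL c U) (csL (cnj c) V)"
proof -
  have "V o\<^sub>L (- JL) = - (JL o\<^sub>L V)"
    by (rule blinfun_eqI) (simp add: blinfun.minus_left blinfun.minus_right AD_JL_commute[OF ell2.AD_sym[OF assms]])
  then have "ell2.AD (JL o\<^sub>L U) (- (JL o\<^sub>L V))" using ell2.AD_comp[OF AD_JL assms] by simp
  from ell2.AD_add[OF ell2.AD_scaleR[OF assms, of "Re c"] ell2.AD_scaleR[OF this, of "Im c"]]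
  show ?thesis by (simp add: csL_def)
qed

text \<open>The C*-identity replaces \<open>c\<close> by the real scalar \<open>cnj c * c\<close>,
  for which the norm formula is immediate.\<close>

lemma norm_csL:
  assumes "ell2.AD U V" shows "norm (csL c U) = cmod c * norm U"
proof -
  have "(norm (csL c U))\<^sup>2 = norm (csL (cnj c) V o\<^sub>L csL c U)"
    using ell2.AD_norm_comp[OF AD_csL[OF assms]] by simp
  also have "\<dots> = norm (csL (cnj c * c) (V o\<^sub>L U))"
    by (simp add: csL_comp_left csL_comp_right[OF ell2.AD_sym[OF assms]] csL_mult)
  also have "cnj c * c = complex_of_real ((cmod c)\<^sup>2)" by (rule sym, rule trans[OF complex_norm_square mult.commute])
  also have "norm (csL (complex_of_real ((cmod c)\<^sup>2)) (V o\<^sub>L U)) = (cmod c * norm U)\<^sup>2"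
    by (simp add: csL_of_real ell2.AD_norm_comp[OF assms] power_mult_distrib del: of_real_power)
  finally show ?thesis by simp
qed

lemma ent_csL: "ent (csL c U) i j = csc c (ent U i j)"
  by (simp add: ent_def csL_apply csc_def plus_ell2.rep_eq scaleR_ell2.rep_eq Rep_JL)

lemma comp_add_left: "(U + V) o\<^sub>L W = (U o\<^sub>L W) + (V o\<^sub>L W)" and comp_add_right: "W o\<^sub>L (U + V) = (W o\<^sub>L U) + (W o\<^sub>L V)"
  and comp_assoc: "(U o\<^sub>L V) o\<^sub>L W = U o\<^sub>L (V o\<^sub>L W)" for U V W :: "'e::real_normed_vector \<Rightarrow>\<^sub>L 'e"
  by (rule blinfun_eqI, simp add: blinfun.add_left blinfun.add_right)+

text \<open>The adjointable operators with all entries in \<open>S\<close> form a C*-algebra, which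
  \<open>enc\<close> transports to a record over another type. Only these operators have codes, so
  injectivity is a statement about them.\<close>

locale coded_ops =
  fixes S :: "'o::cst1 set" and enc :: "('o ell2 \<Rightarrow>\<^sub>L 'o ell2) \<Rightarrow> 'd"
  assumes S_closed: "closed S" and S_zero: "0 \<in> S" and S_add: "x \<in> S \<Longrightarrow> y \<in> S \<Longrightarrow> x + y \<in> S"
    and S_csc: "x \<in> S \<Longrightarrow> csc c x \<in> S" and S_mult: "x \<in> S \<Longrightarrow> y \<in> S \<Longrightarrow> x * y \<in> S" and S_st: "x \<in> S \<Longrightarrow> st x \<in> S"
    and enc_inj: "inj_on enc {U. (\<exists>V. ell2.AD U V) \<and> (\<forall>i j. ent U i j \<in> S)}"
begin

definition G :: "('o ell2 \<Rightarrow>\<^sub>L 'o ell2) set" where "G = {U. (\<exists>V. ell2.AD U V) \<and> (\<forall>i j. ent U i j \<in> S)}"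

lemma GI: "ell2.AD U V \<Longrightarrow> (\<And>i j. ent U i j \<in> S) \<Longrightarrow> U \<in> G"
  by (auto simp: G_def)

lemma G_AD: "U \<in> G \<Longrightarrow> ell2.AD U (ell2.adj U)"
  using ell2.AD_adj by (auto simp: G_def)

lemma G_ent: "U \<in> G \<Longrightarrow> ent U i j \<in> S"
  by (simp add: G_def)

lemma G_zero [simp]: "0 \<in> G"
  using GI[OF ell2.AD_zero] S_zero by (simp add: ent_def zero_ell2.rep_eq)

lemma G_add [simp]: "U \<in> G \<Longrightarrow> V \<in> G \<Longrightarrow> U + V \<in> G"
  using GI[OF ell2.AD_add[OF G_AD G_AD]] by (simp add: ent_add S_add G_ent)

lemma G_csL [simp]: "U \<in> G \<Longrightarrow> csL c U \<in> G"
  using GI[OF AD_csL[OF G_AD]] by (simp add: ent_csL S_csc G_ent)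

lemma G_adj [simp]: "U \<in> G \<Longrightarrow> ell2.adj U \<in> G"
  using GI[OF ell2.AD_sym[OF G_AD]] by (simp add: ent_adj[OF G_AD] S_st G_ent)

lemma S_sums:
  assumes f: "\<And>k. f k \<in> S" and s: "f sums l" shows "l \<in> S"
proof -
  have "(\<Sum>k<n. f k) \<in> S" for n by (induction n) (simp_all add: S_zero S_add f)
  moreover have "(\<lambda>n. \<Sum>k<n. f k) \<longlonglongrightarrow> l" using s unfolding sums_def .
  ultimately show ?thesis by (rule closed_sequentially[OF S_closed])
qed

text \<open>An entry of a product is an infinite sum of products of entries; it stays in
  \<open>S\<close> because \<open>S\<close> is closed.\<close>

lemma G_comp [simp]: "U \<in> G \<Longrightarrow> V \<in> G \<Longrightarrow> U o\<^sub>L V \<in> G"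
proof (rule GI[OF ell2.AD_comp[OF G_AD G_AD]])
  fix i j assume UV: "U \<in> G" "V \<in> G"
  have "(\<lambda>k. ent U i k * ent V k j) sums ent (U o\<^sub>L V) i j"
    using ent_apply_sums[OF G_AD[OF UV(1)], of i "V (ebase j)"] by (simp add: ent_def)
  then show "ent (U o\<^sub>L V) i j \<in> S" by (rule S_sums[rotated]) (simp add: S_mult G_ent UV)
qed

lemma G_limit:
  assumes X: "\<And>n. X n \<in> G" and L: "X \<longlonglongrightarrow> L" shows "L \<in> G"
proof -
  obtain V where V: "ell2.AD L V" using ell2.AD_limit[OF L] X G_AD by blast
  have "ent L i j \<in> S" for i j
  proof (rule closed_sequentially[OF S_closed])
    show "ent (X n) i j \<in> S" for n using G_ent X by blast
    have "(\<lambda>n. ent (X n) i j - ent L i j) \<longlonglongrightarrow> 0"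
    proof (rule Lim_null_comparison)
      show "\<forall>\<^sub>F n in sequentially. norm (ent (X n) i j - ent L i j) \<le> norm (X n - L)"
        using norm_ent_le[of "X _ - L" i j] by (simp add: ent_diff)
      show "(\<lambda>n. norm (X n - L)) \<longlonglongrightarrow> 0" using L by (simp add: tendsto_norm_zero LIM_zero)
    qed
    then show "(\<lambda>n. ent (X n) i j) \<longlonglongrightarrow> ent L i j" by (rule LIM_zero_cancel)
  qed
  then show ?thesis using GI[OF V] by blast
qed

definition dec :: "'d \<Rightarrow> ('o ell2 \<Rightarrow>\<^sub>L 'o ell2)" where "dec = inv_into G enc"

lemma dec_enc [simp]: "U \<in> G \<Longrightarrow> dec (enc U) = U"
  unfolding dec_def using enc_inj inv_into_f_f[of enc G U] by (simp add: G_def)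

definition Crec :: "'d cstar" where
  "Crec = \<lparr> carr = enc ` G, zer = enc 0, pls = (\<lambda>x y. enc (dec x + dec y)), mlt = (\<lambda>x y. enc (dec x o\<^sub>L dec y)),
     scl = (\<lambda>c x. enc (csL c (dec x))), str = (\<lambda>x. enc (ell2.adj (dec x))), nrm = (\<lambda>x. norm (dec x)) \<rparr>"

lemma Crec_simps [simp]:
  "carr Crec = enc ` G" "zer Crec = enc 0"
  "U \<in> G \<Longrightarrow> V \<in> G \<Longrightarrow> pls Crec (enc U) (enc V) = enc (U + V)"
  "U \<in> G \<Longrightarrow> V \<in> G \<Longrightarrow> mlt Crec (enc U) (enc V) = enc (U o\<^sub>L V)"
  "U \<in> G \<Longrightarrow> scl Crec c (enc U) = enc (csL c U)"
  "U \<in> G \<Longrightarrow> str Crec (enc U) = enc (ell2.adj U)"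
  "U \<in> G \<Longrightarrow> nrm Crec (enc U) = norm U"
  by (simp_all add: Crec_def)

lemma G_minus [simp]: "U \<in> G \<Longrightarrow> - U \<in> G"
  using G_csL[of U "-1"] by (simp add: csL_minus_one)

lemma mns_Crec: "U \<in> G \<Longrightarrow> V \<in> G \<Longrightarrow> mns Crec (enc U) (enc V) = enc (U - V)"
  by (simp add: mns_def csL_minus_one)

lemma enc_eq_iff: "U \<in> G \<Longrightarrow> V \<in> G \<Longrightarrow> enc U = enc V \<longleftrightarrow> U = V"
  by (metis dec_enc)

lemma Crec_complete: "complete_wrt (carr Crec) (pls Crec) (scl Crec) (nrm Crec)"
  unfolding complete_wrt_def mns_def[symmetric]
proof (intro allI impI, elim conjE)
  fix f :: "nat \<Rightarrow> 'd" assume f: "\<forall>k. f k \<in> carr Crec" and C: "\<forall>e>0. \<exists>N. \<forall>m\<ge>N. \<forall>k\<ge>N. nrm Crec (mns Crec (f m) (f k)) < e"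
  define U where "U k = dec (f k)" for k :: nat
  have U: "U k \<in> G" "f k = enc (U k)" for k using f[rule_format, of k] by (auto simp: U_def)
  have UU: "U m - U k \<in> G" for m k using G_add[OF U(1) G_minus[OF U(1)], of m k] by simp
  have "Cauchy U" unfolding Cauchy_def dist_norm using C by (simp add: U mns_Crec UU)
  then obtain L where L: "U \<longlonglongrightarrow> L" using Cauchy_convergent convergent_def by metis
  then have LG: "L \<in> G" using G_limit U by blast
  have UL: "U m - L \<in> G" for m using G_add[OF U(1) G_minus[OF LG], of m] by simp
  have "(\<lambda>k. nrm Crec (mns Crec (f k) (enc L))) \<longlonglongrightarrow> 0"
    using L by (simp add: U mns_Crec UL LG tendsto_norm_zero LIM_zero)
  then show "\<exists>x\<in>carr Crec. (\<lambda>k. nrm Crec (mns Crec (f k) x)) \<longlonglongrightarrow> 0" using LG by auto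
qed

lemma cstar_Crec: "cstar_alg Crec"
  unfolding cstar_alg_def Defs.banach_def vspace_def
proof (intro conjI ballI allI Crec_complete)
  show "zer Crec \<in> carr Crec" by simp
  fix x y w c d assume "x \<in> carr Crec"
  then obtain U where U: "x = enc U" "U \<in> G" by auto
  note AU = G_AD[OF U(2)]
  show "scl Crec c x \<in> carr Crec" "pls Crec (zer Crec) x = x" "pls Crec x (scl Crec (- 1) x) = zer Crec" "scl Crec 1 x = x"
    "scl Crec (c + d) x = pls Crec (scl Crec c x) (scl Crec d x)" "scl Crec (c * d) x = scl Crec c (scl Crec d x)"
    "0 \<le> nrm Crec x" "nrm Crec (scl Crec c x) = cmod c * nrm Crec x" "str Crec x \<in> carr Crec"
    using U by (simp_all add: csL_minus_one csL_one csL_add_left csL_mult norm_csL[OF AU])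
  show "(nrm Crec x = 0) = (x = zer Crec)" using U by (simp add: enc_eq_iff)
  show "str Crec (str Crec x) = x" using U ell2.adj_eq[OF ell2.AD_sym[OF AU]] by simp
  show "str Crec (scl Crec c x) = scl Crec (cnj c) (str Crec x)" using U ell2.adj_eq[OF AD_csL[OF AU]] by simp
  show "nrm Crec (mlt Crec (str Crec x) x) = (nrm Crec x)\<^sup>2" using U by (simp add: ell2.AD_norm_comp[OF AU])
  assume "y \<in> carr Crec"
  then obtain V where V: "y = enc V" "V \<in> G" by auto
  note AV = G_AD[OF V(2)]
  show "pls Crec x y \<in> carr Crec" "pls Crec x y = pls Crec y x" "scl Crec c (pls Crec x y) = pls Crec (scl Crec c x) (scl Crec c y)"
    "nrm Crec (pls Crec x y) \<le> nrm Crec x + nrm Crec y" "mlt Crec x y \<in> carr Crec" "nrm Crec (mlt Crec x y) \<le> nrm Crec x * nrm Crec y"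
    "mlt Crec (scl Crec c x) y = scl Crec c (mlt Crec x y)" "mlt Crec x (scl Crec c y) = scl Crec c (mlt Crec x y)"
    using U V by (simp_all add: add.commute csL_add_right norm_triangle_ineq norm_blinfun_compose csL_comp_left csL_comp_right[OF AU])
  show "str Crec (pls Crec x y) = pls Crec (str Crec x) (str Crec y)" using U V ell2.adj_eq[OF ell2.AD_add[OF AU AV]] by simp
  show "str Crec (mlt Crec x y) = mlt Crec (str Crec y) (str Crec x)" using U V ell2.adj_eq[OF ell2.AD_comp[OF AU AV]] by simp
  assume "w \<in> carr Crec"
  then obtain W where W: "w = enc W" "W \<in> G" by auto
  show "pls Crec (pls Crec x y) w = pls Crec x (pls Crec y w)" "mlt Crec (mlt Crec x y) w = mlt Crec x (mlt Crec y w)"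
    "mlt Crec x (pls Crec y w) = pls Crec (mlt Crec x y) (mlt Crec x w)"
    "mlt Crec (pls Crec x y) w = pls Crec (mlt Crec x w) (mlt Crec y w)"
    using U V W by (simp_all add: add.assoc comp_add_left comp_add_right comp_assoc)
qed

end

section \<open>Calculus of diagonal operators and the extended representation\<close>

lemma op_eqI:
  fixes U V :: "'o::cst1 ell2 \<Rightarrow>\<^sub>L 'o ell2"
  assumes "\<And>v i. Rep_ell2 (U v) i = Rep_ell2 (V v) i" shows "U = V"
  by (rule blinfun_eqI, rule ell2_eqI, rule assms)

definition e0 :: "'o::cst1 \<Rightarrow> nat \<Rightarrow> 'o" where "e0 v i = (if i = 0 then v else 0)"

lemma bseq_e0: "bseq (e0 v)"
  by (rule bseqI[of _ "norm v"]) (simp add: e0_def)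

lemma Diag_e0_norm: "norm (Diag (e0 v)) = norm v"
proof (rule antisym)
  show "norm (Diag (e0 v)) \<le> norm v" by (rule Diag_apply_norm(2)[OF bseq_e0]) (simp add: e0_def)
  show "norm v \<le> norm (Diag (e0 v))" using norm_ent_le[of "Diag (e0 v)" 0 0] by (simp add: ent_Diag[OF bseq_e0]) (simp add: e0_def)
qed

lemma Diag_add: "bseq \<alpha> \<Longrightarrow> bseq \<beta> \<Longrightarrow> Diag \<alpha> + Diag \<beta> = Diag (\<lambda>i. \<alpha> i + \<beta> i)"
  by (rule blinfun_eqI, rule ell2_eqI) (simp add: Diag_apply_norm bseq_add blinfun.add_left plus_ell2.rep_eq algebra_simps)

lemma Diag_comp: "bseq \<alpha> \<Longrightarrow> bseq \<beta> \<Longrightarrow> Diag \<alpha> o\<^sub>L Diag \<beta> = Diag (\<lambda>i. \<alpha> i * \<beta> i)"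
  by (rule blinfun_eqI, rule ell2_eqI) (simp add: Diag_apply_norm bseq_mult mult.assoc)

lemma csL_Diag:
  assumes a: "bseq \<alpha>" shows "csL c (Diag \<alpha>) = Diag (\<lambda>i. csc c (\<alpha> i))"
proof -
  have "(\<lambda>i. csc c (\<alpha> i)) = (\<lambda>i. (Re c *\<^sub>R 1 + Im c *\<^sub>R iu) * \<alpha> i)" by (simp add: fun_eq_iff csc_def algebra_simps)
  then have b: "bseq (\<lambda>i. csc c (\<alpha> i))" using bseq_mult[OF bseq_const a, of "Re c *\<^sub>R 1 + Im c *\<^sub>R iu"] by simp
  show "csL c (Diag \<alpha>) = Diag (\<lambda>i. csc c (\<alpha> i))"
    by (rule blinfun_eqI, rule ell2_eqI)
      (simp add: Diag_apply_norm(1)[OF a] Diag_apply_norm(1)[OF b] csL_apply plus_ell2.rep_eq scaleR_ell2.rep_eq Rep_JL, simp add: csc_def algebra_simps)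
qed

lemma Diag_diff_norm:
  assumes "bseq \<alpha>" "bseq \<beta>" "\<And>i. norm (\<alpha> i - \<beta> i) \<le> K" shows "norm (Diag \<alpha> - Diag \<beta>) \<le> K"
proof -
  have b: "bseq (\<lambda>i. \<alpha> i - \<beta> i)" using assms(3) by (rule bseqI)
  have "Diag \<alpha> - Diag \<beta> = Diag (\<lambda>i. \<alpha> i - \<beta> i)"
    by (rule blinfun_eqI, rule ell2_eqI) (simp add: Diag_apply_norm assms b blinfun.diff_left minus_ell2.rep_eq algebra_simps)
  then show ?thesis using Diag_apply_norm(2)[OF b assms(3)] by simp
qed

lemma opnorm_cong:
  assumes "\<And>x. x \<in> hcarr X \<Longrightarrow> U x = V x" shows "opnorm A X U = opnorm A X V"
  unfolding opnorm_def by (intro arg_cong[where f=Sup] Collect_cong ex_cong1) (auto simp: assms)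

lemma (in precorr) defect_eta: "(\<lambda>z. hpls X (phi a z) (hscl X (-1) (thsum X l z))) = defect a l"
  by (simp add: fun_eq_iff defect_def)

text \<open>The type of the codes is left open here; \<open>faithful_extension\<close> chooses the
  element type of \<open>OX\<close>, where the universal property of \<open>OY\<close> is
  available.\<close>

locale tail_ext = precorr A X phi for A :: "'a cstar" and X :: "('x, 'a) hmod" and phi +
  fixes OX :: "'c cstar" and pX :: "'a \<Rightarrow> 'c" and tX :: "'x \<Rightarrow> 'c" and enc :: "('c mul ell2 \<Rightarrow>\<^sub>L 'c mul ell2) \<Rightarrow> 'd"
  assumes coiso: "coisometric A X phi (JX A X phi) OX pX tX"
    and inj: "inj_on enc {U. (\<exists>V. ell2.AD U V) \<and> (\<forall>i j. ent U i j \<in> emb OX ` carr OX)}"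
begin

lemma rep: "is_rep A X phi OX pX tX" and cstar_OX: "cstar_alg OX" and hom_pX: "star_hom A OX pX"
  using coiso unfolding coisometric_def is_rep_def by blast+

sublocale O: cstar_record OX by (rule cstar_record.intro[OF cstar_OX])

sublocale coded_ops "emb OX ` carr OX" enc
proof
  show "closed (emb OX ` carr OX)" by (rule O.closed_emb)
  show "0 \<in> emb OX ` carr OX" using O.emb_zer O.zer_carr by (metis imageI)
  fix x y assume "x \<in> emb OX ` carr OX"
  then obtain a where a: "x = emb OX a" "a \<in> carr OX" by blast
  show "csc c x \<in> emb OX ` carr OX" for c using a by (simp flip: O.emb_scl)
  show "st x \<in> emb OX ` carr OX" using a by (simp flip: O.emb_str)
  assume "y \<in> emb OX ` carr OX"
  then obtain b where b: "y = emb OX b" "b \<in> carr OX" by blast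
  show "x + y \<in> emb OX ` carr OX" "x * y \<in> emb OX ` carr OX" using a b by (simp_all flip: O.emb_pls O.emb_mlt)
qed (rule inj)

lemma pX_carr [simp]: "a \<in> carr A \<Longrightarrow> pX a \<in> carr OX" and tX_carr [simp]: "x \<in> hcarr X \<Longrightarrow> tX x \<in> carr OX"
  using rep unfolding is_rep_def star_hom_def by blast+

definition P :: "'a \<Rightarrow> 'c mul" where "P a = emb OX (pX a)"
definition Q :: "'x \<Rightarrow> 'c mul" where "Q x = emb OX (tX x)"

lemma P_pls: "a \<in> carr A \<Longrightarrow> b \<in> carr A \<Longrightarrow> P (pls A a b) = P a + P b"
  and P_mlt: "a \<in> carr A \<Longrightarrow> b \<in> carr A \<Longrightarrow> P (mlt A a b) = P a * P b"
  and P_scl: "a \<in> carr A \<Longrightarrow> P (scl A c a) = csc c (P a)"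
  and P_str: "a \<in> carr A \<Longrightarrow> P (str A a) = st (P a)"
  using hom_pX unfolding star_hom_def P_def by (simp_all add: O.emb_pls O.emb_mlt O.emb_scl O.emb_str)

lemma Q_hpls: "x \<in> hcarr X \<Longrightarrow> y \<in> hcarr X \<Longrightarrow> Q (hpls X x y) = Q x + Q y"
  and Q_hscl: "x \<in> hcarr X \<Longrightarrow> Q (hscl X c x) = csc c (Q x)"
  and Q_Q: "x \<in> hcarr X \<Longrightarrow> y \<in> hcarr X \<Longrightarrow> st (Q x) * Q y = P (inr X x y)"
  and Q_phi: "a \<in> carr A \<Longrightarrow> x \<in> hcarr X \<Longrightarrow> Q (phi a x) = P a * Q x"
  and Q_ract: "a \<in> carr A \<Longrightarrow> x \<in> hcarr X \<Longrightarrow> Q (ract X x a) = Q x * P a"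
  using rep unfolding is_rep_def P_def Q_def by (simp_all add: O.emb_pls O.emb_scl flip: O.emb_mlt O.emb_str)

lemma P_zer [simp]: "P (zer A) = 0"
  using P_scl[of "zer A" 0] by (simp add: csc_def)

lemma Q_hzer [simp]: "Q (hzer X) = 0"
  using Q_hscl[of "hzer X" 0] by (simp add: csc_def)

lemma P_mns: "a \<in> carr A \<Longrightarrow> b \<in> carr A \<Longrightarrow> P (mns A a b) = P a - P b"
  by (simp add: mns_def P_pls P_scl)

lemma norm_P: "a \<in> carr A \<Longrightarrow> norm (P a) \<le> nrm A a"
  unfolding P_def by (simp add: O.norm_emb star_hom_contractive[OF A cstar_OX hom_pX])

lemma P_mem: "a \<in> carr A \<Longrightarrow> P a \<in> emb OX ` carr OX" and Q_mem: "x \<in> hcarr X \<Longrightarrow> Q x \<in> emb OX ` carr OX"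
  by (simp_all add: P_def Q_def)

text \<open>The kernel acts as zero on X, so its image annihilates the image of X. This
  orthogonality allows the corner entry and the superdiagonal of \<open>Qop\<close> to coexist in
  one operator.\<close>

lemma P_ker_Q: "g \<in> I \<Longrightarrow> x \<in> hcarr X \<Longrightarrow> P g * Q x = 0"
  using Q_phi[of g x] ker_carr[of g] by (simp add: kerphi_def)

lemma st_Q_P_ker: "g \<in> I \<Longrightarrow> x \<in> hcarr X \<Longrightarrow> st (Q x) * P g = 0"
proof -
  assume g: "g \<in> I" and x: "x \<in> hcarr X"
  have z: "st (P g) * Q x = 0" using P_ker_Q[OF ker_str[OF g] x] ker_carr[OF g] by (simp add: P_str)
  have "st (st (P g) * Q x) = st 0" by (simp only: z)
  then show ?thesis by simp
qed

lemma bseq_P: "f \<in> T \<Longrightarrow> bseq (\<lambda>i. P (f i))"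
  using norm_P[OF tail_carr] nrm_le_tnorm by (intro bseqI[of _ "tnorm f"]) (meson order_trans)

lemma coef_carr: "a \<in> carr A \<Longrightarrow> f \<in> T \<Longrightarrow> coef a f i \<in> carr A"
  using tail_carr[of f "i - 1"] by (simp add: coef_def)

lemma bseq_coef:
  assumes "a \<in> carr A" "f \<in> T" shows "bseq (\<lambda>i. P (coef a f i))"
proof (rule bseqI[of _ "max (nrm A a) (tnorm f)"])
  fix i
  have "nrm A (coef a f i) \<le> max (nrm A a) (tnorm f)" using nrm_le_tnorm[OF assms(2), of "i - 1"] by (auto simp: coef_def)
  then show "norm (P (coef a f i)) \<le> max (nrm A a) (tnorm f)" using norm_P[OF coef_carr[OF assms]] by (meson order_trans)
qed

definition Pop :: "'a \<times> (nat \<Rightarrow> 'a) \<Rightarrow> 'c mul ell2 \<Rightarrow>\<^sub>L 'c mul ell2" where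
  "Pop b = Diag (\<lambda>i. P (coef (fst b) (snd b) i))"

definition Qop :: "'x \<times> (nat \<Rightarrow> 'a) \<Rightarrow> 'c mul ell2 \<Rightarrow>\<^sub>L 'c mul ell2" where
  "Qop y = Diag (e0 (Q (fst y))) + (Diag (\<lambda>i. P (snd y i)) o\<^sub>L Shift)"

definition Qst :: "'x \<times> (nat \<Rightarrow> 'a) \<Rightarrow> 'c mul ell2 \<Rightarrow>\<^sub>L 'c mul ell2" where
  "Qst y = Diag (\<lambda>i. st (e0 (Q (fst y)) i)) + (Unshift o\<^sub>L Diag (\<lambda>i. st (P (snd y i))))"

lemma Pop_apply: "a \<in> carr A \<Longrightarrow> f \<in> T \<Longrightarrow> Rep_ell2 (Pop (a, f) v) i = P (coef a f i) * Rep_ell2 v i"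
  by (simp add: Pop_def Diag_apply_norm bseq_coef)

lemma Qop_apply: "g \<in> T \<Longrightarrow> Rep_ell2 (Qop (x, g) v) i = (if i = 0 then Q x * Rep_ell2 v 0 else 0) + P (g i) * Rep_ell2 v (Suc i)"
  by (simp add: Qop_def Diag_apply_norm bseq_P bseq_e0 blinfun.add_left plus_ell2.rep_eq Shift_apply) (simp add: e0_def)

lemma Qst_apply: "g \<in> T \<Longrightarrow> Rep_ell2 (Qst (x, g) v) i = (if i = 0 then st (Q x) * Rep_ell2 v 0 else st (P (g (i - 1))) * Rep_ell2 v (i - 1))"
  by (simp add: Qst_def Diag_apply_norm bseq_P bseq_st bseq_e0 blinfun.add_left plus_ell2.rep_eq Unshift_apply) (simp add: e0_def)

lemma AD_Qop: "g \<in> T \<Longrightarrow> ell2.AD (Qop (x, g)) (Qst (x, g))"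
  unfolding Qop_def Qst_def by (intro ell2.AD_add ell2.AD_comp AD_Diag AD_Shift) (simp_all add: bseq_P bseq_e0)

lemma Pop_G [simp]: "a \<in> carr A \<Longrightarrow> f \<in> T \<Longrightarrow> Pop (a, f) \<in> G"
  using GI[OF AD_Diag[OF bseq_coef]] by (simp add: Pop_def ent_Diag bseq_coef P_mem coef_carr S_zero)

lemma Qop_G [simp]: "x \<in> hcarr X \<Longrightarrow> g \<in> T \<Longrightarrow> Qop (x, g) \<in> G"
proof (rule GI[OF AD_Qop])
  fix i j assume x: "x \<in> hcarr X" and g: "g \<in> T"
  have "ent (Qop (x, g)) i j = (if i = j then e0 (Q x) i else 0) + P (g i) * (if Suc i = j then 1 else 0)"
    by (simp add: Qop_def ent_add ent_Diag bseq_e0 ent_Diag_comp bseq_P g ent_Shift)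
  also have "\<dots> \<in> emb OX ` carr OX"
    using Q_mem[OF x] P_mem[OF tail_carr[OF g]] S_zero by (intro S_add) (auto simp: e0_def)
  finally show "ent (Qop (x, g)) i j \<in> emb OX ` carr OX" .
qed

lemma adj_Pop: "a \<in> carr A \<Longrightarrow> f \<in> T \<Longrightarrow> ell2.adj (Pop (a, f)) = Pop (str A a, \<lambda>n. str A (f n))"
proof -
  assume a: "a \<in> carr A" and f: "f \<in> T"
  have "(\<lambda>i. st (P (coef a f i))) = (\<lambda>i. P (coef (str A a) (\<lambda>n. str A (f n)) i))"
    using a tail_carr[OF f] by (auto simp: coef_def P_str)
  then show ?thesis using ell2.adj_eq[OF AD_Diag[OF bseq_coef[OF a f]]] by (simp add: Pop_def)
qed

lemma adj_Qop: "g \<in> T \<Longrightarrow> ell2.adj (Qop (x, g)) = Qst (x, g)"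
  by (rule ell2.adj_eq[OF AD_Qop])

definition pC :: "'a \<times> (nat \<Rightarrow> 'a) \<Rightarrow> 'd" where "pC b = enc (Pop b)"
definition tC :: "'x \<times> (nat \<Rightarrow> 'a) \<Rightarrow> 'd" where "tC y = enc (Qop y)"

lemma rep_C: "is_rep B Y phiB Crec pC tC"
  unfolding is_rep_def star_hom_def
proof (intro conjI cstar_Crec ballI allI)
  fix x y c assume "x \<in> carr B"
  then obtain a f where x: "x = (a, f)" "a \<in> carr A" "f \<in> T" by auto
  note [simp] = tail_carr[OF x(3)] tail_ker[OF x(3)]
  show "pC x \<in> carr Crec" "pC (str B x) = str Crec (pC x)" using x by (simp_all add: pC_def adj_Pop)
  show "pC (scl B c x) = scl Crec c (pC x)"
    using x by (simp add: pC_def) (simp add: Pop_def csL_Diag bseq_coef, rule arg_cong[where f=enc], rule arg_cong[where f=Diag], simp add: fun_eq_iff coef_def P_scl)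
  {
    assume "y \<in> carr B"
    then obtain b g where y: "y = (b, g)" "b \<in> carr A" "g \<in> T" by auto
    note [simp] = tail_carr[OF y(3)] tail_ker[OF y(3)]
    have "Pop (pls B x y) = Pop x + Pop y"
      using x y by (simp add: Pop_def Diag_add bseq_coef) (rule arg_cong[where f=Diag], simp add: fun_eq_iff coef_def P_pls)
    then show "pC (pls B x y) = pls Crec (pC x) (pC y)" using x y by (simp add: pC_def)
    have "Pop (mlt B x y) = Pop x o\<^sub>L Pop y"
      using x y by (simp add: Pop_def Diag_comp bseq_coef) (rule arg_cong[where f=Diag], simp add: fun_eq_iff coef_def P_mlt)
    then show "pC (mlt B x y) = mlt Crec (pC x) (pC y)" using x y by (simp add: pC_def)
  }
  {
    assume "y \<in> hcarr Y"
    then obtain b g where y: "y = (b, g)" "b \<in> hcarr X" "g \<in> T" by auto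
    note [simp] = tail_carr[OF y(3)] tail_ker[OF y(3)]
    have T1: "(\<lambda>n. if n = 0 then mlt A a (g 0) else mlt A (f (n - 1)) (g n)) \<in> T" using x y by simp
    have "Qop (phiB x y) = Pop x o\<^sub>L Qop y"
      using x y by (intro op_eqI) (auto simp: Qop_apply Pop_apply T1 coef_def Q_phi P_mlt algebra_simps)
    then show "tC (phiB x y) = mlt Crec (pC x) (tC y)" using x y by (simp add: pC_def tC_def)
    have "Qop (ract Y y x) = Qop y o\<^sub>L Pop x"
      using x y by (intro op_eqI) (auto simp: Qop_apply Pop_apply coef_def Q_ract P_mlt algebra_simps)
    then show "tC (ract Y y x) = mlt Crec (tC y) (pC x)" using x y by (simp add: pC_def tC_def)
  }
next
  fix x y c assume "x \<in> hcarr Y"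
  then obtain a f where x: "x = (a, f)" "a \<in> hcarr X" "f \<in> T" by auto
  note [simp] = tail_carr[OF x(3)] tail_ker[OF x(3)]
  show "tC x \<in> carr Crec" using x by (simp add: tC_def)
  have "Qop (hscl Y c x) = csL c (Qop x)"
    using x by (intro op_eqI) (simp add: Qop_apply csL_apply plus_ell2.rep_eq scaleR_ell2.rep_eq Rep_JL P_scl Q_hscl csc_def algebra_simps)
  then show "tC (hscl Y c x) = scl Crec c (tC x)" using x by (simp add: tC_def)
  assume "y \<in> hcarr Y"
  then obtain b g where y: "y = (b, g)" "b \<in> hcarr X" "g \<in> T" by auto
  note [simp] = tail_carr[OF y(3)] tail_ker[OF y(3)]
  have "Qop (hpls Y x y) = Qop x + Qop y"
    using x y by (intro op_eqI) (simp add: Qop_apply blinfun.add_left plus_ell2.rep_eq P_pls Q_hpls algebra_simps)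
  then show "tC (hpls Y x y) = pls Crec (tC x) (tC y)" using x y by (simp add: tC_def)
  \<comment> \<open>These are the cross terms between the corner entry of one operator and the
    superdiagonal of the other; with them gone the product is diagonal.\<close>
  have z: "st (P (f i)) * Q b = 0" "st (Q a) * P (g i) = 0" "st (P (f i)) * (Q b * w) = 0" "st (Q a) * (P (g i) * w) = 0" for i w
    using P_ker_Q[OF ker_str[OF tail_ker[OF x(3)]] y(2), of i] st_Q_P_ker[OF tail_ker[OF y(3)] x(2), of i]
    by (simp_all add: P_str flip: mult.assoc)
  have "Qst x o\<^sub>L Qop y = Pop (inr Y x y)"
    using x y by (intro op_eqI) (auto simp: Qst_apply Qop_apply Pop_apply coef_def z P_mlt P_str algebra_simps Q_Q le_Suc_eq simp flip: mult.assoc)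
  then show "mlt Crec (str Crec (tC x)) (tC y) = pC (inr Y x y)"
    using x y G_adj[OF Qop_G[OF x(2,3)]] by (simp add: pC_def tC_def adj_Qop)
qed

text \<open>The diagonal that the rank-one sums of Y produce under the extended representation. At
  position 0 the contribution of X and that of tail coordinate 0 add up.\<close>

definition beta :: "(('x \<times> (nat \<Rightarrow> 'a)) \<times> ('x \<times> (nat \<Rightarrow> 'a))) list \<Rightarrow> nat \<Rightarrow> 'c mul" where
  "beta l i = e0 (emb OX (tsum OX tX (xlist l))) i + P (csum l i)"

lemma tsum_carr: "set l \<subseteq> hcarr X \<times> hcarr X \<Longrightarrow> tsum OX tX l \<in> carr OX"
  unfolding tsum_def by (induction l) auto

lemma bseq_beta: "set l \<subseteq> hcarr Y \<times> hcarr Y \<Longrightarrow> bseq (beta l)"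
  unfolding beta_def[abs_def] by (intro bseq_add bseq_e0 bseq_P csum_T)

lemma beta_G: "set l \<subseteq> hcarr Y \<times> hcarr Y \<Longrightarrow> Diag (beta l) \<in> G"
proof (rule GI[OF AD_Diag[OF bseq_beta]])
  fix i j assume l: "set l \<subseteq> hcarr Y \<times> hcarr Y"
  have "beta l i \<in> emb OX ` carr OX" unfolding beta_def e0_def
    using tsum_carr[OF xlist_carr[OF l]] P_mem[OF tail_carr[OF csum_T[OF l]]] S_zero by (intro S_add) auto
  then show "ent (Diag (beta l)) i j \<in> emb OX ` carr OX" using S_zero by (cases "i = j") (simp_all add: ent_Diag[OF bseq_beta[OF l]])
qed

text \<open>The corner entry sits in column 0 and the superdiagonal in columns 1, 2 and so on. A
  product \<open>Qop\<close> times an adjoint is therefore diagonal by the shape of the matrices,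
  with no relation in \<open>OX\<close> involved.\<close>

lemma tsum_C: "set l \<subseteq> hcarr Y \<times> hcarr Y \<Longrightarrow> tsum Crec tC l = enc (Diag (beta l))"
proof (induction l)
  case Nil
  have "Diag (beta []) = 0"
    by (rule op_eqI) (simp add: Diag_apply_norm bseq_beta zero_ell2.rep_eq, simp add: beta_def e0_def tsum_def)
  then show ?case by (simp add: tsum_def)
next
  case (Cons p l)
  obtain \<xi> g \<eta> h where p: "p = ((\<xi>, g), (\<eta>, h))" by (metis prod.exhaust)
  have gh: "g \<in> T" "h \<in> T" "\<xi> \<in> hcarr X" "\<eta> \<in> hcarr X" and l: "set l \<subseteq> hcarr Y \<times> hcarr Y" using Cons.prems p by auto
  have gG: "Qop (\<xi>, g) o\<^sub>L Qst (\<eta>, h) \<in> G" using gh by (simp flip: adj_Qop)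
  have "(Qop (\<xi>, g) o\<^sub>L Qst (\<eta>, h)) + Diag (beta l) = Diag (beta (p # l))"
  proof (rule op_eqI)
    fix v i
    have t: "tsum OX tX (xlist (p # l)) = pls OX (mlt OX (tX \<xi>) (str OX (tX \<eta>))) (tsum OX tX (xlist l))"
      by (simp add: p tsum_def)
    have q: "emb OX (tsum OX tX (xlist (p # l))) = Q \<xi> * st (Q \<eta>) + emb OX (tsum OX tX (xlist l))"
      unfolding t Q_def using gh tsum_carr[OF xlist_carr[OF l]] by (simp add: O.emb_pls O.emb_mlt O.emb_str)
    have c: "P (csum (p # l) i) = P (g i) * st (P (h i)) + P (csum l i)" for i
      using gh tail_carr[OF gh(1)] tail_carr[OF gh(2)] tail_carr[OF csum_T[OF l]] by (simp add: p P_pls P_mlt P_str)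
    show "Rep_ell2 (((Qop (\<xi>, g) o\<^sub>L Qst (\<eta>, h)) + Diag (beta l)) v) i = Rep_ell2 (Diag (beta (p # l)) v) i"
      using gh l Cons.prems
      by (simp add: blinfun.add_left plus_ell2.rep_eq Diag_apply_norm bseq_beta Qop_apply Qst_apply)
        (simp add: beta_def q c e0_def algebra_simps)
  qed
  moreover have "tsum Crec tC (p # l) = pls Crec (mlt Crec (tC (\<xi>, g)) (str Crec (tC (\<eta>, h)))) (tsum Crec tC l)"
    by (simp add: p tsum_def)
  moreover have "tC (\<xi>, g) = enc (Qop (\<xi>, g))" "tC (\<eta>, h) = enc (Qop (\<eta>, h))" by (simp_all add: tC_def)
  ultimately show ?case using Cons.IH[OF l] gh gG beta_G[OF l] G_adj[OF Qop_G[OF gh(4,2)]] by (simp add: adj_Qop)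
qed

interpretation Yc: precorr B Y phiB by (rule precorr_Y)

text \<open>Given lists that approximate the left action of (a, f), their multipliers on coordinate
  0 converge to some c' in the kernel. The difference d = a - c' lies in J_X, so the X-parts of the
  lists converge to P d, while the superdiagonals supply P c'; together they give P a in the
  corner.\<close>

lemma coiso_C_value:
  assumes a: "a \<in> carr A" "f \<in> T"
  shows "pi1_value B Y Crec tC (phiB (a, f)) (pC (a, f))"
  unfolding pi1_value_def
proof (intro allI impI, elim conjE)
  fix ls :: "nat \<Rightarrow> (('x \<times> (nat \<Rightarrow> 'a)) \<times> ('x \<times> (nat \<Rightarrow> 'a))) list"
  assume ls: "\<forall>n. set (ls n) \<subseteq> hcarr Y \<times> hcarr Y"
    and lim: "(\<lambda>n. opnorm B Y (\<lambda>z. hpls Y (phiB (a, f) z) (hscl Y (-1) (thsum Y (ls n) z)))) \<longlonglongrightarrow> 0"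
  define r where "r n = opnorm B Y (Yc.defect (a, f) (ls n))" for n
  have r: "r \<longlonglongrightarrow> 0" using lim unfolding r_def[abs_def] Yc.defect_def[abs_def] .
  have r0: "0 \<le> r n" for n unfolding r_def by (rule Yc.opnorm_defect_nonneg) (use a ls in auto)
  define c where "c n = csum (ls n) 0" for n
  have cI: "c n \<in> I" and cc: "c n \<in> carr A" for n
    unfolding c_def using tail_ker[OF csum_T] tail_carr[OF csum_T] ls by blast+
  have ac: "nrm A (mlt A (mns A a (c n)) g) \<le> r n * nrm A g" if "g \<in> I" for g n
    using defect_Y_bound(2)[OF a _ that, of "ls n" 0] ls by (simp add: c_def r_def coef_def)
  \<comment> \<open>Differences of the \<open>c n\<close> lie in the kernel and can be tested on
    their own adjoints, and \<open>a\<close> cancels; only products of a - c n with kernel elements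
    are controlled.\<close>
  have cau: "norm (emb A (c n) - emb A (c m)) \<le> r n + r m" for n m
  proof -
    define k where "k = mns A (c n) (c m)"
    have k: "k \<in> I" "k \<in> carr A" using cI cc by (simp_all add: k_def)
    let ?E = "emb A"
    have ek: "?E k = ?E (c n) - ?E (c m)" using cc by (simp add: k_def A.emb_mns)
    have "(norm (?E k))\<^sup>2 = norm (?E k * st (?E k))" using norm_st_mult[of "st (?E k)"] by simp
    also have "?E k * st (?E k) = (?E a - ?E (c m)) * st (?E k) - (?E a - ?E (c n)) * st (?E k)"
      by (subst ek) (simp add: algebra_simps)
    also have "norm \<dots> \<le> norm ((?E a - ?E (c m)) * st (?E k)) + norm ((?E a - ?E (c n)) * st (?E k))"
      by (rule norm_triangle_ineq4)
    also have "\<dots> \<le> r m * norm (?E k) + r n * norm (?E k)"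
    proof -
      have "norm ((?E a - ?E (c m)) * st (?E k)) \<le> r m * norm (?E k)" for m
        using ac[OF ker_str[OF k(1)], of m] a cc k by (simp add: A.emb_mns A.emb_mlt A.emb_str flip: A.norm_emb)
      then show ?thesis by (intro add_mono)
    qed
    finally have "norm (?E k) * norm (?E k) \<le> (r n + r m) * norm (?E k)" by (simp add: power2_eq_square algebra_simps)
    then have "norm (?E k) \<le> r n + r m" using r0[of n] r0[of m] by (cases "norm (?E k) = 0") (auto simp: mult_le_cancel_right)
    then show ?thesis by (simp add: ek)
  qed
  have "Cauchy (\<lambda>n. emb A (c n))"
  proof (rule CauchyI)
    fix e :: real assume e: "0 < e"
    then obtain N where N: "\<And>n. n \<ge> N \<Longrightarrow> r n < e/2" using LIMSEQ_D[OF r, of "e/2"] r0 by auto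
    have "norm (emb A (c m) - emb A (c n)) < e" if "m \<ge> N" "n \<ge> N" for m n
      using cau[of m n] N[OF that(1)] N[OF that(2)] by linarith
    then show "\<exists>M. \<forall>m\<ge>M. \<forall>n\<ge>M. norm (emb A (c m) - emb A (c n)) < e" by blast
  qed
  then obtain c' where c': "c' \<in> carr A" "(\<lambda>n. emb A (c n)) \<longlonglongrightarrow> emb A c'" using A.Cauchy_emb[of c] cc by blast
  then have c'lim: "(\<lambda>n. nrm A (mns A (c n) c')) \<longlonglongrightarrow> 0" using A.tendsto_emb[of c c'] cc by simp
  have c'I: "c' \<in> I" by (rule ker_closed[OF cI c'(1) c'lim])
  \<comment> \<open>Subtracting a kernel element leaves the action on X unchanged and makes the head
    orthogonal to the kernel, so that \<open>d\<close> lands in J_X.\<close>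
  define d where "d = mns A a c'"
  have d: "d \<in> carr A" using a c' by (simp add: d_def)
  have "mlt A d g = zer A" if g: "g \<in> I" for g
  proof -
    have gc: "g \<in> carr A" using g ker_carr by blast
    have l1: "(\<lambda>n. (emb A a - emb A (c n)) * emb A g) \<longlonglongrightarrow> (emb A a - emb A c') * emb A g" by (intro tendsto_intros c')
    have l2: "(\<lambda>n. (emb A a - emb A (c n)) * emb A g) \<longlonglongrightarrow> 0"
    proof (rule Lim_null_comparison)
      show "\<forall>\<^sub>F n in sequentially. norm ((emb A a - emb A (c n)) * emb A g) \<le> r n * nrm A g"
        using ac[OF g] a cc gc by (simp add: A.emb_mns A.emb_mlt flip: A.norm_emb)
      show "(\<lambda>n. r n * nrm A g) \<longlonglongrightarrow> 0" using tendsto_mult_right[OF r, of "nrm A g"] by simp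
    qed
    have "emb A (mlt A d g) = emb A (zer A)" using LIMSEQ_unique[OF l1 l2] a c' gc by (simp add: d_def A.emb_mlt A.emb_mns)
    then show ?thesis using A.emb_inj[of "mlt A d g" "zer A"] d gc by simp
  qed
  then have perp: "d \<in> perp A I" using d by (simp add: perp_def)
  have pd: "phi d x = phi a x" if "x \<in> hcarr X" for x
    using that a c' c'I by (simp add: d_def phi_diff kerphi_def)
  have od: "opnorm A X (defect d l) = opnorm A X (defect a l)" for l
    by (rule opnorm_cong) (simp add: defect_def pd)
  have bound: "opnorm A X (defect d (xlist (ls n))) \<le> r n" for n
    unfolding od r_def by (rule defect_Y_bound(1)[OF a]) (use ls in blast)
  have "compact_op A X (phi d)"
    unfolding compact_op_def defect_eta
  proof (intro allI impI)
    fix e :: real assume "0 < e"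
    then obtain n where "r n < e" using LIMSEQ_D[OF r, of e] r0 by auto
    then show "\<exists>l. set l \<subseteq> hcarr X \<times> hcarr X \<and> opnorm A X (defect d l) < e"
      using bound[of n] xlist_carr[of "ls n"] ls by (intro exI[of _ "xlist (ls n)"]) auto
  qed
  then have "d \<in> JX A X phi" using d perp by (simp add: JX_def Jid_def)
  then have val: "pi1_value A X OX tX (phi d) (pX d)" using coiso unfolding coisometric_def by blast
  have "(\<lambda>n. opnorm A X (defect d (xlist (ls n)))) \<longlonglongrightarrow> 0"
  proof (rule tendsto_sandwich[OF _ _ tendsto_const r])
    show "\<forall>\<^sub>F n in sequentially. 0 \<le> opnorm A X (defect d (xlist (ls n)))"
      using opnorm_defect_nonneg[OF d xlist_carr] ls by simp
  qed (simp add: bound)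
  then have "(\<lambda>n. nrm OX (mns OX (tsum OX tX (xlist (ls n))) (pX d))) \<longlonglongrightarrow> 0"
    using val[unfolded pi1_value_def defect_eta, rule_format, of "\<lambda>n. xlist (ls n)"] xlist_carr ls by blast
  then have q1: "(\<lambda>n. norm (emb OX (tsum OX tX (xlist (ls n))) - P d)) \<longlonglongrightarrow> 0"
    using tsum_carr[OF xlist_carr] ls d by (simp add: O.nrm_mns P_def)
  define q where "q n = norm (emb OX (tsum OX tX (xlist (ls n))) - P d) + nrm A (mns A (c n) c')" for n
  have q: "q \<longlonglongrightarrow> 0" unfolding q_def[abs_def] using tendsto_add[OF q1 c'lim] by simp
  have q0: "0 \<le> q n" for n using cc c' by (simp add: q_def)
  \<comment> \<open>The bound is uniform in \<open>i\<close>, which is convergence of the diagonal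
    operators in norm. Entry 0 combines the coisometry of X at \<open>d\<close> with the limit c';
    the later entries come from \<open>csum_bound\<close>.\<close>
  have bnd: "norm (beta (ls n) i - P (coef a f i)) \<le> q n + r n" for n i
  proof (cases "i = 0")
    case True
    have "beta (ls n) i - P (coef a f i) = (emb OX (tsum OX tX (xlist (ls n))) - P d) + P (mns A (c n) c')"
      using True a cc c' by (simp add: beta_def e0_def coef_def c_def[symmetric] P_mns d_def)
    also have "norm \<dots> \<le> q n" unfolding q_def using norm_P[of "mns A (c n) c'"] cc c'
      by (intro order_trans[OF norm_triangle_ineq] add_left_mono) simp
    finally show ?thesis using r0[of n] by linarith
  next
    case False
    then obtain j where j: "i = Suc j" using not0_implies_Suc by blast
    have fc: "f j \<in> carr A" "csum (ls n) (Suc j) \<in> carr A" using tail_carr[OF a(2)] tail_carr[OF csum_T] ls by blast+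
    have "beta (ls n) i - P (coef a f i) = - P (mns A (f j) (csum (ls n) (Suc j)))"
      using fc by (simp add: beta_def e0_def coef_def j P_mns)
    also have "norm \<dots> \<le> r n" using norm_P[of "mns A (f j) (csum (ls n) (Suc j))"] fc csum_bound[OF a, of "ls n" j] ls
      by (simp add: r_def)
    finally show ?thesis using q0[of n] by linarith
  qed
  have "(\<lambda>n. norm (Diag (beta (ls n)) - Pop (a, f))) \<longlonglongrightarrow> 0"
  proof (rule tendsto_sandwich[OF _ _ tendsto_const])
    show "\<forall>\<^sub>F n in sequentially. norm (Diag (beta (ls n)) - Pop (a, f)) \<le> q n + r n"
      using bnd ls a by (simp add: Pop_def Diag_diff_norm bseq_beta bseq_coef)
    show "(\<lambda>n. q n + r n) \<longlonglongrightarrow> 0" using tendsto_add[OF q r] by simp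
  qed simp
  moreover have "nrm Crec (mns Crec (tsum Crec tC (ls n)) (pC (a, f))) = norm (Diag (beta (ls n)) - Pop (a, f))" for n
    using a ls beta_G[of "ls n"] G_add[OF beta_G[of "ls n"] G_minus[OF Pop_G[OF a]]] by (simp add: tsum_C pC_def mns_Crec)
  ultimately show "(\<lambda>n. nrm Crec (mns Crec (tsum Crec tC (ls n)) (pC (a, f)))) \<longlonglongrightarrow> 0" by simp
qed

lemma coiso_C: "coisometric B Y phiB (Jid B Y phiB) Crec pC tC"
  unfolding coisometric_def
proof (intro conjI rep_C ballI)
  fix b assume "b \<in> Jid B Y phiB"
  then obtain a f where "b = (a, f)" "a \<in> carr A" "f \<in> T" by (auto simp: Jid_def)
  then show "pi1_value B Y Crec tC (phiB b) (pC b)" using coiso_C_value by blast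
qed

definition kap :: "'c \<Rightarrow> 'd" where "kap x = enc (Diag (e0 (emb OX x)))"

lemma kap_G: "x \<in> carr OX \<Longrightarrow> Diag (e0 (emb OX x)) \<in> G"
proof (rule GI[OF AD_Diag[OF bseq_e0]])
  fix i j assume "x \<in> carr OX"
  then show "ent (Diag (e0 (emb OX x))) i j \<in> emb OX ` carr OX"
    using S_zero by (simp add: ent_Diag bseq_e0) (simp add: e0_def)
qed

lemma nrm_kap: "x \<in> carr OX \<Longrightarrow> nrm Crec (kap x) = nrm OX x"
  by (simp add: kap_def kap_G Diag_e0_norm O.norm_emb)

lemma star_hom_kap: "star_hom OX Crec kap"
  unfolding star_hom_def
proof (intro conjI ballI allI)
  fix x y c assume x: "x \<in> carr OX"
  show "kap x \<in> carr Crec" using x by (simp add: kap_def kap_G)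
  have "Diag (e0 (emb OX (scl OX c x))) = csL c (Diag (e0 (emb OX x)))"
    using x by (simp add: csL_Diag bseq_e0) (rule arg_cong[where f=Diag], auto simp: e0_def O.emb_scl csc_def)
  then show "kap (scl OX c x) = scl Crec c (kap x)" using x by (simp add: kap_def kap_G)
  have "ell2.adj (Diag (e0 (emb OX x))) = Diag (e0 (emb OX (str OX x)))"
    using x by (intro ell2.adj_eq) (use AD_Diag[OF bseq_e0, of "emb OX x"] in \<open>simp add: e0_def[abs_def] O.emb_str if_distrib[of st] cong: if_cong\<close>)
  then show "kap (str OX x) = str Crec (kap x)" using x by (simp add: kap_def kap_G)
  assume y: "y \<in> carr OX"
  have "Diag (e0 (emb OX (pls OX x y))) = Diag (e0 (emb OX x)) + Diag (e0 (emb OX y))"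
    using x y by (simp add: Diag_add bseq_e0) (rule arg_cong[where f=Diag], auto simp: e0_def O.emb_pls)
  then show "kap (pls OX x y) = pls Crec (kap x) (kap y)" using x y by (simp add: kap_def kap_G)
  have "Diag (e0 (emb OX (mlt OX x y))) = Diag (e0 (emb OX x)) o\<^sub>L Diag (e0 (emb OX y))"
    using x y by (simp add: Diag_comp bseq_e0) (rule arg_cong[where f=Diag], auto simp: e0_def O.emb_mlt)
  then show "kap (mlt OX x y) = mlt Crec (kap x) (kap y)" using x y by (simp add: kap_def kap_G)
qed

lemma kap_pX: "a \<in> carr A \<Longrightarrow> kap (pX a) = pC (a, \<lambda>n. zer A)"
  unfolding kap_def pC_def Pop_def
  by (rule arg_cong[where f=enc], rule arg_cong[where f=Diag]) (auto simp: e0_def coef_def P_def[symmetric])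

lemma kap_tX: "x \<in> hcarr X \<Longrightarrow> kap (tX x) = tC (x, \<lambda>n. zer A)"
  unfolding kap_def tC_def
  by (rule arg_cong[where f=enc], rule op_eqI) (simp add: Qop_apply Diag_apply_norm bseq_e0, simp add: e0_def Q_def[symmetric])

end

lemma ratio_le: "0 \<le> n \<Longrightarrow> 0 < e \<Longrightarrow> e / (n + 1) * n \<le> (e :: real)"
  by (simp add: pos_divide_le_eq algebra_simps)

section \<open>The corner\<close>

text \<open>Claims about the whole of O_Y are proved below by showing that the elements with a given
  property form a \<open>ccl\<close> or \<open>csub\<close> set that contains the generators, which
  replaces arguments with words and limits.\<close>

definition ccl :: "'o::cst1 set \<Rightarrow> bool" where
  "ccl K \<longleftrightarrow> closed K \<and> 0 \<in> K \<and> (\<forall>x\<in>K. \<forall>y\<in>K. x + y \<in> K) \<and> (\<forall>c. \<forall>x\<in>K. csc c x \<in> K)"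

definition csub :: "'o::cst1 set \<Rightarrow> bool" where
  "csub K \<longleftrightarrow> ccl K \<and> (\<forall>x\<in>K. \<forall>y\<in>K. x * y \<in> K) \<and> (\<forall>x\<in>K. st x \<in> K)"

lemma ccl_add: "ccl K \<Longrightarrow> x \<in> K \<Longrightarrow> y \<in> K \<Longrightarrow> x + y \<in> K"
  and ccl_csc: "ccl K \<Longrightarrow> x \<in> K \<Longrightarrow> csc c x \<in> K"
  and ccl_zero: "ccl K \<Longrightarrow> 0 \<in> K" and ccl_closed: "ccl K \<Longrightarrow> closed K"
  by (simp_all add: ccl_def)

lemma ccl_minus: "ccl K \<Longrightarrow> x \<in> K \<Longrightarrow> - x \<in> K"
  using ccl_csc[of K x "-1"] by simp

lemma ccl_diff: "ccl K \<Longrightarrow> x \<in> K \<Longrightarrow> y \<in> K \<Longrightarrow> x - y \<in> K"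
  using ccl_add[OF _ _ ccl_minus, of K x y] by simp

lemma ccl_approx:
  assumes K: "ccl K" and a: "\<And>e. 0 < e \<Longrightarrow> \<exists>y\<in>K. norm (x - y) \<le> e" shows "x \<in> K"
proof -
  have "\<forall>e>0. \<exists>y\<in>K. dist y x < e"
  proof (intro allI impI)
    fix e :: real assume "0 < e"
    then obtain y where "y \<in> K" "norm (x - y) \<le> e/2" using a[of "e/2"] by auto
    then show "\<exists>y\<in>K. dist y x < e" using \<open>0 < e\<close> by (intro bexI[of _ y]) (simp_all add: dist_norm norm_minus_commute)
  qed
  then show ?thesis using ccl_closed[OF K] closed_approachable by blast
qed

lemma csub_ccl: "csub K \<Longrightarrow> ccl K" and csub_mult: "csub K \<Longrightarrow> x \<in> K \<Longrightarrow> y \<in> K \<Longrightarrow> x * y \<in> K"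
  and csub_st: "csub K \<Longrightarrow> x \<in> K \<Longrightarrow> st x \<in> K"
  by (simp_all add: csub_def)

lemma csc_zero [simp]: "csc c 0 = 0" and csc_mult_left: "csc c x * y = csc c (x * y)"
  by (simp_all add: csc_def algebra_simps)

lemma csc_mult_right: "x * csc c y = csc c (x * y)"
proof -
  have "x * (iu * y) = iu * (x * y)" by (metis iu_comm mult.assoc)
  then show ?thesis by (simp add: csc_def algebra_simps)
qed

lemma st_csc: "st (csc c x) = csc (cnj c) (st x)"
  by (simp add: csc_def iu_comm)

lemma csc_diff: "csc c (x - y) = csc c x - csc c y"
  by (simp add: csc_def algebra_simps)

lemma bounded_linear_csc: "bounded_linear (csc c :: 'o::cst1 \<Rightarrow> 'o)"
proof -
  have "csc c = (\<lambda>x::'o. csc c 1 * x)" by (simp add: fun_eq_iff csc_mult_left)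
  then show ?thesis using bounded_linear_mult_right[of "csc c (1::'o)"] by simp
qed

lemma ccl_Int: "ccl K \<Longrightarrow> ccl L \<Longrightarrow> ccl (K \<inter> L)"
  by (auto simp: ccl_def closed_Int)

lemma ccl_vimage:
  fixes f :: "'o::cst1 \<Rightarrow> 'o"
  assumes K: "ccl K" and f: "continuous_on UNIV f" "\<And>x y. f (x + y) = f x + f y" "\<And>c x. f (csc c x) = csc c (f x) \<or> f (csc c x) = csc (cnj c) (f x)"
  shows "ccl {x. f x \<in> K}"
  unfolding ccl_def
proof (intro conjI ballI allI)
  show "closed {x. f x \<in> K}" using closed_vimage[OF ccl_closed[OF K] f(1)] by (simp add: vimage_def)
  have "f 0 = 0" using f(2)[of 0 0] by simp
  then show "0 \<in> {x. f x \<in> K}" using ccl_zero[OF K] by simp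
  show "csc c x \<in> {x. f x \<in> K}" if "x \<in> {x. f x \<in> K}" for c x using f(3)[of c x] that ccl_csc[OF K] by auto
qed (use f K in \<open>auto intro: ccl_add\<close>)

lemma ccl_mult_right: "ccl K \<Longrightarrow> ccl {x. x * u \<in> K}" and ccl_mult_left: "ccl K \<Longrightarrow> ccl {x. u * x \<in> K}"
  and ccl_mult_right_st: "ccl K \<Longrightarrow> ccl {x. u * st x \<in> K}"
  by (rule ccl_vimage, assumption, auto intro!: continuous_intros simp: algebra_simps csc_mult_left csc_mult_right st_csc)+

lemma ccl_INT: "(\<And>i. i \<in> F \<Longrightarrow> ccl (K i)) \<Longrightarrow> ccl (\<Inter>i\<in>F. K i)"
  by (auto simp: ccl_def intro!: closed_INT)

lemma ccl_trivial: "ccl {0::'o::cst1}"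
  by (simp add: ccl_def)

definition chull :: "'o::cst1 set \<Rightarrow> 'o set" where "chull S = \<Inter>{K. ccl K \<and> S \<subseteq> K}"

lemma chull_ccl: "ccl (chull S)"
  unfolding chull_def ccl_def by (auto intro: closed_Inter)

lemma chull_subset: "S \<subseteq> chull S"
  unfolding chull_def by blast

lemma chull_least: "ccl K \<Longrightarrow> S \<subseteq> K \<Longrightarrow> chull S \<subseteq> K"
  unfolding chull_def by blast

context cstar_record
begin

lemma closed_subspace_emb:
  assumes D: "closed_subspace C D" shows "ccl (emb C ` D)"
proof -
  have DC: "D \<subseteq> carr C" using D unfolding closed_subspace_def by blast
  note cd = subsetD[OF DC]
  show ?thesis unfolding ccl_def
  proof (intro conjI ballI allI)
    show "0 \<in> emb C ` D" using D emb_zer unfolding closed_subspace_def by (metis imageI)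
    show "closed (emb C ` D)"
      unfolding closed_sequential_limits
    proof (intro allI impI, elim conjE)
      fix X L assume "\<forall>n. X n \<in> emb C ` D" and L: "X \<longlonglongrightarrow> L"
      then have "\<forall>n. \<exists>x. x \<in> D \<and> X n = emb C x" by blast
      then obtain x where x: "\<forall>n. x n \<in> D \<and> X n = emb C (x n)" using choice by metis
      then have X: "X = (\<lambda>n. emb C (x n))" by auto
      obtain a where a: "a \<in> carr C" "X \<longlonglongrightarrow> emb C a"
        using Cauchy_emb[of x] LIMSEQ_imp_Cauchy[OF L] x cd unfolding X by metis
      then have "(\<lambda>n. nrm C (mns C (x n) a)) \<longlonglongrightarrow> 0" using tendsto_emb[of x a] x cd X by simp
      then have "a \<in> D" using D a x unfolding closed_subspace_def by blast
      then show "L \<in> emb C ` D" using LIMSEQ_unique[OF L a(2)] by blast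
    qed
    fix x assume "x \<in> emb C ` D"
    then obtain a where a: "a \<in> D" "x = emb C a" by blast
    show "csc c x \<in> emb C ` D" for c
      using D a cd[OF a(1)] unfolding closed_subspace_def by (simp flip: emb_scl)
    fix y assume "y \<in> emb C ` D"
    then obtain b where b: "b \<in> D" "y = emb C b" by blast
    show "x + y \<in> emb C ` D"
      using D a b cd[OF a(1)] cd[OF b(1)] unfolding closed_subspace_def by (simp flip: emb_pls)
  qed
qed

lemma closed_subspace_vimage:
  assumes K: "ccl K" shows "closed_subspace C {x \<in> carr C. emb C x \<in> K}"
  unfolding closed_subspace_def
proof (intro conjI ballI allI impI)
  fix f x assume "(\<forall>n. f n \<in> {x \<in> carr C. emb C x \<in> K}) \<and> x \<in> carr C \<and> (\<lambda>n. nrm C (mns C (f n) x)) \<longlonglongrightarrow> 0"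
  then have f: "\<And>n. f n \<in> carr C" "\<And>n. emb C (f n) \<in> K" and x: "x \<in> carr C" and l: "(\<lambda>n. nrm C (mns C (f n) x)) \<longlonglongrightarrow> 0" by auto
  have "(\<lambda>n. emb C (f n)) \<longlonglongrightarrow> emb C x" using tendsto_emb[OF f(1) x] l by simp
  from closed_sequentially[OF ccl_closed[OF K] f(2) this] show "x \<in> {x \<in> carr C. emb C x \<in> K}" using x by simp
qed (use K in \<open>auto simp: emb_pls emb_scl ccl_add ccl_csc ccl_zero\<close>)

lemma cstar_sub_emb:
  assumes D: "cstar_sub C D" shows "csub (emb C ` D)"
proof -
  have cs: "closed_subspace C D" and m: "\<And>x y. x \<in> D \<Longrightarrow> y \<in> D \<Longrightarrow> mlt C x y \<in> D" and s: "\<And>x. x \<in> D \<Longrightarrow> str C x \<in> D"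
    using D unfolding cstar_sub_def by blast+
  have cd: "x \<in> carr C" if "x \<in> D" for x using cs that unfolding closed_subspace_def by blast
  show ?thesis unfolding csub_def
    using closed_subspace_emb[OF cs] m s cd by (auto simp flip: emb_mlt emb_str)
qed

lemma cstar_sub_vimage: "csub K \<Longrightarrow> cstar_sub C {x \<in> carr C. emb C x \<in> K}"
  unfolding cstar_sub_def csub_def using closed_subspace_vimage[of K] by (auto simp: emb_mlt emb_str)

lemma csub_carr: "csub (emb C ` carr C)"
proof (rule cstar_sub_emb)
  show "cstar_sub C (carr C)" by (simp add: cstar_sub_def closed_subspace_def)
qed

lemma closed_subspace_limit:
  "closed_subspace C D \<Longrightarrow> (\<And>n. f n \<in> D) \<Longrightarrow> x \<in> carr C \<Longrightarrow> (\<lambda>n. nrm C (mns C (f n) x)) \<longlonglongrightarrow> 0 \<Longrightarrow> x \<in> D"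
  unfolding closed_subspace_def by blast

lemma closed_subspace_zer: "closed_subspace C D \<Longrightarrow> zer C \<in> D"
  and closed_subspace_pls: "closed_subspace C D \<Longrightarrow> x \<in> D \<Longrightarrow> y \<in> D \<Longrightarrow> pls C x y \<in> D"
  and closed_subspace_scl: "closed_subspace C D \<Longrightarrow> x \<in> D \<Longrightarrow> scl C c x \<in> D"
  and closed_subspace_carr: "closed_subspace C D \<Longrightarrow> D \<subseteq> carr C"
  unfolding closed_subspace_def by simp_all

lemma cstar_sub_closed: "cstar_sub C D \<Longrightarrow> closed_subspace C D"
  and cstar_sub_mlt: "cstar_sub C D \<Longrightarrow> x \<in> D \<Longrightarrow> y \<in> D \<Longrightarrow> mlt C x y \<in> D"
  and cstar_sub_str: "cstar_sub C D \<Longrightarrow> x \<in> D \<Longrightarrow> str C x \<in> D"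
  unfolding cstar_sub_def by simp_all

lemma cstar_sub_carr: "cstar_sub C (carr C)"
  by (simp add: cstar_sub_def closed_subspace_def)

lemma cstar_gen_sub:
  assumes S: "S \<subseteq> carr C" shows "cstar_sub C (cstar_gen C S)" "S \<subseteq> cstar_gen C S"
proof -
  have mem: "x \<in> cstar_gen C S \<longleftrightarrow> (\<forall>D. cstar_sub C D \<longrightarrow> S \<subseteq> D \<longrightarrow> x \<in> D)" for x
    unfolding cstar_gen_def by blast
  show "S \<subseteq> cstar_gen C S" using mem by blast
  have "closed_subspace C (cstar_gen C S)"
    unfolding closed_subspace_def
  proof (intro conjI ballI allI impI)
    show "cstar_gen C S \<subseteq> carr C" using mem cstar_sub_carr S by blast
    show "zer C \<in> cstar_gen C S" using mem closed_subspace_zer cstar_sub_closed by blast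
    show "pls C x y \<in> cstar_gen C S" if "x \<in> cstar_gen C S" "y \<in> cstar_gen C S" for x y
      using that mem closed_subspace_pls cstar_sub_closed by blast
    show "scl C c x \<in> cstar_gen C S" if "x \<in> cstar_gen C S" for x c
      using that mem closed_subspace_scl cstar_sub_closed by blast
    fix f x assume h: "(\<forall>n. f n \<in> cstar_gen C S) \<and> x \<in> carr C \<and> (\<lambda>n. nrm C (mns C (f n) x)) \<longlonglongrightarrow> 0"
    show "x \<in> cstar_gen C S"
      unfolding mem
    proof (intro allI impI)
      fix D assume D: "cstar_sub C D" "S \<subseteq> D"
      have "f n \<in> D" for n using h D mem by blast
      then show "x \<in> D" using closed_subspace_limit[OF cstar_sub_closed[OF D(1)], of f x] h by simp
    qed
  qed
  moreover have "mlt C x y \<in> cstar_gen C S" if "x \<in> cstar_gen C S" "y \<in> cstar_gen C S" for x y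
    using that mem cstar_sub_mlt by blast
  moreover have "str C x \<in> cstar_gen C S" if "x \<in> cstar_gen C S" for x
    using that mem cstar_sub_str by blast
  ultimately show "cstar_sub C (cstar_gen C S)" unfolding cstar_sub_def by simp
qed

lemma cstar_gen_least: "cstar_sub C D \<Longrightarrow> S \<subseteq> D \<Longrightarrow> cstar_gen C S \<subseteq> D"
  unfolding cstar_gen_def by (rule Inter_lower) simp

lemma cstar_gen_emb_least:
  assumes K: "csub K" and S: "S \<subseteq> carr C" "emb C ` S \<subseteq> K" shows "emb C ` cstar_gen C S \<subseteq> K"
proof -
  have "S \<subseteq> {x \<in> carr C. emb C x \<in> K}" using S by auto
  from cstar_gen_least[OF cstar_sub_vimage[OF K] this] show ?thesis by auto
qed

end

section \<open>Approximation of tail sequences\<close>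

context precorr
begin

lemma inr_hzer_left: "x \<in> hcarr X \<Longrightarrow> inr X (hzer X) x = zer A" and inr_hzer_right: "x \<in> hcarr X \<Longrightarrow> inr X x (hzer X) = zer A"
proof -
  assume x: "x \<in> hcarr X"
  show r: "inr X x (hzer X) = zer A" using inr_hscl[OF x hzer_carr, of 0] x by simp
  show "inr X (hzer X) x = zer A" using str_inr[OF x hzer_carr] r by simp
qed

lemma ract_zer: "x \<in> hcarr X \<Longrightarrow> ract X x (zer A) = hzer X"
  by (rule heqI) (simp_all add: inr_ract inr_hzer_right)

lemma ract_hzer: "a \<in> carr A \<Longrightarrow> ract X (hzer X) a = hzer X"
  by (rule heqI) (simp_all add: inr_ract inr_hzer_right)

lemma phi_zer: "x \<in> hcarr X \<Longrightarrow> phi (zer A) x = hzer X"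
  using ker_zer unfolding kerphi_def by blast

text \<open>Approximate units of the kernel are chosen for each coordinate and cut off where
  \<open>g\<close> is already small, since without the cut-off they need not form a null
  sequence.\<close>

lemma tail_approx:
  assumes g: "g \<in> T" and e: "0 < e"
  obtains u where "u \<in> T" "\<And>n. nrm A (mns A (g n) (mlt A (g n) (u n))) \<le> e" "\<And>n. str A (u n) = u n"
proof -
  note [simp] = tail_carr[OF g] tail_ker[OF g]
  have "\<exists>h. h \<in> I \<and> str A h = h \<and> nrm A (mns A (g n) (mlt A (g n) h)) < e" for n
    by (rule A.approximate_unit_record[of I "g n" e]) (use e ker_carr tail_ker[OF g] in auto)
  then obtain h where h: "\<And>n. h n \<in> I" "\<And>n. str A (h n) = h n" "\<And>n. nrm A (mns A (g n) (mlt A (g n) (h n))) < e" by metis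
  obtain N where N: "\<And>n. n \<ge> N \<Longrightarrow> nrm A (g n) < e" using LIMSEQ_D[OF tail_null[OF g] e] by auto
  define u where "u n = (if n < N then h n else zer A)" for n
  show thesis
  proof (rule that)
    have "(\<lambda>n. nrm A (u n)) \<longlonglongrightarrow> 0"
      by (rule tendsto_eventually, rule eventually_sequentiallyI[of N]) (simp add: u_def)
    then show "u \<in> T" using h by (simp add: tailset_def u_def)
    show "str A (u n) = u n" for n using h by (simp add: u_def)
    show "nrm A (mns A (g n) (mlt A (g n) (u n))) \<le> e" for n
      using h(3)[of n] N[of n] by (auto simp: u_def mns_def less_imp_le not_less)
  qed
qed

definition trunc :: "nat \<Rightarrow> (nat \<Rightarrow> 'a) \<Rightarrow> nat \<Rightarrow> 'a" where
  "trunc N f n = (if n < N then f n else zer A)"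

lemma trunc_T: "f \<in> T \<Longrightarrow> trunc N f \<in> T"
  using tail_null[of f] tail_ker[of f] by (intro tailI[where g="\<lambda>n. nrm A (f n)"]) (auto simp: trunc_def tail_carr)

lemma trunc_approx:
  assumes f: "f \<in> T" and e: "0 < e" obtains N where "\<And>n. nrm A (mns A (f n) (trunc N f n)) \<le> e"
proof -
  note [simp] = tail_carr[OF f]
  obtain N where "\<And>n. n \<ge> N \<Longrightarrow> nrm A (f n) < e" using LIMSEQ_D[OF tail_null[OF f] e] by auto
  then show thesis using e by (intro that[of N]) (auto simp: trunc_def mns_def less_imp_le not_less)
qed

end

locale tail_corner = precorr A X phi for A :: "'a cstar" and X :: "('x, 'a) hmod" and phi +
  fixes OY :: "'c cstar" and pY :: "'a \<times> (nat \<Rightarrow> 'a) \<Rightarrow> 'c" and tY :: "'x \<times> (nat \<Rightarrow> 'a) \<Rightarrow> 'c"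
  assumes coY: "coisometric (tailB A X phi) (tailY A X phi) (tailphi A X phi) (Jid (tailB A X phi) (tailY A X phi) (tailphi A X phi)) OY pY tY"
    and genY: "carr OY = cstar_gen OY (pY ` carr (tailB A X phi) \<union> tY ` hcarr (tailY A X phi))"
begin

lemma repY: "is_rep B Y phiB OY pY tY" and cstar_OY: "cstar_alg OY" and hom_pY: "star_hom B OY pY"
  using coY unfolding coisometric_def is_rep_def by blast+

sublocale O: cstar_record OY by (rule cstar_record.intro[OF cstar_OY])

abbreviation "E \<equiv> emb OY"
definition M :: "'c mul set" where "M = E ` carr OY"

definition PB :: "'a \<times> (nat \<Rightarrow> 'a) \<Rightarrow> 'c mul" where "PB b = E (pY b)"
definition QY :: "'x \<times> (nat \<Rightarrow> 'a) \<Rightarrow> 'c mul" where "QY y = E (tY y)"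
definition P :: "'a \<Rightarrow> 'c mul" where "P a = PB (a, \<lambda>n. zer A)"
definition sg :: "(nat \<Rightarrow> 'a) \<Rightarrow> 'c mul" where "sg f = PB (zer A, f)"
definition Q :: "'x \<Rightarrow> 'c mul" where "Q x = QY (x, \<lambda>n. zer A)"
definition ta :: "(nat \<Rightarrow> 'a) \<Rightarrow> 'c mul" where "ta g = QY (hzer X, g)"

lemma csubM: "csub M"
  unfolding M_def by (rule O.csub_carr)

lemma pY_carr: "b \<in> carr B \<Longrightarrow> pY b \<in> carr OY" and tY_carr: "y \<in> hcarr Y \<Longrightarrow> tY y \<in> carr OY"
  using repY unfolding is_rep_def star_hom_def by blast+

lemma PB_M: "b \<in> carr B \<Longrightarrow> PB b \<in> M" and QY_M: "y \<in> hcarr Y \<Longrightarrow> QY y \<in> M"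
  by (simp_all add: PB_def QY_def M_def pY_carr tY_carr del: B_simps Y_simps)

lemma PB_pls: "a \<in> carr B \<Longrightarrow> b \<in> carr B \<Longrightarrow> PB (pls B a b) = PB a + PB b"
  and PB_mlt: "a \<in> carr B \<Longrightarrow> b \<in> carr B \<Longrightarrow> PB (mlt B a b) = PB a * PB b"
  and PB_scl: "a \<in> carr B \<Longrightarrow> PB (scl B c a) = csc c (PB a)"
  and PB_str: "a \<in> carr B \<Longrightarrow> PB (str B a) = st (PB a)"
  using hom_pY unfolding star_hom_def PB_def by (simp_all add: O.emb_pls O.emb_mlt O.emb_scl O.emb_str pY_carr del: B_simps)

lemma QY_hpls: "x \<in> hcarr Y \<Longrightarrow> y \<in> hcarr Y \<Longrightarrow> QY (hpls Y x y) = QY x + QY y"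
  and QY_hscl: "x \<in> hcarr Y \<Longrightarrow> QY (hscl Y c x) = csc c (QY x)"
  and QY_QY: "x \<in> hcarr Y \<Longrightarrow> y \<in> hcarr Y \<Longrightarrow> st (QY x) * QY y = PB (inr Y x y)"
  and QY_phi: "a \<in> carr B \<Longrightarrow> x \<in> hcarr Y \<Longrightarrow> QY (phiB a x) = PB a * QY x"
  and QY_ract: "a \<in> carr B \<Longrightarrow> x \<in> hcarr Y \<Longrightarrow> QY (ract Y x a) = QY x * PB a"
  using repY unfolding is_rep_def PB_def QY_def
  by (simp_all add: O.emb_pls O.emb_scl pY_carr tY_carr del: B_simps Y_simps flip: O.emb_mlt O.emb_str)

lemma norm_PB: "b \<in> carr B \<Longrightarrow> norm (PB b) \<le> nrm B b"
  unfolding PB_def using pY_carr[of b] star_hom_contractive[OF cstar_B cstar_OY hom_pY, of b] by (simp add: O.norm_emb del: B_simps)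

lemma PB_split: "a \<in> carr A \<Longrightarrow> f \<in> T \<Longrightarrow> PB (a, f) = P a + sg f"
  using PB_pls[of "(a, \<lambda>n. zer A)" "(zer A, f)"] tail_carr[of f] by (simp add: P_def sg_def)

lemma QY_split: "x \<in> hcarr X \<Longrightarrow> g \<in> T \<Longrightarrow> QY (x, g) = Q x + ta g"
  using QY_hpls[of "(x, \<lambda>n. zer A)" "(hzer X, g)"] tail_carr[of g] by (simp add: Q_def ta_def)

lemma PB_zer: "PB (zer A, \<lambda>n. zer A) = 0"
  using PB_scl[of "(zer A, \<lambda>n. zer A)" 0] by (simp add: csc_def)

lemma QY_zer: "QY (hzer X, \<lambda>n. zer A) = 0"
  using QY_hscl[of "(hzer X, \<lambda>n. zer A)" 0] by (simp add: csc_def)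

lemma P_zer [simp]: "P (zer A) = 0" and sg_zer [simp]: "sg (\<lambda>n. zer A) = 0"
  and Q_zer [simp]: "Q (hzer X) = 0" and ta_zer [simp]: "ta (\<lambda>n. zer A) = 0"
  by (simp_all add: P_def sg_def Q_def ta_def PB_zer QY_zer)

lemma P_M: "a \<in> carr A \<Longrightarrow> P a \<in> M" and sg_M: "f \<in> T \<Longrightarrow> sg f \<in> M" and Q_M: "x \<in> hcarr X \<Longrightarrow> Q x \<in> M" and ta_M: "f \<in> T \<Longrightarrow> ta f \<in> M"
  by (simp_all add: P_def sg_def Q_def ta_def PB_M QY_M)

lemma P_mlt: "a \<in> carr A \<Longrightarrow> b \<in> carr A \<Longrightarrow> P (mlt A a b) = P a * P b"
  and P_mns: "a \<in> carr A \<Longrightarrow> b \<in> carr A \<Longrightarrow> P (mns A a b) = P a - P b"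
  and P_str: "a \<in> carr A \<Longrightarrow> P (str A a) = st (P a)"
  using PB_mlt[of "(a, \<lambda>n. zer A)" "(b, \<lambda>n. zer A)"] PB_str[of "(a, \<lambda>n. zer A)"]
    PB_pls[of "(a, \<lambda>n. zer A)" "(scl A (-1) b, \<lambda>n. zer A)"] PB_scl[of "(b, \<lambda>n. zer A)" "-1"]
  by (simp_all add: P_def mns_def)

lemma norm_P: "a \<in> carr A \<Longrightarrow> norm (P a) \<le> nrm A a"
  using norm_PB[of "(a, \<lambda>n. zer A)"] by (simp add: P_def)

lemma st_sg: "f \<in> T \<Longrightarrow> st (sg f) = sg (\<lambda>n. str A (f n))"
  and sg_pls: "f \<in> T \<Longrightarrow> g \<in> T \<Longrightarrow> sg (\<lambda>n. pls A (f n) (g n)) = sg f + sg g"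
  and norm_sg: "f \<in> T \<Longrightarrow> norm (sg f) \<le> tnorm f"
  using PB_str[of "(zer A, f)"] PB_pls[of "(zer A, f)" "(zer A, g)"] norm_PB[of "(zer A, f)"]
  by (simp_all add: sg_def)

lemma sg_mns: "f \<in> T \<Longrightarrow> g \<in> T \<Longrightarrow> sg (\<lambda>n. mns A (f n) (g n)) = sg f - sg g"
  using sg_pls[of f "\<lambda>n. scl A (-1) (g n)"] PB_scl[of "(zer A, g)" "-1"] by (simp add: sg_def mns_def)

lemma sg_P: "a \<in> carr A \<Longrightarrow> f \<in> T \<Longrightarrow> sg f * P a = 0"
  using PB_mlt[of "(zer A, f)" "(a, \<lambda>n. zer A)"] tail_carr[of f]
  by (simp add: P_def sg_def PB_zer)

lemma sg_Q: "x \<in> hcarr X \<Longrightarrow> f \<in> T \<Longrightarrow> sg f * Q x = 0"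
  using QY_phi[of "(zer A, f)" "(x, \<lambda>n. zer A)"] tail_carr[of f] by (simp add: sg_def Q_def phi_zer QY_zer cong: if_cong)

lemma Q_sg: "x \<in> hcarr X \<Longrightarrow> f \<in> T \<Longrightarrow> Q x * sg f = 0"
  using QY_ract[of "(zer A, f)" "(x, \<lambda>n. zer A)"] tail_carr[of f] by (simp add: sg_def Q_def ract_zer QY_zer)

lemma ta_sg: "f \<in> T \<Longrightarrow> g \<in> T \<Longrightarrow> ta g * sg f = ta (\<lambda>n. mlt A (g n) (f n))"
  using QY_ract[of "(zer A, f)" "(hzer X, g)"] by (simp add: sg_def ta_def ract_hzer)

text \<open>On the left of \<open>ta\<close> the tail acts one coordinate lower than on the right,
  in \<open>ta_sg\<close>. So \<open>ta (single (Suc i) g)\<close> behaves as a step from tail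
  coordinate \<open>i\<close> to the next one, and \<open>ta (single 0 g)\<close> as a step from A
  into the tail.\<close>

lemma sg_ta: "f \<in> T \<Longrightarrow> g \<in> T \<Longrightarrow> sg f * ta g = ta (\<lambda>n. if n = 0 then zer A else mlt A (f (n - 1)) (g n))"
  using QY_phi[of "(zer A, f)" "(hzer X, g)"] tail_carr[of g 0] by (simp add: sg_def ta_def phi_hzer cong: if_cong)

lemma P_ta:
  assumes a: "a \<in> carr A" and g: "g \<in> T" shows "P a * ta g = ta (single 0 (mlt A a (g 0)))"
proof -
  have "(\<lambda>n. if n = 0 then mlt A a (g 0) else mlt A (zer A) (g n)) = single 0 (mlt A a (g 0))"
    using tail_carr[OF g] by (auto simp: single_def)
  then show ?thesis using QY_phi[of "(a, \<lambda>n. zer A)" "(hzer X, g)"] a g by (simp add: P_def ta_def phi_hzer)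
qed

lemma ta_ta: "f \<in> T \<Longrightarrow> g \<in> T \<Longrightarrow> st (ta f) * ta g = sg (\<lambda>n. mlt A (str A (f n)) (g n))"
  using QY_QY[of "(hzer X, f)" "(hzer X, g)"] by (simp add: sg_def ta_def inr_hzer_left)

lemma ta_pls: "f \<in> T \<Longrightarrow> g \<in> T \<Longrightarrow> ta (\<lambda>n. pls A (f n) (g n)) = ta f + ta g"
  using QY_hpls[of "(hzer X, f)" "(hzer X, g)"] by (simp add: ta_def)

lemma ta_mns: "f \<in> T \<Longrightarrow> g \<in> T \<Longrightarrow> ta (\<lambda>n. mns A (f n) (g n)) = ta f - ta g"
  using ta_pls[of f "\<lambda>n. scl A (-1) (g n)"] QY_hscl[of "(hzer X, g)" "-1"] by (simp add: ta_def mns_def)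

lemma norm_ta:
  assumes g: "g \<in> T" shows "norm (ta g) \<le> tnorm g"
proof (rule power2_le_imp_le)
  have "(norm (ta g))\<^sup>2 = norm (sg (\<lambda>n. mlt A (str A (g n)) (g n)))" using g by (simp add: ta_ta flip: norm_st_mult)
  also have "\<dots> \<le> (tnorm g)\<^sup>2" using norm_sg[of "\<lambda>n. mlt A (str A (g n)) (g n)"] g by (simp add: tnorm_mlt_str)
  finally show "(norm (ta g))\<^sup>2 \<le> (tnorm g)\<^sup>2" .
qed (use g in simp)

lemma Q_Q: "x \<in> hcarr X \<Longrightarrow> y \<in> hcarr X \<Longrightarrow> st (Q x) * Q y = P (inr X x y)"
  using QY_QY[of "(x, \<lambda>n. zer A)" "(y, \<lambda>n. zer A)"] by (simp add: P_def Q_def)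

lemma sg_approx:
  assumes f: "f \<in> T" "g \<in> T" and e: "\<And>n. nrm A (mns A (f n) (g n)) \<le> e"
  shows "norm (sg f - sg g) \<le> e" "norm (ta f - ta g) \<le> e"
proof -
  have T: "(\<lambda>n. mns A (f n) (g n)) \<in> T" using f by (simp add: mns_def)
  show "norm (sg f - sg g) \<le> e" "norm (ta f - ta g) \<le> e"
    using order_trans[OF norm_sg[OF T] tnorm_leI[OF e]] order_trans[OF norm_ta[OF T] tnorm_leI[OF e]] by (simp_all add: sg_mns ta_mns f)
qed

text \<open>\<open>ta g\<close> is a limit of products \<open>ta g * sg u\<close>, so a closed
  condition may be checked after inserting a tail element on the right.\<close>

lemma ta_right_unit:
  assumes g: "g \<in> T" and K: "ccl K" and k: "\<And>u. u \<in> T \<Longrightarrow> ta g * sg u * w \<in> K" shows "ta g * w \<in> K"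
proof (rule ccl_approx[OF K])
  fix e :: real assume e: "0 < e"
  define d where "d = e / (norm w + 1)"
  have d: "0 < d" using e by (simp add: d_def add_nonneg_pos)
  obtain u where u: "u \<in> T" "\<And>n. nrm A (mns A (g n) (mlt A (g n) (u n))) \<le> d" using tail_approx[OF g d] by metis
  have "norm (ta g * w - ta g * sg u * w) \<le> norm (ta g - ta g * sg u) * norm w"
    using norm_mult_ineq[of "ta g - ta g * sg u" w] by (simp add: algebra_simps)
  also have "\<dots> \<le> d * norm w" using sg_approx(2)[OF g tail_mlt[OF g u(1)] u(2)] by (intro mult_right_mono) (simp_all add: ta_sg g u)
  also have "\<dots> \<le> e" unfolding d_def using ratio_le[OF norm_ge_zero e, of w] by (simp add: mult.commute)
  finally show "\<exists>y\<in>K. norm (ta g * w - y) \<le> e" using k[OF u(1)] by blast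
qed

text \<open>On the left only steps that start inside the tail absorb \<open>sg u\<close>, which is
  the reason for the condition on coordinate 0.\<close>

lemma ta_left_unit:
  assumes g: "g \<in> T" and g0: "g 0 = zer A" and K: "ccl K" and k: "\<And>u. u \<in> T \<Longrightarrow> w * (sg u * ta g) \<in> K" shows "w * ta g \<in> K"
proof (rule ccl_approx[OF K])
  fix e :: real assume e: "0 < e"
  note [simp] = tail_carr[OF g]
  define d where "d = e / (norm w + 1)"
  have d: "0 < d" using e by (simp add: d_def add_nonneg_pos)
  \<comment> \<open>Shifted by one because \<open>sg u\<close> acts one coordinate lower from the
    left, and adjoined because \<open>tail_approx\<close> provides units on the right.\<close>
  define h where "h = (\<lambda>n. str A (g (Suc n)))"
  have h: "h \<in> T" using g LIMSEQ_Suc[OF tail_null[OF g]] by (simp add: tailset_def h_def tail_ker[OF g] tail_carr[OF g])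
  obtain u where u: "u \<in> T" "\<And>n. nrm A (mns A (h n) (mlt A (h n) (u n))) \<le> d" "\<And>n. str A (u n) = u n" using tail_approx[OF h d] by metis
  note [simp] = tail_carr[OF u(1)]
  have "nrm A (mns A (g n) (if n = 0 then zer A else mlt A (u (n - 1)) (g n))) \<le> d" for n
  proof (cases n)
    case 0 then show ?thesis using d by (simp add: g0 mns_def)
  next
    case (Suc m)
    have "str A (mns A (h m) (mlt A (h m) (u m))) = mns A (g n) (mlt A (u m) (g n))"
      by (simp add: h_def Suc mns_def A.str_pls A.str_scl A.str_mlt u)
    then have "nrm A (mns A (g n) (mlt A (u m) (g n))) = nrm A (mns A (h m) (mlt A (h m) (u m)))"
      using A.nrm_str[of "mns A (h m) (mlt A (h m) (u m))"] by (simp add: h_def)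
    then show ?thesis using u(2)[of m] by (simp add: Suc)
  qed
  moreover have "(\<lambda>n. if n = 0 then zer A else mlt A (u (n - 1)) (g n)) \<in> T"
    using tail_phi[of "zer A" u g] u g by (simp cong: if_cong)
  ultimately have a: "norm (ta g - sg u * ta g) \<le> d" using g u by (simp add: sg_ta sg_approx(2))
  have "norm (w * ta g - w * (sg u * ta g)) \<le> norm w * norm (ta g - sg u * ta g)"
    using norm_mult_ineq[of w "ta g - sg u * ta g"] by (simp add: algebra_simps)
  also have "\<dots> \<le> norm w * d" using a by (intro mult_left_mono) simp_all
  also have "\<dots> \<le> e" unfolding d_def using ratio_le[OF norm_ge_zero e, of w] by (simp add: mult.commute)
  finally show "\<exists>y\<in>K. norm (w * ta g - y) \<le> e" using k[OF u(1)] by blast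
qed

text \<open>Splitting (a, f) and (x, f) into head and tail lets membership be checked on four
  separate families.\<close>

lemma M_least:
  assumes K: "csub K" and g: "\<And>a. a \<in> carr A \<Longrightarrow> P a \<in> K" "\<And>f. f \<in> T \<Longrightarrow> sg f \<in> K" "\<And>x. x \<in> hcarr X \<Longrightarrow> Q x \<in> K" "\<And>f. f \<in> T \<Longrightarrow> ta f \<in> K"
  shows "M \<subseteq> K"
proof -
  have "E ` (pY ` carr B \<union> tY ` hcarr Y) \<subseteq> K"
  proof -
    have "PB (a, f) \<in> K" if "a \<in> carr A" "f \<in> T" for a f using that g ccl_add[OF csub_ccl[OF K]] by (simp add: PB_split)
    moreover have "QY (x, f) \<in> K" if "x \<in> hcarr X" "f \<in> T" for x f using that g ccl_add[OF csub_ccl[OF K]] by (simp add: QY_split)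
    ultimately show ?thesis unfolding PB_def QY_def by auto
  qed
  moreover have "pY ` carr B \<union> tY ` hcarr Y \<subseteq> carr OY" using pY_carr tY_carr by blast
  ultimately show ?thesis unfolding M_def using O.cstar_gen_emb_least[OF K] genY by simp
qed

section \<open>The subalgebra D and the projection\<close>

definition D :: "'c set" where "D = cstar_gen OY ((\<lambda>a. pY (a, \<lambda>n. zer A)) ` carr A \<union> (\<lambda>x. tY (x, \<lambda>n. zer A)) ` hcarr X)"

definition Dt :: "'c mul set" where "Dt = E ` D"

lemma gen_carr: "(\<lambda>a. pY (a, \<lambda>n. zer A)) ` carr A \<union> (\<lambda>x. tY (x, \<lambda>n. zer A)) ` hcarr X \<subseteq> carr OY"
  using pY_carr tY_carr by auto

lemma Dt_least: "csub K \<Longrightarrow> (\<And>a. a \<in> carr A \<Longrightarrow> P a \<in> K) \<Longrightarrow> (\<And>x. x \<in> hcarr X \<Longrightarrow> Q x \<in> K) \<Longrightarrow> Dt \<subseteq> K"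
  unfolding Dt_def D_def by (rule O.cstar_gen_emb_least[OF _ gen_carr]) (auto simp: P_def PB_def Q_def QY_def)

lemma csub_Dt: "csub Dt" and P_Dt: "a \<in> carr A \<Longrightarrow> P a \<in> Dt" and Q_Dt: "x \<in> hcarr X \<Longrightarrow> Q x \<in> Dt"
  using O.cstar_gen_sub[OF gen_carr] O.cstar_sub_emb unfolding Dt_def D_def P_def PB_def Q_def QY_def by blast+

lemma Dt_M: "Dt \<subseteq> M"
  by (rule Dt_least[OF csubM P_M Q_M])

text \<open>The right ideal p M, described without p as what the tail annihilates; \<open>N\<close>
  is to become (1 - p) M.\<close>

definition D1 :: "'c mul set" where "D1 = {x \<in> M. \<forall>f\<in>T. sg f * x = 0}"
definition N :: "'c mul set" where "N = {x \<in> M. \<forall>z\<in>D1. st z * x = 0}"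

lemma ccl_D1: "ccl D1"
proof -
  have "D1 = M \<inter> (\<Inter>f\<in>T. {x. sg f * x \<in> {0}})" by (auto simp: D1_def)
  then show ?thesis using ccl_Int[OF csub_ccl[OF csubM] ccl_INT[OF ccl_mult_left[OF ccl_trivial]]] by simp
qed

lemma ccl_N: "ccl N"
proof -
  have "N = M \<inter> (\<Inter>z\<in>D1. {x. st z * x \<in> {0}})" by (auto simp: N_def)
  then show ?thesis using ccl_Int[OF csub_ccl[OF csubM] ccl_INT[OF ccl_mult_left[OF ccl_trivial]]] by simp
qed

lemma D1_M: "x \<in> D1 \<Longrightarrow> x \<in> M" and N_M: "x \<in> N \<Longrightarrow> x \<in> M"
  by (simp_all add: D1_def N_def)

lemma D1_mult: "x \<in> D1 \<Longrightarrow> y \<in> M \<Longrightarrow> x * y \<in> D1" and N_mult: "x \<in> N \<Longrightarrow> y \<in> M \<Longrightarrow> x * y \<in> N"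
  by (simp_all add: D1_def N_def csub_mult[OF csubM] flip: mult.assoc)

lemma D1_N: "x \<in> D1 \<Longrightarrow> y \<in> N \<Longrightarrow> st x * y = 0"
  by (simp add: N_def)

lemma N_D1: "x \<in> D1 \<Longrightarrow> y \<in> N \<Longrightarrow> st y * x = 0"
  using arg_cong[OF D1_N, of x y st] by simp

text \<open>Multiplying x + y by \<open>st x\<close> removes y by orthogonality. The projection onto
  \<open>D1\<close> along \<open>N\<close> is therefore contractive, and it follows that their sum
  is closed.\<close>

lemma norm_D1_le:
  assumes "x \<in> D1" "y \<in> N" shows "norm x \<le> norm (x + y)"
proof (cases "norm x = 0")
  case False
  have "st x * (x + y) = st x * x" using D1_N[OF assms] by (simp add: algebra_simps)
  then have "norm x * norm x \<le> norm x * norm (x + y)"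
    using norm_mult_ineq[of "st x" "x + y"] by (simp add: norm_st_mult power2_eq_square)
  then show ?thesis using False by simp
qed simp

lemma D1_N_unique: "x \<in> D1 \<Longrightarrow> y \<in> N \<Longrightarrow> x' \<in> D1 \<Longrightarrow> y' \<in> N \<Longrightarrow> x + y = x' + y' \<Longrightarrow> x = x'"
proof -
  assume a: "x \<in> D1" "y \<in> N" "x' \<in> D1" "y' \<in> N" "x + y = x' + y'"
  have "norm (x - x') \<le> norm ((x - x') + (y - y'))"
    by (intro norm_D1_le ccl_diff[OF ccl_D1] ccl_diff[OF ccl_N] a)
  also have "(x - x') + (y - y') = 0" using a(5) by (simp add: algebra_simps)
  finally show ?thesis by simp
qed

definition S where "S = {x. \<exists>a\<in>D1. x - a \<in> N}"

lemma ccl_S: "ccl S"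
  unfolding ccl_def
proof (intro conjI ballI allI)
  show "0 \<in> S" unfolding S_def using ccl_zero[OF ccl_D1] ccl_zero[OF ccl_N] by force
  fix x assume "x \<in> S"
  then obtain a where a: "a \<in> D1" "x - a \<in> N" by (auto simp: S_def)
  show "csc c x \<in> S" for c
    unfolding S_def using ccl_csc[OF ccl_D1 a(1), of c] ccl_csc[OF ccl_N a(2), of c] by (auto simp: csc_diff)
  fix y assume "y \<in> S"
  then obtain b where b: "b \<in> D1" "y - b \<in> N" by (auto simp: S_def)
  have "x + y - (a + b) = (x - a) + (y - b)" by simp
  also have "\<dots> \<in> N" by (rule ccl_add[OF ccl_N a(2) b(2)])
  finally show "x + y \<in> S" unfolding S_def using ccl_add[OF ccl_D1 a(1) b(1)] by blast
next
  show "closed S"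
    unfolding closed_sequential_limits
  proof (intro allI impI, elim conjE)
    fix X L assume "\<forall>n. X n \<in> S" and L: "X \<longlonglongrightarrow> L"
    then have "\<forall>n. \<exists>a. a \<in> D1 \<and> X n - a \<in> N" by (auto simp: S_def)
    then obtain a where a: "\<And>n. a n \<in> D1" "\<And>n. X n - a n \<in> N" by metis
    have "norm (a m - a n) \<le> norm (X m - X n)" for m n
      using norm_D1_le[OF ccl_diff[OF ccl_D1 a(1) a(1)] ccl_diff[OF ccl_N a(2) a(2)], of m n m n] by (simp add: algebra_simps)
    then have "Cauchy a" using LIMSEQ_imp_Cauchy[OF L] unfolding Cauchy_def dist_norm by (meson le_less_trans)
    then obtain b where b: "a \<longlonglongrightarrow> b" using Cauchy_convergent convergent_def by metis
    have "b \<in> D1" by (rule closed_sequentially[OF ccl_closed[OF ccl_D1] a(1) b])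
    moreover have "(\<lambda>n. X n - a n) \<longlonglongrightarrow> L - b" by (intro tendsto_intros L b)
    then have "L - b \<in> N" by (rule closed_sequentially[OF ccl_closed[OF ccl_N] a(2)])
    ultimately show "L \<in> S" by (auto simp: S_def)
  qed
qed

lemma D1_S: "x \<in> D1 \<Longrightarrow> x \<in> S" and N_S: "x \<in> N \<Longrightarrow> x \<in> S"
  unfolding S_def using ccl_zero[OF ccl_D1] ccl_zero[OF ccl_N] by force+

lemma S_mult: "x \<in> S \<Longrightarrow> y \<in> M \<Longrightarrow> x * y \<in> S"
  unfolding S_def using D1_mult N_mult by (force simp flip: left_diff_distrib)

lemma P_D1: "a \<in> carr A \<Longrightarrow> P a \<in> D1" and Q_D1: "x \<in> hcarr X \<Longrightarrow> Q x \<in> D1"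
  by (simp_all add: D1_def P_M Q_M sg_P sg_Q)

lemma st_Q_D1: "x \<in> hcarr X \<Longrightarrow> st (Q x) \<in> D1"
proof -
  assume x: "x \<in> hcarr X"
  have "sg f * st (Q x) = 0" if "f \<in> T" for f
    using arg_cong[OF Q_sg[OF x tail_str[OF that]], of st] tail_carr[OF that] that by (simp add: st_sg)
  then show ?thesis using x by (simp add: D1_def csub_st[OF csubM] Q_M)
qed

lemma sg_N: "f \<in> T \<Longrightarrow> sg f \<in> N"
proof -
  assume f: "f \<in> T"
  have "st z * sg f = 0" if "z \<in> D1" for z
  proof -
    have "sg (\<lambda>n. str A (f n)) * z = 0" using that f by (simp add: D1_def)
    then have "st (sg (\<lambda>n. str A (f n)) * z) = st 0" by (simp only:)
    then show ?thesis using f tail_carr[OF f] by (simp add: st_sg)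
  qed
  then show ?thesis using f by (simp add: N_def sg_M)
qed

lemma D1_sg: "z \<in> D1 \<Longrightarrow> f \<in> T \<Longrightarrow> st z * sg f = 0"
  using sg_N by (simp add: N_def)

lemma ta0_D1: "g \<in> I \<Longrightarrow> ta (single 0 g) \<in> D1"
proof -
  assume g: "g \<in> I"
  have "sg f * ta (single 0 g) = 0" if "f \<in> T" for f
  proof -
    have "(\<lambda>n. if n = 0 then zer A else mlt A (f (n - 1)) (single 0 g n)) = (\<lambda>n. zer A)"
      using tail_carr[OF that] by (auto simp: single_def)
    then show ?thesis using that g by (simp add: sg_ta)
  qed
  then show ?thesis using g by (simp add: D1_def ta_M)
qed

text \<open>A step that starts inside the tail absorbs tail elements on its left and is thus
  orthogonal to p M.\<close>

lemma ta_N: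
  assumes g: "g \<in> T" "g 0 = zer A" shows "ta g \<in> N"
proof -
  have "st z * ta g \<in> {0}" if z: "z \<in> D1" for z
    by (rule ta_left_unit[OF g ccl_trivial]) (simp add: D1_sg[OF z] flip: mult.assoc)
  then show ?thesis using g by (simp add: N_def ta_M)
qed

text \<open>Every step ends in the tail: \<open>ta g\<close> absorbs tail elements on its right, so
  that ta g p = 0.\<close>

lemma st_ta_N:
  assumes g: "g \<in> T" shows "st (ta g) \<in> N"
proof -
  have "ta g * z \<in> {0}" if z: "z \<in> D1" for z
    by (rule ta_right_unit[OF g ccl_trivial]) (use z in \<open>simp add: D1_def mult.assoc\<close>)
  then have "st (ta g * z) = st 0" if "z \<in> D1" for z using that by (metis singletonD)
  then have "st z * st (ta g) = 0" if "z \<in> D1" for z using that by simp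
  then show ?thesis using g by (simp add: N_def csub_st[OF csubM] ta_M)
qed

lemma ta_split:
  assumes g: "g \<in> T"
  obtains g' where "g' \<in> T" "g' 0 = zer A" "ta g = ta (single 0 (g 0)) + ta g'"
proof -
  define g' where "g' n = (if n = 0 then zer A else g n)" for n
  have g': "g' \<in> T" using g tail_null[OF g] tail_ker[OF g] tail_carr[OF g]
    by (intro tailI[where g="\<lambda>n. nrm A (g n)"]) (auto simp: g'_def)
  have "(\<lambda>n. pls A (single 0 (g 0) n) (g' n)) = g" using tail_carr[OF g] by (auto simp: single_def g'_def)
  then have "ta g = ta (single 0 (g 0)) + ta g'" using ta_pls[OF single_T[OF tail_ker[OF g, of 0], of 0] g'] by simp
  then show thesis using that g' by (simp add: g'_def)
qed

lemma M_S: "M \<subseteq> S"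
proof -
  \<comment> \<open>\<open>S\<close> is only a right ideal; imposing the condition on the adjoint as
    well makes the set a subalgebra closed under \<open>st\<close>.\<close>
  let ?Z = "{x \<in> M. x \<in> S \<and> st x \<in> S}"
  have "?Z = M \<inter> (S \<inter> {x. 1 * st x \<in> S})" by auto
  then have "ccl ?Z" using ccl_Int[OF csub_ccl[OF csubM] ccl_Int[OF ccl_S ccl_mult_right_st[OF ccl_S, of 1]]] by simp
  then have Z: "csub ?Z" unfolding csub_def using S_mult csub_mult[OF csubM] csub_st[OF csubM] by auto
  have "M \<subseteq> ?Z"
  proof (rule M_least[OF Z])
    show "P a \<in> ?Z" if "a \<in> carr A" for a using that P_M D1_S[OF P_D1] by (simp flip: P_str)
    show "sg f \<in> ?Z" if "f \<in> T" for f using that sg_M N_S[OF sg_N] by (simp add: st_sg)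
    show "Q x \<in> ?Z" if "x \<in> hcarr X" for x using that Q_M D1_S[OF Q_D1] D1_S[OF st_Q_D1] by simp
    show "ta g \<in> ?Z" if g: "g \<in> T" for g
    proof -
      obtain g' where g': "g' \<in> T" "g' 0 = zer A" "ta g = ta (single 0 (g 0)) + ta g'" by (rule ta_split[OF g])
      have "ta g \<in> S" unfolding g'(3) by (intro ccl_add[OF ccl_S] D1_S[OF ta0_D1] N_S[OF ta_N] g' tail_ker[OF g])
      then show ?thesis using g ta_M N_S[OF st_ta_N] by simp
    qed
  qed
  then show ?thesis by blast
qed

text \<open>Left multiplication by the projection: the component in \<open>D1\<close> along \<open>N\<close>, which exists and is unique on \<open>M\<close>.\<close>

definition Lp :: "'c mul \<Rightarrow> 'c mul" where "Lp x = (SOME a. a \<in> D1 \<and> x - a \<in> N)"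

lemma Lp: "x \<in> M \<Longrightarrow> Lp x \<in> D1 \<and> x - Lp x \<in> N"
  unfolding Lp_def by (rule someI_ex) (use M_S in \<open>auto simp: S_def\<close>)

lemma Lp_M: "x \<in> M \<Longrightarrow> Lp x \<in> M"
  using Lp D1_M by blast

lemma Lp_eq: "a \<in> D1 \<Longrightarrow> b \<in> N \<Longrightarrow> Lp (a + b) = a"
proof -
  assume a: "a \<in> D1" and b: "b \<in> N"
  then have m: "a + b \<in> M" using D1_M N_M ccl_add[OF csub_ccl[OF csubM]] by blast
  show ?thesis using D1_N_unique[of "Lp (a + b)" "a + b - Lp (a + b)" a b] Lp[OF m] a b by simp
qed

lemma Lp_D1: "a \<in> D1 \<Longrightarrow> Lp a = a" and Lp_N: "b \<in> N \<Longrightarrow> Lp b = 0"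
  using Lp_eq[of a 0] Lp_eq[of 0 b] ccl_zero[OF ccl_D1] ccl_zero[OF ccl_N] by simp_all

lemma Lp_add: "x \<in> M \<Longrightarrow> y \<in> M \<Longrightarrow> Lp (x + y) = Lp x + Lp y"
  using Lp_eq[of "Lp x + Lp y" "(x - Lp x) + (y - Lp y)"] Lp[of x] Lp[of y] ccl_add[OF ccl_D1] ccl_add[OF ccl_N] by simp

lemma Lp_csc: "x \<in> M \<Longrightarrow> Lp (csc c x) = csc c (Lp x)"
proof -
  assume x: "x \<in> M"
  have "csc c x = csc c (Lp x) + csc c (x - Lp x)" by (simp add: csc_diff)
  then show ?thesis using Lp_eq[of "csc c (Lp x)" "csc c (x - Lp x)"] Lp[OF x] ccl_csc[OF ccl_D1] ccl_csc[OF ccl_N] by metis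
qed

lemma Lp_mult: "x \<in> M \<Longrightarrow> y \<in> M \<Longrightarrow> Lp (x * y) = Lp x * y"
  using Lp_eq[of "Lp x * y" "(x - Lp x) * y"] Lp[of x] D1_mult[of "Lp x" y] N_mult[of "x - Lp x" y] by (simp add: algebra_simps)

lemma norm_Lp: "x \<in> M \<Longrightarrow> norm (Lp x) \<le> norm x"
  using norm_D1_le[of "Lp x" "x - Lp x"] Lp[of x] by simp

lemma Lp_diff: "x \<in> M \<Longrightarrow> y \<in> M \<Longrightarrow> Lp (x - y) = Lp x - Lp y"
  using Lp_add[of x "- y"] Lp_csc[of y "-1"] ccl_minus[OF csub_ccl[OF csubM]] by simp

text \<open>Right multiplication by p, obtained by conjugating left multiplication with the
  adjoint.\<close>

definition Rp :: "'c mul \<Rightarrow> 'c mul" where "Rp x = st (Lp (st x))"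

lemma Rp_M: "x \<in> M \<Longrightarrow> Rp x \<in> M"
  by (simp add: Rp_def Lp_M csub_st[OF csubM])

text \<open>Both sides are a p b: the remaining parts a (1 - p) and (1 - p) b meet a factor p to
  which they are orthogonal. This is the double centralizer identity.\<close>

lemma Lp_Rp:
  assumes a: "a \<in> M" and b: "b \<in> M" shows "a * Lp b = Rp a * b"
proof -
  have sa: "st a \<in> M" using a csub_st[OF csubM] by blast
  have "st (st a - Lp (st a)) * Lp b = 0" "st (Lp (st a)) * (b - Lp b) = 0"
    using N_D1[of "Lp b" "st a - Lp (st a)"] D1_N[of "Lp (st a)" "b - Lp b"] Lp[OF sa] Lp[OF b] by auto
  then show ?thesis by (simp add: Rp_def algebra_simps)
qed

lemma Rp_mult: "x \<in> M \<Longrightarrow> y \<in> M \<Longrightarrow> Rp (x * y) = x * Rp y"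
  by (simp add: Rp_def Lp_mult csub_st[OF csubM])

text \<open>\<open>Lp\<close> is linear and contractive on \<open>M\<close>, so conditions on
  \<open>Lp x\<close> also define closed subspaces.\<close>

lemma ccl_Lp:
  assumes K: "ccl K" shows "ccl {x \<in> M. Lp x \<in> K}"
  unfolding ccl_def
proof (intro conjI ballI allI)
  show "0 \<in> {x \<in> M. Lp x \<in> K}" using Lp_D1[OF ccl_zero[OF ccl_D1]] ccl_zero[OF K] ccl_zero[OF csub_ccl[OF csubM]] by simp
  show "closed {x \<in> M. Lp x \<in> K}"
    unfolding closed_sequential_limits
  proof (intro allI impI, elim conjE)
    fix X L assume X: "\<forall>n. X n \<in> {x \<in> M. Lp x \<in> K}" and L: "X \<longlonglongrightarrow> L"
    have LM: "L \<in> M" by (rule closed_sequentially[OF ccl_closed[OF csub_ccl[OF csubM]] _ L]) (use X in auto)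
    have "(\<lambda>n. Lp (X n) - Lp L) \<longlonglongrightarrow> 0"
    proof (rule Lim_null_comparison)
      show "\<forall>\<^sub>F n in sequentially. norm (Lp (X n) - Lp L) \<le> norm (X n - L)"
        using X LM norm_Lp[OF ccl_diff[OF csub_ccl[OF csubM]]] by (auto simp flip: Lp_diff)
      show "(\<lambda>n. norm (X n - L)) \<longlonglongrightarrow> 0" using L by (simp add: tendsto_norm_zero LIM_zero)
    qed
    then have "(\<lambda>n. Lp (X n)) \<longlonglongrightarrow> Lp L" by (rule LIM_zero_cancel)
    then have "Lp L \<in> K" by (rule closed_sequentially[OF ccl_closed[OF K], rotated]) (use X in auto)
    then show "L \<in> {x \<in> M. Lp x \<in> K}" using LM by simp
  qed
qed (use K in \<open>auto simp: Lp_add Lp_csc intro: ccl_add ccl_csc csub_ccl[OF csubM]\<close>)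

lemma ccl_st: "ccl K \<Longrightarrow> ccl {x. st x \<in> K}"
  using ccl_mult_right_st[of K 1] by simp

end

section \<open>Rank-one relations and paths along the tail\<close>

lemma (in precorr) ker_right_unit:
  assumes g: "g \<in> I" and e: "0 < e" obtains h where "h \<in> I" "nrm A (mns A g (mlt A g h)) \<le> e"
  by (rule A.approximate_unit_record[of I g e]) (use e g ker_carr that in \<open>auto simp: less_imp_le\<close>)

lemma (in precorr) ker_left_unit:
  assumes g: "g \<in> I" and e: "0 < e" obtains h where "h \<in> I" "nrm A (mns A g (mlt A h g)) \<le> e"
proof -
  obtain h where h: "h \<in> I" "nrm A (mns A (str A g) (mlt A (str A g) h)) \<le> e" using ker_right_unit[OF ker_str[OF g] e] by blast
  have c: "g \<in> carr A" "h \<in> carr A" using g h ker_carr by blast+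
  have "str A (mns A (str A g) (mlt A (str A g) h)) = mns A g (mlt A (str A h) g)"
    using c by (simp add: mns_def A.str_pls A.str_scl A.str_mlt)
  then have "nrm A (mns A g (mlt A (str A h) g)) \<le> e"
    using h(2) A.nrm_str[of "mns A (str A g) (mlt A (str A g) h)"] c by simp
  then show thesis using that[of "str A h"] h by simp
qed

lemma (in precorr) right_unit:
  assumes g: "g \<in> carr A" and e: "0 < e" obtains h where "h \<in> carr A" "nrm A h \<le> 1" "str A h = h" "nrm A (mns A g (mlt A g h)) \<le> e"
  by (rule A.approximate_unit_record[of "carr A" g e]) (use e g that in \<open>auto simp: less_imp_le\<close>)

lemma (in precorr) single_mns: "g \<in> carr A \<Longrightarrow> h \<in> carr A \<Longrightarrow> nrm A (mns A g h) \<le> e \<Longrightarrow> 0 \<le> e \<Longrightarrow> nrm A (mns A (single i g n) (single i h n)) \<le> e"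
  by (simp add: single_def mns_def)

context tail_corner
begin

interpretation Yc: precorr B Y phiB by (rule precorr_Y)

text \<open>If the left action of \<open>b\<close> is itself a rank-one operator, the constant
  one-term list approximates it with error 0, and coisometry becomes an equation in O_Y.\<close>

lemma rank_one_exact:
  assumes b: "b \<in> carr B" and x: "\<xi> \<in> hcarr Y" "\<eta> \<in> hcarr Y"
    and eq: "\<And>y. y \<in> hcarr Y \<Longrightarrow> phiB b y = ract Y \<xi> (inr Y \<eta> y)"
  shows "QY \<xi> * st (QY \<eta>) = PB b"
proof -
  let ?l = "[(\<xi>, \<eta>)]"
  have l: "set ?l \<subseteq> hcarr Y \<times> hcarr Y" using x by (simp del: Y_simps)
  have "opnorm B Y (Yc.defect b ?l) \<le> 0"
  proof (rule Yc.opnorm_le)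
    fix y assume y: "y \<in> hcarr Y"
    have "thsum Y ?l y = phiB b y" using eq[OF y] x y by (simp add: thsum_def Yc.hpls_hzer_right Yc.ract_carr Yc.inr_carr del: Y_simps B_simps)
    then have "Yc.defect b ?l y = hzer Y" unfolding Yc.defect_def using Yc.hpls_minus[OF Yc.phi_carr[OF b y]] by simp
    then show "hnorm B Y (Yc.defect b ?l y) \<le> 0" using Yc.hnorm_hzer by (simp del: Y_simps)
  qed
  then have 0: "opnorm B Y (Yc.defect b ?l) = 0" using Yc.opnorm_defect_nonneg[OF b l] by linarith
  have "compact_op B Y (phiB b)"
    unfolding compact_op_def Yc.defect_eta using 0 l by (intro allI impI exI[of _ ?l]) (simp del: Y_simps)
  then have "b \<in> Jid B Y phiB" using b by (simp add: Jid_def del: B_simps)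
  then have "pi1_value B Y OY tY (phiB b) (pY b)" using coY unfolding coisometric_def by blast
  then have "(\<lambda>n::nat. nrm OY (mns OY (tsum OY tY ?l) (pY b))) \<longlonglongrightarrow> 0"
    unfolding pi1_value_def Yc.defect_eta using 0 l by (elim allE[of _ "\<lambda>n. ?l"]) (simp del: Y_simps)
  then have "nrm OY (mns OY (tsum OY tY ?l) (pY b)) = 0" by (simp add: LIMSEQ_const_iff)
  moreover have t: "tsum OY tY ?l = mlt OY (tY \<xi>) (str OY (tY \<eta>))" using tY_carr x by (simp add: tsum_def)
  ultimately have "E (mlt OY (tY \<xi>) (str OY (tY \<eta>))) = E (pY b)" using tY_carr x pY_carr[OF b] by (simp add: O.nrm_mns t)
  then show ?thesis using tY_carr x by (simp add: O.emb_mlt O.emb_str QY_def PB_def)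
qed

text \<open>A product of kernel elements acts as zero on X and as multiplication on tail coordinate
  0, which is a rank-one operator of Y. Hence a step into the tail followed by a return is an
  element of \<open>P\<close>.\<close>

lemma ta0_st_ta0:
  assumes g: "g \<in> I" "h \<in> I" shows "ta (single 0 g) * st (ta (single 0 h)) = P (mlt A g (str A h))"
  unfolding ta_def P_def
proof (rule rank_one_exact)
  have c: "g \<in> carr A" "h \<in> carr A" using g ker_carr by blast+
  show "(mlt A g (str A h), \<lambda>n. zer A) \<in> carr B" "(hzer X, single 0 g) \<in> hcarr Y" "(hzer X, single 0 h) \<in> hcarr Y" using c g by simp_all
  fix y assume "y \<in> hcarr Y"
  then obtain x w where y: "y = (x, w)" "x \<in> hcarr X" "w \<in> T" by auto
  note [simp] = tail_carr[OF y(3)]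
  have k: "mlt A g (str A h) \<in> I" using g by simp
  then have "phi (mlt A g (str A h)) x = hzer X" using y(2) by (simp add: kerphi_def)
  then show "phiB (mlt A g (str A h), \<lambda>n. zer A) y = ract Y (hzer X, single 0 g) (inr Y (hzer X, single 0 h) y)"
    using y c by (simp add: inr_hzer_left ract_zer) (auto simp: single_def A.mlt_assoc)
qed

lemma taS_st_taS:
  assumes g: "g \<in> I" "h \<in> I" shows "ta (single (Suc i) g) * st (ta (single (Suc i) h)) = sg (single i (mlt A g (str A h)))"
  unfolding ta_def sg_def
proof (rule rank_one_exact)
  have c: "g \<in> carr A" "h \<in> carr A" using g ker_carr by blast+
  show "(zer A, single i (mlt A g (str A h))) \<in> carr B" "(hzer X, single (Suc i) g) \<in> hcarr Y" "(hzer X, single (Suc i) h) \<in> hcarr Y" using c g by simp_all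
  fix y assume "y \<in> hcarr Y"
  then obtain x w where y: "y = (x, w)" "x \<in> hcarr X" "w \<in> T" by auto
  note [simp] = tail_carr[OF y(3)]
  show "phiB (zer A, single i (mlt A g (str A h))) y = ract Y (hzer X, single (Suc i) g) (inr Y (hzer X, single (Suc i) h) y)"
    using y c by (simp add: inr_hzer_left ract_zer phi_zer) (auto simp: single_def A.mlt_assoc fun_eq_iff)
qed

lemma ta_single_sg: "g \<in> I \<Longrightarrow> f \<in> T \<Longrightarrow> ta (single i g) * sg f = ta (single i (mlt A g (f i)))"
proof -
  assume g: "g \<in> I" and f: "f \<in> T"
  have "(\<lambda>n. mlt A (single i g n) (f n)) = single i (mlt A g (f i))" using tail_carr[OF f] by (auto simp: single_def)
  then show ?thesis using ta_sg[OF f single_T[OF g], of i] by simp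
qed

lemma ta_sg_single: "g \<in> T \<Longrightarrow> f \<in> I \<Longrightarrow> ta g * sg (single i f) = ta (single i (mlt A (g i) f))"
proof -
  assume g: "g \<in> T" and f: "f \<in> I"
  have "(\<lambda>n. mlt A (g n) (single i f n)) = single i (mlt A (g i) f)" using tail_carr[OF g] by (auto simp: single_def)
  then show ?thesis using ta_sg[OF single_T[OF f] g, of i] by simp
qed

lemma sg_single_ta: "g \<in> T \<Longrightarrow> f \<in> I \<Longrightarrow> sg (single i f) * ta g = ta (single (Suc i) (mlt A f (g (Suc i))))"
proof -
  assume g: "g \<in> T" and f: "f \<in> I"
  have "(\<lambda>n. if n = 0 then zer A else mlt A (single i f (n - 1)) (g n)) = single (Suc i) (mlt A f (g (Suc i)))"
    using tail_carr[OF g] by (auto simp: single_def fun_eq_iff)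
  then show ?thesis using sg_ta[OF single_T[OF f] g, of i] by simp
qed

lemma single_self [simp]: "single i g i = g"
  by (simp add: single_def)

text \<open>The step is a limit of its products with \<open>sg (single i u)\<close>, so it sees of
  \<open>w\<close> only what these elements see.\<close>

lemma ta_single_eqI:
  assumes g: "g \<in> I" and w: "\<And>u. u \<in> I \<Longrightarrow> sg (single i u) * w = sg (single i u) * w'"
  shows "ta (single i g) * w = ta (single i g) * w'"
proof -
  have "ta (single i g) * (w - w') \<in> {0}"
  proof (rule ta_right_unit[OF single_T[OF g] ccl_trivial])
    fix u assume u: "u \<in> T"
    have "ta (single i g) * sg u = ta (single i g) * sg (single i (u i))"
      using g u tail_ker[OF u] by (simp add: ta_single_sg)
    then have "ta (single i g) * sg u * (w - w') = ta (single i g) * (sg (single i (u i)) * w - sg (single i (u i)) * w')"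
      by (simp only: mult.assoc right_diff_distrib)
    then show "ta (single i g) * sg u * (w - w') \<in> {0}" using w[OF tail_ker[OF u]] by simp
  qed
  then show ?thesis by (simp add: algebra_simps)
qed

text \<open>After a step into coordinate \<open>i\<close>, only the part of \<open>ta h\<close> that
  starts at \<open>i\<close> survives. The next lemma says the same for the return steps
  \<open>st (ta h)\<close>.\<close>

lemma ta_ta_collapse:
  assumes g: "g \<in> I" and h: "h \<in> T" shows "ta (single i g) * ta h = ta (single i g) * ta (single (Suc i) (h (Suc i)))"
  by (rule ta_single_eqI[OF g]) (simp add: sg_single_ta h tail_ker[OF h])

lemma ta_st_ta_collapse:
  assumes g: "g \<in> I" and h: "h \<in> T" shows "ta (single i g) * st (ta h) = ta (single i g) * st (ta (single i (h i)))"
proof (rule ta_single_eqI[OF g])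
  fix u assume u: "u \<in> I"
  have s: "sg (single i u) = st (sg (single i (str A u)))"
  proof -
    have "(\<lambda>n. str A (single i (str A u) n)) = single i u" using ker_carr[OF u] by (auto simp: single_def)
    then show ?thesis using u by (simp add: st_sg)
  qed
  have "ta h * sg (single i (str A u)) = ta (single i (h i)) * sg (single i (str A u))"
    using u h tail_ker[OF h] by (simp add: ta_sg_single)
  then have "st (ta h * sg (single i (str A u))) = st (ta (single i (h i)) * sg (single i (str A u)))" by (simp only:)
  then show "sg (single i u) * st (ta h) = sg (single i u) * st (ta (single i (h i)))" unfolding s by simp
qed

lemma ta_D1: "g \<in> T \<Longrightarrow> z \<in> D1 \<Longrightarrow> ta g * z = 0"
  using ta_right_unit[OF _ ccl_trivial, of g z] by (simp add: D1_def mult.assoc)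

lemma Dt_D1: "d \<in> Dt \<Longrightarrow> d \<in> D1" and st_Dt_D1: "d \<in> Dt \<Longrightarrow> st d \<in> D1"
proof -
  let ?K = "D1 \<inter> {x. st x \<in> D1}"
  have "csub ?K" unfolding csub_def using ccl_Int[OF ccl_D1 ccl_st[OF ccl_D1]] D1_mult D1_M by auto
  then have "Dt \<subseteq> ?K" by (rule Dt_least) (simp_all add: P_D1 Q_D1 st_Q_D1 flip: P_str)
  then show "d \<in> Dt \<Longrightarrow> d \<in> D1" "d \<in> Dt \<Longrightarrow> st d \<in> D1" by auto
qed

lemma Dt_sg: "d \<in> Dt \<Longrightarrow> f \<in> T \<Longrightarrow> d * sg f = 0"
  using D1_sg[OF st_Dt_D1] by force

lemma Dt_st_ta: "d \<in> Dt \<Longrightarrow> g \<in> T \<Longrightarrow> d * st (ta g) = 0"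
  using D1_N[OF st_Dt_D1 st_ta_N] by force

lemma Dt_ta:
  assumes d: "d \<in> Dt" and g: "g \<in> T" shows "d * ta g = d * ta (single 0 (g 0))"
proof -
  obtain g' where g': "g' \<in> T" "g' 0 = zer A" "ta g = ta (single 0 (g 0)) + ta g'" by (rule ta_split[OF g])
  have "d * ta g' = 0" using D1_N[OF st_Dt_D1[OF d] ta_N[OF g'(1,2)]] by simp
  then show ?thesis by (simp add: g'(3) algebra_simps)
qed

text \<open>The steps must visit the coordinates 0, 1, ..., k - 1 in order, so the length alone
  determines where a path ends: in A for length 0, otherwise at tail coordinate k - 1.\<close>

inductive path :: "nat \<Rightarrow> 'c mul \<Rightarrow> bool" where
  path0: "d \<in> Dt \<Longrightarrow> path 0 d"
| pathS: "path k v \<Longrightarrow> g \<in> I \<Longrightarrow> path (Suc k) (v * ta (single k g))"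

inductive_cases path0_E: "path 0 v"
inductive_cases pathS_E: "path (Suc k) v"

lemma path_M: "path k v \<Longrightarrow> v \<in> M"
  by (induction rule: path.induct) (use Dt_M csub_mult[OF csubM] ta_M in auto)

lemma path_sg:
  assumes p: "path (Suc k) v" and f: "f \<in> T" shows "path (Suc k) (v * sg f)"
proof -
  obtain v' g where v: "v = v' * ta (single k g)" "path k v'" "g \<in> I" using p by (rule pathS_E)
  have "v * sg f = v' * ta (single k (mlt A g (f k)))" using v f by (simp add: mult.assoc ta_single_sg)
  then show ?thesis using pathS[OF v(2), of "mlt A g (f k)"] v(3) tail_ker[OF f] by simp
qed

definition V :: "'c mul set" where "V = chull {v. \<exists>k. path k v}"

lemma ccl_V: "ccl V"
  unfolding V_def by (rule chull_ccl)

lemma path_V: "path k v \<Longrightarrow> v \<in> V"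
  unfolding V_def by (rule subsetD[OF chull_subset]) auto

lemma V_least: "ccl K \<Longrightarrow> (\<And>k v. path k v \<Longrightarrow> v \<in> K) \<Longrightarrow> V \<subseteq> K"
  unfolding V_def by (rule chull_least, assumption) blast

lemma Dt_V: "d \<in> Dt \<Longrightarrow> d \<in> V"
  using path_V[OF path0] .

lemma zero_V: "0 \<in> V"
  by (rule ccl_zero[OF ccl_V])

text \<open>At length 0, \<open>P\<close>, \<open>Q\<close> and the adjoint of \<open>Q\<close> keep
  the path in \<open>Dt\<close>, while \<open>sg\<close> and the adjoint of \<open>ta\<close> kill
  it. At positive length those from A and X kill it and \<open>sg\<close> is absorbed. In every case
  \<open>ta\<close> lengthens the path, and its adjoint shortens a path of positive length.\<close>

lemma path_mult:
  assumes p: "path k v"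
  shows "a \<in> carr A \<Longrightarrow> v * P a \<in> V" and "f \<in> T \<Longrightarrow> v * sg f \<in> V" and "x \<in> hcarr X \<Longrightarrow> v * Q x \<in> V"
    and "g \<in> T \<Longrightarrow> v * ta g \<in> V" and "x \<in> hcarr X \<Longrightarrow> v * st (Q x) \<in> V" and "g \<in> T \<Longrightarrow> v * st (ta g) \<in> V"
proof -
  note [simp] = zero_V
  have "(a \<in> carr A \<longrightarrow> v * P a \<in> V) \<and> (f \<in> T \<longrightarrow> v * sg f \<in> V) \<and> (x \<in> hcarr X \<longrightarrow> v * Q x \<in> V)
    \<and> (g \<in> T \<longrightarrow> v * ta g \<in> V) \<and> (x \<in> hcarr X \<longrightarrow> v * st (Q x) \<in> V) \<and> (g \<in> T \<longrightarrow> v * st (ta g) \<in> V)" for a f x g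
  proof (cases k)
    case 0
    then have d: "v \<in> Dt" using p path0_E by blast
    have "v * ta (single 0 (g 0)) \<in> V" if "g \<in> T" using path_V[OF pathS[OF path0[OF d] tail_ker[OF that]]] .
    then show ?thesis using csub_mult[OF csub_Dt d] csub_st[OF csub_Dt] d
      by (auto simp: Dt_sg Dt_st_ta Dt_ta[OF d] intro!: Dt_V P_Dt Q_Dt)
  next
    case (Suc j)
    then obtain v' h where v: "v = v' * ta (single j h)" "path j v'" "h \<in> I" using p pathS_E by blast
    have 1: "v * z = 0" if "z \<in> D1" for z using that v by (simp add: mult.assoc ta_D1)
    have 2: "v * ta g \<in> V" if "g \<in> T"
    proof -
      have "v * ta g = v * ta (single (Suc j) (g (Suc j)))" using v that by (simp add: mult.assoc ta_ta_collapse)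
      then show ?thesis using path_V[OF pathS[OF p tail_ker[OF that]]] Suc by simp
    qed
    have 3: "v * st (ta g) \<in> V" if g: "g \<in> T"
    proof -
      have e: "v * st (ta g) = v' * (ta (single j h) * st (ta (single j (g j))))" using v g by (simp add: mult.assoc ta_st_ta_collapse)
      have gI: "g j \<in> I" using tail_ker[OF g] .
      \<comment> \<open>Cancelling the only step leaves an element of \<open>P\<close>, absorbed by
        \<open>Dt\<close>; cancelling a later step leaves \<open>sg\<close> at the previous
        coordinate, absorbed by the shorter path.\<close>
      show ?thesis
      proof (cases j)
        case 0
        then have d: "v' \<in> Dt" using v(2) path0_E by blast
        have "v * st (ta g) = v' * P (mlt A h (str A (g j)))" unfolding e using 0 ta0_st_ta0[OF v(3) gI] by simp
        then show ?thesis using Dt_V[OF csub_mult[OF csub_Dt d P_Dt]] ker_carr[OF v(3)] ker_carr[OF gI] by simp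
      next
        case (Suc i)
        have "v * st (ta g) = v' * sg (single i (mlt A h (str A (g j))))" unfolding e using Suc taS_st_taS[OF v(3) gI] by simp
        then show ?thesis using path_V[OF path_sg[of i v']] v(2,3) gI Suc by simp
      qed
    qed
    show ?thesis using 1[OF P_D1] 1[OF Q_D1] 1[OF st_Q_D1] 2 3 path_V[OF path_sg[of j v]] p Suc by auto
  qed
  then show "a \<in> carr A \<Longrightarrow> v * P a \<in> V" "f \<in> T \<Longrightarrow> v * sg f \<in> V" "x \<in> hcarr X \<Longrightarrow> v * Q x \<in> V"
    "g \<in> T \<Longrightarrow> v * ta g \<in> V" "x \<in> hcarr X \<Longrightarrow> v * st (Q x) \<in> V" "g \<in> T \<Longrightarrow> v * st (ta g) \<in> V" by blast+
qed

lemma V_mult_M: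
  assumes "v \<in> V" "u \<in> M" shows "v * u \<in> V"
proof -
  \<comment> \<open>Requiring the same of \<open>st u\<close> makes \<open>K\<close> closed under
    the adjoint, so that it is enough to multiply paths by the generators and their
    adjoints.\<close>
  define K where "K = {u \<in> M. \<forall>v\<in>V. v * u \<in> V \<and> v * st u \<in> V}"
  have "K = M \<inter> (\<Inter>v\<in>V. {u. v * u \<in> V} \<inter> {u. v * st u \<in> V})" unfolding K_def using zero_V by auto
  moreover have "ccl ({u. v * u \<in> V} \<inter> {u. v * st u \<in> V})" for v
    by (intro ccl_Int ccl_mult_left ccl_mult_right_st ccl_V)
  ultimately have "ccl K" using ccl_Int[OF csub_ccl[OF csubM] ccl_INT[of V]] by simp
  then have K: "csub K" unfolding csub_def K_def using csub_mult[OF csubM] csub_st[OF csubM] by (auto simp flip: mult.assoc)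
  have mem: "u \<in> K" if "u \<in> M" "\<And>k v. path k v \<Longrightarrow> v * u \<in> V" "\<And>k v. path k v \<Longrightarrow> v * st u \<in> V" for u
  proof -
    have "V \<subseteq> {v. v * u \<in> V}" "V \<subseteq> {v. v * st u \<in> V}"
      by (rule V_least[OF ccl_mult_right[OF ccl_V]], simp add: that)+
    then show ?thesis using that(1) by (auto simp: K_def)
  qed
  have "M \<subseteq> K"
  proof (rule M_least[OF K])
    show "P a \<in> K" if "a \<in> carr A" for a
      using that by (intro mem P_M path_mult(1)) (simp_all add: path_mult(1) flip: P_str)
    show "sg f \<in> K" if "f \<in> T" for f
      using that by (intro mem sg_M path_mult(2)) (simp_all add: path_mult(2) st_sg)
    show "Q x \<in> K" if "x \<in> hcarr X" for x
      using that by (intro mem Q_M path_mult(3) path_mult(5))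
    show "ta f \<in> K" if "f \<in> T" for f
      using that by (intro mem ta_M path_mult(4) path_mult(6))
  qed
  then show ?thesis using assms unfolding K_def by blast
qed

lemma P_ta_single: "a \<in> carr A \<Longrightarrow> g \<in> I \<Longrightarrow> P a * ta (single 0 g) = ta (single 0 (mlt A a g))"
  using P_ta[of a "single 0 g"] by simp

lemma ta_single_approx:
  assumes K: "ccl K" and g: "g \<in> I" and k: "\<And>h. h \<in> I \<Longrightarrow> ta (single i (mlt A h g)) \<in> K" shows "ta (single i g) \<in> K"
proof (rule ccl_approx[OF K])
  fix e :: real assume e: "0 < e"
  obtain h where h: "h \<in> I" "nrm A (mns A g (mlt A h g)) \<le> e" using ker_left_unit[OF g e] .
  have "norm (ta (single i g) - ta (single i (mlt A h g))) \<le> e"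
    using g h e ker_carr[OF g] ker_carr[OF h(1)] by (intro sg_approx(2) single_mns) simp_all
  then show "\<exists>y\<in>K. norm (ta (single i g) - y) \<le> e" using k[OF h(1)] by blast
qed

lemma sg_single_approx:
  assumes K: "ccl K" and g: "g \<in> I" and k: "\<And>h. h \<in> I \<Longrightarrow> sg (single i (mlt A g h)) \<in> K" shows "sg (single i g) \<in> K"
proof (rule ccl_approx[OF K])
  fix e :: real assume e: "0 < e"
  obtain h where h: "h \<in> I" "nrm A (mns A g (mlt A g h)) \<le> e" using ker_right_unit[OF g e] .
  have "norm (sg (single i g) - sg (single i (mlt A g h))) \<le> e"
    using g h e ker_carr[OF g] ker_carr[OF h(1)] by (intro sg_approx(1) single_mns) simp_all
  then show "\<exists>y\<in>K. norm (sg (single i g) - y) \<le> e" using k[OF h(1)] by blast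
qed

lemma ta0_V: "g \<in> I \<Longrightarrow> ta (single 0 g) \<in> V"
proof (rule ta_single_approx[OF ccl_V])
  fix h assume g: "g \<in> I" and h: "h \<in> I"
  have "path (Suc 0) (P h * ta (single 0 g))" by (intro pathS path0 P_Dt ker_carr h g)
  then show "ta (single 0 (mlt A h g)) \<in> V" using path_V P_ta_single[OF ker_carr[OF h] g] by metis
qed

text \<open>\<open>V\<close> is a right ideal of \<open>M\<close> that contains the images under p
  of all generators and their adjoints, so it contains p M.\<close>

lemma Lp_V: "x \<in> M \<Longrightarrow> Lp x \<in> V"
proof -
  let ?K = "{u \<in> M. Lp u \<in> V} \<inter> {u. st u \<in> {u \<in> M. Lp u \<in> V}}"
  have "ccl ?K" by (intro ccl_Int ccl_st ccl_Lp ccl_V)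
  then have K: "csub ?K" unfolding csub_def
    by (auto simp: Lp_mult V_mult_M csub_mult[OF csubM] csub_st[OF csubM])
  have "M \<subseteq> ?K"
  proof (rule M_least[OF K])
    show "P a \<in> ?K" if "a \<in> carr A" for a using that by (simp add: Lp_D1[OF P_D1] P_M Dt_V P_Dt flip: P_str)
    show "sg f \<in> ?K" if "f \<in> T" for f using that by (simp add: Lp_N[OF sg_N] sg_M zero_V st_sg)
    show "Q x \<in> ?K" if "x \<in> hcarr X" for x
      using that by (simp add: Lp_D1[OF Q_D1] Lp_D1[OF st_Q_D1] Q_M csub_st[OF csubM] csub_st[OF csub_Dt] Dt_V Q_Dt)
    show "ta g \<in> ?K" if g: "g \<in> T" for g
    proof -
      obtain g' where g': "g' \<in> T" "g' 0 = zer A" "ta g = ta (single 0 (g 0)) + ta g'" by (rule ta_split[OF g])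
      have "Lp (ta g) = ta (single 0 (g 0))" unfolding g'(3) by (intro Lp_eq ta0_D1 ta_N g' tail_ker[OF g])
      then show ?thesis using g by (simp add: Lp_N[OF st_ta_N] ta_M csub_st[OF csubM] zero_V ta0_V tail_ker[OF g])
    qed
  qed
  then show "x \<in> M \<Longrightarrow> Lp x \<in> V" by auto
qed

lemma Rp_Dt: "d \<in> Dt \<Longrightarrow> Rp d = d"
  by (simp add: Rp_def Lp_D1 st_Dt_D1)

text \<open>A path of positive length ends with a step, which p on the right sends to 0; a path of
  length 0 is fixed.\<close>

lemma Rp_V: "x \<in> V \<Longrightarrow> Rp x \<in> Dt"
proof -
  let ?K = "{x. st x \<in> {x \<in> M. Lp x \<in> {x. st x \<in> Dt}}}"
  have "V \<subseteq> ?K"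
  proof (rule V_least)
    show "ccl ?K" by (intro ccl_st ccl_Lp csub_ccl csub_Dt)
    have "Rp v \<in> Dt" if "path k v" for k v
      using that
    proof (cases rule: path.cases)
      case path0 then show ?thesis by (simp add: Rp_Dt)
    next
      case (pathS j v' g)
      then have "Rp v = v' * Rp (ta (single j g))" using path_M by (simp add: Rp_mult ta_M)
      also have "Rp (ta (single j g)) = 0" using pathS by (simp add: Rp_def Lp_N[OF st_ta_N])
      finally show ?thesis using ccl_zero[OF csub_ccl[OF csub_Dt]] by simp
    qed
    then show "v \<in> ?K" if "path k v" for k v using that path_M csub_st[OF csubM] by (auto simp: Rp_def)
  qed
  then show "x \<in> V \<Longrightarrow> Rp x \<in> Dt" by (auto simp: Rp_def)
qed

lemma Lp_Rp_Dt: "x \<in> M \<Longrightarrow> Lp (Rp x) \<in> Dt"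
proof -
  assume x: "x \<in> M"
  have "Lp (Rp x) = st (Rp (Lp (st x)))" by (simp add: Rp_def)
  then show ?thesis using csub_st[OF csub_Dt Rp_V[OF Lp_V[OF csub_st[OF csubM x]]]] by simp
qed

section \<open>Fullness of the corner\<close>

definition F :: "'c mul set" where "F = chull {Rp a * b | a b. a \<in> M \<and> b \<in> M}"

lemma ccl_F: "ccl F"
  unfolding F_def by (rule chull_ccl)

lemma F_gen: "a \<in> M \<Longrightarrow> b \<in> M \<Longrightarrow> Rp a * b \<in> F"
  unfolding F_def by (rule subsetD[OF chull_subset]) auto

lemma F_least: "ccl K \<Longrightarrow> (\<And>a b. a \<in> M \<Longrightarrow> b \<in> M \<Longrightarrow> Rp a * b \<in> K) \<Longrightarrow> F \<subseteq> K"
  unfolding F_def by (rule chull_least, assumption) blast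

lemma F_M: "F \<subseteq> M"
  by (rule F_least[OF csub_ccl[OF csubM]]) (simp add: csub_mult[OF csubM] Rp_M)

lemma F_mult_right: "x \<in> F \<Longrightarrow> u \<in> M \<Longrightarrow> x * u \<in> F"
  using F_least[OF ccl_mult_right[OF ccl_F], of u] by (auto simp: mult.assoc F_gen csub_mult[OF csubM])

lemma F_mult_left: "x \<in> F \<Longrightarrow> u \<in> M \<Longrightarrow> u * x \<in> F"
  using F_least[OF ccl_mult_left[OF ccl_F], of u] by (auto simp: F_gen csub_mult[OF csubM] simp flip: mult.assoc Rp_mult)

lemma F_st: "x \<in> F \<Longrightarrow> st x \<in> F"
proof -
  have "F \<subseteq> {x. st x \<in> F}"
  proof (rule F_least[OF ccl_st[OF ccl_F]], simp)
    fix a b assume ab: "a \<in> M" "b \<in> M"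
    have "st b * st (Rp a) = Rp (st b) * st a" using Lp_Rp[of "st b" "st a"] ab csub_st[OF csubM] by (simp add: Rp_def)
    then show "st b * st (Rp a) \<in> F" using F_gen ab csub_st[OF csubM] by simp
  qed
  then show "x \<in> F \<Longrightarrow> st x \<in> F" by blast
qed

lemma Rp_P: "a \<in> carr A \<Longrightarrow> Rp (P a) = P a" and Rp_Q: "x \<in> hcarr X \<Longrightarrow> Rp (Q x) = Q x"
  by (simp_all add: Rp_Dt P_Dt Q_Dt)

text \<open>\<open>P a\<close> is fixed by p, but \<open>M\<close> may lack a unit to serve as
  second factor; an approximate unit of A takes its place.\<close>

lemma P_F:
  assumes a: "a \<in> carr A" shows "P a \<in> F"
proof (rule ccl_approx[OF ccl_F])
  fix e :: real assume e: "0 < e"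
  obtain h where h: "h \<in> carr A" "nrm A (mns A a (mlt A a h)) \<le> e" using right_unit[OF a e] by metis
  have "norm (P a - P a * P h) \<le> e" using norm_P[of "mns A a (mlt A a h)"] a h by (simp add: P_mns P_mlt)
  moreover have "P a * P h \<in> F" using F_gen[OF P_M[OF a] P_M[OF h(1)]] a by (simp add: Rp_P)
  ultimately show "\<exists>y\<in>F. norm (P a - y) \<le> e" by blast
qed

text \<open>\<open>Q x\<close> is a limit of \<open>Q x * P h\<close> for h an approximate unit at
  <x, x>. The inner square of the error splits into two terms of norm at most e^2 / 2 each.\<close>

lemma Q_F:
  assumes x: "x \<in> hcarr X" shows "Q x \<in> F"
proof (rule ccl_approx[OF ccl_F])
  fix e :: real assume e: "0 < e"
  define p where "p = inr X x x"
  have p: "p \<in> carr A" using x by (simp add: p_def)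
  obtain h where h: "h \<in> carr A" "nrm A h \<le> 1" "str A h = h" "nrm A (mns A p (mlt A p h)) \<le> e\<^sup>2 / 2"
    using right_unit[OF p, of "e\<^sup>2 / 2"] e by auto
  have sP: "st (P h) = P h" using h by (simp flip: P_str)
  have eq: "st (Q x - Q x * P h) * (Q x - Q x * P h) = (P p - P p * P h) - P h * (P p - P p * P h)"
  proof -
    have 1: "st (Q x) * Q x = P p" using Q_Q[OF x x] by (simp add: p_def)
    have 2: "st (Q x) * (Q x * z) = P p * z" for z by (simp add: 1 flip: mult.assoc)
    show ?thesis by (simp add: sP algebra_simps 1 2)
  qed
  have pp: "norm (P p - P p * P h) \<le> e\<^sup>2 / 2" using norm_P[of "mns A p (mlt A p h)"] p h by (simp add: P_mns P_mlt)
  have "norm (P h * (P p - P p * P h)) \<le> 1 * (e\<^sup>2 / 2)"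
    using norm_P[of h] h pp by (intro order_trans[OF norm_mult_ineq mult_mono]) auto
  then have "norm (st (Q x - Q x * P h) * (Q x - Q x * P h)) \<le> e\<^sup>2"
    unfolding eq using pp norm_triangle_ineq4[of "P p - P p * P h" "P h * (P p - P p * P h)"] by linarith
  then have "(norm (Q x - Q x * P h))\<^sup>2 \<le> e\<^sup>2" by (simp only: norm_st_mult)
  then have "norm (Q x - Q x * P h) \<le> e" by (rule power2_le_imp_le) (use e in simp)
  moreover have "Q x * P h \<in> F" using F_gen[OF Q_M[OF x] P_M[OF h(1)]] x by (simp add: Rp_Q)
  ultimately show "\<exists>y\<in>F. norm (Q x - y) \<le> e" by blast
qed

text \<open>Induction along the tail. Steps into coordinate 0 factor through \<open>P\<close>; steps
  into coordinate \<open>i\<close> give \<open>sg\<close> at \<open>i\<close> as adjoint times step;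
  and \<open>sg\<close> at \<open>i\<close> gives the steps that leave coordinate \<open>i\<close>.
  Each time an approximate unit of the kernel supplies the extra factor.\<close>

lemma single_F: "g \<in> I \<Longrightarrow> ta (single i g) \<in> F" "g \<in> I \<Longrightarrow> sg (single i g) \<in> F"
proof -
  have sgF: "\<forall>g\<in>I. sg (single i g) \<in> F" if t: "\<forall>g\<in>I. ta (single i g) \<in> F" for i
  proof
    fix g assume g: "g \<in> I"
    show "sg (single i g) \<in> F"
    proof (rule sg_single_approx[OF ccl_F g])
      fix h assume h: "h \<in> I"
      have "(\<lambda>n. mlt A (str A (single i (str A g) n)) (single i h n)) = single i (mlt A g h)"
        using ker_carr[OF g] ker_carr[OF h] by (auto simp: single_def)
      then have "sg (single i (mlt A g h)) = st (ta (single i (str A g))) * ta (single i h)"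
        using g h by (simp add: ta_ta)
      then show "sg (single i (mlt A g h)) \<in> F" using t h g by (simp add: F_mult_left csub_st[OF csubM] ta_M)
    qed
  qed
  have "\<forall>g\<in>I. ta (single i g) \<in> F"
  proof (induction i)
    case 0
    show ?case
    proof
      fix g assume g: "g \<in> I"
      show "ta (single 0 g) \<in> F"
      proof (rule ta_single_approx[OF ccl_F g])
        fix h assume h: "h \<in> I"
        have "ta (single 0 (mlt A h g)) = P h * ta (single 0 g)" using P_ta_single[OF ker_carr[OF h] g] by simp
        then show "ta (single 0 (mlt A h g)) \<in> F" using F_mult_right[OF P_F[OF ker_carr[OF h]] ta_M] g by simp
      qed
    qed
  next
    case (Suc i)
    show ?case
    proof
      fix g assume g: "g \<in> I"
      show "ta (single (Suc i) g) \<in> F"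
      proof (rule ta_single_approx[OF ccl_F g])
        fix h assume h: "h \<in> I"
        have "ta (single (Suc i) (mlt A h g)) = sg (single i h) * ta (single (Suc i) g)" using g h by (simp add: sg_single_ta)
        then show "ta (single (Suc i) (mlt A h g)) \<in> F" using F_mult_right[OF _ ta_M] sgF[OF Suc] g h by simp
      qed
    qed
  qed
  then show "g \<in> I \<Longrightarrow> ta (single i g) \<in> F" "g \<in> I \<Longrightarrow> sg (single i g) \<in> F" using sgF by blast+
qed

lemma trunc_F:
  assumes f: "f \<in> T" shows "ta (trunc n f) \<in> F \<and> sg (trunc n f) \<in> F"
proof (induction n)
  case 0
  have "trunc 0 f = (\<lambda>n. zer A)" by (simp add: trunc_def fun_eq_iff)
  then show ?case using ccl_zero[OF ccl_F] by simp
next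
  case (Suc n)
  have "trunc (Suc n) f = (\<lambda>k. pls A (trunc n f k) (single n (f n) k))"
    using tail_carr[OF f] by (auto simp: trunc_def single_def fun_eq_iff less_Suc_eq)
  then have "ta (trunc (Suc n) f) = ta (trunc n f) + ta (single n (f n))" "sg (trunc (Suc n) f) = sg (trunc n f) + sg (single n (f n))"
    using ta_pls[OF trunc_T[OF f] single_T[OF tail_ker[OF f]]] sg_pls[OF trunc_T[OF f] single_T[OF tail_ker[OF f]]] by metis+
  then show ?case using Suc single_F[OF tail_ker[OF f]] ccl_add[OF ccl_F] by simp
qed

lemma M_F: "M \<subseteq> F"
proof (rule M_least)
  show "csub F" unfolding csub_def using ccl_F F_mult_right F_M F_st by blast
  show "ta f \<in> F" "sg f \<in> F" if f: "f \<in> T" for f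
  proof -
    have "\<exists>y\<in>F. norm (ta f - y) \<le> e" "\<exists>y\<in>F. norm (sg f - y) \<le> e" if e: "0 < e" for e
    proof -
      obtain n where n: "\<And>k. nrm A (mns A (f k) (trunc n f k)) \<le> e" using trunc_approx[OF f e] by blast
      show "\<exists>y\<in>F. norm (ta f - y) \<le> e" "\<exists>y\<in>F. norm (sg f - y) \<le> e"
        using trunc_F[OF f, of n] sg_approx[OF f trunc_T[OF f] n] by blast+
    qed
    then show "ta f \<in> F" "sg f \<in> F" using ccl_approx[OF ccl_F] by blast+
  qed
qed (auto intro: P_F Q_F)

theorem full_corner_D: "full_corner OY D"
proof -
  \<comment> \<open>The inverse of the embedding brings the two multiplications by p back to the
    elements of \<open>OY\<close>.\<close>
  define ei where "ei = inv_into (carr OY) E"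
  have ei: "E (ei z) = z" "ei z \<in> carr OY" if "z \<in> M" for z
    using that unfolding ei_def M_def by (auto intro: f_inv_into_f inv_into_into)
  have EM: "E x \<in> M" if "x \<in> carr OY" for x using that by (simp add: M_def)
  have eqI: "x = y" if "x \<in> carr OY" "y \<in> carr OY" "E x = E y" for x y using that O.emb_inj by blast
  define L where "L x = ei (Lp (E x))" for x
  define R where "R x = ei (Rp (E x))" for x
  have L: "E (L x) = Lp (E x)" "L x \<in> carr OY" and R: "E (R x) = Rp (E x)" "R x \<in> carr OY" if "x \<in> carr OY" for x
    using ei Lp_M Rp_M EM[OF that] by (auto simp: L_def R_def)
  show ?thesis unfolding full_corner_def
  proof (intro exI conjI ballI)
    fix x y assume x: "x \<in> carr OY"
    show "L x \<in> carr OY" "R x \<in> carr OY" using L R x by auto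
    show "L (L x) = L x" using x L by (intro eqI) (simp_all add: Lp_D1 Lp EM)
    show "L x = str OY (R (str OY x))" using x L R by (intro eqI) (simp_all add: O.emb_str Rp_def)
    assume y: "y \<in> carr OY"
    show "mlt OY x (L y) = mlt OY (R x) y" using x y L R by (intro eqI) (simp_all add: O.emb_mlt Lp_Rp EM)
  next
    have DC: "D \<subseteq> carr OY" using O.cstar_gen_sub(1)[OF gen_carr] O.cstar_sub_closed O.closed_subspace_carr unfolding D_def by blast
    show "D = {L (R x) |x. x \<in> carr OY}"
    proof (intro set_eqI iffI)
      fix d assume d: "d \<in> D"
      then have dc: "d \<in> carr OY" and dt: "E d \<in> Dt" using DC by (auto simp: Dt_def)
      have "d = L (R d)" using dc L R by (intro eqI) (simp_all add: Rp_Dt dt Lp_D1 Dt_D1)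
      then show "d \<in> {L (R x) |x. x \<in> carr OY}" using dc by blast
    next
      fix d assume "d \<in> {L (R x) |x. x \<in> carr OY}"
      then obtain x where x: "x \<in> carr OY" "d = L (R x)" by blast
      have "E d \<in> Dt" using x L R Lp_Rp_Dt[OF EM] by simp
      then obtain d' where "d' \<in> D" "E d = E d'" by (auto simp: Dt_def)
      then show "d \<in> D" using eqI[of d d'] x L R DC by auto
    qed
    let ?S = "{mlt OY (R a) b |a b. a \<in> carr OY \<and> b \<in> carr OY}"
    show "cl_span OY ?S = carr OY"
    proof (rule antisym)
      have "closed_subspace OY (carr OY)" using O.cstar_sub_carr O.cstar_sub_closed by blast
      moreover have "?S \<subseteq> carr OY" using R by auto
      ultimately show "cl_span OY ?S \<subseteq> carr OY" unfolding cl_span_def by (intro Inter_lower) simp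
      show "carr OY \<subseteq> cl_span OY ?S"
        unfolding cl_span_def
      proof (intro subsetI InterI, elim CollectE conjE)
        fix x G assume x: "x \<in> carr OY" and G: "closed_subspace OY G" "?S \<subseteq> G"
        have GC: "G \<subseteq> carr OY" using O.closed_subspace_carr[OF G(1)] .
        \<comment> \<open>After embedding, any closed subspace that contains the products contains
          \<open>F\<close>, and \<open>M_F\<close> says that \<open>F\<close> is everything.\<close>
        have "F \<subseteq> E ` G"
        proof (rule F_least[OF O.closed_subspace_emb[OF G(1)]])
          fix a b assume "a \<in> M" "b \<in> M"
          then have ab: "ei a \<in> carr OY" "ei b \<in> carr OY" "E (ei a) = a" "E (ei b) = b" using ei by auto
          then have "mlt OY (R (ei a)) (ei b) \<in> G" using G(2) by blast
          then have "E (mlt OY (R (ei a)) (ei b)) \<in> E ` G" by (rule imageI)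
          then show "Rp a * b \<in> E ` G" using ab R by (simp add: O.emb_mlt)
        qed
        then have "E x \<in> E ` G" using M_F EM[OF x] by blast
        then obtain y where "y \<in> G" "E x = E y" by blast
        then show "x \<in> G" using eqI[OF x] GC by blast
      qed
    qed
  qed
qed

end

section \<open>The isomorphism onto the corner\<close>

locale star_map = A: cstar_record A + C: cstar_record C for A :: "'a cstar" and C :: "'c cstar" +
  fixes f :: "'a \<Rightarrow> 'c"
  assumes hom: "star_hom A C f"
begin

lemma f_carr [simp]: "x \<in> carr A \<Longrightarrow> f x \<in> carr C"
  and f_scl [simp]: "x \<in> carr A \<Longrightarrow> f (scl A c x) = scl C c (f x)"
  and f_str [simp]: "x \<in> carr A \<Longrightarrow> f (str A x) = str C (f x)"
  using hom unfolding star_hom_def by simp_all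

lemma f_pls [simp]: "x \<in> carr A \<Longrightarrow> y \<in> carr A \<Longrightarrow> f (pls A x y) = pls C (f x) (f y)"
  and f_mlt [simp]: "x \<in> carr A \<Longrightarrow> y \<in> carr A \<Longrightarrow> f (mlt A x y) = mlt C (f x) (f y)"
  using hom unfolding star_hom_def by simp_all

lemma f_mns [simp]: "x \<in> carr A \<Longrightarrow> y \<in> carr A \<Longrightarrow> f (mns A x y) = mns C (f x) (f y)"
  by (simp add: mns_def)

lemma f_contractive: "x \<in> carr A \<Longrightarrow> nrm C (f x) \<le> nrm A x"
  by (rule star_hom_contractive[OF A.cstar C.cstar hom])

lemma f_zer [simp]: "f (zer A) = zer C"
proof -
  have "nrm C (f (zer A)) \<le> 0" using f_contractive[of "zer A"] A.norm_emb[of "zer A"] by simp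
  then have "norm (emb C (f (zer A))) \<le> 0" by (simp add: C.norm_emb)
  then show ?thesis using C.emb_inj[of "f (zer A)" "zer C"] by simp
qed

lemma f_tendsto:
  assumes x: "\<And>n. x n \<in> carr A" "y \<in> carr A" and lim: "(\<lambda>n. nrm A (mns A (x n) y)) \<longlonglongrightarrow> 0"
  shows "(\<lambda>n. emb C (f (x n))) \<longlonglongrightarrow> emb C (f y)"
proof -
  have "(\<lambda>n. nrm C (mns C (f (x n)) (f y))) \<longlonglongrightarrow> 0"
  proof (rule tendsto_sandwich[OF _ _ tendsto_const lim])
    show "\<forall>\<^sub>F n in sequentially. nrm C (mns C (f (x n)) (f y)) \<le> nrm A (mns A (x n) y)"
      using f_contractive[of "mns A (x _) y"] x by (intro always_eventually allI) simp
  qed (use x in \<open>simp add: C.nrm_nonneg\<close>)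
  then show ?thesis using C.tendsto_emb[of "\<lambda>n. f (x n)" "f y"] x by simp
qed

lemma cstar_sub_preimage:
  assumes D: "cstar_sub C D" shows "cstar_sub A {x \<in> carr A. f x \<in> D}"
  unfolding cstar_sub_def closed_subspace_def
proof (intro conjI ballI allI impI)
  note cs = C.cstar_sub_closed[OF D]
  show "zer A \<in> {x \<in> carr A. f x \<in> D}" using C.closed_subspace_zer[OF cs] by simp
  fix x g c
  show "x \<in> {x \<in> carr A. f x \<in> D} \<Longrightarrow> scl A c x \<in> {x \<in> carr A. f x \<in> D}" using C.closed_subspace_scl[OF cs] by simp
  show "x \<in> {x \<in> carr A. f x \<in> D} \<Longrightarrow> str A x \<in> {x \<in> carr A. f x \<in> D}" using C.cstar_sub_str[OF D] by simp
  assume "(\<forall>n. g n \<in> {x \<in> carr A. f x \<in> D}) \<and> x \<in> carr A \<and> (\<lambda>n. nrm A (mns A (g n) x)) \<longlonglongrightarrow> 0"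
  then have g: "\<And>n. g n \<in> carr A" "\<And>n. f (g n) \<in> D" "x \<in> carr A" "(\<lambda>n. nrm A (mns A (g n) x)) \<longlonglongrightarrow> 0" by auto
  have "(\<lambda>n. nrm C (mns C (f (g n)) (f x))) \<longlonglongrightarrow> 0"
    using f_tendsto[OF g(1,3,4)] C.tendsto_emb[of "\<lambda>n. f (g n)" "f x"] g(1,3) by simp
  then show "x \<in> {x \<in> carr A. f x \<in> D}" using C.closed_subspace_limit[OF cs g(2) f_carr[OF g(3)]] g(3) by simp
next
  note cs = C.cstar_sub_closed[OF D]
  fix x y assume "x \<in> {x \<in> carr A. f x \<in> D}" "y \<in> {x \<in> carr A. f x \<in> D}"
  then show "pls A x y \<in> {x \<in> carr A. f x \<in> D}" "mlt A x y \<in> {x \<in> carr A. f x \<in> D}"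
    using C.closed_subspace_pls[OF cs] C.cstar_sub_mlt[OF D] by auto
qed auto

text \<open>Consequently homomorphisms that agree on generators agree on the algebra they
  generate.\<close>

lemma cstar_sub_equalizer:
  assumes "star_map A C g" shows "cstar_sub A {x \<in> carr A. f x = g x}"
  unfolding cstar_sub_def closed_subspace_def
proof (intro conjI ballI allI impI)
  interpret g: star_map A C g by (rule assms)
  show "zer A \<in> {x \<in> carr A. f x = g x}" by simp
  fix x y c
  show "x \<in> {x \<in> carr A. f x = g x} \<Longrightarrow> scl A c x \<in> {x \<in> carr A. f x = g x}"
    and "x \<in> {x \<in> carr A. f x = g x} \<Longrightarrow> str A x \<in> {x \<in> carr A. f x = g x}" by auto
  show "x \<in> {x \<in> carr A. f x = g x} \<Longrightarrow> y \<in> {x \<in> carr A. f x = g x} \<Longrightarrow> pls A x y \<in> {x \<in> carr A. f x = g x}"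
    and "x \<in> {x \<in> carr A. f x = g x} \<Longrightarrow> y \<in> {x \<in> carr A. f x = g x} \<Longrightarrow> mlt A x y \<in> {x \<in> carr A. f x = g x}" by auto
  fix u assume "(\<forall>n. u n \<in> {x \<in> carr A. f x = g x}) \<and> x \<in> carr A \<and> (\<lambda>n. nrm A (mns A (u n) x)) \<longlonglongrightarrow> 0"
  then have u: "\<And>n. u n \<in> carr A" "\<And>n. f (u n) = g (u n)" "x \<in> carr A" "(\<lambda>n. nrm A (mns A (u n) x)) \<longlonglongrightarrow> 0" by auto
  have "emb C (f x) = emb C (g x)"
    using LIMSEQ_unique[OF f_tendsto[OF u(1,3,4)]] g.f_tendsto[OF u(1,3,4)] u(2) by simp
  then show "x \<in> {x \<in> carr A. f x = g x}" using u(3) C.emb_inj by simp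
qed auto

text \<open>An isometric image of a complete space is complete and therefore closed.\<close>

lemma cstar_sub_image:
  assumes iso: "\<And>x. x \<in> carr A \<Longrightarrow> nrm C (f x) = nrm A x"
  shows "cstar_sub C (f ` carr A)"
  unfolding cstar_sub_def closed_subspace_def
proof (intro conjI ballI allI impI)
  show "zer C \<in> f ` carr A" using f_zer A.zer_carr by (metis imageI)
  show "f ` carr A \<subseteq> carr C" by auto
  fix y z c
  show "y \<in> f ` carr A \<Longrightarrow> scl C c y \<in> f ` carr A" by (auto simp flip: f_scl)
  show "y \<in> f ` carr A \<Longrightarrow> str C y \<in> f ` carr A" by (auto simp flip: f_str)
  show "y \<in> f ` carr A \<Longrightarrow> z \<in> f ` carr A \<Longrightarrow> pls C y z \<in> f ` carr A" by (auto simp flip: f_pls)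
  show "y \<in> f ` carr A \<Longrightarrow> z \<in> f ` carr A \<Longrightarrow> mlt C y z \<in> f ` carr A" by (auto simp flip: f_mlt)
  fix g assume g: "(\<forall>n. g n \<in> f ` carr A) \<and> y \<in> carr C \<and> (\<lambda>n. nrm C (mns C (g n) y)) \<longlonglongrightarrow> 0"
  then have "\<forall>n. \<exists>x. x \<in> carr A \<and> g n = f x" by blast
  then obtain x where x: "\<And>n. x n \<in> carr A" "\<And>n. g n = f (x n)" using choice by metis
  have y: "y \<in> carr C" "(\<lambda>n. emb C (f (x n))) \<longlonglongrightarrow> emb C y"
    using g C.tendsto_emb[of "\<lambda>n. f (x n)" y] x by simp_all
  have "norm (emb A (x m) - emb A (x n)) = norm (emb C (f (x m)) - emb C (f (x n)))" for m n
    using iso[of "mns A (x m) (x n)"] x by (simp add: A.nrm_mns C.nrm_mns)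
  then have "Cauchy (\<lambda>n. emb A (x n))"
    using LIMSEQ_imp_Cauchy[OF y(2)] unfolding Cauchy_def dist_norm by simp
  then obtain a where a: "a \<in> carr A" "(\<lambda>n. emb A (x n)) \<longlonglongrightarrow> emb A a" using A.Cauchy_emb[of x] x(1) by metis
  have "(\<lambda>n. emb C (f (x n))) \<longlonglongrightarrow> emb C (f a)"
    by (rule f_tendsto[OF x(1) a(1) iffD1[OF A.tendsto_emb[OF x(1) a(1)] a(2)]])
  then have "emb C y = emb C (f a)" by (rule LIMSEQ_unique[OF y(2)])
  then show "y \<in> f ` carr A" using C.emb_inj y(1) a(1) by auto
qed

lemma isometric_inj:
  assumes iso: "\<And>x. x \<in> carr A \<Longrightarrow> nrm C (f x) = nrm A x"
  shows "inj_on f (carr A)"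
proof (rule inj_onI)
  fix x y assume xy: "x \<in> carr A" "y \<in> carr A" "f x = f y"
  then have "norm (emb A x - emb A y) = 0" using iso[of "mns A x y"] by (simp add: A.nrm_mns C.nrm_mns)
  then show "x = y" using xy A.emb_inj by simp
qed

end

section \<open>Restricting the universal representation of Y to X\<close>

context tail_corner
begin

interpretation Yc: precorr B Y phiB by (rule precorr_Y)

lemma zero_tail_lift:
  defines "up \<equiv> map (\<lambda>(\<xi>, \<eta>). ((\<xi>, \<lambda>n. zer A), (\<eta>, \<lambda>n. zer A)))"
  assumes l: "set l \<subseteq> hcarr X \<times> hcarr X"
  shows "set (up l) \<subseteq> hcarr Y \<times> hcarr Y" "xlist (up l) = l" "csum (up l) n = zer A"
    "tsum OY tY (up l) = tsum OY (\<lambda>x. tY (x, \<lambda>n. zer A)) l"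
  using l by (induction l) (auto simp: up_def tsum_def)

text \<open>As \<open>a\<close> is orthogonal to the kernel, (a, 0) acts as zero on coordinate 0 of
  the tail and hence on the whole tail. Lifted lists then approximate it as well as the original
  ones do on X.\<close>

lemma opnorm_zero_tail_lift:
  assumes a: "a \<in> carr A" "a \<in> perp A I" and l: "set l \<subseteq> hcarr X \<times> hcarr X"
  shows "opnorm B Y (Yc.defect (a, \<lambda>n. zer A) (map (\<lambda>(\<xi>, \<eta>). ((\<xi>, \<lambda>n. zer A), (\<eta>, \<lambda>n. zer A))) l)) \<le> opnorm A X (defect a l)"
    (is "opnorm B Y (Yc.defect _ ?l) \<le> _")
proof (rule Yc.opnorm_le)
  note up = zero_tail_lift[OF l]
  fix y assume y: "y \<in> hcarr Y" "hnorm B Y y \<le> 1"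
  then obtain x w where yx: "y = (x, w)" "x \<in> hcarr X" "w \<in> T" by auto
  note [simp] = tail_carr[OF yx(3)]
  have x1: "hnorm A X x \<le> 1" using y(2) yx by (simp add: hnorm_Y)
  have z: "mlt A a (w 0) = zer A" using a(2) tail_ker[OF yx(3)] by (simp add: perp_def)
  have "Yc.defect (a, \<lambda>n. zer A) ?l y = (defect a l x, \<lambda>n. mlt A (mns A (coef a (\<lambda>n. zer A) n) (zer A)) (w n))"
    unfolding yx(1) using defect_Y[OF a(1) _ up(1) yx(2,3), of "\<lambda>n. zer A"] up(2,3) by simp
  also have "(\<lambda>n. mlt A (mns A (coef a (\<lambda>n. zer A) n) (zer A)) (w n)) = (\<lambda>n. zer A)"
    using a z by (auto simp: coef_def mns_def)
  finally have e: "Yc.defect (a, \<lambda>n. zer A) ?l y = (defect a l x, \<lambda>n. zer A)" .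
  have "defect a l x \<in> hcarr X" using a l yx by (simp add: defect_def)
  moreover have "0 \<le> opnorm A X (defect a l)" by (rule opnorm_defect_nonneg[OF a(1) l])
  moreover have "tnorm (\<lambda>n. zer A) \<le> 0" by (rule tnorm_leI) simp
  ultimately show "hnorm B Y (Yc.defect (a, \<lambda>n. zer A) ?l y) \<le> opnorm A X (defect a l)"
    unfolding e using defect_le_opnorm[OF a(1) l yx(2) x1] by (simp add: hnorm_Y)
qed

text \<open>For a in J_X the element (a, 0) lies in J(Y), and every approximating sequence for the
  action of a lifts to one for (a, 0) with the same sums in \<open>OY\<close>.\<close>

lemma coisometric_restriction:
  "coisometric A X phi (JX A X phi) OY (\<lambda>a. pY (a, \<lambda>n. zer A)) (\<lambda>x. tY (x, \<lambda>n. zer A))"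
  unfolding coisometric_def
proof (intro conjI ballI)
  have r: "\<And>a b. a \<in> carr B \<Longrightarrow> b \<in> carr B \<Longrightarrow> pY (pls B a b) = pls OY (pY a) (pY b)"
    "\<And>a b. a \<in> carr B \<Longrightarrow> b \<in> carr B \<Longrightarrow> pY (mlt B a b) = mlt OY (pY a) (pY b)"
    "\<And>a c. a \<in> carr B \<Longrightarrow> pY (scl B c a) = scl OY c (pY a)"
    "\<And>a. a \<in> carr B \<Longrightarrow> pY (str B a) = str OY (pY a)"
    using hom_pY unfolding star_hom_def by blast+
  have q: "\<And>x y. x \<in> hcarr Y \<Longrightarrow> y \<in> hcarr Y \<Longrightarrow> tY (hpls Y x y) = pls OY (tY x) (tY y)"
    "\<And>x c. x \<in> hcarr Y \<Longrightarrow> tY (hscl Y c x) = scl OY c (tY x)"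
    "\<And>x y. x \<in> hcarr Y \<Longrightarrow> y \<in> hcarr Y \<Longrightarrow> mlt OY (str OY (tY x)) (tY y) = pY (inr Y x y)"
    "\<And>x a. a \<in> carr B \<Longrightarrow> x \<in> hcarr Y \<Longrightarrow> tY (phiB a x) = mlt OY (pY a) (tY x)"
    "\<And>x a. a \<in> carr B \<Longrightarrow> x \<in> hcarr Y \<Longrightarrow> tY (ract Y x a) = mlt OY (tY x) (pY a)"
    using repY unfolding is_rep_def by blast+
  show "is_rep A X phi OY (\<lambda>a. pY (a, \<lambda>n. zer A)) (\<lambda>x. tY (x, \<lambda>n. zer A))"
    unfolding is_rep_def star_hom_def
  proof (intro conjI ballI allI cstar_OY)
    fix a b c assume a: "a \<in> carr A"
    show "pY (a, \<lambda>n. zer A) \<in> carr OY" using pY_carr a by simp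
    show "pY (scl A c a, \<lambda>n. zer A) = scl OY c (pY (a, \<lambda>n. zer A))" using r(3)[of "(a, \<lambda>n. zer A)" c] a by simp
    show "pY (str A a, \<lambda>n. zer A) = str OY (pY (a, \<lambda>n. zer A))" using r(4)[of "(a, \<lambda>n. zer A)"] a by simp
    assume b: "b \<in> carr A"
    show "pY (pls A a b, \<lambda>n. zer A) = pls OY (pY (a, \<lambda>n. zer A)) (pY (b, \<lambda>n. zer A))"
      "pY (mlt A a b, \<lambda>n. zer A) = mlt OY (pY (a, \<lambda>n. zer A)) (pY (b, \<lambda>n. zer A))"
      using r(1,2)[of "(a, \<lambda>n. zer A)" "(b, \<lambda>n. zer A)"] a b by simp_all
  next
    fix x y c assume x: "x \<in> hcarr X"
    show "tY (x, \<lambda>n. zer A) \<in> carr OY" using tY_carr x by simp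
    show "tY (hscl X c x, \<lambda>n. zer A) = scl OY c (tY (x, \<lambda>n. zer A))" using q(2)[of "(x, \<lambda>n. zer A)" c] x by simp
    assume y: "y \<in> hcarr X"
    show "tY (hpls X x y, \<lambda>n. zer A) = pls OY (tY (x, \<lambda>n. zer A)) (tY (y, \<lambda>n. zer A))"
      "mlt OY (str OY (tY (x, \<lambda>n. zer A))) (tY (y, \<lambda>n. zer A)) = pY (inr X x y, \<lambda>n. zer A)"
      using q(1,3)[of "(x, \<lambda>n. zer A)" "(y, \<lambda>n. zer A)"] x y by simp_all
  next
    fix a x assume a: "a \<in> carr A" "x \<in> hcarr X"
    show "tY (phi a x, \<lambda>n. zer A) = mlt OY (pY (a, \<lambda>n. zer A)) (tY (x, \<lambda>n. zer A))"
      "tY (ract X x a, \<lambda>n. zer A) = mlt OY (tY (x, \<lambda>n. zer A)) (pY (a, \<lambda>n. zer A))"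
      using q(4,5)[of "(a, \<lambda>n. zer A)" "(x, \<lambda>n. zer A)"] a by (simp_all cong: if_cong)
  qed
  fix a assume "a \<in> JX A X phi"
  then have a: "a \<in> carr A" "compact_op A X (phi a)" "a \<in> perp A I" by (auto simp: JX_def Jid_def)
  define up where "up = map (\<lambda>(\<xi>, \<eta>). ((\<xi>, \<lambda>n. zer A), (\<eta>, \<lambda>n. zer A :: 'a)) :: ('x \<times> (nat \<Rightarrow> 'a)) \<times> ('x \<times> (nat \<Rightarrow> 'a)))"
  note up = zero_tail_lift[folded up_def] and ob = opnorm_zero_tail_lift[OF a(1,3), folded up_def]
  have aB: "(a, \<lambda>n. zer A) \<in> carr B" using a by simp
  have "compact_op B Y (phiB (a, \<lambda>n. zer A))"
    unfolding compact_op_def Yc.defect_eta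
  proof (intro allI impI)
    fix e :: real assume "0 < e"
    then obtain l where l: "set l \<subseteq> hcarr X \<times> hcarr X" "opnorm A X (defect a l) < e"
      using a(2) unfolding compact_op_def defect_eta by blast
    then show "\<exists>l. set l \<subseteq> hcarr Y \<times> hcarr Y \<and> opnorm B Y (Yc.defect (a, \<lambda>n. zer A) l) < e"
      using up(1)[OF l(1)] ob[OF l(1)] by (intro exI[of _ "up l"]) linarith
  qed
  then have "(a, \<lambda>n. zer A) \<in> Jid B Y phiB" using aB by (simp add: Jid_def del: B_simps)
  then have val: "pi1_value B Y OY tY (phiB (a, \<lambda>n. zer A)) (pY (a, \<lambda>n. zer A))" using coY unfolding coisometric_def by blast
  show "pi1_value A X OY (\<lambda>x. tY (x, \<lambda>n. zer A)) (phi a) (pY (a, \<lambda>n. zer A))"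
    unfolding pi1_value_def defect_eta
  proof (intro allI impI, elim conjE)
    fix ls :: "nat \<Rightarrow> ('x \<times> 'x) list"
    assume ls: "\<forall>n. set (ls n) \<subseteq> hcarr X \<times> hcarr X" and lim: "(\<lambda>n. opnorm A X (defect a (ls n))) \<longlonglongrightarrow> 0"
    have "(\<lambda>n. opnorm B Y (Yc.defect (a, \<lambda>n. zer A) (up (ls n)))) \<longlonglongrightarrow> 0"
    proof (rule tendsto_sandwich[OF _ _ tendsto_const lim])
      show "\<forall>\<^sub>F n in sequentially. 0 \<le> opnorm B Y (Yc.defect (a, \<lambda>n. zer A) (up (ls n)))"
        using Yc.opnorm_defect_nonneg[OF aB up(1)] ls by (intro always_eventually allI) blast
      show "\<forall>\<^sub>F n in sequentially. opnorm B Y (Yc.defect (a, \<lambda>n. zer A) (up (ls n))) \<le> opnorm A X (defect a (ls n))"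
        using ob ls by (intro always_eventually allI) blast
    qed
    moreover have "\<forall>n. set (up (ls n)) \<subseteq> hcarr Y \<times> hcarr Y" using up(1) ls by blast
    ultimately have "(\<lambda>n. nrm OY (mns OY (tsum OY tY (up (ls n))) (pY (a, \<lambda>n. zer A)))) \<longlonglongrightarrow> 0"
      using val[unfolded pi1_value_def Yc.defect_eta, rule_format, of "\<lambda>n. up (ls n)"] by blast
    then show "(\<lambda>n. nrm OY (mns OY (tsum OY (\<lambda>x. tY (x, \<lambda>n. zer A)) (ls n)) (pY (a, \<lambda>n. zer A)))) \<longlonglongrightarrow> 0"
      using up(4) ls by simp
  qed
qed

end

text \<open>The record \<open>C\<close> lives over the element type of \<open>OX\<close>, which is
  what the universal property of \<open>OY\<close> accepts. The algebra is nonzero because the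
  coding starts from a nonzero vector.\<close>

lemma faithful_extension:
  fixes A :: "'a cstar" and X :: "('x, 'a) hmod" and OX :: "'ox cstar"
  assumes pc: "precorr A X phi" and coX: "coisometric A X phi (JX A X phi) OX pX tX"
    and nz: "carr OX \<noteq> {zer OX}"
  shows "\<exists>(C :: 'ox cstar) p t k. coisometric (tailB A X phi) (tailY A X phi) (tailphi A X phi)
      (Jid (tailB A X phi) (tailY A X phi) (tailphi A X phi)) C p t
    \<and> star_hom OX C k \<and> (\<forall>x\<in>carr OX. nrm C (k x) = nrm OX x)
    \<and> (\<forall>a\<in>carr A. k (pX a) = p (a, \<lambda>n. zer A)) \<and> (\<forall>x\<in>hcarr X. k (tX x) = t (x, \<lambda>n. zer A))"
proof -
  interpret precorr A X phi by (rule pc)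
  have cO: "cstar_alg OX" using coX unfolding coisometric_def is_rep_def by blast
  interpret O: cstar_record OX by (rule cstar_record.intro[OF cO])
  let ?V = "emb OX ` carr OX"
  have V: "csub ?V" by (rule O.csub_carr)
  obtain x0 where x0: "x0 \<in> carr OX" "x0 \<noteq> zer OX" using nz O.zer_carr by blast
  have v0: "emb OX x0 \<in> ?V" "emb OX x0 \<noteq> 0" using x0 O.emb_inj[of x0 "zer OX"] by auto
  obtain J :: "(nat \<Rightarrow> 'ox mul) \<Rightarrow> 'ox mul" where J: "inj_on J {f. \<forall>n. f n \<in> ?V}" "\<And>f. (\<And>n. f n \<in> ?V) \<Longrightarrow> J f \<in> ?V"
  proof (rule sequence_coding[OF O.closed_emb _ _ v0])
    show "x + y \<in> ?V" if "x \<in> ?V" "y \<in> ?V" for x y by (rule ccl_add[OF csub_ccl[OF V] that])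
    show "r *\<^sub>R x \<in> ?V" if "x \<in> ?V" for r x using ccl_csc[OF csub_ccl[OF V] that, of "complex_of_real r"] by simp
  qed blast
  \<comment> \<open>The infinite matrix of an operator is flattened to a sequence, to which the
    coding map \<open>J\<close> applies.\<close>
  define s where "s U = (\<lambda>n. ent U (fst (prod_decode n)) (snd (prod_decode n)))" for U :: "'ox mul ell2 \<Rightarrow>\<^sub>L 'ox mul ell2"
  define enc where "enc U = inv_into (carr OX) (emb OX) (J (s U))" for U
  have "inj_on enc {U. (\<exists>V. ell2.AD U V) \<and> (\<forall>i j. ent U i j \<in> ?V)}"
  proof (rule inj_onI, clarify)
    fix U U' W W' assume U: "ell2.AD U W" "\<forall>i j. ent U i j \<in> ?V" "ell2.AD U' W'" "\<forall>i j. ent U' i j \<in> ?V" and e: "enc U = enc U'"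
    have sV: "s U n \<in> ?V" "s U' n \<in> ?V" for n using U by (auto simp: s_def)
    have "emb OX (enc U) = J (s U)" "emb OX (enc U') = J (s U')"
      unfolding enc_def using J(2) sV by (auto intro!: f_inv_into_f)
    then have "J (s U) = J (s U')" using e by simp
    then have ss: "s U = s U'" using sV by (intro inj_onD[OF J(1)]) auto
    have "ent U i j = ent U' i j" for i j using fun_cong[OF ss, of "prod_encode (i, j)"] by (simp add: s_def)
    then show "U = U'" using ent_inject[OF U(1,3)] by blast
  qed
  then interpret X: tail_ext A X phi OX pX tX enc
    by (intro tail_ext.intro tail_ext_axioms.intro pc coX)
  show ?thesis
    using X.coiso_C X.star_hom_kap X.nrm_kap X.kap_pX X.kap_tX by blast
qed

theorem mainTheorem13:
  fixes A :: "'a cstar" and X :: "('x, 'a) hmod" and phi :: "'a \<Rightarrow> 'x \<Rightarrow> 'x"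
    and OX :: "'ox cstar" and piX :: "'a \<Rightarrow> 'ox" and tX :: "'x \<Rightarrow> 'ox"
    and OY :: "'oy cstar" and piY :: "'a \<times> (nat \<Rightarrow> 'a) \<Rightarrow> 'oy"
    and tY :: "'x \<times> (nat \<Rightarrow> 'a) \<Rightarrow> 'oy"
  assumes corr: "correspondence A X phi"
    and OX_univ1: "univ_rep A X phi (JX A X phi) OX piX tX TYPE('ox)"
    and OX_univ2: "univ_rep A X phi (JX A X phi) OX piX tX TYPE('oy)"
    and OY_univ1: "univ_rep (tailB A X phi) (tailY A X phi) (tailphi A X phi)
                     (Jid (tailB A X phi) (tailY A X phi) (tailphi A X phi)) OY piY tY TYPE('oy)"
    and OY_univ2: "univ_rep (tailB A X phi) (tailY A X phi) (tailphi A X phi)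
                     (Jid (tailB A X phi) (tailY A X phi) (tailphi A X phi)) OY piY tY TYPE('ox)"
  shows "let p = (\<lambda>a. piY (a, \<lambda>n. zer A)); t = (\<lambda>x. tY (x, \<lambda>n. zer A));
             D = cstar_gen OY (p ` carr A \<union> t ` hcarr X) in
           coisometric A X phi (JX A X phi) OY p t
         \<and> (\<exists>rho. star_hom OX OY rho \<and> factors A X piX tX p t rho)
         \<and> (\<forall>rho. star_hom OX OY rho \<and> factors A X piX tX p t rho \<longrightarrow>
                 inj_on rho (carr OX) \<and> rho ` carr OX = D)
         \<and> full_corner OY D"
proof -
  have pc: "precorr A X phi" by (rule correspondence_precorr[OF corr])
  have coX: "coisometric A X phi (JX A X phi) OX piX tX"
    and genX: "carr OX = cstar_gen OX (piX ` carr A \<union> tX ` hcarr X)"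
    using OX_univ2 unfolding univ_rep_def by blast+
  interpret Y: tail_corner A X phi OY piY tY
    using pc OY_univ2 unfolding univ_rep_def tail_corner_def tail_corner_axioms_def by blast
  have cX: "cstar_alg OX" using coX unfolding coisometric_def is_rep_def by blast
  interpret OX: cstar_record OX by (rule cstar_record.intro[OF cX])
  have gX: "piX ` carr A \<union> tX ` hcarr X \<subseteq> carr OX"
    using coX unfolding coisometric_def is_rep_def star_hom_def by blast
  define p where "p a = piY (a, \<lambda>n. zer A)" for a
  define t where "t x = tY (x, \<lambda>n. zer A)" for x
  have D: "Y.D = cstar_gen OY (p ` carr A \<union> t ` hcarr X)" by (simp add: Y.D_def p_def t_def)
  have gY: "p ` carr A \<union> t ` hcarr X \<subseteq> carr OY" using Y.gen_carr by (simp add: p_def[abs_def] t_def[abs_def])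
  have co: "coisometric A X phi (JX A X phi) OY p t"
    using Y.coisometric_restriction by (simp add: p_def[abs_def] t_def[abs_def])
  have ex: "\<exists>rho. star_hom OX OY rho \<and> factors A X piX tX p t rho"
    using OX_univ2 co unfolding univ_rep_def by blast
  have rho: "inj_on rho (carr OX) \<and> rho ` carr OX = Y.D" if rho: "star_hom OX OY rho" and fac: "factors A X piX tX p t rho" for rho
  proof -
    interpret r: star_map OX OY rho by unfold_locales (rule rho)
    have iso: "nrm OY (rho x) = nrm OX x" if x: "x \<in> carr OX" for x
    \<comment> \<open>The zero algebra has no room for codes, and there the equality of norms is
      trivial.\<close>
    proof (cases "carr OX = {zer OX}")
      case True
      then show ?thesis using x OX.norm_emb[of "zer OX"] Y.O.norm_emb[of "zer OY"] by simp
    next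
      case False
      obtain C :: "'ox cstar" and pC tC k where C: "coisometric (tailB A X phi) (tailY A X phi) (tailphi A X phi)
          (Jid (tailB A X phi) (tailY A X phi) (tailphi A X phi)) C pC tC"
        and k: "star_hom OX C k" "\<forall>x\<in>carr OX. nrm C (k x) = nrm OX x"
          "\<forall>a\<in>carr A. k (piX a) = pC (a, \<lambda>n. zer A)" "\<forall>x\<in>hcarr X. k (tX x) = tC (x, \<lambda>n. zer A)"
        using faithful_extension[OF pc coX False] by blast
      \<comment> \<open>Here the universal property of \<open>OY\<close> is used at the element type
        of \<open>OX\<close>.\<close>
      obtain h where h: "star_hom OY C h" "factors (tailB A X phi) (tailY A X phi) piY tY pC tC h"
        using OY_univ2 C unfolding univ_rep_def by blast
      have cC: "cstar_alg C" using C unfolding coisometric_def is_rep_def by blast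
      interpret C: cstar_record C by (rule cstar_record.intro[OF cC])
      interpret h: star_map OY C h by unfold_locales (rule h(1))
      have hr: "star_map OX C (h \<circ> rho)" by unfold_locales (simp add: star_hom_def)
      interpret k: star_map OX C k by unfold_locales (rule k(1))
      \<comment> \<open>The composite h rho agrees with the isometry \<open>k\<close> on the
        generators, hence everywhere. As \<open>h\<close> and \<open>rho\<close> are contractive,
        \<open>rho\<close> must preserve norms.\<close>
      have "carr OX \<subseteq> {x \<in> carr OX. k x = (h \<circ> rho) x}"
      proof (subst genX, rule OX.cstar_gen_least[OF k.cstar_sub_equalizer[OF hr]])
        have "k (piX a) = h (rho (piX a))" if "a \<in> carr A" for a
          using k(3) h(2) fac that unfolding factors_def by (simp add: p_def)
        moreover have "k (tX x) = h (rho (tX x))" if "x \<in> hcarr X" for x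
          using k(4) h(2) fac that unfolding factors_def by (simp add: t_def)
        ultimately show "piX ` carr A \<union> tX ` hcarr X \<subseteq> {x \<in> carr OX. k x = (h \<circ> rho) x}" using gX by auto
      qed
      then have "nrm OX x = nrm C (h (rho x))" using k(2) x by fastforce
      then show ?thesis using h.f_contractive[of "rho x"] r.f_contractive[OF x] x by simp
    qed
    have "carr OX \<subseteq> {x \<in> carr OX. rho x \<in> Y.D}"
    proof (subst genX, rule OX.cstar_gen_least[OF r.cstar_sub_preimage])
      show "cstar_sub OY Y.D" unfolding D by (rule Y.O.cstar_gen_sub(1)[OF gY])
      show "piX ` carr A \<union> tX ` hcarr X \<subseteq> {x \<in> carr OX. rho x \<in> Y.D}"
        using gX fac Y.O.cstar_gen_sub(2)[OF gY] unfolding D factors_def by auto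
    qed
    moreover have "Y.D \<subseteq> rho ` carr OX"
      unfolding D
    \<comment> \<open>The image of \<open>rho\<close> is closed because \<open>rho\<close> is
      isometric, so it contains the subalgebra generated by the images of the generators.\<close>
    proof (rule Y.O.cstar_gen_least[OF r.cstar_sub_image[OF iso]])
      show "p ` carr A \<union> t ` hcarr X \<subseteq> rho ` carr OX"
      proof (intro Un_least image_subsetI)
        show "p a \<in> rho ` carr OX" if "a \<in> carr A" for a
          using that fac gX unfolding factors_def by (intro image_eqI[of _ _ "piX a"]) auto
        show "t x \<in> rho ` carr OX" if "x \<in> hcarr X" for x
          using that fac gX unfolding factors_def by (intro image_eqI[of _ _ "tX x"]) auto
      qed
    qed
    ultimately show ?thesis using r.isometric_inj[OF iso] by blast
  qed
  have "full_corner OY Y.D" by (rule Y.full_corner_D)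
  then show ?thesis
    unfolding Let_def p_def[abs_def, symmetric] t_def[abs_def, symmetric] D[symmetric]
    using co ex rho by blast
qed

end
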